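(* Let $k$ be a field and let $B$ be a unital $k$-algebra endowed with a locally finite filtration $\mathcal{F}=\{B_n:n\ge -1\}$ such that the associated graded $k$-algebra $\bar{B}=\operatorname{gr}(B,\mathcal{F})$ is left noetherian. Then every cyclic graded left $\bar{B}[X]$-module is generically free over $k[X]$. In particular, $B$ is a Jacobson algebra (every semiprime ideal of $B$ is semiprimitive), and for every simple left $B$-module $M$ the commutant $\operatorname{End}_B(M)$ is algebraic over $k$ (every element of it is algebraic over $k$).
   Context: Rings and algebras are associative and unital, not necessarily commutative; "ideal" means two-sided ideal; modules are left modules, and simple modules are non-zero. A filtration of a $k$-algebra $B$ is an increasing sequence $\mathcal{F}=\{B_n:n\ge -1\}$ of $k$-subspaces with $B_{-1}=0$, $k\cdot 1\subset B_0$, $\sum_{n\ge 0}B_n=B$ and $B_mB_n\subset B_{m+n}$. It is locally finite if each $B_n$ is finite-dimensional over $k$. The associated graded algebra is $\operatorname{gr}(B,\mathcal{F})=\bigoplus_{n\ge 0}B_n/B_{n-1}$ with multiplication $(x+B_{m-1})(y+B_{n-1})=xy+B_{m+n-1}$ for $x\in B_m$, $y\in B_n$. $\bar{B}[X]$ is the polynomial ring in one central indeterminate $X$ over $\bar B$, graded by $\bar{B}[X]=\bigoplus_{n\ge 0}\bar{B}_n[X]$, where $\bar B_n=B_n/B_{n-1}$ (so $X$ has degree $0$). A graded $\bar{B}[X]$-module is a module $\bar M=\bigoplus_{n\ge 0}\bar M_n$ with $\bar{B}_m[X]\cdot\bar M_n\subset\bar M_{m+n}$; it is cyclic if it is generated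 by one element as a $\bar B[X]$-module. For a commutative ring $A$ and non-nilpotent $f\in A$, $A_f$ denotes the localization of $A$ at $\{f^j:j\ge 0\}$. An $A$-module $M$ is generically free if there is a non-nilpotent $f\in A$ such that $A_f\otimes_A M$ is a free $A_f$-module (the zero module counts as free). A proper ideal $P$ of $B$ is prime if for all ideals $J_1,J_2$ of $B$, $J_1J_2\subset P$ implies $J_1\subset P$ or $J_2\subset P$. A proper ideal is semiprime if it equals the intersection of all prime ideals containing it. An ideal is primitive if it is the annihilator of a simple $B$-module, and semiprimitive if it is an intersection of primitive ideals. *)

theory Defs
  imports "HOL-Algebra.Algebra"
begin

section \<open>Modules over rings that need not be commutative\<close>

text \<open>The library locale \<^locale>\<open>module\<close> is restricted to commutative rings of scalars.  As there, the
  fields \<^const>\<open>monoid.mult\<close> and \<^const>\<open>one\<close> of a module record are ignored.\<close>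

locale left_module = R?: ring R + M?: abelian_group M
  for R :: "('a, 'r) ring_scheme" (structure) and M :: "('a, 'm, 'x) module_scheme" (structure) +
  assumes smult_closed [simp, intro]:
      "\<lbrakk>a \<in> carrier R; x \<in> carrier M\<rbrakk> \<Longrightarrow> a \<odot>\<^bsub>M\<^esub> x \<in> carrier M"
    and smult_l_distr:
      "\<lbrakk>a \<in> carrier R; b \<in> carrier R; x \<in> carrier M\<rbrakk>
        \<Longrightarrow> (a \<oplus> b) \<odot>\<^bsub>M\<^esub> x = a \<odot>\<^bsub>M\<^esub> x \<oplus>\<^bsub>M\<^esub> b \<odot>\<^bsub>M\<^esub> x"
    and smult_r_distr:
      "\<lbrakk>a \<in> carrier R; x \<in> carrier M; y \<in> carrier M\<rbrakk>
        \<Longrightarrow> a \<odot>\<^bsub>M\<^esub> (x \<oplus>\<^bsub>M\<^esub> y) = a \<odot>\<^bsub>M\<^esub> x \<oplus>\<^bsub>M\<^esub> a \<odot>\<^bsub>M\<^esub> y"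
    and smult_assoc1:
      "\<lbrakk>a \<in> carrier R; b \<in> carrier R; x \<in> carrier M\<rbrakk>
        \<Longrightarrow> (a \<otimes> b) \<odot>\<^bsub>M\<^esub> x = a \<odot>\<^bsub>M\<^esub> (b \<odot>\<^bsub>M\<^esub> x)"
    and smult_one [simp]:
      "x \<in> carrier M \<Longrightarrow> \<one> \<odot>\<^bsub>M\<^esub> x = x"

definition submodule_gen ::
    "('a, 'r) ring_scheme \<Rightarrow> ('a, 'm, 'x) module_scheme \<Rightarrow> 'm set \<Rightarrow> 'm set"
  where "submodule_gen R M S = \<Inter>{N. submodule N R M \<and> S \<subseteq> N}"

definition cyclic_module :: "('a, 'r) ring_scheme \<Rightarrow> ('a, 'm, 'x) module_scheme \<Rightarrow> bool"
  where "cyclic_module R M \<longleftrightarrow>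
    left_module R M \<and> (\<exists>g\<in>carrier M. carrier M = submodule_gen R M {g})"

definition simple_module :: "('a, 'r) ring_scheme \<Rightarrow> ('a, 'm, 'x) module_scheme \<Rightarrow> bool"
  where "simple_module R M \<longleftrightarrow>
    left_module R M \<and> carrier M \<noteq> {\<zero>\<^bsub>M\<^esub>} \<and>
    (\<forall>N. submodule N R M \<longrightarrow> N = {\<zero>\<^bsub>M\<^esub>} \<or> N = carrier M)"

definition restrict_scalars :: "('a \<Rightarrow> 'b) \<Rightarrow> ('b, 'm, 'x) module_scheme \<Rightarrow> ('a, 'm) module"
  where "restrict_scalars \<phi> M =
    \<lparr>carrier = carrier M, monoid.mult = monoid.mult M, one = one M,
     ring.zero = ring.zero M, ring.add = ring.add M,
     smult = (\<lambda>a x. \<phi> a \<odot>\<^bsub>M\<^esub> x)\<rparr>"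

definition regular_module :: "('a, 'r) ring_scheme \<Rightarrow> ('a, 'a) module"
  where "regular_module R =
    \<lparr>carrier = carrier R, monoid.mult = monoid.mult R, one = one R,
     ring.zero = ring.zero R, ring.add = ring.add R,
     smult = monoid.mult R\<rparr>"

text \<open>The submodules of the regular left module are the left ideals.\<close>

definition left_noetherian :: "('a, 'r) ring_scheme \<Rightarrow> bool"
  where "left_noetherian R \<longleftrightarrow>
    ring R \<and>
    (\<forall>L. submodule L R (regular_module R) \<longrightarrow>
      (\<exists>S. finite S \<and> S \<subseteq> carrier R \<and> L = submodule_gen R (regular_module R) S))"


section \<open>Generically free modules over a commutative ring\<close>

definition is_basis :: "('a, 'r) ring_scheme \<Rightarrow> ('a, 'm, 'x) module_scheme \<Rightarrow> 'm set \<Rightarrow> bool"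
  where "is_basis A M S \<longleftrightarrow>
    S \<subseteq> carrier M \<and>
    (\<forall>x\<in>carrier M. \<exists>!c. (\<forall>s. c s \<in> carrier A) \<and> (\<forall>s. s \<notin> S \<longrightarrow> c s = \<zero>\<^bsub>A\<^esub>) \<and>
      finite {s. c s \<noteq> \<zero>\<^bsub>A\<^esub>} \<and> x = (\<Oplus>\<^bsub>M\<^esub>s\<in>{s. c s \<noteq> \<zero>\<^bsub>A\<^esub>}. c s \<odot>\<^bsub>M\<^esub> s))"

definition free_module :: "('a, 'r) ring_scheme \<Rightarrow> ('a, 'm, 'x) module_scheme \<Rightarrow> bool"
  where "free_module A M \<longleftrightarrow> module A M \<and> (\<exists>S. is_basis A M S)"

definition powers :: "('a, 'r) ring_scheme \<Rightarrow> 'a \<Rightarrow> 'a set"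
  where "powers A f = {f [^]\<^bsub>A\<^esub> j |j::nat. True}"

text \<open>Localization of a commutative ring at a multiplicative set \<open>S\<close>: the fraction \<open>a / s\<close> is the class
  of \<open>(a, s)\<close>.\<close>

definition fraction_rel :: "('a, 'r) ring_scheme \<Rightarrow> 'a set \<Rightarrow> (('a \<times> 'a) \<times> ('a \<times> 'a)) set"
  where "fraction_rel A S =
    {((a, s), (b, t)). a \<in> carrier A \<and> s \<in> S \<and> b \<in> carrier A \<and> t \<in> S \<and>
      (\<exists>u\<in>S. u \<otimes>\<^bsub>A\<^esub> (a \<otimes>\<^bsub>A\<^esub> t \<ominus>\<^bsub>A\<^esub> b \<otimes>\<^bsub>A\<^esub> s) = \<zero>\<^bsub>A\<^esub>)}"

definition fraction :: "('a, 'r) ring_scheme \<Rightarrow> 'a set \<Rightarrow> 'a \<Rightarrow> 'a \<Rightarrow> ('a \<times> 'a) set"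
  where "fraction A S a s = fraction_rel A S `` {(a, s)}"

definition localization :: "('a, 'r) ring_scheme \<Rightarrow> 'a set \<Rightarrow> ('a \<times> 'a) set ring"
  where "localization A S =
    \<lparr>carrier = (carrier A \<times> S) // fraction_rel A S,
     monoid.mult = (\<lambda>U V. \<Union>(a, s)\<in>U. \<Union>(b, t)\<in>V. fraction A S (a \<otimes>\<^bsub>A\<^esub> b) (s \<otimes>\<^bsub>A\<^esub> t)),
     one = fraction A S \<one>\<^bsub>A\<^esub> \<one>\<^bsub>A\<^esub>,
     ring.zero = fraction A S \<zero>\<^bsub>A\<^esub> \<one>\<^bsub>A\<^esub>,
     ring.add = (\<lambda>U V. \<Union>(a, s)\<in>U. \<Union>(b, t)\<in>V.
              fraction A S (a \<otimes>\<^bsub>A\<^esub> t \<oplus>\<^bsub>A\<^esub> b \<otimes>\<^bsub>A\<^esub> s) (s \<otimes>\<^bsub>A\<^esub> t))\<rparr>"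

text \<open>For a homomorphism \<open>\<phi>\<close> from \<open>A\<close> to \<open>C\<close> of commutative rings, \<open>base_change A \<phi> C M\<close> is the
  \<open>C\<close>-module given by the tensor product of \<open>C\<close> and \<open>M\<close> over \<open>A\<close>: the free abelian group on the pairs
  \<open>(c, x)\<close> modulo the subgroup generated by the relators of biadditivity and \<open>A\<close>-balancedness, with
  \<open>d (c, x) = (d c, x)\<close>.\<close>

definition tensor_group ::
    "('c, 'r) ring_scheme \<Rightarrow> ('a, 'm, 'x) module_scheme \<Rightarrow> ('c \<times> 'm \<Rightarrow>\<^sub>0 int) monoid"
  where "tensor_group C M = free_Abelian_group (carrier C \<times> carrier M)"

definition tensor_relators ::
    "('a, 'q) ring_scheme \<Rightarrow> ('a \<Rightarrow> 'c) \<Rightarrow> ('c, 'r) ring_scheme \<Rightarrow> ('a, 'm, 'x) module_scheme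
      \<Rightarrow> ('c \<times> 'm \<Rightarrow>\<^sub>0 int) set"
  where "tensor_relators A \<phi> C M =
    {frag_of (c \<oplus>\<^bsub>C\<^esub> d, x) - frag_of (c, x) - frag_of (d, x) |c d x.
      c \<in> carrier C \<and> d \<in> carrier C \<and> x \<in> carrier M} \<union>
    {frag_of (c, x \<oplus>\<^bsub>M\<^esub> y) - frag_of (c, x) - frag_of (c, y) |c x y.
      c \<in> carrier C \<and> x \<in> carrier M \<and> y \<in> carrier M} \<union>
    {frag_of (c \<otimes>\<^bsub>C\<^esub> \<phi> a, x) - frag_of (c, a \<odot>\<^bsub>M\<^esub> x) |c a x.
      c \<in> carrier C \<and> a \<in> carrier A \<and> x \<in> carrier M}"

definition tensor_null ::
    "('a, 'q) ring_scheme \<Rightarrow> ('a \<Rightarrow> 'c) \<Rightarrow> ('c, 'r) ring_scheme \<Rightarrow> ('a, 'm, 'x) module_scheme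
      \<Rightarrow> ('c \<times> 'm \<Rightarrow>\<^sub>0 int) set"
  where "tensor_null A \<phi> C M = generate (tensor_group C M) (tensor_relators A \<phi> C M)"

definition base_change ::
    "('a, 'q) ring_scheme \<Rightarrow> ('a \<Rightarrow> 'c) \<Rightarrow> ('c, 'r) ring_scheme \<Rightarrow> ('a, 'm, 'x) module_scheme
      \<Rightarrow> ('c, ('c \<times> 'm \<Rightarrow>\<^sub>0 int) set) module"
  where "base_change A \<phi> C M =
    \<lparr>carrier = carrier (tensor_group C M Mod tensor_null A \<phi> C M),
     monoid.mult = undefined,
     one = undefined,
     ring.zero = one (tensor_group C M Mod tensor_null A \<phi> C M),
     ring.add = monoid.mult (tensor_group C M Mod tensor_null A \<phi> C M),
     smult = (\<lambda>d T. \<Union>t\<in>T. tensor_null A \<phi> C M #>\<^bsub>tensor_group C M\<^esub>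
                frag_extend (\<lambda>(c, x). frag_of (d \<otimes>\<^bsub>C\<^esub> c, x)) t)\<rparr>"

definition generically_free :: "('a, 'r) ring_scheme \<Rightarrow> ('a, 'm, 'x) module_scheme \<Rightarrow> bool"
  where "generically_free A M \<longleftrightarrow>
    (\<exists>f\<in>carrier A. (\<forall>j::nat. f [^]\<^bsub>A\<^esub> j \<noteq> \<zero>\<^bsub>A\<^esub>) \<and>
      (let C = localization A (powers A f)
       in free_module C (base_change A (\<lambda>a. fraction A (powers A f) a \<one>\<^bsub>A\<^esub>) C M)))"


section \<open>Filtered algebras\<close>

locale unital_algebra = K?: field K + module K B + B?: ring B
  for K :: "('k, 'r) ring_scheme" (structure)
    and B :: "('k, 'b, 'x) module_scheme" (structure) +
  assumes smult_mult_left: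
      "\<lbrakk>a \<in> carrier K; x \<in> carrier B; y \<in> carrier B\<rbrakk>
        \<Longrightarrow> (a \<odot>\<^bsub>B\<^esub> x) \<otimes>\<^bsub>B\<^esub> y = a \<odot>\<^bsub>B\<^esub> (x \<otimes>\<^bsub>B\<^esub> y)"
    and smult_mult_right:
      "\<lbrakk>a \<in> carrier K; x \<in> carrier B; y \<in> carrier B\<rbrakk>
        \<Longrightarrow> x \<otimes>\<^bsub>B\<^esub> (a \<odot>\<^bsub>B\<^esub> y) = a \<odot>\<^bsub>B\<^esub> (x \<otimes>\<^bsub>B\<^esub> y)"

text \<open>Filtrations are indexed by the integers at least \<open>-1\<close>; the values of \<open>F\<close> at other integers are
  irrelevant.\<close>

definition filtration ::
    "('k, 'r) ring_scheme \<Rightarrow> ('k, 'b, 'x) module_scheme \<Rightarrow> (int \<Rightarrow> 'b set) \<Rightarrow> bool"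
  where "filtration K B F \<longleftrightarrow>
    (\<forall>n\<ge>-1. submodule (F n) K B) \<and>
    (\<forall>n\<ge>-1. F n \<subseteq> F (n + 1)) \<and>
    F (-1) = {\<zero>\<^bsub>B\<^esub>} \<and>
    (\<forall>a\<in>carrier K. a \<odot>\<^bsub>B\<^esub> \<one>\<^bsub>B\<^esub> \<in> F 0) \<and>
    submodule_gen K B (\<Union>n\<in>{0..}. F n) = carrier B \<and>
    (\<forall>m\<ge>0. \<forall>n\<ge>0. \<forall>x\<in>F m. \<forall>y\<in>F n. x \<otimes>\<^bsub>B\<^esub> y \<in> F (m + n))"

definition locally_finite ::
    "('k, 'r) ring_scheme \<Rightarrow> ('k, 'b, 'x) module_scheme \<Rightarrow> (int \<Rightarrow> 'b set) \<Rightarrow> bool"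
  where "locally_finite K B F \<longleftrightarrow>
    (\<forall>n\<ge>-1. \<exists>S. finite S \<and> S \<subseteq> F n \<and> F n = submodule_gen K B S)"

definition gr_component ::
    "('k, 'b, 'x) module_scheme \<Rightarrow> (int \<Rightarrow> 'b set) \<Rightarrow> nat \<Rightarrow> 'b set monoid"
  where "gr_component B F n = B\<lparr>carrier := F (int n)\<rparr> A_Mod F (int n - 1)"

text \<open>An element of the associated graded algebra is a finitely supported family of cosets.  The
  product of the components of degrees \<open>i\<close> and \<open>n - i\<close> is the coset of \<open>F (n - 1)\<close> given by
  \<^const>\<open>rcoset_mult\<close>; the addition of \<^const>\<open>gr_component\<close> is written multiplicatively.\<close>

definition gr ::
    "('k, 'b, 'x) module_scheme \<Rightarrow> (int \<Rightarrow> 'b set) \<Rightarrow> ('k, nat \<Rightarrow> 'b set) module"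
  where "gr B F =
    \<lparr>carrier = carrier (sum_group UNIV (gr_component B F)),
     monoid.mult = (\<lambda>x y n. finprod (gr_component B F n)
               (\<lambda>i. rcoset_mult B (F (int n - 1)) (x i) (y (n - i))) {..n}),
     one = (\<lambda>n. if n = 0 then F (-1) +>\<^bsub>B\<^esub> \<one>\<^bsub>B\<^esub> else F (int n - 1)),
     ring.zero = one (sum_group UNIV (gr_component B F)),
     ring.add = monoid.mult (sum_group UNIV (gr_component B F)),
     smult = (\<lambda>a x n. \<Union>y\<in>x n. F (int n - 1) +>\<^bsub>B\<^esub> (a \<odot>\<^bsub>B\<^esub> y))\<rparr>"

definition gr_poly_component ::
    "('k, 'b, 'x) module_scheme \<Rightarrow> (int \<Rightarrow> 'b set) \<Rightarrow> nat \<Rightarrow> (nat \<Rightarrow> nat \<Rightarrow> 'b set) set"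
  where "gr_poly_component B F n =
    {p \<in> carrier (UP (gr B F)). \<forall>i m. m \<noteq> n \<longrightarrow> coeff (UP (gr B F)) p i m = \<zero>\<^bsub>gr B F\<^esub> m}"

text \<open>The ring homomorphism from \<open>K[X]\<close> to \<open>E[X]\<close> for a \<open>K\<close>-algebra \<open>E\<close>.\<close>

definition poly_scalars ::
    "('k, 'r) ring_scheme \<Rightarrow> ('k, 'e, 'x) module_scheme \<Rightarrow> (nat \<Rightarrow> 'k) \<Rightarrow> nat \<Rightarrow> 'e"
  where "poly_scalars K E p = (\<lambda>i. coeff (UP K) p i \<odot>\<^bsub>E\<^esub> \<one>\<^bsub>E\<^esub>)"

text \<open>\<open>N\<close> is a grading of the module \<open>M\<close> over a ring \<open>R\<close> graded by \<open>D\<close>.\<close>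

definition module_grading ::
    "(nat \<Rightarrow> 'a set) \<Rightarrow> ('a, 'm, 'x) module_scheme \<Rightarrow> (nat \<Rightarrow> 'm set) \<Rightarrow> bool"
  where "module_grading D M N \<longleftrightarrow>
    (\<forall>n. subgroup (N n) (add_monoid M)) \<and>
    (\<forall>x\<in>carrier M. \<exists>!c. (\<forall>n. c n \<in> N n) \<and> finite {n. c n \<noteq> \<zero>\<^bsub>M\<^esub>} \<and>
      x = (\<Oplus>\<^bsub>M\<^esub>n\<in>{n. c n \<noteq> \<zero>\<^bsub>M\<^esub>}. c n)) \<and>
    (\<forall>m n. \<forall>a\<in>D m. \<forall>x\<in>N n. a \<odot>\<^bsub>M\<^esub> x \<in> N (m + n))"


section \<open>Jacobson algebras\<close>

definition prime_ideal :: "'a set \<Rightarrow> ('a, 'r) ring_scheme \<Rightarrow> bool"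
  where "prime_ideal P R \<longleftrightarrow>
    ideal P R \<and> P \<noteq> carrier R \<and>
    (\<forall>I J. ideal I R \<and> ideal J R \<and> ideal_prod R I J \<subseteq> P \<longrightarrow> I \<subseteq> P \<or> J \<subseteq> P)"

definition semiprime_ideal :: "'a set \<Rightarrow> ('a, 'r) ring_scheme \<Rightarrow> bool"
  where "semiprime_ideal I R \<longleftrightarrow>
    ideal I R \<and> I \<noteq> carrier R \<and> I = \<Inter>{P. prime_ideal P R \<and> I \<subseteq> P}"

definition annihilator :: "('a, 'r) ring_scheme \<Rightarrow> ('a, 'm, 'x) module_scheme \<Rightarrow> 'a set"
  where "annihilator R M = {a \<in> carrier R. \<forall>x\<in>carrier M. a \<odot>\<^bsub>M\<^esub> x = \<zero>\<^bsub>M\<^esub>}"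

text \<open>The simple module is sought among the modules with elements of type \<^typ>\<open>'a set\<close>.  This is no
  restriction: the lemma \<open>primitive_ideal_annihilator\<close> below allows elements of any type.\<close>

definition primitive_ideal :: "'a set \<Rightarrow> ('a, 'r) ring_scheme \<Rightarrow> bool"
  where "primitive_ideal P R \<longleftrightarrow>
    (\<exists>M :: ('a, 'a set) module. simple_module R M \<and> P = annihilator R M)"

context
  fixes R :: "('a, 'r) ring_scheme" (structure)
    and M :: "('a, 'm, 'x) module_scheme"
    and g :: "'m \<Rightarrow> 'c"
    and T :: "('a, 'c) module"
  assumes M: "left_module R M"
    and inj: "inj_on g (carrier M)"
    and carrier_T: "carrier T = g ` carrier M"
    and zero_T: "\<zero>\<^bsub>T\<^esub> = g \<zero>\<^bsub>M\<^esub>"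
    and add_T: "\<And>x y. \<lbrakk>x \<in> carrier M; y \<in> carrier M\<rbrakk> \<Longrightarrow> g x \<oplus>\<^bsub>T\<^esub> g y = g (x \<oplus>\<^bsub>M\<^esub> y)"
    and smult_T: "\<And>a x. \<lbrakk>a \<in> carrier R; x \<in> carrier M\<rbrakk> \<Longrightarrow> a \<odot>\<^bsub>T\<^esub> g x = g (a \<odot>\<^bsub>M\<^esub> x)"
begin

interpretation left_module R M
  by (rule M)

lemma transport_left_module: "left_module R T"
proof -
  have "abelian_group T"
  proof (rule abelian_groupI)
    fix u assume "u \<in> carrier T"
    then obtain x where x: "x \<in> carrier M" "u = g x"
      by (auto simp: carrier_T)
    then have "g (\<ominus>\<^bsub>M\<^esub> x) \<oplus>\<^bsub>T\<^esub> u = \<zero>\<^bsub>T\<^esub>"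
      by (simp add: add_T zero_T M.l_neg)
    with x show "\<exists>v\<in>carrier T. v \<oplus>\<^bsub>T\<^esub> u = \<zero>\<^bsub>T\<^esub>"
      by (auto simp: carrier_T)
  qed (auto simp: carrier_T zero_T add_T M.a_ac)
  moreover have "left_module_axioms R T"
    by unfold_locales
      (auto simp: carrier_T add_T smult_T smult_l_distr smult_r_distr smult_assoc1)
  ultimately show ?thesis
    by (simp add: left_module_def R.ring_axioms)
qed

lemma transport_submodule:
  assumes "submodule N R T"
  shows "submodule {x \<in> carrier M. g x \<in> N} R M"
proof -
  interpret T: left_module R T
    by (rule transport_left_module)
  interpret N: submodule N R T
    by (rule assms)
  have N_zero: "g \<zero>\<^bsub>M\<^esub> \<in> N"
    using N.one_closed by (simp add: zero_T)
  have N_add: "g (x \<oplus>\<^bsub>M\<^esub> y) \<in> N"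
    if "x \<in> carrier M" "y \<in> carrier M" "g x \<in> N" "g y \<in> N" for x y
    using that N.m_closed[of "g x" "g y"] by (simp add: add_T)
  have N_smult: "g (a \<odot>\<^bsub>M\<^esub> x) \<in> N"
    if "a \<in> carrier R" "x \<in> carrier M" "g x \<in> N" for a x
    using that N.smult_closed[of a "g x"] by (simp add: smult_T)
  have neg: "\<ominus>\<^bsub>M\<^esub> x = (\<ominus> \<one>) \<odot>\<^bsub>M\<^esub> x" if "x \<in> carrier M" for x
  proof (rule M.minus_equality)
    have "(\<ominus> \<one> \<oplus> \<one>) \<odot>\<^bsub>M\<^esub> x = \<zero>\<^bsub>M\<^esub>"
    proof -
      have "\<zero> \<odot>\<^bsub>M\<^esub> x \<oplus>\<^bsub>M\<^esub> \<zero> \<odot>\<^bsub>M\<^esub> x = \<zero> \<odot>\<^bsub>M\<^esub> x"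
        using that smult_l_distr[of \<zero> \<zero> x] by simp
      then show ?thesis
        using that by (simp add: R.l_neg)
    qed
    then show "(\<ominus> \<one>) \<odot>\<^bsub>M\<^esub> x \<oplus>\<^bsub>M\<^esub> x = \<zero>\<^bsub>M\<^esub>"
      using that by (simp add: smult_l_distr)
  qed (use that in auto)
  show ?thesis
  proof (intro submodule.intro M.add.subgroupI submodule_axioms.intro)
    fix x assume "x \<in> {x \<in> carrier M. g x \<in> N}"
    then show "\<ominus>\<^bsub>M\<^esub> x \<in> {x \<in> carrier M. g x \<in> N}"
      using N_smult[of "\<ominus> \<one>" x] by (simp add: neg del: M.add.inv_closed)
  qed (use N_zero N_add N_smult in auto)
qed

lemma transport_simple_module:
  assumes "simple_module R M"
  shows "simple_module R T"
  unfolding simple_module_def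
proof (intro conjI allI impI)
  show "left_module R T"
    by (rule transport_left_module)
  have "carrier M \<noteq> {\<zero>\<^bsub>M\<^esub>}"
    using assms by (simp add: simple_module_def)
  then obtain x where "x \<in> carrier M" "x \<noteq> \<zero>\<^bsub>M\<^esub>"
    using M.zero_closed by blast
  then have "g x \<in> carrier T" "g x \<noteq> \<zero>\<^bsub>T\<^esub>"
    using inj by (auto simp: carrier_T zero_T inj_on_def)
  then show "carrier T \<noteq> {\<zero>\<^bsub>T\<^esub>}"
    by blast
next
  fix N assume N: "submodule N R T"
  let ?N = "{x \<in> carrier M. g x \<in> N}"
  have "N \<subseteq> carrier T"
    using subgroup.subset[OF submodule.axioms(1)[OF N]] by simp
  then have "N = g ` ?N"
    by (auto simp: carrier_T)
  moreover have "?N = {\<zero>\<^bsub>M\<^esub>} \<or> ?N = carrier M"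
    using assms transport_submodule[OF N] unfolding simple_module_def by blast
  ultimately show "N = {\<zero>\<^bsub>T\<^esub>} \<or> N = carrier T"
    unfolding carrier_T zero_T by (elim disjE) auto
qed

lemma transport_annihilator: "annihilator R T = annihilator R M"
proof -
  have "g (a \<odot>\<^bsub>M\<^esub> x) = g \<zero>\<^bsub>M\<^esub> \<longleftrightarrow> a \<odot>\<^bsub>M\<^esub> x = \<zero>\<^bsub>M\<^esub>"
    if "a \<in> carrier R" "x \<in> carrier M" for a x
    using that inj by (auto simp: inj_on_def)
  then show ?thesis
    by (auto simp: annihilator_def carrier_T zero_T smult_T)
qed

end

lemma simple_module_generated:
  assumes "simple_module R M" and x: "x \<in> carrier M" "x \<noteq> \<zero>\<^bsub>M\<^esub>"
  shows "carrier M = (\<lambda>a. a \<odot>\<^bsub>M\<^esub> x) ` carrier R"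
proof -
  interpret left_module R M
    using assms(1) by (simp add: simple_module_def)
  let ?N = "(\<lambda>a. a \<odot>\<^bsub>M\<^esub> x) ` carrier R"
  have zero: "\<zero>\<^bsub>R\<^esub> \<odot>\<^bsub>M\<^esub> x = \<zero>\<^bsub>M\<^esub>"
    using x(1) smult_l_distr[of "\<zero>\<^bsub>R\<^esub>" "\<zero>\<^bsub>R\<^esub>" x] by simp
  have "submodule ?N R M"
  proof (intro submodule.intro M.add.subgroupI submodule_axioms.intro)
    fix y assume "y \<in> ?N"
    then obtain a where a: "a \<in> carrier R" "y = a \<odot>\<^bsub>M\<^esub> x"
      by auto
    have "(\<ominus>\<^bsub>R\<^esub> a) \<odot>\<^bsub>M\<^esub> x \<oplus>\<^bsub>M\<^esub> y = \<zero>\<^bsub>M\<^esub>"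
      using a x(1) zero smult_l_distr[of "\<ominus>\<^bsub>R\<^esub> a" a x] by (simp add: R.l_neg)
    then have "\<ominus>\<^bsub>M\<^esub> y = (\<ominus>\<^bsub>R\<^esub> a) \<odot>\<^bsub>M\<^esub> x"
      using a x(1) by (intro M.minus_equality) auto
    then show "\<ominus>\<^bsub>M\<^esub> y \<in> ?N"
      using a(1) by blast
  next
    fix y z assume "y \<in> ?N" "z \<in> ?N"
    then show "y \<oplus>\<^bsub>M\<^esub> z \<in> ?N"
      using x(1) by (auto simp flip: smult_l_distr)
  next
    fix a y assume "a \<in> carrier R" "y \<in> ?N"
    then show "a \<odot>\<^bsub>M\<^esub> y \<in> ?N"
      using x(1) by (auto simp flip: smult_assoc1)
  qed (use x(1) in auto)
  moreover have "x \<in> ?N"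
    using x(1) by (intro image_eqI[of _ _ "\<one>\<^bsub>R\<^esub>"]) auto
  ultimately show ?thesis
    using assms(1) x(2) unfolding simple_module_def by blast
qed

lemma primitive_ideal_annihilator:
  fixes M :: "('a, 'm, 'x) module_scheme"
  assumes "simple_module R M"
  shows "primitive_ideal (annihilator R M) R"
proof -
  have M: "left_module R M"
    using assms by (simp add: simple_module_def)
  interpret left_module R M
    by (rule M)
  obtain x where x: "x \<in> carrier M" "x \<noteq> \<zero>\<^bsub>M\<^esub>"
    using assms M.zero_closed unfolding simple_module_def by blast
  define g where "g y = {a \<in> carrier R. a \<odot>\<^bsub>M\<^esub> x = y}" for y
  define h where "h = inv_into (carrier M) g"
  have g_nonempty: "g y \<noteq> {}" if "y \<in> carrier M" for y
    using that simple_module_generated[OF assms x] by (auto simp: g_def)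
  have inj: "inj_on g (carrier M)"
  proof (rule inj_onI)
    fix y z assume "y \<in> carrier M" "g y = g z"
    then show "y = z"
      using g_nonempty[of y] by (auto simp: g_def)
  qed
  then have h: "h (g y) = y" if "y \<in> carrier M" for y
    using that by (simp add: h_def)
  define T :: "('a, 'a set) module" where "T =
    \<lparr>carrier = g ` carrier M, monoid.mult = undefined, one = undefined, ring.zero = g \<zero>\<^bsub>M\<^esub>,
     ring.add = (\<lambda>u v. g (h u \<oplus>\<^bsub>M\<^esub> h v)), smult = (\<lambda>a u. g (a \<odot>\<^bsub>M\<^esub> h u))\<rparr>"
  have T: "carrier T = g ` carrier M" "\<zero>\<^bsub>T\<^esub> = g \<zero>\<^bsub>M\<^esub>"
    "\<And>y z. \<lbrakk>y \<in> carrier M; z \<in> carrier M\<rbrakk> \<Longrightarrow> g y \<oplus>\<^bsub>T\<^esub> g z = g (y \<oplus>\<^bsub>M\<^esub> z)"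
    "\<And>a y. \<lbrakk>a \<in> carrier R; y \<in> carrier M\<rbrakk> \<Longrightarrow> a \<odot>\<^bsub>T\<^esub> g y = g (a \<odot>\<^bsub>M\<^esub> y)"
    by (simp_all add: T_def h)
  show ?thesis
    unfolding primitive_ideal_def
    by (intro exI[of _ T] conjI transport_simple_module[OF M inj T assms]
        transport_annihilator[OF M inj T, symmetric])
qed

text \<open>The intersection of the empty family is the whole ring.\<close>

definition semiprimitive_ideal :: "'a set \<Rightarrow> ('a, 'r) ring_scheme \<Rightarrow> bool"
  where "semiprimitive_ideal I R \<longleftrightarrow>
    (\<exists>\<P>. (\<forall>P\<in>\<P>. primitive_ideal P R) \<and> I = carrier R \<inter> \<Inter>\<P>)"

definition jacobson :: "('a, 'r) ring_scheme \<Rightarrow> bool"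
  where "jacobson R \<longleftrightarrow> (\<forall>I. semiprime_ideal I R \<longrightarrow> semiprimitive_ideal I R)"


section \<open>The commutant of a module\<close>

text \<open>Endomorphisms are represented by extensional functions, and \<open>a \<in> K\<close> acts on \<open>M\<close> through the
  element \<open>a \<odot> \<one>\<close> of the algebra \<open>B\<close>.\<close>

definition commutant ::
    "('k, 'b, 'x) module_scheme \<Rightarrow> ('b, 'm, 'y) module_scheme \<Rightarrow> ('k, 'm \<Rightarrow> 'm) module"
  where "commutant B M =
    \<lparr>carrier = {\<phi> \<in> extensional (carrier M). \<phi> \<in> hom (add_monoid M) (add_monoid M) \<and>
                (\<forall>b\<in>carrier B. \<forall>x\<in>carrier M. \<phi> (b \<odot>\<^bsub>M\<^esub> x) = b \<odot>\<^bsub>M\<^esub> \<phi> x)},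
     monoid.mult = compose (carrier M),
     one = (\<lambda>x\<in>carrier M. x),
     ring.zero = (\<lambda>x\<in>carrier M. \<zero>\<^bsub>M\<^esub>),
     ring.add = (\<lambda>\<phi> \<psi>. \<lambda>x\<in>carrier M. \<phi> x \<oplus>\<^bsub>M\<^esub> \<psi> x),
     smult = (\<lambda>a \<phi>. \<lambda>x\<in>carrier M. (a \<odot>\<^bsub>B\<^esub> \<one>\<^bsub>B\<^esub>) \<odot>\<^bsub>M\<^esub> \<phi> x)\<rparr>"

definition algebraic_element ::
    "('k, 'r) ring_scheme \<Rightarrow> ('k, 'e, 'x) module_scheme \<Rightarrow> 'e \<Rightarrow> bool"
  where "algebraic_element K E x \<longleftrightarrow>
    (\<exists>p\<in>carrier (UP K). p \<noteq> \<zero>\<^bsub>UP K\<^esub> \<and>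
      (\<Oplus>\<^bsub>E\<^esub>i\<in>{..deg K p}. coeff (UP K) p i \<odot>\<^bsub>E\<^esub> (x [^]\<^bsub>E\<^esub> i)) = \<zero>\<^bsub>E\<^esub>)"

definition algebraic_algebra :: "('k, 'r) ring_scheme \<Rightarrow> ('k, 'e, 'x) module_scheme \<Rightarrow> bool"
  where "algebraic_algebra K E \<longleftrightarrow> (\<forall>x\<in>carrier E. algebraic_element K E x)"

end

theory Submission
  imports Defs
begin

text \<open>Write \<open>G\<close> for the associated graded algebra.  By Hilbert's basis theorem \<open>G[X]\<close> and \<open>B[X]\<close> are
  left noetherian, so the \<open>K[X]\<close>-torsion of a cyclic \<open>G[X]\<close>-module is killed by a single \<open>f \<noteq> 0\<close>.  If
  the module is graded, its components are finitely generated over the principal ideal domain \<open>K[X]\<close>;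
  bases of these components modulo torsion together become a basis after inverting \<open>f\<close>.

  For a maximal left ideal \<open>L\<close> of \<open>B[X]\<close>, comparing \<open>B[X]/L\<close> with its associated graded \<open>G[X]\<close>-module
  shows that \<open>L\<close> contains a non-zero polynomial with coefficients in \<open>K\<close>.  Letting \<open>X\<close> act on a simple
  \<open>B\<close>-module through an endomorphism, one finds that the endomorphism is algebraic.  A maximal left
  ideal containing \<open>1 - x X\<close> (Rabinowitsch's trick) shows that an element \<open>x\<close> of all primitive ideals
  above a prime ideal \<open>P\<close> is nilpotent modulo \<open>P\<close>; and in a left noetherian ring a nil ideal modulo \<open>P\<close>
  is zero.\<close>

section \<open>Polynomials as coefficient functions\<close>

text \<open>The field \<open>K\<close> may be finite or countable, so no comparison of dimensions
  with the number of scalars can force an algebraic relation. The relation is forced inside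
  \<open>K[X]\<close>, where every \<open>f \<noteq> 0\<close> has a non-unit prime to it, whatever
  the field.

  The obstacle is that modules over \<open>G[X]\<close> or \<open>B[X]\<close> are rarely finitely
  generated over \<open>K[X]\<close>: torsion in degree \<open>n\<close> might need a denominator
  that grows with \<open>n\<close>. Noetherianity of \<open>G[X]\<close> excludes this, since one
  \<open>f\<close> serves all degrees. Giving \<open>X\<close> the degree 0 makes the graded
  components of a cyclic module finitely generated over \<open>K[X]\<close>, by local finiteness, so
  that euclidean division settles each degree separately.

  The consequences for \<open>B\<close> are not drawn from a basis of the localized module but from
  the same \<open>f\<close>: it permits a division by a scalar to be pushed down the filtration of
  \<open>B[X]\<close> to degree 0, where finite generation turns it into a contradiction.\<close>

lemma UP_mem_iff:
  "p \<in> carrier (UP R) \<longleftrightarrow> (\<forall>i. p i \<in> carrier R) \<and> (\<exists>n. \<forall>i\<ge>n. p i = \<zero>\<^bsub>R\<^esub>)"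
proof -
  \<comment> \<open>The vanishing range is shifted from \<open>i > n\<close> to
    \<open>i \<ge> n\<close>, so that \<open>n = 0\<close> describes the zero polynomial and
    inductions on \<open>n\<close> start there.\<close>
  have "(\<exists>n. bound \<zero>\<^bsub>R\<^esub> n p) \<longleftrightarrow> (\<exists>n. \<forall>i\<ge>n. p i = \<zero>\<^bsub>R\<^esub>)"
    unfolding bound_def by (meson Suc_le_eq less_imp_le)
  then show ?thesis
    by (auto simp: UP_def up_def)
qed

lemma UP_coeff_closed [simp, intro]: "p \<in> carrier (UP R) \<Longrightarrow> p i \<in> carrier R"
  by (simp add: UP_mem_iff)

text \<open>With this rewriting coefficients are written \<open>p i\<close> throughout;
  \<open>coeff\<close> survives only where library lemmas or the main statement mention it.\<close>

lemma coeff_UP [simp]: "p \<in> carrier (UP R) \<Longrightarrow> coeff (UP R) p = p"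
  by (simp add: UP_def)

lemma UP_zero_eq: "\<zero>\<^bsub>UP R\<^esub> = (\<lambda>i. \<zero>\<^bsub>R\<^esub>)"
  by (simp add: UP_def)

lemma UP_zero_apply: "\<zero>\<^bsub>UP R\<^esub> i = \<zero>\<^bsub>R\<^esub>"
  by (simp add: UP_def)

lemma UP_one_apply: "\<one>\<^bsub>UP R\<^esub> i = (if i = 0 then \<one>\<^bsub>R\<^esub> else \<zero>\<^bsub>R\<^esub>)"
  by (simp add: UP_def)

lemma UP_add_apply:
  "\<lbrakk>p \<in> carrier (UP R); q \<in> carrier (UP R)\<rbrakk> \<Longrightarrow> (p \<oplus>\<^bsub>UP R\<^esub> q) i = p i \<oplus>\<^bsub>R\<^esub> q i"
  by (simp add: UP_def)

lemma UP_mult_apply: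
  "\<lbrakk>p \<in> carrier (UP R); q \<in> carrier (UP R)\<rbrakk>
    \<Longrightarrow> (p \<otimes>\<^bsub>UP R\<^esub> q) n = (\<Oplus>\<^bsub>R\<^esub>i\<in>{..n}. p i \<otimes>\<^bsub>R\<^esub> q (n - i))"
  by (simp add: UP_def)

lemma UP_monom_apply: "a \<in> carrier R \<Longrightarrow> up_ring.monom (UP R) a m i = (if i = m then a else \<zero>\<^bsub>R\<^esub>)"
  by (simp add: UP_def)

context ring
begin

lemma UP_ring_UP: "UP_ring R"
  by unfold_locales

lemma ring_UP: "ring (UP R)"
  using UP_ring.UP_ring[OF UP_ring_UP] .

lemma UP_minus_apply:
  assumes "p \<in> carrier (UP R)" "q \<in> carrier (UP R)"
  shows "(p \<ominus>\<^bsub>UP R\<^esub> q) i = p i \<ominus> q i"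
proof -
  interpret P: UP_ring R "UP R"
    by (rule UP_ring_UP)
  have "p \<ominus>\<^bsub>UP R\<^esub> q \<in> carrier (UP R)"
    using assms by simp
  then show ?thesis
    using P.coeff_minus[OF assms, of i] assms by simp
qed

lemma UP_monom_closed [simp]: "a \<in> carrier R \<Longrightarrow> up_ring.monom (UP R) a m \<in> carrier (UP R)"
  by (simp add: UP_ring.monom_closed[OF UP_ring_UP])

lemma UP_finsum_apply:
  assumes "finite Y" "f \<in> Y \<rightarrow> carrier (UP R)"
  shows "(\<Oplus>\<^bsub>UP R\<^esub>x\<in>Y. f x) i = (\<Oplus>x\<in>Y. f x i)"
proof -
  interpret P: ring "UP R"
    by (rule ring_UP)
  show ?thesis
    using assms by (induction Y) (auto simp: Pi_iff UP_add_apply UP_zero_apply)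
qed

lemma monom_mult_apply:
  assumes "a \<in> carrier R" "p \<in> carrier (UP R)"
  shows "(up_ring.monom (UP R) a m \<otimes>\<^bsub>UP R\<^esub> p) i = (if m \<le> i then a \<otimes> p (i - m) else \<zero>)"
proof -
  have "(up_ring.monom (UP R) a m \<otimes>\<^bsub>UP R\<^esub> p) i
      = (\<Oplus>j\<in>{..i}. if m = j then a \<otimes> p (i - j) else \<zero>)"
    using assms by (auto simp: UP_mult_apply UP_monom_apply intro!: finsum_cong')
  then show ?thesis
    using assms finsum_singleton[of m "{..i}" "\<lambda>j. a \<otimes> p (i - j)"]
    by (cases "m \<le> i") (auto intro!: add.finprod_one_eqI)
qed

lemma mult_monom_apply:
  assumes "a \<in> carrier R" "p \<in> carrier (UP R)"
  shows "(p \<otimes>\<^bsub>UP R\<^esub> up_ring.monom (UP R) a m) i = (if m \<le> i then p (i - m) \<otimes> a else \<zero>)"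
proof -
  have "(p \<otimes>\<^bsub>UP R\<^esub> up_ring.monom (UP R) a m) i
      = (\<Oplus>j\<in>{..i}. if m \<le> i \<and> i - m = j then p j \<otimes> a else \<zero>)"
    using assms by (auto simp: UP_mult_apply UP_monom_apply intro!: finsum_cong')
  then show ?thesis
    using assms finsum_singleton[of "i - m" "{..i}" "\<lambda>j. p j \<otimes> a"]
    by (cases "m \<le> i") (auto intro!: add.finprod_one_eqI)
qed

text \<open>Serves to check that a set closed under sums is closed under multiplication by all
  polynomials. The monomial case concerns the terms of \<open>p\<close> itself, because
  \<open>p\<close> is the sum of these.\<close>

lemma UP_monom_induct [consumes 1, case_names zero add monom]:
  assumes p: "p \<in> carrier (UP R)"
    and zero: "Q \<zero>\<^bsub>UP R\<^esub>"
    and add: "\<And>p q. \<lbrakk>p \<in> carrier (UP R); q \<in> carrier (UP R); Q p; Q q\<rbrakk> \<Longrightarrow> Q (p \<oplus>\<^bsub>UP R\<^esub> q)"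
    and monom: "\<And>i. Q (up_ring.monom (UP R) (p i) i)"
  shows "Q p"
proof -
  interpret P: UP_ring R "UP R"
    by (rule UP_ring_UP)
  have "Q (\<Oplus>\<^bsub>UP R\<^esub>i\<in>Y. up_ring.monom (UP R) (p i) i)" if "finite Y" for Y
    using that
  proof (induction Y)
    case (insert x Y)
    then have "(\<Oplus>\<^bsub>UP R\<^esub>i\<in>insert x Y. up_ring.monom (UP R) (p i) i)
        = up_ring.monom (UP R) (p x) x \<oplus>\<^bsub>UP R\<^esub> (\<Oplus>\<^bsub>UP R\<^esub>i\<in>Y. up_ring.monom (UP R) (p i) i)"
      using p by (intro P.finsum_insert) auto
    moreover have "(\<Oplus>\<^bsub>UP R\<^esub>i\<in>Y. up_ring.monom (UP R) (p i) i) \<in> carrier (UP R)"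
      using p by (intro P.finsum_closed) auto
    ultimately show ?case
      using insert(3) by (simp only: add monom UP_monom_closed UP_coeff_closed[OF p])
  qed (simp only: P.finsum_empty zero)
  from this[of "{..deg R p}"] show ?thesis
    using P.up_repr[OF p] by (simp only: coeff_UP[OF p] finite_atMost)
qed

end


section \<open>Left ideals and the ascending chain condition\<close>

definition left_ideal :: "'a set \<Rightarrow> ('a, 'r) ring_scheme \<Rightarrow> bool"
  where "left_ideal L R \<longleftrightarrow> submodule L R (regular_module R)"

text \<open>The form of noetherianity that travels: chains of left ideals can be mapped from
  \<open>B[X]\<close> to \<open>G[X]\<close> and from \<open>B\<close> to \<open>B[X]\<close>
  without naming generators.\<close>

definition left_acc :: "('a, 'r) ring_scheme \<Rightarrow> bool"
  where "left_acc R \<longleftrightarrow>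
    (\<forall>I :: nat \<Rightarrow> 'a set. (\<forall>n. left_ideal (I n) R) \<and> (\<forall>n. I n \<subseteq> I (Suc n)) \<longrightarrow>
      (\<exists>k. \<forall>n\<ge>k. I n = I k))"

text \<open>Maximality in the form in which it is applied: every element outside \<open>L\<close>
  has a left inverse modulo \<open>L\<close>.\<close>

definition maximal_left_ideal :: "'a set \<Rightarrow> ('a, 'r) ring_scheme \<Rightarrow> bool"
  where "maximal_left_ideal L R \<longleftrightarrow>
    left_ideal L R \<and> \<one>\<^bsub>R\<^esub> \<notin> L \<and>
    (\<forall>x\<in>carrier R - L. \<exists>r\<in>carrier R. \<exists>l\<in>L. \<one>\<^bsub>R\<^esub> = r \<otimes>\<^bsub>R\<^esub> x \<oplus>\<^bsub>R\<^esub> l)"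

context ring
begin

lemma left_ideal_iff:
  "left_ideal L R \<longleftrightarrow> L \<subseteq> carrier R \<and> \<zero> \<in> L \<and> (\<forall>x\<in>L. \<forall>y\<in>L. x \<oplus> y \<in> L) \<and>
    (\<forall>a\<in>carrier R. \<forall>x\<in>L. a \<otimes> x \<in> L)" (is "_ \<longleftrightarrow> ?rhs")
proof
  assume "left_ideal L R"
  then interpret submodule L R "regular_module R"
    by (simp add: left_ideal_def)
  show ?rhs
    using subset one_closed m_closed smult_closed by (simp add: regular_module_def)
next
  assume L: ?rhs
  have *: "subgroup L (add_monoid R)"
  proof (rule add.subgroupI)
    fix x assume "x \<in> L"
    then show "\<ominus> x \<in> L"
      using L l_minus[of \<one> x] by (metis (no_types) a_inv_closed l_one one_closed subsetD)
  qed (use L in auto)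
  \<comment> \<open>An inverse is a description over a whole record, so equal additive fields still
    have to be seen to give equal inverses.\<close>
  have "m_inv (add_monoid (regular_module R)) = m_inv (add_monoid R)"
    by (rule ext) (simp add: m_inv_def regular_module_def)
  then have "subgroup L (add_monoid (regular_module R))"
    using * by (simp add: subgroup_def regular_module_def)
  then show "left_ideal L R"
    using L by (simp add: left_ideal_def submodule_def submodule_axioms_def regular_module_def)
qed

lemma left_idealI:
  assumes "L \<subseteq> carrier R" "\<zero> \<in> L" "\<And>x y. \<lbrakk>x \<in> L; y \<in> L\<rbrakk> \<Longrightarrow> x \<oplus> y \<in> L"
    "\<And>a x. \<lbrakk>a \<in> carrier R; x \<in> L\<rbrakk> \<Longrightarrow> a \<otimes> x \<in> L"
  shows "left_ideal L R"
  using assms by (simp add: left_ideal_iff)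

lemma left_ideal_subset: "left_ideal L R \<Longrightarrow> L \<subseteq> carrier R"
  and left_ideal_carrier: "\<lbrakk>left_ideal L R; x \<in> L\<rbrakk> \<Longrightarrow> x \<in> carrier R"
  and left_ideal_zero: "left_ideal L R \<Longrightarrow> \<zero> \<in> L"
  and left_ideal_add: "\<lbrakk>left_ideal L R; x \<in> L; y \<in> L\<rbrakk> \<Longrightarrow> x \<oplus> y \<in> L"
  and left_ideal_mult: "\<lbrakk>left_ideal L R; a \<in> carrier R; x \<in> L\<rbrakk> \<Longrightarrow> a \<otimes> x \<in> L"
  by (auto simp: left_ideal_iff)

lemma left_ideal_uminus: "\<lbrakk>left_ideal L R; x \<in> L\<rbrakk> \<Longrightarrow> \<ominus> x \<in> L"
  using left_ideal_mult[of L "\<ominus> \<one>" x] left_ideal_carrier[of L x] by (simp add: l_minus)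

lemma left_ideal_minus: "\<lbrakk>left_ideal L R; x \<in> L; y \<in> L\<rbrakk> \<Longrightarrow> x \<ominus> y \<in> L"
  by (simp add: a_minus_def left_ideal_add left_ideal_uminus)

lemma left_ideal_finsum:
  assumes "left_ideal L R" "\<And>x. x \<in> Y \<Longrightarrow> f x \<in> L"
  shows "(\<Oplus>x\<in>Y. f x) \<in> L"
  using assms(2)
proof (induction Y rule: infinite_finite_induct)
  case (insert x Y)
  then show ?case
    using left_ideal_carrier[OF assms(1)] by (subst finsum_insert) (auto intro: left_ideal_add[OF assms(1)])
qed (auto simp: left_ideal_zero[OF assms(1)])

text \<open>This is \<open>R x + L\<close>. It serves twice: to enlarge a left ideal by an outside
  element, and to form \<open>B[X] (1 - x X) + P[X]\<close> in Rabinowitsch's argument.\<close>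

lemma left_ideal_sum_principal:
  assumes L: "left_ideal L R" and x: "x \<in> carrier R"
  shows "left_ideal {r \<otimes> x \<oplus> l |r l. r \<in> carrier R \<and> l \<in> L} R" (is "left_ideal ?S R")
proof (rule left_idealI)
  note c = left_ideal_carrier[OF L]
  show "?S \<subseteq> carrier R"
    using x c by auto
  show "\<zero> \<in> ?S"
    using x left_ideal_zero[OF L] by (intro CollectI exI[of _ \<zero>]) auto
next
  note c = left_ideal_carrier[OF L]
  fix u v assume "u \<in> ?S" "v \<in> ?S"
  then obtain r l s m where "r \<in> carrier R" "l \<in> L" "s \<in> carrier R" "m \<in> L"
    "u = r \<otimes> x \<oplus> l" "v = s \<otimes> x \<oplus> m"
    by blast
  then show "u \<oplus> v \<in> ?S"
    using x c left_ideal_add[OF L]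
    by (intro CollectI exI[of _ "r \<oplus> s"] exI[of _ "l \<oplus> m"]) (auto simp: l_distr a_ac)
next
  note c = left_ideal_carrier[OF L]
  fix a u assume a: "a \<in> carrier R" and "u \<in> ?S"
  then obtain r l where "r \<in> carrier R" "l \<in> L" "u = r \<otimes> x \<oplus> l"
    by blast
  then show "a \<otimes> u \<in> ?S"
    using a x c left_ideal_mult[OF L]
    by (intro CollectI exI[of _ "a \<otimes> r"] exI[of _ "a \<otimes> l"]) (auto simp: r_distr m_assoc)
qed

section \<open>Ascending chains of left ideals and maximal members of families\<close>

lemma chain_mono:
  fixes I :: "nat \<Rightarrow> 'z set"
  assumes "\<And>n. I n \<subseteq> I (Suc n)" "m \<le> n"
  shows "I m \<subseteq> I n"
  using assms by (rule lift_Suc_mono_le)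

lemma left_ideal_Union_chain:
  fixes I :: "nat \<Rightarrow> 'a set"
  assumes I: "\<And>n. left_ideal (I n) R" and mono: "\<And>n. I n \<subseteq> I (Suc n)"
  shows "left_ideal (\<Union>n. I n) R"
proof (rule left_idealI)
  fix x y assume "x \<in> (\<Union>n. I n)" "y \<in> (\<Union>n. I n)"
  then obtain m n where "x \<in> I m" "y \<in> I n"
    by blast
  then have "x \<in> I (max m n)" "y \<in> I (max m n)"
    using chain_mono[of I, OF mono, of m "max m n"] chain_mono[of I, OF mono, of n "max m n"] by auto
  then show "x \<oplus> y \<in> (\<Union>n. I n)"
    using left_ideal_add[OF I] by blast
next
  show "(\<Union>n. I n) \<subseteq> carrier R"
    using left_ideal_subset[OF I] by (rule UN_least)
  show "\<zero> \<in> (\<Union>n. I n)"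
    using left_ideal_zero[OF I] by (rule UN_I[OF UNIV_I])
  fix a x assume "a \<in> carrier R" "x \<in> (\<Union>n. I n)"
  then obtain n where "a \<otimes> x \<in> I n"
    using left_ideal_mult[OF I] by (meson UN_E)
  then show "a \<otimes> x \<in> (\<Union>n. I n)"
    by (rule UN_I[OF UNIV_I])
qed

text \<open>The union of the chain has finitely many generators; these lie in a common step, and the
  chain is constant from there on.\<close>

lemma left_noetherian_imp_acc:
  assumes "left_noetherian R"
  shows "left_acc R"
  unfolding left_acc_def
proof (intro allI impI)
  fix I :: "nat \<Rightarrow> 'a set"
  assume *: "(\<forall>n. left_ideal (I n) R) \<and> (\<forall>n. I n \<subseteq> I (Suc n))"
  then have I: "\<And>n. left_ideal (I n) R" and mono: "\<And>n. I n \<subseteq> I (Suc n)"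
    by simp_all
  have "\<exists>S. finite S \<and> S \<subseteq> carrier R \<and> (\<Union>n. I n) = submodule_gen R (regular_module R) S"
    using assms left_ideal_Union_chain[of I, OF I mono] by (simp add: left_noetherian_def left_ideal_def)
  then obtain S where S: "finite S" "(\<Union>n. I n) = submodule_gen R (regular_module R) S"
    by (elim exE conjE)
  have "S \<subseteq> (\<Union>n. I n)"
    unfolding S(2) submodule_gen_def by (rule Inter_greatest) simp
  then have "\<forall>s\<in>S. \<exists>n. s \<in> I n"
    by auto
  then obtain k where k: "\<And>s. s \<in> S \<Longrightarrow> s \<in> I (k s)"
    by metis
  obtain m where m: "\<And>s. s \<in> S \<Longrightarrow> k s \<le> m"
    using finite_nat_set_iff_bounded_le[of "k ` S"] S(1) by auto
  have "S \<subseteq> I m"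
    using k chain_mono[of I, OF mono m] by blast
  then have "(\<Union>n. I n) \<subseteq> I m"
    using I[of m] unfolding S(2) submodule_gen_def left_ideal_def by (intro Inter_lower) simp
  then have "I n = I m" if "n \<ge> m" for n
    using chain_mono[of I, OF mono that] by (intro equalityI) auto
  then show "\<exists>k. \<forall>n\<ge>k. I n = I k"
    by blast
qed

end

text \<open>Without a maximal member, dependent choice builds a strictly ascending chain. The family
  is arbitrary because it will consist in turn of proper left ideals, of leading coefficient ideals,
  of torsion parts and of left annihilators.\<close>

lemma left_acc_maximal:
  assumes acc: "left_acc R" and "L0 \<in> \<F>" and \<F>: "\<And>L. L \<in> \<F> \<Longrightarrow> left_ideal L R"
  shows "\<exists>M\<in>\<F>. \<forall>L\<in>\<F>. M \<subseteq> L \<longrightarrow> L = M"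
proof (rule ccontr)
  assume no: "\<not> ?thesis"
  have *: "\<exists>L\<in>\<F>. M \<subseteq> L \<and> L \<noteq> M" if "M \<in> \<F>" for M
    using no that by meson
  have "\<exists>I :: nat \<Rightarrow> _. (\<forall>n. I n \<in> \<F>) \<and> (\<forall>n. I n \<subseteq> I (Suc n) \<and> I (Suc n) \<noteq> I n)"
    using dependent_nat_choice[of "\<lambda>_ L. L \<in> \<F>" "\<lambda>_ L L'. L \<subseteq> L' \<and> L' \<noteq> L"] * \<open>L0 \<in> \<F>\<close>
    by metis
  then obtain I :: "nat \<Rightarrow> _" where I: "\<forall>n. I n \<in> \<F>"
    "\<forall>n. I n \<subseteq> I (Suc n) \<and> I (Suc n) \<noteq> I n"
    by (elim exE conjE)
  have "\<exists>k. \<forall>n\<ge>k. I n = I k"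
    using acc I \<F> by (simp add: left_acc_def)
  then obtain k where k: "\<forall>n\<ge>k. I n = I k" ..
  have "I (Suc k) = I k"
    by (rule k[rule_format]) simp
  then show False
    using I(2) by simp
qed

context ring
begin

text \<open>For a maximal member \<open>M\<close> among the proper left ideals over \<open>L\<close>
  and an outside \<open>x\<close>, the left ideal \<open>R x + M\<close> is larger than
  \<open>M\<close>, hence contains \<open>\<one>\<close>.\<close>

lemma exists_maximal_left_ideal:
  assumes acc: "left_acc R" and L: "left_ideal L R" and "\<one> \<notin> L"
  shows "\<exists>M. maximal_left_ideal M R \<and> L \<subseteq> M"
proof -
  let ?F = "{M. left_ideal M R \<and> \<one> \<notin> M \<and> L \<subseteq> M}"
  have "\<exists>M\<in>?F. \<forall>N\<in>?F. M \<subseteq> N \<longrightarrow> N = M"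
    by (rule left_acc_maximal[OF acc, of L]) (use assms in simp_all)
  then obtain M where M: "M \<in> ?F" and max: "\<forall>N\<in>?F. M \<subseteq> N \<longrightarrow> N = M" ..
  then have id: "left_ideal M R"
    by simp
  have "\<exists>r\<in>carrier R. \<exists>l\<in>M. \<one> = r \<otimes> x \<oplus> l" if x: "x \<in> carrier R - M" for x
  proof (rule ccontr)
    let ?S = "{r \<otimes> x \<oplus> l |r l. r \<in> carrier R \<and> l \<in> M}"
    assume "\<not> ?thesis"
    then have "\<one> \<notin> ?S"
      by blast
    moreover have "M \<subseteq> ?S"
    proof
      fix l assume "l \<in> M"
      then show "l \<in> ?S"
        using x left_ideal_carrier[OF id] by (intro CollectI exI[of _ \<zero>] exI[of _ l]) auto
    qed
    moreover have "left_ideal ?S R"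
      using x by (intro left_ideal_sum_principal id) auto
    ultimately have "?S = M"
      using M by (intro max[rule_format]) auto
    moreover have "x \<in> ?S"
      using x left_ideal_zero[OF id] by (intro CollectI exI[of _ \<one>] exI[of _ \<zero>]) auto
    ultimately show False
      using x by blast
  qed
  then show ?thesis
    using M unfolding maximal_left_ideal_def by blast
qed

text \<open>Hilbert's basis theorem: a left ideal \<open>J\<close> of \<open>R[X]\<close> is controlled by the left ideals of the
  \<open>n\<close>-th coefficients of the elements of \<open>J\<close> of degree at most \<open>n\<close>.\<close>

lemma left_ideal_leading_coefficients:
  assumes J: "left_ideal J (UP R)"
  shows "left_ideal {p n |p. p \<in> J \<and> (\<forall>i>n. p i = \<zero>)} R" (is "left_ideal (?C n) R")
proof (rule left_idealI)
  interpret P: ring "UP R"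
    by (rule ring_UP)
  note c = P.left_ideal_carrier[OF J]
  show "?C n \<subseteq> carrier R"
    using c by auto
  show "\<zero> \<in> ?C n"
    using P.left_ideal_zero[OF J]
    by (intro CollectI exI[of _ "\<zero>\<^bsub>UP R\<^esub>"] conjI allI impI)
      (rule UP_zero_apply[symmetric], assumption, rule UP_zero_apply)
  show "x \<oplus> y \<in> ?C n" if "x \<in> ?C n" "y \<in> ?C n" for x y
  proof -
    from that obtain p q where pq: "p \<in> J" "q \<in> J" "\<forall>i>n. p i = \<zero>" "\<forall>i>n. q i = \<zero>"
      and xy: "x = p n" "y = q n"
      by blast
    have *: "(p \<oplus>\<^bsub>UP R\<^esub> q) i = p i \<oplus> q i" for i
      using c[OF pq(1)] c[OF pq(2)] by (rule UP_add_apply)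
    have "p \<oplus>\<^bsub>UP R\<^esub> q \<in> J"
      using pq(1,2) by (rule P.left_ideal_add[OF J])
    moreover have "(p \<oplus>\<^bsub>UP R\<^esub> q) i = \<zero>" if "i > n" for i
      unfolding * using that pq(3,4) by simp
    ultimately show ?thesis
      unfolding xy *[symmetric] by blast
  qed
  show "a \<otimes> x \<in> ?C n" if a: "a \<in> carrier R" and "x \<in> ?C n" for a x
  proof -
    from that(2) obtain p where p: "p \<in> J" "\<forall>i>n. p i = \<zero>" and x: "x = p n"
      by blast
    let ?m = "up_ring.monom (UP R) a 0"
    have *: "(?m \<otimes>\<^bsub>UP R\<^esub> p) i = a \<otimes> p i" for i
      using monom_mult_apply[OF a c[OF p(1)], of 0 i] by simp
    have "?m \<otimes>\<^bsub>UP R\<^esub> p \<in> J"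
      using a p(1) by (intro P.left_ideal_mult[OF J] UP_monom_closed)
    moreover have "(?m \<otimes>\<^bsub>UP R\<^esub> p) i = \<zero>" if "i > n" for i
      unfolding * using that a p(2) by simp
    ultimately show ?thesis
      unfolding x *[symmetric] by blast
  qed
qed

text \<open>Multiplication by \<open>X^(n - m)\<close> moves the coefficient from place
  \<open>m\<close> to place \<open>n\<close>.\<close>

lemma leading_coefficients_mono:
  assumes J: "left_ideal J (UP R)" and "m \<le> n"
  shows "{p m |p. p \<in> J \<and> (\<forall>i>m. p i = \<zero>)} \<subseteq> {p n |p. p \<in> J \<and> (\<forall>i>n. p i = \<zero>)}"
proof clarify
  interpret P: ring "UP R"
    by (rule ring_UP)
  fix p assume p: "p \<in> J" "\<forall>i>m. p i = \<zero>"
  then have "p \<in> carrier (UP R)"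
    using P.left_ideal_carrier[OF J] by blast
  then show "\<exists>q. p m = q n \<and> q \<in> J \<and> (\<forall>i>n. q i = \<zero>)"
    using p \<open>m \<le> n\<close> by (intro exI[of _ "up_ring.monom (UP R) \<one> (n - m) \<otimes>\<^bsub>UP R\<^esub> p"])
      (auto intro!: P.left_ideal_mult[OF J] simp: monom_mult_apply)
qed

text \<open>Subtracting from an element of \<open>J\<close> one of \<open>I\<close> with the same
  leading coefficient lowers the degree bound, and the difference stays in \<open>J\<close> because
  \<open>I \<subseteq> J\<close>.\<close>

lemma left_ideal_eq_if_leading_coefficients:
  assumes J: "left_ideal J (UP R)" and I: "left_ideal I (UP R)" and "I \<subseteq> J"
    and lead: "\<And>n. {p n |p. p \<in> J \<and> (\<forall>i>n. p i = \<zero>)} \<subseteq> {p n |p. p \<in> I \<and> (\<forall>i>n. p i = \<zero>)}"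
  shows "J = I"
proof -
  interpret P: ring "UP R"
    by (rule ring_UP)
  note c = P.left_ideal_carrier[OF J]
  have *: "p \<in> I" if "p \<in> J" "\<forall>i\<ge>n. p i = \<zero>" for p n
    using that
  proof (induction n arbitrary: p)
    case 0
    then have "p = \<zero>\<^bsub>UP R\<^esub>"
      by (auto simp: UP_zero_eq)
    then show ?case
      by (simp add: P.left_ideal_zero[OF I])
  next
    case (Suc n)
    then have "p n \<in> {p n |p. p \<in> J \<and> (\<forall>i>n. p i = \<zero>)}"
      by auto
    then obtain q where q: "q \<in> I" "\<forall>i>n. q i = \<zero>" "p n = q n"
      using lead[of n] by blast
    have pq: "p \<in> carrier (UP R)" "q \<in> carrier (UP R)"
      using Suc.prems(1) q(1) c \<open>I \<subseteq> J\<close> by auto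
    have "p \<ominus>\<^bsub>UP R\<^esub> q \<in> I"
    proof (rule Suc.IH)
      show "p \<ominus>\<^bsub>UP R\<^esub> q \<in> J"
        using Suc.prems(1) q(1) \<open>I \<subseteq> J\<close> by (auto intro: P.left_ideal_minus[OF J])
      show "\<forall>i\<ge>n. (p \<ominus>\<^bsub>UP R\<^esub> q) i = \<zero>"
      proof (intro allI impI)
        fix i assume "n \<le> i"
        then have "p i = q i"
          using Suc.prems(2) q(2,3) by (cases "i = n") auto
        then show "(p \<ominus>\<^bsub>UP R\<^esub> q) i = \<zero>"
          using pq by (simp add: UP_minus_apply r_right_minus_eq)
      qed
    qed
    then have "(p \<ominus>\<^bsub>UP R\<^esub> q) \<oplus>\<^bsub>UP R\<^esub> q \<in> I"
      using q(1) by (rule P.left_ideal_add[OF I])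
    then show ?case
      using pq by (simp add: P.minus_eq P.a_assoc P.l_neg)
  qed
  have "p \<in> I" if p: "p \<in> J" for p
  proof -
    obtain n where "\<forall>i\<ge>n. p i = \<zero>"
      using c[OF p] by (auto simp: UP_mem_iff)
    with p show ?thesis
      by (rule *)
  qed
  then show ?thesis
    using \<open>I \<subseteq> J\<close> by blast
qed

text \<open>The left ideals \<open>C n k\<close> ascend in both indices. A maximal member
  \<open>C n0 k0\<close> fixes all \<open>C n k\<close> with \<open>n \<ge> n0\<close> and
  \<open>k \<ge> k0\<close> at once, and the finitely many degrees below \<open>n0\<close> become
  stationary one by one; so a single \<open>k\<close> serves every degree.\<close>

theorem left_acc_UP:
  assumes acc: "left_acc R"
  shows "left_acc (UP R)"
  unfolding left_acc_def
proof (intro allI impI)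
  fix J :: "nat \<Rightarrow> (nat \<Rightarrow> 'a) set"
  assume "(\<forall>n. left_ideal (J n) (UP R)) \<and> (\<forall>n. J n \<subseteq> J (Suc n))"
  then have J: "\<And>k. left_ideal (J k) (UP R)" and mono: "\<And>k. J k \<subseteq> J (Suc k)"
    by simp_all
  define C where "C n k = {p n |p. p \<in> J k \<and> (\<forall>i>n. p i = \<zero>)}" for n k
  have C: "left_ideal (C n k) R" for n k
    unfolding C_def by (rule left_ideal_leading_coefficients[OF J])
  have C_mono: "C m k \<subseteq> C n l" if "m \<le> n" "k \<le> l" for m n k l
    using leading_coefficients_mono[OF J that(1), of k] chain_mono[of J, OF mono that(2)]
    unfolding C_def by blast
  have "\<exists>M\<in>range (\<lambda>(n, k). C n k). \<forall>L\<in>range (\<lambda>(n, k). C n k). M \<subseteq> L \<longrightarrow> L = M"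
    by (rule left_acc_maximal[OF acc, of "C 0 0"]) (use C in auto)
  then obtain n0 k0 where max: "\<And>n k. C n0 k0 \<subseteq> C n k \<Longrightarrow> C n k = C n0 k0"
    by auto
  have "\<exists>k. \<forall>l\<ge>k. C n l = C n k" for n
    using acc C C_mono unfolding left_acc_def by (meson lessI less_imp_le order_refl)
  then obtain \<kappa> where \<kappa>: "\<And>n l. \<kappa> n \<le> l \<Longrightarrow> C n l = C n (\<kappa> n)"
    by metis
  define k where "k = Max (insert k0 (\<kappa> ` {..<n0}))"
  have k: "k0 \<le> k" "\<And>n. n < n0 \<Longrightarrow> \<kappa> n \<le> k"
    unfolding k_def by auto
  have C_eq: "C n l = C n k" if "k \<le> l" for n l
  proof (cases "n < n0")
    case True
    then show ?thesis
      using \<kappa>[of n l] \<kappa>[of n k] k(2)[of n] that by simp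
  next
    case False
    then show ?thesis
      using max[of n l] max[of n k] C_mono[of n0 n k0 k] C_mono[of n0 n k0 l] k that by simp
  qed
  have CC: "C n l \<subseteq> C n k" if "k \<le> l" for n l
    using C_eq[OF that, of n] by (rule equalityD1)
  have "J l = J k" if "k \<le> l" for l
    using J J chain_mono[of J, OF mono that] CC[OF that, unfolded C_def]
    by (rule left_ideal_eq_if_leading_coefficients)
  then show "\<exists>k. \<forall>l\<ge>k. J l = J k"
    by blast
qed

end

section \<open>Modules and their finitely generated submodules\<close>

lemma module_imp_left_module: "module A V \<Longrightarrow> left_module A V"
  by (simp add: module_def module_axioms_def left_module_def left_module_axioms_def cring_def)

text \<open>The regular module and the restriction of scalars rebuild the record of a given group;
  the axioms are carried over along the equal additive fields.\<close>

lemma abelian_group_cong: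
  assumes "abelian_group M" "carrier N = carrier M" "ring.zero N = ring.zero M" "ring.add N = ring.add M"
  shows "abelian_group N"
proof -
  interpret M: abelian_group M
    by (rule assms(1))
  show ?thesis
  proof (rule abelian_groupI)
    fix x assume "x \<in> carrier N"
    then show "\<exists>y\<in>carrier N. y \<oplus>\<^bsub>N\<^esub> x = \<zero>\<^bsub>N\<^esub>"
      using M.l_neg[of x] by (auto simp: assms(2-4) intro: M.a_inv_closed)
  qed (auto simp: assms(2-4) M.a_ac)
qed

context left_module
begin

lemma smult_l_null [simp]: "x \<in> carrier M \<Longrightarrow> \<zero> \<odot>\<^bsub>M\<^esub> x = \<zero>\<^bsub>M\<^esub>"
  using smult_l_distr[of \<zero> \<zero> x] by simp

lemma smult_r_null [simp]: "a \<in> carrier R \<Longrightarrow> a \<odot>\<^bsub>M\<^esub> \<zero>\<^bsub>M\<^esub> = \<zero>\<^bsub>M\<^esub>"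
  using smult_r_distr[of a "\<zero>\<^bsub>M\<^esub>" "\<zero>\<^bsub>M\<^esub>"] by simp

lemma smult_l_minus:
  assumes "a \<in> carrier R" "x \<in> carrier M"
  shows "(\<ominus> a) \<odot>\<^bsub>M\<^esub> x = \<ominus>\<^bsub>M\<^esub> (a \<odot>\<^bsub>M\<^esub> x)"
  using assms smult_l_distr[of "\<ominus> a" a x] by (simp add: R.l_neg M.minus_equality)

lemma smult_r_minus:
  assumes "a \<in> carrier R" "x \<in> carrier M"
  shows "a \<odot>\<^bsub>M\<^esub> (\<ominus>\<^bsub>M\<^esub> x) = \<ominus>\<^bsub>M\<^esub> (a \<odot>\<^bsub>M\<^esub> x)"
  using assms smult_r_distr[of a "\<ominus>\<^bsub>M\<^esub> x" x] by (simp add: M.l_neg M.minus_equality)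

lemma smult_finsum:
  assumes "finite Y" "a \<in> carrier R" "f \<in> Y \<rightarrow> carrier M"
  shows "a \<odot>\<^bsub>M\<^esub> (\<Oplus>\<^bsub>M\<^esub>y\<in>Y. f y) = (\<Oplus>\<^bsub>M\<^esub>y\<in>Y. a \<odot>\<^bsub>M\<^esub> f y)"
  using assms by (induction Y) (auto simp: smult_r_distr Pi_iff)

lemma submodule_iff:
  "submodule N R M \<longleftrightarrow> N \<subseteq> carrier M \<and> \<zero>\<^bsub>M\<^esub> \<in> N \<and> (\<forall>x\<in>N. \<forall>y\<in>N. x \<oplus>\<^bsub>M\<^esub> y \<in> N) \<and>
    (\<forall>a\<in>carrier R. \<forall>x\<in>N. a \<odot>\<^bsub>M\<^esub> x \<in> N)" (is "_ \<longleftrightarrow> ?rhs")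
proof
  assume "submodule N R M"
  then interpret submodule N R M .
  show ?rhs
    using subset one_closed m_closed smult_closed by simp
next
  assume N: ?rhs
  have "subgroup N (add_monoid M)"
  proof (rule M.add.subgroupI)
    fix x assume "x \<in> N"
    then show "\<ominus>\<^bsub>M\<^esub> x \<in> N"
      using N smult_l_minus[of \<one> x] by (metis R.a_inv_closed R.one_closed smult_one subsetD)
  qed (use N in auto)
  then show "submodule N R M"
    using N by (simp add: submodule_def submodule_axioms_def)
qed

lemma submodule_subset: "submodule N R M \<Longrightarrow> N \<subseteq> carrier M"
  and submodule_carrier: "\<lbrakk>submodule N R M; x \<in> N\<rbrakk> \<Longrightarrow> x \<in> carrier M"
  and submodule_zero: "submodule N R M \<Longrightarrow> \<zero>\<^bsub>M\<^esub> \<in> N"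
  and submodule_add: "\<lbrakk>submodule N R M; x \<in> N; y \<in> N\<rbrakk> \<Longrightarrow> x \<oplus>\<^bsub>M\<^esub> y \<in> N"
  and submodule_smult: "\<lbrakk>submodule N R M; a \<in> carrier R; x \<in> N\<rbrakk> \<Longrightarrow> a \<odot>\<^bsub>M\<^esub> x \<in> N"
  by (auto simp: submodule_iff)

lemma submodule_uminus: "\<lbrakk>submodule N R M; x \<in> N\<rbrakk> \<Longrightarrow> \<ominus>\<^bsub>M\<^esub> x \<in> N"
  using submodule_smult[of N "\<ominus> \<one>" x] submodule_carrier[of N x] by (simp add: smult_l_minus)

lemma submodule_minus: "\<lbrakk>submodule N R M; x \<in> N; y \<in> N\<rbrakk> \<Longrightarrow> x \<ominus>\<^bsub>M\<^esub> y \<in> N"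
  by (simp add: a_minus_def submodule_add submodule_uminus)

lemma submodule_finsum:
  assumes "submodule N R M" "\<And>y. y \<in> Y \<Longrightarrow> f y \<in> N"
  shows "(\<Oplus>\<^bsub>M\<^esub>y\<in>Y. f y) \<in> N"
  using assms(2)
proof (induction Y rule: infinite_finite_induct)
  case (insert y Y)
  then show ?case
    using submodule_carrier[OF assms(1)]
    by (subst M.finsum_insert) (auto intro: submodule_add[OF assms(1)])
qed (auto simp: submodule_zero[OF assms(1)])

lemma subset_submodule_gen: "S \<subseteq> submodule_gen R M S"
  unfolding submodule_gen_def by blast

lemma submodule_gen_minimal: "\<lbrakk>submodule N R M; S \<subseteq> N\<rbrakk> \<Longrightarrow> submodule_gen R M S \<subseteq> N"
  unfolding submodule_gen_def by blast

lemma submodule_submodule_gen: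
  assumes "S \<subseteq> carrier M"
  shows "submodule (submodule_gen R M S) R M"
proof -
  have "submodule (carrier M) R M"
    by (simp add: submodule_iff)
  then have "submodule_gen R M S \<subseteq> carrier M"
    using assms by (rule submodule_gen_minimal)
  then show ?thesis
    unfolding submodule_iff
    by (auto simp: submodule_gen_def intro: submodule_zero submodule_add submodule_smult)
qed

lemma submodule_lincomb:
  assumes S: "finite S" "S \<subseteq> carrier M"
  shows "submodule {\<Oplus>\<^bsub>M\<^esub>s\<in>S. c s \<odot>\<^bsub>M\<^esub> s |c. c \<in> S \<rightarrow> carrier R} R M" (is "submodule ?L R M")
proof -
  have cl: "(\<lambda>s. c s \<odot>\<^bsub>M\<^esub> s) \<in> S \<rightarrow> carrier M" if "c \<in> S \<rightarrow> carrier R" for c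
    using that S by auto
  have "\<zero>\<^bsub>M\<^esub> \<in> ?L"
    using S by (intro CollectI exI[of _ "\<lambda>_. \<zero>"]) (auto intro!: M.add.finprod_one_eqI[symmetric])
  moreover have "x \<oplus>\<^bsub>M\<^esub> y \<in> ?L" if "x \<in> ?L" "y \<in> ?L" for x y
  proof -
    from that obtain c d where "c \<in> S \<rightarrow> carrier R" "d \<in> S \<rightarrow> carrier R"
      "x = (\<Oplus>\<^bsub>M\<^esub>s\<in>S. c s \<odot>\<^bsub>M\<^esub> s)" "y = (\<Oplus>\<^bsub>M\<^esub>s\<in>S. d s \<odot>\<^bsub>M\<^esub> s)"
      by blast
    moreover have "(\<Oplus>\<^bsub>M\<^esub>s\<in>S. (c s \<oplus> d s) \<odot>\<^bsub>M\<^esub> s)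
        = (\<Oplus>\<^bsub>M\<^esub>s\<in>S. c s \<odot>\<^bsub>M\<^esub> s \<oplus>\<^bsub>M\<^esub> d s \<odot>\<^bsub>M\<^esub> s)"
      using S calculation(1,2) by (intro M.finsum_cong') (auto simp: Pi_iff smult_l_distr subset_iff)
    ultimately show ?thesis
      using cl by (intro CollectI exI[of _ "\<lambda>s. c s \<oplus> d s"]) (auto simp: M.finsum_addf)
  qed
  moreover have "a \<odot>\<^bsub>M\<^esub> x \<in> ?L" if a: "a \<in> carrier R" and "x \<in> ?L" for a x
  proof -
    from that obtain c where c: "c \<in> S \<rightarrow> carrier R" "x = (\<Oplus>\<^bsub>M\<^esub>s\<in>S. c s \<odot>\<^bsub>M\<^esub> s)"
      by blast
    moreover have "(\<Oplus>\<^bsub>M\<^esub>s\<in>S. (a \<otimes> c s) \<odot>\<^bsub>M\<^esub> s) = (\<Oplus>\<^bsub>M\<^esub>s\<in>S. a \<odot>\<^bsub>M\<^esub> (c s \<odot>\<^bsub>M\<^esub> s))"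
      using S a c(1) by (intro M.finsum_cong') (auto simp: Pi_iff smult_assoc1 subset_iff)
    ultimately show ?thesis
      using S a cl by (intro CollectI exI[of _ "\<lambda>s. a \<otimes> c s"]) (auto simp: smult_finsum)
  qed
  ultimately show ?thesis
    using cl unfolding submodule_iff by auto
qed

lemma submodule_gen_lincomb:
  assumes S: "finite S" "S \<subseteq> carrier M" and x: "x \<in> submodule_gen R M S"
  shows "\<exists>c \<in> S \<rightarrow> carrier R. x = (\<Oplus>\<^bsub>M\<^esub>s\<in>S. c s \<odot>\<^bsub>M\<^esub> s)"
proof -
  let ?L = "{\<Oplus>\<^bsub>M\<^esub>s\<in>S. c s \<odot>\<^bsub>M\<^esub> s |c. c \<in> S \<rightarrow> carrier R}"
  have "s \<in> ?L" if "s \<in> S" for s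
  proof -
    have "(\<Oplus>\<^bsub>M\<^esub>t\<in>S. (if s = t then \<one> else \<zero>) \<odot>\<^bsub>M\<^esub> t) = (\<Oplus>\<^bsub>M\<^esub>t\<in>S. if s = t then t else \<zero>\<^bsub>M\<^esub>)"
      using S by (intro M.finsum_cong') auto
    also have "\<dots> = s"
      using S that by (intro M.finsum_singleton) auto
    finally show ?thesis
      by (intro CollectI exI[of _ "\<lambda>t. if s = t then \<one> else \<zero>"]) auto
  qed
  then have "submodule_gen R M S \<subseteq> ?L"
    by (intro submodule_gen_minimal submodule_lincomb S subsetI)
  then show ?thesis
    using x by blast
qed

lemma restrict_scalars_module:
  assumes "cring A" and \<phi>: "\<phi> \<in> ring_hom A R"
  shows "module A (restrict_scalars \<phi> M)"
proof -
  have "abelian_group (restrict_scalars \<phi> M)"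
    by (rule abelian_group_cong[OF M.abelian_group_axioms]) (simp_all add: restrict_scalars_def)
  moreover have "module_axioms A (restrict_scalars \<phi> M)"
    using ring_hom_closed[OF \<phi>] ring_hom_add[OF \<phi>] ring_hom_mult[OF \<phi>] ring_hom_one[OF \<phi>]
    by (simp add: module_axioms_def restrict_scalars_def smult_l_distr smult_r_distr smult_assoc1)
  ultimately show ?thesis
    by (simp add: module_def assms(1))
qed

end

lemma restrict_scalars_simps [simp]:
  "carrier (restrict_scalars \<phi> M) = carrier M"
  "\<zero>\<^bsub>restrict_scalars \<phi> M\<^esub> = \<zero>\<^bsub>M\<^esub>"
  "x \<oplus>\<^bsub>restrict_scalars \<phi> M\<^esub> y = x \<oplus>\<^bsub>M\<^esub> y"
  "a \<odot>\<^bsub>restrict_scalars \<phi> M\<^esub> x = \<phi> a \<odot>\<^bsub>M\<^esub> x"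
  "\<ominus>\<^bsub>restrict_scalars \<phi> M\<^esub> x = \<ominus>\<^bsub>M\<^esub> x"
  "x \<ominus>\<^bsub>restrict_scalars \<phi> M\<^esub> y = x \<ominus>\<^bsub>M\<^esub> y"
  "finsum (restrict_scalars \<phi> M) f Y = finsum M f Y"
  by (simp_all add: restrict_scalars_def a_minus_def a_inv_def m_inv_def finsum_def finprod_def)

lemma regular_module_simps [simp]:
  "carrier (regular_module R) = carrier R"
  "\<zero>\<^bsub>regular_module R\<^esub> = \<zero>\<^bsub>R\<^esub>"
  "x \<oplus>\<^bsub>regular_module R\<^esub> y = x \<oplus>\<^bsub>R\<^esub> y"
  "a \<odot>\<^bsub>regular_module R\<^esub> x = a \<otimes>\<^bsub>R\<^esub> x"
  "\<ominus>\<^bsub>regular_module R\<^esub> x = \<ominus>\<^bsub>R\<^esub> x"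
  "x \<ominus>\<^bsub>regular_module R\<^esub> y = x \<ominus>\<^bsub>R\<^esub> y"
  "finsum (regular_module R) f Y = finsum R f Y"
  by (simp_all add: regular_module_def a_minus_def a_inv_def m_inv_def finsum_def finprod_def)

lemma (in ring) left_module_regular_module: "left_module R (regular_module R)"
proof -
  have "abelian_group (regular_module R)"
    by (rule abelian_group_cong[OF abelian_group_axioms]) (simp_all add: regular_module_def)
  then show ?thesis
    by (simp add: left_module_def left_module_axioms_def ring_axioms l_distr r_distr m_assoc)
qed


section \<open>Modules over euclidean domains\<close>

text \<open>A finite generating family of least cardinality modulo \<open>T\<close> is independent modulo \<open>T\<close>: a
  coefficient of least degree among all relations of all such families divides the others, so that
  the family could be shortened, \<open>T\<close> being saturated.\<close>

lemma euclidean_basis_modulo: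
  fixes A (structure)
  assumes A: "euclidean_domain A \<phi>" and V: "module A V" and T: "submodule T A V"
    and sat: "\<And>a x. \<lbrakk>a \<in> carrier A; a \<noteq> \<zero>; x \<in> carrier V; a \<odot>\<^bsub>V\<^esub> x \<in> T\<rbrakk> \<Longrightarrow> x \<in> T"
    and Z: "finite Z" "Z \<subseteq> carrier V"
  shows "\<exists>S. finite S \<and> S \<subseteq> submodule_gen A V Z \<and>
    (\<forall>w\<in>submodule_gen A V Z. \<exists>c\<in>S \<rightarrow> carrier A. w \<ominus>\<^bsub>V\<^esub> (\<Oplus>\<^bsub>V\<^esub>s\<in>S. c s \<odot>\<^bsub>V\<^esub> s) \<in> T) \<and>
    (\<forall>c\<in>S \<rightarrow> carrier A. (\<Oplus>\<^bsub>V\<^esub>s\<in>S. c s \<odot>\<^bsub>V\<^esub> s) \<in> T \<longrightarrow> (\<forall>s\<in>S. c s = \<zero>))"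
proof -
  interpret A: euclidean_domain A \<phi>
    by (rule A)
  interpret V: left_module A V
    by (rule module_imp_left_module[OF V])
  note T_rules = V.submodule_zero[OF T] V.submodule_add[OF T] V.submodule_smult[OF T]
    V.submodule_minus[OF T] V.submodule_carrier[OF T]
  define W where "W = submodule_gen A V Z"
  have W: "submodule W A V"
    unfolding W_def by (rule V.submodule_submodule_gen[OF Z(2)])
  note Wc = V.submodule_carrier[OF W]
  \<comment> \<open>Generators form a family indexed by \<open>I\<close> rather than a set: changing
    one of them could make two coincide, and cardinality is to be counted on the index set.\<close>
  define lc where "lc I c y = (\<Oplus>\<^bsub>V\<^esub>i\<in>I. c i \<odot>\<^bsub>V\<^esub> y i)" for I :: "'c set" and c and y :: "'c \<Rightarrow> 'c"
  define gen where "gen I y \<longleftrightarrow> y \<in> I \<rightarrow> W \<and>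
    (\<forall>w\<in>W. \<exists>c\<in>I \<rightarrow> carrier A. w \<ominus>\<^bsub>V\<^esub> lc I c y \<in> T)" for I y
  have lc_closed: "lc I c y \<in> carrier V" if "c \<in> I \<rightarrow> carrier A" "y \<in> I \<rightarrow> W" for I c y
    unfolding lc_def using that Wc by (auto intro!: V.M.finsum_closed simp: Pi_iff)
  have lc_insert: "lc (insert i I) c y = c i \<odot>\<^bsub>V\<^esub> y i \<oplus>\<^bsub>V\<^esub> lc I c y"
    if "finite I" "i \<notin> I" "c \<in> insert i I \<rightarrow> carrier A" "y \<in> insert i I \<rightarrow> W" for i I c y
    unfolding lc_def using that Wc by (intro V.M.finsum_insert) (auto simp: Pi_iff)
  have lc_cong: "lc I c y = lc I c' y'"
    if "c' \<in> I \<rightarrow> carrier A" "y' \<in> I \<rightarrow> W" "\<And>i. i \<in> I \<Longrightarrow> c i = c' i \<and> y i = y' i" for I c y c' y'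
    unfolding lc_def using that Wc by (intro V.M.finsum_cong') (auto simp: Pi_iff)
  have "gen Z id"
    unfolding gen_def
  proof (intro conjI ballI)
    show "id \<in> Z \<rightarrow> W"
      using V.subset_submodule_gen[of Z] unfolding W_def by auto
    fix w assume w: "w \<in> W"
    then obtain c where c: "c \<in> Z \<rightarrow> carrier A" "w = (\<Oplus>\<^bsub>V\<^esub>s\<in>Z. c s \<odot>\<^bsub>V\<^esub> s)"
      using V.submodule_gen_lincomb[OF Z] unfolding W_def by blast
    then have "w \<ominus>\<^bsub>V\<^esub> lc Z c id = \<zero>\<^bsub>V\<^esub>"
      using Wc[OF w] by (simp add: lc_def V.M.minus_eq V.M.r_neg)
    then show "\<exists>c\<in>Z \<rightarrow> carrier A. w \<ominus>\<^bsub>V\<^esub> lc Z c id \<in> T"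
      using c(1) T_rules(1) by (intro bexI[of _ c]) simp_all
  qed
  with Z(1) obtain I where "finite I \<and> (\<exists>y. gen I y)"
    and min_I: "\<And>J. finite J \<and> (\<exists>y. gen J y) \<Longrightarrow> card I \<le> card J"
    using ex_has_least_nat[of "\<lambda>I. finite I \<and> (\<exists>y. gen I y)" Z card] by blast
  then have I: "finite I" "\<exists>y. gen I y"
    by auto
  have "\<exists>y. gen I y \<and> (\<forall>c\<in>I \<rightarrow> carrier A. lc I c y \<in> T \<longrightarrow> (\<forall>i\<in>I. c i = \<zero>))"
  proof (rule ccontr)
    \<comment> \<open>A triple is a generating family, a relation of it modulo \<open>T\<close> and
      a place with non-zero coefficient. The degree is minimised over all families on
      \<open>I\<close> at once, because the division below changes the family.\<close>
    define rel where "rel = (\<lambda>(y, c, j). gen I y \<and> c \<in> I \<rightarrow> carrier A \<and> lc I c y \<in> T \<and>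
      j \<in> I \<and> c j \<noteq> \<zero>)"
    assume no: "\<not> ?thesis"
    obtain y0 where y0: "gen I y0"
      using I(2) by blast
    then obtain c0 j0 where "c0 \<in> I \<rightarrow> carrier A" "lc I c0 y0 \<in> T" "j0 \<in> I" "c0 j0 \<noteq> \<zero>"
      using no by blast
    with y0 have "rel (y0, c0, j0)"
      by (simp add: rel_def)
    then have "\<exists>r. rel r"
      by blast
    then obtain r where "rel r" and min: "\<And>r'. rel r' \<Longrightarrow> \<phi> (case r of (y, c, j) \<Rightarrow> c j) \<le> \<phi> (case r' of (y, c, j) \<Rightarrow> c j)"
      using ex_has_least_nat[of rel _ "\<lambda>r. \<phi> (case r of (y, c, j) \<Rightarrow> c j)"] by blast
    obtain y c j where r: "r = (y, c, j)"
      by (cases r)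
    have y: "gen I y" and c: "c \<in> I \<rightarrow> carrier A" and cT: "lc I c y \<in> T" and j: "j \<in> I" "c j \<noteq> \<zero>"
      using \<open>rel r\<close> by (auto simp: r rel_def)
    have yW: "y \<in> I \<rightarrow> W"
      using y by (simp add: gen_def)
    have cj: "c j \<in> carrier A"
      using c j by auto
    have yj: "y j \<in> carrier V"
      using yW j Wc by auto
    have "\<exists>q\<in>carrier A. c i = c j \<otimes> q" if i: "i \<in> I - {j}" for i
    proof (cases "c i = \<zero>")
      case True
      then show ?thesis
        using cj by (intro bexI[of _ \<zero>]) auto
    next
      case False
      have ci: "c i \<in> carrier A"
        using c i by auto
      have yi: "y i \<in> carrier V"
        using yW i Wc by auto
      obtain q p where qp: "q \<in> carrier A" "p \<in> carrier A" "c i = c j \<otimes> q \<oplus> p"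
        "p = \<zero> \<or> \<phi> p < \<phi> (c j)"
        using A.euclidean_function[of "c i" "c j"] False j(2) ci cj by auto
      have "p = \<zero>"
      proof (rule ccontr)
        assume "p \<noteq> \<zero>"
        \<comment> \<open>With \<open>c i = c j q + p\<close> one has
          \<open>c i y_i + c j y_j = p y_i + c j (y_j + q y_i)\<close>. Replacing \<open>y j\<close>
          accordingly puts the remainder \<open>p\<close>, of smaller degree, at place
          \<open>i\<close>.\<close>
        define y' where "y' = y(j := y j \<oplus>\<^bsub>V\<^esub> q \<odot>\<^bsub>V\<^esub> y i)"
        define I0 where "I0 = I - {i, j}"
        have I0: "I = insert i (insert j I0)" "finite I0" "i \<notin> insert j I0" "j \<notin> I0"
          using i j I(1) by (auto simp: I0_def)
        have y'W: "y' \<in> I \<rightarrow> W"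
          using yW i j qp(1) V.submodule_add[OF W] V.submodule_smult[OF W] by (auto simp: y'_def Pi_iff)
        have shift: "lc I (d(i := d i \<ominus> d j \<otimes> q)) y' = lc I d y" if d: "d \<in> I \<rightarrow> carrier A" for d
        proof -
          have dij: "d i \<in> carrier A" "d j \<in> carrier A"
            using d i j by auto
          let ?d = "d(i := d i \<ominus> d j \<otimes> q)"
          have d': "?d \<in> I \<rightarrow> carrier A"
            using d dij qp(1) by auto
          have eq: "lc I0 ?d y' = lc I0 d y"
            using d yW I0 by (intro lc_cong) (auto simp: y'_def)
          have cl: "lc I0 d y \<in> carrier V"
            using d yW by (intro lc_closed) (auto simp: I0_def)
          have "lc I ?d y' = ?d i \<odot>\<^bsub>V\<^esub> y' i \<oplus>\<^bsub>V\<^esub> (?d j \<odot>\<^bsub>V\<^esub> y' j \<oplus>\<^bsub>V\<^esub> lc I0 ?d y')"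
            using d' y'W I0 by (simp add: lc_insert)
          also have "\<dots> = (d i \<ominus> d j \<otimes> q) \<odot>\<^bsub>V\<^esub> y i \<oplus>\<^bsub>V\<^esub> (d j \<odot>\<^bsub>V\<^esub> (y j \<oplus>\<^bsub>V\<^esub> q \<odot>\<^bsub>V\<^esub> y i) \<oplus>\<^bsub>V\<^esub> lc I0 d y)"
            using I0 i unfolding eq by (auto simp: y'_def)
          also have "\<dots> = d i \<odot>\<^bsub>V\<^esub> y i \<oplus>\<^bsub>V\<^esub> (d j \<odot>\<^bsub>V\<^esub> y j \<oplus>\<^bsub>V\<^esub> lc I0 d y)
              \<oplus>\<^bsub>V\<^esub> ((d j \<otimes> q) \<odot>\<^bsub>V\<^esub> y i \<ominus>\<^bsub>V\<^esub> (d j \<otimes> q) \<odot>\<^bsub>V\<^esub> y i)"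
            using dij qp(1) yi yj cl
            by (simp add: A.minus_eq V.M.minus_eq V.smult_l_distr V.smult_r_distr V.smult_l_minus
                V.smult_assoc1 V.M.a_ac)
          also have "\<dots> = d i \<odot>\<^bsub>V\<^esub> y i \<oplus>\<^bsub>V\<^esub> (d j \<odot>\<^bsub>V\<^esub> y j \<oplus>\<^bsub>V\<^esub> lc I0 d y)"
            using dij qp(1) yi yj cl by (simp add: V.M.minus_eq V.M.r_neg)
          also have "\<dots> = lc I d y"
            using d yW I0 by (simp add: lc_insert)
          finally show ?thesis .
        qed
        have "gen I y'"
          unfolding gen_def
        proof (intro conjI ballI y'W)
          fix w assume "w \<in> W"
          then obtain d where d: "d \<in> I \<rightarrow> carrier A" "w \<ominus>\<^bsub>V\<^esub> lc I d y \<in> T"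
            using y unfolding gen_def by blast
          moreover have "d(i := d i \<ominus> d j \<otimes> q) \<in> I \<rightarrow> carrier A"
            using d(1) i j qp(1) by (auto simp: Pi_iff)
          ultimately show "\<exists>d\<in>I \<rightarrow> carrier A. w \<ominus>\<^bsub>V\<^esub> lc I d y' \<in> T"
            using shift[OF d(1)] by metis
        qed
        moreover have "c i \<ominus> c j \<otimes> q = p"
          using qp cj ci by (simp add: A.minus_eq A.a_ac A.r_neg2 A.r_neg)
        then have "lc I (c(i := p)) y' \<in> T"
          using shift[OF c] cT by simp
        ultimately have "rel (y', c(i := p), i)"
          using c qp(2) i \<open>p \<noteq> \<zero>\<close> unfolding rel_def by auto
        then have "\<phi> (c j) \<le> \<phi> p"
          using min by (force simp: r)
        then show False
          using qp(4) \<open>p \<noteq> \<zero>\<close> by simp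
      qed
      then show ?thesis
        using qp cj by auto
    qed
    then obtain q where q: "\<And>i. i \<in> I - {j} \<Longrightarrow> q i \<in> carrier A \<and> c i = c j \<otimes> q i"
      by metis
    define I0 where "I0 = I - {j}"
    have I0: "I = insert j I0" "finite I0" "j \<notin> I0"
      using j I(1) by (auto simp: I0_def)
    have q_cl: "q \<in> I0 \<rightarrow> carrier A" and yW0: "y \<in> I0 \<rightarrow> W" and c0: "c \<in> I0 \<rightarrow> carrier A"
      using q yW c by (auto simp: I0_def)
    \<comment> \<open>Since \<open>c j\<close> divides all coefficients, the relation reads
      \<open>c j z \<in> T\<close>; saturation gives \<open>z \<in> T\<close>, which expresses
      \<open>y j\<close> by the other generators modulo \<open>T\<close>.\<close>
    define z where "z = y j \<oplus>\<^bsub>V\<^esub> lc I0 q y"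
    have z: "z \<in> carrier V"
      unfolding z_def using yj lc_closed[OF q_cl yW0] by simp
    have scale: "a \<odot>\<^bsub>V\<^esub> lc I0 q y = lc I0 (\<lambda>i. a \<otimes> q i) y" if "a \<in> carrier A" for a
    proof -
      have "a \<odot>\<^bsub>V\<^esub> lc I0 q y = (\<Oplus>\<^bsub>V\<^esub>i\<in>I0. a \<odot>\<^bsub>V\<^esub> (q i \<odot>\<^bsub>V\<^esub> y i))"
        unfolding lc_def using that q_cl yW0 Wc I0(2)
        by (intro V.smult_finsum) (auto simp: Pi_iff)
      also have "\<dots> = lc I0 (\<lambda>i. a \<otimes> q i) y"
        unfolding lc_def using that q_cl yW0 Wc
        by (intro V.M.finsum_cong') (auto simp: Pi_iff V.smult_assoc1)
      finally show ?thesis .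
    qed
    have "c j \<odot>\<^bsub>V\<^esub> z = c j \<odot>\<^bsub>V\<^esub> y j \<oplus>\<^bsub>V\<^esub> lc I0 (\<lambda>i. c j \<otimes> q i) y"
      unfolding z_def using cj yj lc_closed[OF q_cl yW0] by (simp add: V.smult_r_distr scale)
    also have "lc I0 (\<lambda>i. c j \<otimes> q i) y = lc I0 c y"
      using q c0 yW0 by (intro lc_cong) (auto simp: I0_def)
    also have "c j \<odot>\<^bsub>V\<^esub> y j \<oplus>\<^bsub>V\<^esub> lc I0 c y = lc I c y"
      using c yW I0 by (simp add: lc_insert)
    finally have zT: "z \<in> T"
      using sat[OF cj j(2) z] cT by simp
    have "gen I0 y"
      unfolding gen_def
    proof (intro conjI ballI yW0)
      fix w assume w: "w \<in> W"
      then obtain d where d: "d \<in> I \<rightarrow> carrier A" "w \<ominus>\<^bsub>V\<^esub> lc I d y \<in> T"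
        using y unfolding gen_def by blast
      have dj: "d j \<in> carrier A" and d0: "d \<in> I0 \<rightarrow> carrier A"
        using d(1) I0 by auto
      \<comment> \<open>The coefficients left after substituting \<open>z\<close> minus the
        combination of the \<open>q i\<close> for \<open>y j\<close>.\<close>
      define d' where "d' i = d i \<ominus> d j \<otimes> q i" for i
      have d': "d' \<in> I0 \<rightarrow> carrier A"
        using dj d0 q_cl by (auto simp: d'_def Pi_iff)
      have dq: "(\<lambda>i. d j \<otimes> q i) \<in> I0 \<rightarrow> carrier A"
        using dj q_cl by auto
      have "lc I0 d y = (\<Oplus>\<^bsub>V\<^esub>i\<in>I0. d' i \<odot>\<^bsub>V\<^esub> y i \<oplus>\<^bsub>V\<^esub> (d j \<otimes> q i) \<odot>\<^bsub>V\<^esub> y i)"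
        unfolding lc_def
      proof (intro V.M.finsum_cong' refl)
        show "(\<lambda>i. d' i \<odot>\<^bsub>V\<^esub> y i \<oplus>\<^bsub>V\<^esub> (d j \<otimes> q i) \<odot>\<^bsub>V\<^esub> y i) \<in> I0 \<rightarrow> carrier V"
          using d' dq yW0 Wc by (auto simp: Pi_iff)
        fix i assume i: "i \<in> I0"
        then have *: "d i \<in> carrier A" "d j \<otimes> q i \<in> carrier A" "y i \<in> carrier V"
          using d0 dq yW0 Wc by auto
        then have "d i = d' i \<oplus> d j \<otimes> q i"
          unfolding d'_def by (simp add: A.minus_eq A.a_assoc A.l_neg)
        then show "d i \<odot>\<^bsub>V\<^esub> y i = d' i \<odot>\<^bsub>V\<^esub> y i \<oplus>\<^bsub>V\<^esub> (d j \<otimes> q i) \<odot>\<^bsub>V\<^esub> y i"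
          using * d' i by (metis PiE V.smult_l_distr)
      qed
      also have "\<dots> = lc I0 d' y \<oplus>\<^bsub>V\<^esub> d j \<odot>\<^bsub>V\<^esub> lc I0 q y"
        unfolding scale[OF dj] unfolding lc_def
        using d' dq yW0 Wc by (intro V.M.finsum_addf) (auto simp: Pi_iff)
      finally have "lc I d y = lc I0 d' y \<oplus>\<^bsub>V\<^esub> d j \<odot>\<^bsub>V\<^esub> z"
        using d(1) yW I0 dj yj lc_closed[OF q_cl yW0] lc_closed[OF d' yW0]
        by (simp add: lc_insert z_def V.smult_r_distr V.M.a_ac)
      then have "w \<ominus>\<^bsub>V\<^esub> lc I0 d' y = (w \<ominus>\<^bsub>V\<^esub> lc I d y) \<oplus>\<^bsub>V\<^esub> d j \<odot>\<^bsub>V\<^esub> z"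
        using Wc[OF w] dj z lc_closed[OF d' yW0]
        by (simp add: V.M.minus_eq V.M.minus_add V.M.a_assoc V.M.l_neg)
      then show "\<exists>d\<in>I0 \<rightarrow> carrier A. w \<ominus>\<^bsub>V\<^esub> lc I0 d y \<in> T"
        using d' d(2) zT dj T_rules by metis
    qed
    then have "card I \<le> card I0"
      using I0(2) by (intro min_I) auto
    then show False
      using I0 by simp
  qed
  then obtain y where y: "gen I y"
    and ind: "\<And>c. \<lbrakk>c \<in> I \<rightarrow> carrier A; lc I c y \<in> T\<rbrakk> \<Longrightarrow> \<forall>i\<in>I. c i = \<zero>"
    by blast
  have yW: "y \<in> I \<rightarrow> W"
    using y by (simp add: gen_def)
  \<comment> \<open>Two equal generators would satisfy the relation with coefficients 1 and -1.
    Injectivity allows the return from the family to a set.\<close>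
  have inj: "inj_on y I"
  proof (rule inj_onI, rule ccontr)
    fix i j assume ij: "i \<in> I" "j \<in> I" "y i = y j" "i \<noteq> j"
    define c where "c k = (if k = i then \<one> else if k = j then \<ominus> \<one> else \<zero>)" for k
    define I0 where "I0 = I - {i, j}"
    have I0: "I = insert i (insert j I0)" "finite I0" "i \<notin> insert j I0" "j \<notin> I0"
      using ij I(1) by (auto simp: I0_def)
    have c: "c \<in> I \<rightarrow> carrier A"
      by (auto simp: c_def)
    have "lc I0 c y = \<zero>\<^bsub>V\<^esub>"
      unfolding lc_def using yW Wc I0 by (intro V.M.add.finprod_one_eqI) (auto simp: c_def Pi_iff)
    moreover have "lc I c y = c i \<odot>\<^bsub>V\<^esub> y i \<oplus>\<^bsub>V\<^esub> (c j \<odot>\<^bsub>V\<^esub> y j \<oplus>\<^bsub>V\<^esub> lc I0 c y)"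
      using c yW I0 by (simp add: lc_insert)
    moreover have "y j \<in> carrier V"
      using yW ij Wc by auto
    ultimately have "lc I c y = \<zero>\<^bsub>V\<^esub>"
      using ij by (simp add: c_def V.smult_l_minus V.M.r_neg)
    then have "c i = \<zero>"
      using ind[OF c] T_rules(1) ij(1) by simp
    then show False
      by (simp add: c_def)
  qed
  have lc_image: "(\<Oplus>\<^bsub>V\<^esub>s\<in>y ` I. c s \<odot>\<^bsub>V\<^esub> s) = lc I (\<lambda>i. c (y i)) y"
    if "c \<in> y ` I \<rightarrow> carrier A" for c
    unfolding lc_def using that yW Wc by (intro V.M.finsum_reindex inj) (auto simp: Pi_iff)
  show ?thesis
    unfolding W_def[symmetric]
  proof (intro exI[of _ "y ` I"] conjI ballI impI)
    show "finite (y ` I)" "y ` I \<subseteq> W"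
      using I(1) yW by auto
  next
    fix w assume "w \<in> W"
    then obtain d where d: "d \<in> I \<rightarrow> carrier A" "w \<ominus>\<^bsub>V\<^esub> lc I d y \<in> T"
      using y unfolding gen_def by blast
    let ?c = "\<lambda>s. d (inv_into I y s)"
    have c: "?c \<in> y ` I \<rightarrow> carrier A"
      using d(1) inj by auto
    moreover have "lc I (\<lambda>i. ?c (y i)) y = lc I d y"
      using d(1) yW inj by (intro lc_cong) auto
    ultimately show "\<exists>c\<in>y ` I \<rightarrow> carrier A. w \<ominus>\<^bsub>V\<^esub> (\<Oplus>\<^bsub>V\<^esub>s\<in>y ` I. c s \<odot>\<^bsub>V\<^esub> s) \<in> T"
      using d(2) lc_image[OF c] by (intro bexI[of _ ?c]) auto
  next
    fix c s assume c: "c \<in> y ` I \<rightarrow> carrier A" "(\<Oplus>\<^bsub>V\<^esub>s\<in>y ` I. c s \<odot>\<^bsub>V\<^esub> s) \<in> T" "s \<in> y ` I"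
    then have "\<forall>i\<in>I. c (y i) = \<zero>"
      by (intro ind) (auto simp: lc_image)
    then show "c s = \<zero>"
      using c(3) by blast
  qed
qed

section \<open>Division with remainder in \<open>K[X]\<close>\<close>

lemma (in field) UP_domain_UP: "domain (UP R)"
proof -
  have "UP_domain R"
    by unfold_locales
  then show ?thesis
    by (rule UP_domain.UP_domain)
qed

lemma (in field) UP_division:
  assumes b: "b \<in> carrier (UP R)" "b d \<noteq> \<zero>" "\<And>i. i > d \<Longrightarrow> b i = \<zero>"
    and a: "a \<in> carrier (UP R)"
  shows "\<exists>q\<in>carrier (UP R). \<exists>r\<in>carrier (UP R). a = b \<otimes>\<^bsub>UP R\<^esub> q \<oplus>\<^bsub>UP R\<^esub> r \<and> (\<forall>i\<ge>d. r i = \<zero>)"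
proof -
  interpret P: domain "UP R"
    by (rule UP_domain_UP)
  obtain n where "\<forall>i\<ge>n. a i = \<zero>"
    using a by (auto simp: UP_mem_iff)
  with a show ?thesis
  proof (induction n arbitrary: a)
    case 0
    then have "\<forall>i\<ge>d. a i = \<zero>"
      by blast
    moreover have "a = b \<otimes>\<^bsub>UP R\<^esub> \<zero>\<^bsub>UP R\<^esub> \<oplus>\<^bsub>UP R\<^esub> a"
      using 0(1) b(1) by simp
    ultimately show ?case
      using 0(1) P.zero_closed by blast
  next
    case (Suc n)
    show ?case
    proof (cases "n < d")
      case True
      then have "\<forall>i\<ge>d. a i = \<zero>"
        using Suc.prems(2) by simp
      moreover have "a = b \<otimes>\<^bsub>UP R\<^esub> \<zero>\<^bsub>UP R\<^esub> \<oplus>\<^bsub>UP R\<^esub> a"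
        using Suc.prems(1) b(1) by simp
      ultimately show ?thesis
        using Suc.prems(1) P.zero_closed by blast
    next
      case False
      have bd: "b d \<in> carrier R" "a n \<in> carrier R"
        using b(1) Suc.prems(1) by auto
      then have bU: "inv (b d) \<in> carrier R" "b d \<otimes> inv (b d) = \<one>"
        using b(2) field_Units by auto
      \<comment> \<open>Here \<open>a\<close> has no coefficient beyond place \<open>n\<close>;
        \<open>b\<close> times this monomial cancels the one at \<open>n\<close>, which may be
        zero.\<close>
      define m where "m = up_ring.monom (UP R) (inv (b d) \<otimes> a n) (n - d)"
      have m: "m \<in> carrier (UP R)"
        unfolding m_def using bd bU by simp
      define a' where "a' = a \<ominus>\<^bsub>UP R\<^esub> b \<otimes>\<^bsub>UP R\<^esub> m"
      have a': "a' \<in> carrier (UP R)"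
        unfolding a'_def using Suc.prems(1) b(1) m by simp
      have "a' i = \<zero>" if "i \<ge> n" for i
      proof -
        have "n - d \<le> i"
          using that by simp
        then have "a' i = a i \<ominus> b (i - (n - d)) \<otimes> (inv (b d) \<otimes> a n)"
          unfolding a'_def using Suc.prems(1) b(1) bd bU m that False
          by (simp add: UP_minus_apply m_def mult_monom_apply)
        also have "\<dots> = \<zero>"
        proof (cases "i = n")
          case True
          then have "i - (n - d) = d"
            using False by simp
          with True bd bU show ?thesis
            by (simp add: m_assoc[symmetric] r_right_minus_eq)
        next
          case neq: False
          then have "b (i - (n - d)) = \<zero>" "a i = \<zero>"
            using that False Suc.prems(2) by (auto intro!: b(3))
          with bd bU show ?thesis
            by (simp add: r_right_minus_eq)
        qed
        finally show ?thesis .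
      qed
      then obtain q r where qr: "q \<in> carrier (UP R)" "r \<in> carrier (UP R)"
        "a' = b \<otimes>\<^bsub>UP R\<^esub> q \<oplus>\<^bsub>UP R\<^esub> r" "\<forall>i\<ge>d. r i = \<zero>"
        using Suc.IH[OF a'] by blast
      have "a = a' \<oplus>\<^bsub>UP R\<^esub> b \<otimes>\<^bsub>UP R\<^esub> m"
        unfolding a'_def using Suc.prems(1) b(1) m by (simp add: P.minus_eq P.a_assoc P.l_neg)
      also have "\<dots> = b \<otimes>\<^bsub>UP R\<^esub> (q \<oplus>\<^bsub>UP R\<^esub> m) \<oplus>\<^bsub>UP R\<^esub> r"
        using qr b(1) m by (simp add: P.r_distr P.a_ac)
      finally show ?thesis
        using qr m by (intro bexI[of _ "q \<oplus>\<^bsub>UP R\<^esub> m"] bexI[of _ r]) auto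
    qed
  qed
qed

lemma (in field) UP_euclidean: "euclidean_domain (UP R) (deg R)"
proof -
  interpret P: domain "UP R"
    by (rule UP_domain_UP)
  interpret U: UP_ring R "UP R"
    by (rule UP_ring_UP)
  have nz: "p (deg R p) \<noteq> \<zero>" if "p \<in> carrier (UP R)" "p \<noteq> \<zero>\<^bsub>UP R\<^esub>" for p
    using U.lcoeff_nonzero[OF that(2,1)] that(1) by simp
  have above: "p i = \<zero>" if "p \<in> carrier (UP R)" "deg R p < i" for p i
    using U.deg_aboveD[OF that(2,1)] that(1) by simp
  show ?thesis
  proof (intro euclidean_domain.intro UP_domain_UP euclidean_domain_axioms.intro)
    fix a b assume ab: "a \<in> carrier (UP R) - {\<zero>\<^bsub>UP R\<^esub>}" "b \<in> carrier (UP R) - {\<zero>\<^bsub>UP R\<^esub>}"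
    obtain q r where qr: "q \<in> carrier (UP R)" "r \<in> carrier (UP R)"
      "a = b \<otimes>\<^bsub>UP R\<^esub> q \<oplus>\<^bsub>UP R\<^esub> r" "\<forall>i\<ge>deg R b. r i = \<zero>"
      using UP_division[of b "deg R b" a] ab nz above by blast
    then have "r = \<zero>\<^bsub>UP R\<^esub> \<or> deg R r < deg R b"
      using nz[of r] by (meson not_le)
    then show "\<exists>q r. q \<in> carrier (UP R) \<and> r \<in> carrier (UP R) \<and> a = b \<otimes>\<^bsub>UP R\<^esub> q \<oplus>\<^bsub>UP R\<^esub> r \<and>
        (r = \<zero>\<^bsub>UP R\<^esub> \<or> deg R r < deg R b)"
      using qr by blast
  qed
qed

section \<open>Bases\<close>

context left_module
begin

lemma submodule_gen_mono: "S \<subseteq> T \<Longrightarrow> submodule_gen R M S \<subseteq> submodule_gen R M T"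
  unfolding submodule_gen_def by blast

text \<open>The spans of the finite subsets form a directed family, so their union is already a
  submodule.\<close>

lemma submodule_gen_finite_subset:
  assumes S: "S \<subseteq> carrier M" and x: "x \<in> submodule_gen R M S"
  shows "\<exists>Y. finite Y \<and> Y \<subseteq> S \<and> x \<in> submodule_gen R M Y"
proof -
  let ?Q = "\<Union>Y\<in>{Y. finite Y \<and> Y \<subseteq> S}. submodule_gen R M Y"
  have sub: "submodule (submodule_gen R M Y) R M" if "Y \<subseteq> S" for Y
    using that S by (intro submodule_submodule_gen) auto
  have "submodule ?Q R M"
    unfolding submodule_iff
  proof (intro conjI ballI)
    show "?Q \<subseteq> carrier M"
      using submodule_subset[OF sub] by blast
    show "\<zero>\<^bsub>M\<^esub> \<in> ?Q"
      using submodule_zero[OF sub[of "{}"]] by blast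
  next
    fix x y assume "x \<in> ?Q" "y \<in> ?Q"
    then obtain Y Z where Y: "finite Y" "Y \<subseteq> S" "x \<in> submodule_gen R M Y"
      and Z: "finite Z" "Z \<subseteq> S" "y \<in> submodule_gen R M Z"
      by blast
    then have "x \<in> submodule_gen R M (Y \<union> Z)" "y \<in> submodule_gen R M (Y \<union> Z)"
      using submodule_gen_mono[of Y "Y \<union> Z"] submodule_gen_mono[of Z "Y \<union> Z"] by auto
    then have "x \<oplus>\<^bsub>M\<^esub> y \<in> submodule_gen R M (Y \<union> Z)"
      using Y(2) Z(2) by (intro submodule_add[OF sub]) auto
    moreover have "finite (Y \<union> Z)" "Y \<union> Z \<subseteq> S"
      using Y Z by auto
    ultimately show "x \<oplus>\<^bsub>M\<^esub> y \<in> ?Q"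
      by blast
  next
    fix a x assume "a \<in> carrier R" "x \<in> ?Q"
    then show "a \<odot>\<^bsub>M\<^esub> x \<in> ?Q"
      using submodule_smult[OF sub] by blast
  qed
  moreover have "S \<subseteq> ?Q"
  proof
    fix s assume "s \<in> S"
    moreover have "s \<in> submodule_gen R M {s}"
      using subset_submodule_gen[of "{s}"] by simp
    ultimately show "s \<in> ?Q"
      by blast
  qed
  ultimately have "x \<in> ?Q"
    using x submodule_gen_minimal[of ?Q S] by blast
  then show ?thesis
    by blast
qed

text \<open>The maps \<open>h s\<close> are coordinate functions: spanning gives the existence of
  coefficients, and applying \<open>h s\<close> recovers them. They are required to be additive with
  prescribed values on multiples of \<open>S\<close>, which is the kind of map that the universal
  property of the tensor product supplies.\<close>

lemma is_basisI:
  assumes S: "S \<subseteq> carrier M"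
    and span: "carrier M \<subseteq> submodule_gen R M S"
    and h: "\<And>s. s \<in> S \<Longrightarrow> h s \<in> carrier M \<rightarrow> carrier R"
    and h_add: "\<And>s x y. \<lbrakk>s \<in> S; x \<in> carrier M; y \<in> carrier M\<rbrakk> \<Longrightarrow> h s (x \<oplus>\<^bsub>M\<^esub> y) = h s x \<oplus> h s y"
    and h_smult: "\<And>s t a. \<lbrakk>s \<in> S; t \<in> S; a \<in> carrier R\<rbrakk>
      \<Longrightarrow> h s (a \<odot>\<^bsub>M\<^esub> t) = (if s = t then a else \<zero>)"
  shows "is_basis R M S"
proof -
  have h_zero: "h s \<zero>\<^bsub>M\<^esub> = \<zero>" if "s \<in> S" for s
  proof -
    have "h s \<zero>\<^bsub>M\<^esub> \<in> carrier R"
      using h[OF that] by auto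
    moreover have "h s \<zero>\<^bsub>M\<^esub> \<oplus> h s \<zero>\<^bsub>M\<^esub> = h s \<zero>\<^bsub>M\<^esub>"
      using h_add[OF that, of "\<zero>\<^bsub>M\<^esub>" "\<zero>\<^bsub>M\<^esub>"] by simp
    ultimately show ?thesis
      by simp
  qed
  have coeff: "h s (\<Oplus>\<^bsub>M\<^esub>t\<in>Y. c t \<odot>\<^bsub>M\<^esub> t) = (if s \<in> Y then c s else \<zero>)"
    if "s \<in> S" "finite Y" "Y \<subseteq> S" "c \<in> Y \<rightarrow> carrier R" for s Y c
    using that(2-4)
  proof (induction Y)
    case empty
    then show ?case
      using h_zero[OF that(1)] by simp
  next
    case (insert t Y)
    have cl: "(\<lambda>t. c t \<odot>\<^bsub>M\<^esub> t) \<in> Y \<rightarrow> carrier M" "c t \<odot>\<^bsub>M\<^esub> t \<in> carrier M" "c t \<in> carrier R" "t \<in> S"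
      using insert.prems S by auto
    have "h s (\<Oplus>\<^bsub>M\<^esub>t\<in>insert t Y. c t \<odot>\<^bsub>M\<^esub> t) = h s (c t \<odot>\<^bsub>M\<^esub> t \<oplus>\<^bsub>M\<^esub> (\<Oplus>\<^bsub>M\<^esub>t\<in>Y. c t \<odot>\<^bsub>M\<^esub> t))"
      using insert.hyps cl by simp
    also have "\<dots> = (if s = t then c t else \<zero>) \<oplus> h s (\<Oplus>\<^bsub>M\<^esub>t\<in>Y. c t \<odot>\<^bsub>M\<^esub> t)"
      using that(1) cl by (simp add: h_add h_smult)
    also have "\<dots> = (if s = t then c t else \<zero>) \<oplus> (if s \<in> Y then c s else \<zero>)"
      using insert.IH insert.prems by simp
    also have "\<dots> = (if s \<in> insert t Y then c s else \<zero>)"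
      using insert.hyps insert.prems by (auto simp: Pi_iff)
    finally show ?case .
  qed
  show ?thesis
    unfolding is_basis_def
  proof (intro conjI S ballI)
    fix x assume x: "x \<in> carrier M"
    define d where "d s = (if s \<in> S then h s x else \<zero>)" for s
    let ?P = "\<lambda>c. (\<forall>s. c s \<in> carrier R) \<and> (\<forall>s. s \<notin> S \<longrightarrow> c s = \<zero>) \<and>
      finite {s. c s \<noteq> \<zero>} \<and> x = (\<Oplus>\<^bsub>M\<^esub>s\<in>{s. c s \<noteq> \<zero>}. c s \<odot>\<^bsub>M\<^esub> s)"
    obtain Y where Y: "finite Y" "Y \<subseteq> S" "x \<in> submodule_gen R M Y"
      using submodule_gen_finite_subset[OF S] span x by blast
    then obtain c where c: "c \<in> Y \<rightarrow> carrier R" "x = (\<Oplus>\<^bsub>M\<^esub>s\<in>Y. c s \<odot>\<^bsub>M\<^esub> s)"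
      using submodule_gen_lincomb[of Y x] S by blast
    have d_eq: "d s = (if s \<in> Y then c s else \<zero>)" for s
      using coeff[OF _ Y(1,2) c(1), of s] c(2) Y(2) by (auto simp: d_def)
    have supp: "{s. d s \<noteq> \<zero>} \<subseteq> Y"
      by (auto simp: d_eq)
    have "(\<Oplus>\<^bsub>M\<^esub>s\<in>{s. d s \<noteq> \<zero>}. d s \<odot>\<^bsub>M\<^esub> s) = x"
      unfolding c(2) using supp Y S c(1)
      by (intro M.add.finprod_mono_neutral_cong_left) (auto simp: d_eq Pi_iff subset_iff)
    then have "?P d"
      using finite_subset[OF supp Y(1)] h x by (auto simp: d_def Pi_iff)
    moreover have "c' = d" if c': "?P c'" for c'
    proof
      fix s
      let ?Z = "{s. c' s \<noteq> \<zero>}"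
      have "?Z \<subseteq> S"
        using c' by auto
      moreover have "x = (\<Oplus>\<^bsub>M\<^esub>s\<in>?Z. c' s \<odot>\<^bsub>M\<^esub> s)" "finite ?Z" "c' \<in> ?Z \<rightarrow> carrier R"
        using c' by auto
      ultimately have "s \<in> S \<Longrightarrow> h s x = (if s \<in> ?Z then c' s else \<zero>)"
        using coeff[of s ?Z c'] by simp
      then show "c' s = d s"
        using c' by (auto simp: d_def)
    qed
    ultimately show "\<exists>!c. ?P c"
      by blast
  qed
qed

end


section \<open>Localizations of integral domains\<close>

locale localized_domain = domain A for A (structure) +
  fixes S
  assumes S_subset: "S \<subseteq> carrier A"
    and S_one: "\<one> \<in> S"
    and S_mult: "\<lbrakk>s \<in> S; t \<in> S\<rbrakk> \<Longrightarrow> s \<otimes> t \<in> S"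
    and S_zero: "\<zero> \<notin> S"
begin

lemma S_carrier [simp]: "s \<in> S \<Longrightarrow> s \<in> carrier A"
  using S_subset by blast

lemma S_nonzero: "s \<in> S \<Longrightarrow> s \<noteq> \<zero>"
  using S_zero by blast

text \<open>In a domain the auxiliary factor \<open>u\<close>, being non-zero, cancels; fractions
  are then compared by cross multiplication.\<close>

lemma fraction_rel_iff:
  "((a, s), (b, t)) \<in> fraction_rel A S \<longleftrightarrow>
    a \<in> carrier A \<and> s \<in> S \<and> b \<in> carrier A \<and> t \<in> S \<and> a \<otimes> t = b \<otimes> s"
proof -
  have "(\<exists>u\<in>S. u \<otimes> (a \<otimes> t \<ominus> b \<otimes> s) = \<zero>) \<longleftrightarrow> a \<otimes> t = b \<otimes> s"
    if "a \<in> carrier A" "s \<in> S" "b \<in> carrier A" "t \<in> S"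
  proof
    assume "\<exists>u\<in>S. u \<otimes> (a \<otimes> t \<ominus> b \<otimes> s) = \<zero>"
    then obtain u where u: "u \<in> S" "u \<otimes> (a \<otimes> t \<ominus> b \<otimes> s) = \<zero>"
      by blast
    then have "a \<otimes> t \<ominus> b \<otimes> s = \<zero>"
      using that integral[OF u(2)] S_nonzero[OF u(1)] by auto
    then show "a \<otimes> t = b \<otimes> s"
      using that by simp
  next
    assume "a \<otimes> t = b \<otimes> s"
    then have "\<one> \<otimes> (a \<otimes> t \<ominus> b \<otimes> s) = \<zero>"
      using that by (simp add: r_right_minus_eq)
    then show "\<exists>u\<in>S. u \<otimes> (a \<otimes> t \<ominus> b \<otimes> s) = \<zero>"
      using S_one by blast
  qed
  then show ?thesis
    unfolding fraction_rel_def by auto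
qed

lemma equiv_fraction_rel: "equiv (carrier A \<times> S) (fraction_rel A S)"
proof (rule equivI)
  show "fraction_rel A S \<subseteq> (carrier A \<times> S) \<times> (carrier A \<times> S)"
    by (auto simp: fraction_rel_iff)
  show "refl_on (carrier A \<times> S) (fraction_rel A S)"
    by (rule refl_onI) (auto simp: fraction_rel_iff)
  show "sym (fraction_rel A S)"
    by (rule symI) (auto simp: fraction_rel_iff)
  show "trans (fraction_rel A S)"
  proof (rule transI)
    fix x y z assume *: "(x, y) \<in> fraction_rel A S" "(y, z) \<in> fraction_rel A S"
    obtain a s b t c u where xyz: "x = (a, s)" "y = (b, t)" "z = (c, u)"
      by (cases x, cases y, cases z)
    have cl: "a \<in> carrier A" "s \<in> S" "b \<in> carrier A" "t \<in> S" "c \<in> carrier A" "u \<in> S"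
      and eq: "a \<otimes> t = b \<otimes> s" "b \<otimes> u = c \<otimes> t"
      using * by (auto simp: xyz fraction_rel_iff)
    have "t \<otimes> (a \<otimes> u) = (a \<otimes> t) \<otimes> u"
      using cl by (simp add: m_ac)
    also have "\<dots> = (b \<otimes> u) \<otimes> s"
      unfolding eq(1) using cl by (simp add: m_ac)
    also have "\<dots> = t \<otimes> (c \<otimes> s)"
      unfolding eq(2) using cl by (simp add: m_ac)
    finally have "a \<otimes> u = c \<otimes> s"
      using cl S_nonzero by (simp add: m_lcancel)
    then show "(x, z) \<in> fraction_rel A S"
      using cl by (simp add: xyz fraction_rel_iff)
  qed
qed

lemma mem_fraction_iff:
  "\<lbrakk>a \<in> carrier A; s \<in> S\<rbrakk>
    \<Longrightarrow> (b, t) \<in> fraction A S a s \<longleftrightarrow> b \<in> carrier A \<and> t \<in> S \<and> a \<otimes> t = b \<otimes> s"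
  by (simp add: fraction_def fraction_rel_iff)

lemma fraction_eq_iff:
  "\<lbrakk>a \<in> carrier A; s \<in> S; b \<in> carrier A; t \<in> S\<rbrakk>
    \<Longrightarrow> fraction A S a s = fraction A S b t \<longleftrightarrow> a \<otimes> t = b \<otimes> s"
  unfolding fraction_def
  using eq_equiv_class_iff[OF equiv_fraction_rel, of "(a, s)" "(b, t)"] by (simp add: fraction_rel_iff)

abbreviation "C \<equiv> localization A S"

lemma carrier_localization: "carrier C = {fraction A S a s |a s. a \<in> carrier A \<and> s \<in> S}"
  unfolding localization_def fraction_def quotient_def by auto

lemma fraction_closed [simp]: "\<lbrakk>a \<in> carrier A; s \<in> S\<rbrakk> \<Longrightarrow> fraction A S a s \<in> carrier C"
  unfolding carrier_localization by blast

text \<open>The operations of \<open>localization\<close> are unions over all representatives.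
  Well-definedness means that the sets united all coincide, and non-emptiness that there is at least
  one.\<close>

lemma UN_pairs_const:
  assumes "y0 \<in> Y" "z0 \<in> Z" "\<And>a s b t. \<lbrakk>(a, s) \<in> Y; (b, t) \<in> Z\<rbrakk> \<Longrightarrow> g a s b t = c"
  shows "(\<Union>(a, s)\<in>Y. \<Union>(b, t)\<in>Z. g a s b t) = c"
proof -
  have *: "(\<Union>(b, t)\<in>Z. g a s b t) = c" if "(a, s) \<in> Y" for a s
    using assms(2) assms(3)[OF that] by auto
  have "(\<Union>p\<in>Y. case p of (a, s) \<Rightarrow> \<Union>(b, t)\<in>Z. g a s b t) = (\<Union>p\<in>Y. c)"
  proof (rule SUP_cong[OF refl])
    fix p assume "p \<in> Y"
    moreover obtain a s where "p = (a, s)"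
      by (rule prod.exhaust)
    ultimately show "(case p of (a, s) \<Rightarrow> \<Union>(b, t)\<in>Z. g a s b t) = c"
      using * by (simp only: prod.case)
  qed
  then show ?thesis
    using assms(1) by auto
qed

lemma fraction_mult:
  assumes "a \<in> carrier A" "s \<in> S" "b \<in> carrier A" "t \<in> S"
  shows "fraction A S a s \<otimes>\<^bsub>C\<^esub> fraction A S b t = fraction A S (a \<otimes> b) (s \<otimes> t)"
proof -
  have mem: "(a, s) \<in> fraction A S a s" "(b, t) \<in> fraction A S b t"
    using assms by (auto simp: mem_fraction_iff)
  have "fraction A S (a' \<otimes> b') (s' \<otimes> t') = fraction A S (a \<otimes> b) (s \<otimes> t)"
    if "(a', s') \<in> fraction A S a s" "(b', t') \<in> fraction A S b t" for a' s' b' t'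
  proof -
    have *: "a' \<in> carrier A" "s' \<in> S" "a \<otimes> s' = a' \<otimes> s" "b' \<in> carrier A" "t' \<in> S" "b \<otimes> t' = b' \<otimes> t"
      using that assms by (auto simp: mem_fraction_iff)
    have "a' \<otimes> b' \<otimes> (s \<otimes> t) = (a' \<otimes> s) \<otimes> (b' \<otimes> t)"
      using *(1,2,4,5) assms by (simp add: m_ac)
    also have "\<dots> = (a \<otimes> s') \<otimes> (b \<otimes> t')"
      using * by simp
    also have "\<dots> = a \<otimes> b \<otimes> (s' \<otimes> t')"
      using *(1,2,4,5) assms by (simp add: m_ac)
    finally show ?thesis
      using * assms S_mult by (simp add: fraction_eq_iff)
  qed
  then show ?thesis
    unfolding localization_def monoid.simps ring.simps by (rule UN_pairs_const[OF mem])
qed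

lemma fraction_add:
  assumes "a \<in> carrier A" "s \<in> S" "b \<in> carrier A" "t \<in> S"
  shows "fraction A S a s \<oplus>\<^bsub>C\<^esub> fraction A S b t = fraction A S (a \<otimes> t \<oplus> b \<otimes> s) (s \<otimes> t)"
proof -
  have mem: "(a, s) \<in> fraction A S a s" "(b, t) \<in> fraction A S b t"
    using assms by (auto simp: mem_fraction_iff)
  have "fraction A S (a' \<otimes> t' \<oplus> b' \<otimes> s') (s' \<otimes> t') = fraction A S (a \<otimes> t \<oplus> b \<otimes> s) (s \<otimes> t)"
    if "(a', s') \<in> fraction A S a s" "(b', t') \<in> fraction A S b t" for a' s' b' t'
  proof -
    have *: "a' \<in> carrier A" "s' \<in> S" "a \<otimes> s' = a' \<otimes> s" "b' \<in> carrier A" "t' \<in> S" "b \<otimes> t' = b' \<otimes> t"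
      using that assms by (auto simp: mem_fraction_iff)
    have "(a' \<otimes> t' \<oplus> b' \<otimes> s') \<otimes> (s \<otimes> t) = (a' \<otimes> s) \<otimes> (t \<otimes> t') \<oplus> (b' \<otimes> t) \<otimes> (s \<otimes> s')"
      using *(1,2,4,5) assms by (simp add: m_ac l_distr r_distr)
    also have "\<dots> = (a \<otimes> s') \<otimes> (t \<otimes> t') \<oplus> (b \<otimes> t') \<otimes> (s \<otimes> s')"
      using * by simp
    also have "\<dots> = (a \<otimes> t \<oplus> b \<otimes> s) \<otimes> (s' \<otimes> t')"
      using *(1,2,4,5) assms by (simp add: m_ac l_distr r_distr)
    finally show ?thesis
      using * assms S_mult by (simp add: fraction_eq_iff)
  qed
  then show ?thesis
    unfolding localization_def monoid.simps ring.simps by (rule UN_pairs_const[OF mem])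
qed

lemma localization_one: "\<one>\<^bsub>C\<^esub> = fraction A S \<one> \<one>"
  and localization_zero: "\<zero>\<^bsub>C\<^esub> = fraction A S \<zero> \<one>"
  by (simp_all add: localization_def)

lemma fraction_zero: "s \<in> S \<Longrightarrow> fraction A S \<zero> s = \<zero>\<^bsub>C\<^esub>"
  and fraction_self: "s \<in> S \<Longrightarrow> fraction A S s s = \<one>\<^bsub>C\<^esub>"
  using S_one by (simp_all add: localization_zero localization_one fraction_eq_iff)

lemma cring_localization: "cring C"
proof (rule cringI)
  show "abelian_group C"
  proof (rule abelian_groupI)
    show "\<zero>\<^bsub>C\<^esub> \<in> carrier C"
      using S_one by (simp add: localization_zero)
  next
    fix x y assume "x \<in> carrier C" "y \<in> carrier C"
    then obtain a s b t where "a \<in> carrier A" "s \<in> S" "b \<in> carrier A" "t \<in> S"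
      "x = fraction A S a s" "y = fraction A S b t"
      by (auto simp: carrier_localization)
    then show "x \<oplus>\<^bsub>C\<^esub> y \<in> carrier C"
      using S_mult by (simp add: fraction_add)
  next
    fix x y z assume "x \<in> carrier C" "y \<in> carrier C" "z \<in> carrier C"
    then show "x \<oplus>\<^bsub>C\<^esub> y \<oplus>\<^bsub>C\<^esub> z = x \<oplus>\<^bsub>C\<^esub> (y \<oplus>\<^bsub>C\<^esub> z)"
      using S_mult by (auto simp: carrier_localization fraction_add m_ac l_distr r_distr a_ac)
  next
    fix x y assume "x \<in> carrier C" "y \<in> carrier C"
    then show "x \<oplus>\<^bsub>C\<^esub> y = y \<oplus>\<^bsub>C\<^esub> x"
      by (auto simp: carrier_localization fraction_add m_comm a_comm)
  next
    fix x assume "x \<in> carrier C"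
    then show "\<zero>\<^bsub>C\<^esub> \<oplus>\<^bsub>C\<^esub> x = x"
      using S_one by (auto simp: carrier_localization localization_zero fraction_add)
  next
    fix x assume "x \<in> carrier C"
    then obtain a s where as: "a \<in> carrier A" "s \<in> S" "x = fraction A S a s"
      by (auto simp: carrier_localization)
    then have "fraction A S (\<ominus> a) s \<oplus>\<^bsub>C\<^esub> x = fraction A S \<zero> (s \<otimes> s)"
      by (simp add: fraction_add l_minus l_neg)
    then have "fraction A S (\<ominus> a) s \<oplus>\<^bsub>C\<^esub> x = \<zero>\<^bsub>C\<^esub>"
      using as S_mult by (simp add: fraction_zero)
    then show "\<exists>y\<in>carrier C. y \<oplus>\<^bsub>C\<^esub> x = \<zero>\<^bsub>C\<^esub>"
      using as fraction_closed by blast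
  qed
  show "comm_monoid C"
  proof (rule comm_monoidI)
    show "\<one>\<^bsub>C\<^esub> \<in> carrier C"
      using S_one by (simp add: localization_one)
  next
    fix x y assume "x \<in> carrier C" "y \<in> carrier C"
    then obtain a s b t where "a \<in> carrier A" "s \<in> S" "b \<in> carrier A" "t \<in> S"
      "x = fraction A S a s" "y = fraction A S b t"
      by (auto simp: carrier_localization)
    then show "x \<otimes>\<^bsub>C\<^esub> y \<in> carrier C"
      using S_mult by (simp add: fraction_mult)
  next
    fix x y z assume "x \<in> carrier C" "y \<in> carrier C" "z \<in> carrier C"
    then show "x \<otimes>\<^bsub>C\<^esub> y \<otimes>\<^bsub>C\<^esub> z = x \<otimes>\<^bsub>C\<^esub> (y \<otimes>\<^bsub>C\<^esub> z)"
      using S_mult by (auto simp: carrier_localization fraction_mult m_assoc)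
  next
    fix x assume "x \<in> carrier C"
    then show "\<one>\<^bsub>C\<^esub> \<otimes>\<^bsub>C\<^esub> x = x"
      using S_one by (auto simp: carrier_localization localization_one fraction_mult)
  next
    fix x y assume "x \<in> carrier C" "y \<in> carrier C"
    then show "x \<otimes>\<^bsub>C\<^esub> y = y \<otimes>\<^bsub>C\<^esub> x"
      by (auto simp: carrier_localization fraction_mult m_comm)
  qed
  fix x y z assume "x \<in> carrier C" "y \<in> carrier C" "z \<in> carrier C"
  then obtain a s b t c u where *: "a \<in> carrier A" "s \<in> S" "b \<in> carrier A" "t \<in> S" "c \<in> carrier A" "u \<in> S"
    and xyz: "x = fraction A S a s" "y = fraction A S b t" "z = fraction A S c u"
    by (auto simp: carrier_localization)
  have "(x \<oplus>\<^bsub>C\<^esub> y) \<otimes>\<^bsub>C\<^esub> z = fraction A S ((a \<otimes> t \<oplus> b \<otimes> s) \<otimes> c) (s \<otimes> t \<otimes> u)"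
    using * S_mult by (simp add: xyz fraction_add fraction_mult)
  \<comment> \<open>Numerator and denominator are expanded by the factor \<open>u\<close>, to match
    the sum of two products over the denominators \<open>s u\<close> and \<open>t u\<close>.\<close>
  also have "\<dots> = fraction A S (a \<otimes> c \<otimes> (t \<otimes> u) \<oplus> b \<otimes> c \<otimes> (s \<otimes> u)) (s \<otimes> u \<otimes> (t \<otimes> u))"
    using * S_mult by (subst fraction_eq_iff) (auto simp: l_distr r_distr m_ac)
  also have "\<dots> = x \<otimes>\<^bsub>C\<^esub> z \<oplus>\<^bsub>C\<^esub> y \<otimes>\<^bsub>C\<^esub> z"
    using * S_mult by (simp add: xyz fraction_add fraction_mult)
  finally show "(x \<oplus>\<^bsub>C\<^esub> y) \<otimes>\<^bsub>C\<^esub> z = x \<otimes>\<^bsub>C\<^esub> z \<oplus>\<^bsub>C\<^esub> y \<otimes>\<^bsub>C\<^esub> z" .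
qed

end


section \<open>Extension of scalars\<close>

text \<open>The closure conditions place the relators inside the free abelian group, so that they
  generate a subgroup of it.\<close>

locale scalar_extension = C?: cring C + M?: abelian_group M
  for A :: "('a, 'q) ring_scheme" and \<phi> :: "'a \<Rightarrow> 'c" and C :: "('c, 'r) ring_scheme" (structure)
    and M :: "('a, 'm, 'x) module_scheme" +
  assumes \<phi>_closed: "a \<in> carrier A \<Longrightarrow> \<phi> a \<in> carrier C"
    and scale_closed: "\<lbrakk>a \<in> carrier A; x \<in> carrier M\<rbrakk> \<Longrightarrow> a \<odot>\<^bsub>M\<^esub> x \<in> carrier M"
begin

abbreviation "G \<equiv> tensor_group C M"
abbreviation "N \<equiv> tensor_null A \<phi> C M"
abbreviation "V \<equiv> base_change A \<phi> C M"

text \<open>Written with the subtraction of finitely supported functions, so that computations are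
  ordinary additive algebra; \<open>r_coset_eq\<close> identifies it with the coset of the quotient
  group.\<close>

definition coset where "coset t = {u. u - t \<in> N}"

definition tensor where "tensor c x = coset (frag_of (c, x))"

lemma carrier_G_iff: "t \<in> carrier G \<longleftrightarrow> Poly_Mapping.keys t \<subseteq> carrier C \<times> carrier M"
  by (simp add: tensor_group_def)

lemma comm_group_G: "comm_group G"
  by (simp add: tensor_group_def abelian_free_Abelian_group)

lemma mult_G: "t \<otimes>\<^bsub>G\<^esub> u = t + u"
  by (simp add: tensor_group_def)

lemma G_add: "\<lbrakk>t \<in> carrier G; u \<in> carrier G\<rbrakk> \<Longrightarrow> t + u \<in> carrier G"
  unfolding carrier_G_iff using keys_add[of t u] by blast

lemma G_diff: "\<lbrakk>t \<in> carrier G; u \<in> carrier G\<rbrakk> \<Longrightarrow> t - u \<in> carrier G"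
  unfolding carrier_G_iff using keys_diff[of t u] by blast

lemma G_frag_of: "\<lbrakk>c \<in> carrier C; x \<in> carrier M\<rbrakk> \<Longrightarrow> frag_of (c, x) \<in> carrier G"
  by (simp add: tensor_group_def)

lemma relators_subset: "tensor_relators A \<phi> C M \<subseteq> carrier G"
  unfolding tensor_relators_def
  by (auto intro!: G_diff G_frag_of \<phi>_closed scale_closed)

lemma subgroup_N: "subgroup N G"
proof -
  interpret comm_group G
    by (rule comm_group_G)
  show ?thesis
    unfolding tensor_null_def by (rule generate_is_subgroup[OF relators_subset])
qed

lemma N_subset: "N \<subseteq> carrier G"
  by (rule subgroup.subset[OF subgroup_N])

lemma N_add: "\<lbrakk>t \<in> N; u \<in> N\<rbrakk> \<Longrightarrow> t + u \<in> N"
  using subgroup.m_closed[OF subgroup_N] by (simp add: mult_G)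

lemma N_zero: "0 \<in> N"
  using subgroup.one_closed[OF subgroup_N] by (simp add: tensor_group_def)

lemma N_uminus: "t \<in> N \<Longrightarrow> - t \<in> N"
  using subgroup.m_inv_closed[OF subgroup_N, of t] N_subset
  by (auto simp: tensor_group_def)

lemma N_diff: "\<lbrakk>t \<in> N; u \<in> N\<rbrakk> \<Longrightarrow> t - u \<in> N"
  using N_add[of t "- u"] N_uminus[of u] by simp

lemma N_relator: "t \<in> tensor_relators A \<phi> C M \<Longrightarrow> t \<in> N"
  unfolding tensor_null_def by (rule generate.incl)

lemma coset_eq_iff: "coset t = coset u \<longleftrightarrow> t - u \<in> N"
proof
  assume "coset t = coset u"
  moreover have "t \<in> coset t"
    by (simp add: coset_def N_zero)
  ultimately show "t - u \<in> N"
    by (simp add: coset_def)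
next
  assume tu: "t - u \<in> N"
  have "v - t \<in> N \<longleftrightarrow> v - u \<in> N" for v
    using N_add[OF _ tu, of "v - t"] N_diff[OF _ tu, of "v - u"] by auto
  then show "coset t = coset u"
    by (simp add: coset_def)
qed

lemma r_coset_eq: "N #>\<^bsub>G\<^esub> t = coset t"
proof -
  have "u \<in> N #>\<^bsub>G\<^esub> t \<longleftrightarrow> u - t \<in> N" for u
    unfolding r_coset_def mult_G by (auto intro: bexI[of _ "u - t"])
  then show ?thesis
    by (auto simp: coset_def)
qed

lemma coset_add: "coset t <#>\<^bsub>G\<^esub> coset u = coset (t + u)"
proof -
  have "v \<in> coset t <#>\<^bsub>G\<^esub> coset u \<longleftrightarrow> v - (t + u) \<in> N" for v
  proof
    assume "v \<in> coset t <#>\<^bsub>G\<^esub> coset u"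
    then obtain x y where "x - t \<in> N" "y - u \<in> N" "v = x + y"
      by (auto simp: set_mult_def coset_def mult_G)
    then show "v - (t + u) \<in> N"
      using N_add[of "x - t" "y - u"] by (simp add: algebra_simps)
  next
    assume "v - (t + u) \<in> N"
    then have "v - u \<in> coset t" "u \<in> coset u" "v = (v - u) + u"
      by (auto simp: coset_def N_zero algebra_simps)
    then show "v \<in> coset t <#>\<^bsub>G\<^esub> coset u"
      unfolding set_mult_def mult_G by blast
  qed
  then show ?thesis
    by (auto simp: coset_def)
qed

lemma carrier_V: "carrier V = coset ` carrier G"
  by (auto simp: base_change_def FactGroup_def RCOSETS_def r_coset_eq)

lemma add_V: "coset t \<oplus>\<^bsub>V\<^esub> coset u = coset (t + u)"
  by (simp add: base_change_def FactGroup_def coset_add)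

lemma zero_V: "\<zero>\<^bsub>V\<^esub> = coset 0"
  by (simp add: base_change_def FactGroup_def coset_def)

definition scale :: "'c \<Rightarrow> ('c \<times> 'm \<Rightarrow>\<^sub>0 int) \<Rightarrow> ('c \<times> 'm \<Rightarrow>\<^sub>0 int)"
  where "scale d = frag_extend (\<lambda>(c, x). frag_of (d \<otimes> c, x))"

lemma scale_add: "scale d (t + u) = scale d t + scale d u"
  and scale_diff: "scale d (t - u) = scale d t - scale d u"
  and scale_frag_of: "scale d (frag_of (c, x)) = frag_of (d \<otimes> c, x)"
  by (simp_all add: scale_def frag_extend_add frag_extend_diff)

lemma scale_carrier:
  assumes "d \<in> carrier C" "t \<in> carrier G"
  shows "scale d t \<in> carrier G"
proof -
  have "Poly_Mapping.keys (scale d t) \<subseteq> (\<Union>k\<in>Poly_Mapping.keys t. Poly_Mapping.keys (case k of (c, x) \<Rightarrow> frag_of (d \<otimes> c, x)))"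
    unfolding scale_def by (rule keys_frag_extend)
  also have "\<dots> \<subseteq> carrier C \<times> carrier M"
    using assms unfolding carrier_G_iff by (auto dest: subsetD)
  finally show ?thesis
    unfolding carrier_G_iff .
qed

text \<open>The module axioms of the tensor product are congruences modulo \<open>N\<close> between
  additive expressions; this reduces them to the generators \<open>(c, x)\<close>.\<close>

lemma additive_in_N:
  assumes F: "\<And>t u. F (t - u) = F t - F u"
    and gen: "\<And>c x. \<lbrakk>c \<in> carrier C; x \<in> carrier M\<rbrakk> \<Longrightarrow> F (frag_of (c, x)) \<in> N"
    and t: "t \<in> carrier G"
  shows "F t \<in> N"
proof (rule free_Abelian_group_induct[of t "carrier C \<times> carrier M"])
  show "Poly_Mapping.keys t \<subseteq> carrier C \<times> carrier M"
    using t by (simp add: carrier_G_iff)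
  show "F 0 \<in> N"
    using F[of 0 0] N_zero by simp
next
  fix x y assume "F x \<in> N" "F y \<in> N"
  then show "F (x - y) \<in> N"
    by (simp add: F N_diff)
next
  fix k assume "k \<in> carrier C \<times> carrier M"
  then show "F (frag_of k) \<in> N"
    using gen by auto
qed

text \<open>Multiplication by \<open>d\<close> sends each relator to a relator of the same kind.
  This makes scalar multiplication well defined on classes.\<close>

lemma scale_N:
  assumes d: "d \<in> carrier C" and t: "t \<in> N"
  shows "scale d t \<in> N"
proof -
  interpret G: comm_group G
    by (rule comm_group_G)
  let ?H = "{t \<in> carrier G. scale d t \<in> N}"
  have "subgroup ?H G"
  proof (rule G.subgroupI)
    have "(0 :: _ \<Rightarrow>\<^sub>0 int) \<in> carrier G" "scale d 0 = 0"
      using scale_diff[of d 0 0] by (simp_all add: carrier_G_iff)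
    then show "?H \<noteq> {}"
      using N_zero by auto
  next
    fix t assume "t \<in> ?H"
    moreover from this have "inv\<^bsub>G\<^esub> t = 0 - t"
      by (simp add: tensor_group_def)
    moreover have "(0 :: _ \<Rightarrow>\<^sub>0 int) \<in> carrier G" "scale d 0 = 0"
      using scale_diff[of d 0 0] by (simp_all add: carrier_G_iff)
    ultimately show "inv\<^bsub>G\<^esub> t \<in> ?H"
      using N_uminus[of "scale d t"] G_diff[of 0 t] scale_diff[of d 0 t] by simp
  next
    fix t u assume "t \<in> ?H" "u \<in> ?H"
    then show "t \<otimes>\<^bsub>G\<^esub> u \<in> ?H"
      using G_add N_add by (simp add: mult_G scale_add)
  qed auto
  moreover have "tensor_relators A \<phi> C M \<subseteq> ?H"
  proof
    fix r assume r: "r \<in> tensor_relators A \<phi> C M"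
    then have "scale d r \<in> tensor_relators A \<phi> C M"
      unfolding tensor_relators_def
    proof (elim UnE)
      assume "r \<in> {frag_of (c \<oplus> e, x) - frag_of (c, x) - frag_of (e, x) |c e x.
        c \<in> carrier C \<and> e \<in> carrier C \<and> x \<in> carrier M}"
      then obtain c e x where "c \<in> carrier C" "e \<in> carrier C" "x \<in> carrier M"
        "r = frag_of (c \<oplus> e, x) - frag_of (c, x) - frag_of (e, x)"
        by blast
      then show "scale d r \<in> {frag_of (c \<oplus> e, x) - frag_of (c, x) - frag_of (e, x) |c e x.
          c \<in> carrier C \<and> e \<in> carrier C \<and> x \<in> carrier M} \<union>
        {frag_of (c, x \<oplus>\<^bsub>M\<^esub> y) - frag_of (c, x) - frag_of (c, y) |c x y.
          c \<in> carrier C \<and> x \<in> carrier M \<and> y \<in> carrier M} \<union>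
        {frag_of (c \<otimes> \<phi> a, x) - frag_of (c, a \<odot>\<^bsub>M\<^esub> x) |c a x.
          c \<in> carrier C \<and> a \<in> carrier A \<and> x \<in> carrier M}"
        using d by (intro UnI1 CollectI exI[of _ "d \<otimes> c"] exI[of _ "d \<otimes> e"] exI[of _ x])
          (simp add: scale_diff scale_frag_of C.r_distr)
    next
      assume "r \<in> {frag_of (c, x \<oplus>\<^bsub>M\<^esub> y) - frag_of (c, x) - frag_of (c, y) |c x y.
        c \<in> carrier C \<and> x \<in> carrier M \<and> y \<in> carrier M}"
      then obtain c x y where "c \<in> carrier C" "x \<in> carrier M" "y \<in> carrier M"
        "r = frag_of (c, x \<oplus>\<^bsub>M\<^esub> y) - frag_of (c, x) - frag_of (c, y)"
        by blast
      then show "scale d r \<in> {frag_of (c \<oplus> e, x) - frag_of (c, x) - frag_of (e, x) |c e x.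
          c \<in> carrier C \<and> e \<in> carrier C \<and> x \<in> carrier M} \<union>
        {frag_of (c, x \<oplus>\<^bsub>M\<^esub> y) - frag_of (c, x) - frag_of (c, y) |c x y.
          c \<in> carrier C \<and> x \<in> carrier M \<and> y \<in> carrier M} \<union>
        {frag_of (c \<otimes> \<phi> a, x) - frag_of (c, a \<odot>\<^bsub>M\<^esub> x) |c a x.
          c \<in> carrier C \<and> a \<in> carrier A \<and> x \<in> carrier M}"
        using d by (intro UnI1[OF UnI2] CollectI exI[of _ "d \<otimes> c"] exI[of _ x] exI[of _ y])
          (simp add: scale_diff scale_frag_of)
    next
      assume "r \<in> {frag_of (c \<otimes> \<phi> a, x) - frag_of (c, a \<odot>\<^bsub>M\<^esub> x) |c a x.
        c \<in> carrier C \<and> a \<in> carrier A \<and> x \<in> carrier M}"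
      then obtain c a x where "c \<in> carrier C" "a \<in> carrier A" "x \<in> carrier M"
        "r = frag_of (c \<otimes> \<phi> a, x) - frag_of (c, a \<odot>\<^bsub>M\<^esub> x)"
        by blast
      then show "scale d r \<in> {frag_of (c \<oplus> e, x) - frag_of (c, x) - frag_of (e, x) |c e x.
          c \<in> carrier C \<and> e \<in> carrier C \<and> x \<in> carrier M} \<union>
        {frag_of (c, x \<oplus>\<^bsub>M\<^esub> y) - frag_of (c, x) - frag_of (c, y) |c x y.
          c \<in> carrier C \<and> x \<in> carrier M \<and> y \<in> carrier M} \<union>
        {frag_of (c \<otimes> \<phi> a, x) - frag_of (c, a \<odot>\<^bsub>M\<^esub> x) |c a x.
          c \<in> carrier C \<and> a \<in> carrier A \<and> x \<in> carrier M}"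
        using d \<phi>_closed by (intro UnI2 CollectI exI[of _ "d \<otimes> c"] exI[of _ a] exI[of _ x])
          (simp add: scale_diff scale_frag_of C.m_assoc)
    qed
    then show "r \<in> ?H"
      using r relators_subset N_relator by blast
  qed
  ultimately have "N \<subseteq> ?H"
    unfolding tensor_null_def by (intro G.generate_subgroup_incl)
  then show ?thesis
    using t by blast
qed

lemma smult_V:
  assumes "d \<in> carrier C"
  shows "d \<odot>\<^bsub>V\<^esub> coset t = coset (scale d t)"
proof -
  have "t \<in> coset t"
    by (simp add: coset_def N_zero)
  moreover have "coset (scale d u) = coset (scale d t)" if "u \<in> coset t" for u
    using that scale_N[OF assms, of "u - t"] by (simp add: coset_def coset_eq_iff[unfolded coset_def] scale_diff)
  ultimately have "(\<Union>u\<in>coset t. coset (scale d u)) = coset (scale d t)"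
    by blast
  then show ?thesis
    by (simp add: base_change_def r_coset_eq scale_def)
qed

lemma abelian_group_V: "abelian_group V"
proof (rule abelian_groupI)
  fix T assume "T \<in> carrier V"
  then obtain t where t: "t \<in> carrier G" "T = coset t"
    by (auto simp: carrier_V)
  have "0 - t \<in> carrier G"
    using t(1) by (simp add: carrier_G_iff)
  moreover have "coset (0 - t) \<oplus>\<^bsub>V\<^esub> T = \<zero>\<^bsub>V\<^esub>"
    by (simp add: t(2) add_V zero_V)
  ultimately show "\<exists>Y\<in>carrier V. Y \<oplus>\<^bsub>V\<^esub> T = \<zero>\<^bsub>V\<^esub>"
    unfolding carrier_V by blast
next
  show "\<zero>\<^bsub>V\<^esub> \<in> carrier V"
    unfolding carrier_V zero_V by (rule imageI) (simp add: carrier_G_iff)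
qed (auto simp: carrier_V add_V zero_V G_add algebra_simps)

lemma module_V: "module C V"
proof -
  have "module_axioms C V"
  proof
    fix d T assume "d \<in> carrier C" "T \<in> carrier V"
    then show "d \<odot>\<^bsub>V\<^esub> T \<in> carrier V"
      by (auto simp: carrier_V smult_V scale_carrier)
  next
    fix d e T assume de: "d \<in> carrier C" "e \<in> carrier C" and "T \<in> carrier V"
    then obtain t where t: "t \<in> carrier G" "T = coset t"
      by (auto simp: carrier_V)
    have "scale (d \<oplus> e) t - (scale d t + scale e t) \<in> N"
    proof (rule additive_in_N[OF _ _ t(1), of "\<lambda>t. scale (d \<oplus> e) t - (scale d t + scale e t)"])
      fix c x assume cx: "c \<in> carrier C" "x \<in> carrier M"
      have "frag_of (d \<otimes> c \<oplus> e \<otimes> c, x) - frag_of (d \<otimes> c, x) - frag_of (e \<otimes> c, x) \<in> N"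
        using de cx by (intro N_relator) (auto simp: tensor_relators_def)
      then show "scale (d \<oplus> e) (frag_of (c, x)) - (scale d (frag_of (c, x)) + scale e (frag_of (c, x))) \<in> N"
        using de cx by (simp add: scale_frag_of C.l_distr algebra_simps)
    qed (simp add: scale_diff)
    then show "(d \<oplus> e) \<odot>\<^bsub>V\<^esub> T = d \<odot>\<^bsub>V\<^esub> T \<oplus>\<^bsub>V\<^esub> e \<odot>\<^bsub>V\<^esub> T"
      using de by (simp add: t smult_V add_V coset_eq_iff)
    have "scale (d \<otimes> e) t - scale d (scale e t) \<in> N"
    proof (rule additive_in_N[OF _ _ t(1), of "\<lambda>t. scale (d \<otimes> e) t - scale d (scale e t)"])
      fix c x assume cx: "c \<in> carrier C" "x \<in> carrier M"
      then show "scale (d \<otimes> e) (frag_of (c, x)) - scale d (scale e (frag_of (c, x))) \<in> N"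
        using de by (simp add: scale_frag_of C.m_assoc N_zero)
    qed (simp add: scale_diff)
    then show "(d \<otimes> e) \<odot>\<^bsub>V\<^esub> T = d \<odot>\<^bsub>V\<^esub> (e \<odot>\<^bsub>V\<^esub> T)"
      using de by (simp add: t smult_V coset_eq_iff)
  next
    fix d T Y assume "d \<in> carrier C" "T \<in> carrier V" "Y \<in> carrier V"
    then show "d \<odot>\<^bsub>V\<^esub> (T \<oplus>\<^bsub>V\<^esub> Y) = d \<odot>\<^bsub>V\<^esub> T \<oplus>\<^bsub>V\<^esub> d \<odot>\<^bsub>V\<^esub> Y"
      by (auto simp: carrier_V smult_V add_V scale_add)
  next
    fix T assume "T \<in> carrier V"
    then obtain t where t: "t \<in> carrier G" "T = coset t"
      by (auto simp: carrier_V)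
    have "scale \<one> t - t \<in> N"
      by (rule additive_in_N[OF _ _ t(1), of "\<lambda>t. scale \<one> t - t"])
        (simp_all add: scale_diff scale_frag_of N_zero)
    then show "\<one> \<odot>\<^bsub>V\<^esub> T = T"
      by (simp add: t smult_V coset_eq_iff)
  qed
  then show ?thesis
    by (simp add: module_def abelian_group_V C.is_cring)
qed

lemma tensor_closed [simp]: "\<lbrakk>c \<in> carrier C; x \<in> carrier M\<rbrakk> \<Longrightarrow> tensor c x \<in> carrier V"
  by (simp add: tensor_def carrier_V G_frag_of)

lemma tensor_add_right:
  assumes "c \<in> carrier C" "x \<in> carrier M" "y \<in> carrier M"
  shows "tensor c (x \<oplus>\<^bsub>M\<^esub> y) = tensor c x \<oplus>\<^bsub>V\<^esub> tensor c y"
proof -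
  have "frag_of (c, x \<oplus>\<^bsub>M\<^esub> y) - frag_of (c, x) - frag_of (c, y) \<in> N"
    using assms by (intro N_relator) (auto simp: tensor_relators_def)
  then show ?thesis
    by (simp add: tensor_def add_V coset_eq_iff algebra_simps)
qed

lemma tensor_balanced:
  assumes "c \<in> carrier C" "a \<in> carrier A" "x \<in> carrier M"
  shows "tensor (c \<otimes> \<phi> a) x = tensor c (a \<odot>\<^bsub>M\<^esub> x)"
proof -
  have "frag_of (c \<otimes> \<phi> a, x) - frag_of (c, a \<odot>\<^bsub>M\<^esub> x) \<in> N"
    using assms by (intro N_relator) (auto simp: tensor_relators_def)
  then show ?thesis
    by (simp add: tensor_def coset_eq_iff)
qed

lemma smult_tensor: "d \<in> carrier C \<Longrightarrow> d \<odot>\<^bsub>V\<^esub> tensor c x = tensor (d \<otimes> c) x"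
  by (simp add: tensor_def smult_V scale_frag_of)

lemma tensor_finsum:
  assumes c: "c \<in> carrier C" and Y: "finite Y" "f \<in> Y \<rightarrow> carrier M"
  shows "tensor c (\<Oplus>\<^bsub>M\<^esub>y\<in>Y. f y) = (\<Oplus>\<^bsub>V\<^esub>y\<in>Y. tensor c (f y))"
proof -
  interpret V: left_module C V
    by (rule module_imp_left_module[OF module_V])
  show ?thesis
    using Y
  proof (induction Y)
    case empty
    have "tensor c \<zero>\<^bsub>M\<^esub> = tensor c \<zero>\<^bsub>M\<^esub> \<oplus>\<^bsub>V\<^esub> tensor c \<zero>\<^bsub>M\<^esub>"
      using tensor_add_right[OF c, of "\<zero>\<^bsub>M\<^esub>" "\<zero>\<^bsub>M\<^esub>"] by simp
    then have "tensor c \<zero>\<^bsub>M\<^esub> = \<zero>\<^bsub>V\<^esub>"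
      using tensor_closed[OF c, of "\<zero>\<^bsub>M\<^esub>"] by (metis M.zero_closed V.M.add.r_cancel_one')
    then show ?case
      by simp
  next
    case (insert y Y)
    then have cl: "f y \<in> carrier M" "f \<in> Y \<rightarrow> carrier M"
      by auto
    then have "(\<lambda>y. tensor c (f y)) \<in> Y \<rightarrow> carrier V"
      using c by (auto simp: Pi_iff)
    then show ?case
      using insert cl c by (simp add: tensor_add_right)
  qed
qed

lemma V_generated:
  assumes Q: "submodule Q C V" and gen: "\<And>c x. \<lbrakk>c \<in> carrier C; x \<in> carrier M\<rbrakk> \<Longrightarrow> tensor c x \<in> Q"
  shows "carrier V \<subseteq> Q"
proof -
  interpret V: left_module C V
    by (rule module_imp_left_module[OF module_V])
  have "coset t \<in> Q" if "t \<in> carrier G" for t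
  proof (rule free_Abelian_group_induct[of t "carrier C \<times> carrier M"])
    show "Poly_Mapping.keys t \<subseteq> carrier C \<times> carrier M"
      using that by (simp add: carrier_G_iff)
    show "coset 0 \<in> Q"
      using V.submodule_zero[OF Q] by (simp add: zero_V)
  next
    fix x y assume xy: "coset x \<in> Q" "coset y \<in> Q"
    have cl: "coset x \<in> carrier V" "coset y \<in> carrier V"
      using xy V.submodule_carrier[OF Q] by auto
    assume "Poly_Mapping.keys x \<subseteq> carrier C \<times> carrier M" "Poly_Mapping.keys y \<subseteq> carrier C \<times> carrier M"
    then have "coset (x - y) \<in> carrier V"
      using G_diff[of x y] by (simp add: carrier_V carrier_G_iff)
    moreover have "coset (x - y) \<oplus>\<^bsub>V\<^esub> coset y = coset x"
      by (simp add: add_V)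
    ultimately have "coset x \<ominus>\<^bsub>V\<^esub> coset y = coset (x - y)"
      using cl by (metis V.M.add.inv_solve_right V.M.minus_eq)
    then show "coset (x - y) \<in> Q"
      using V.submodule_minus[OF Q xy] by simp
  next
    fix k assume "k \<in> carrier C \<times> carrier M"
    then show "coset (frag_of k) \<in> Q"
      using gen by (auto simp: tensor_def)
  qed
  then show ?thesis
    by (auto simp: carrier_V)
qed

text \<open>The map \<open>(c, x) \<mapsto> c g(x)\<close> is biadditive and balanced, so its
  additive extension kills the relators and factors through the quotient. With coordinate functions
  for \<open>g\<close> it yields the functionals wanted by \<open>is_basisI\<close>.\<close>

lemma tensor_universal:
  assumes g: "g \<in> carrier M \<rightarrow> carrier C"
    and g_add: "\<And>x y. \<lbrakk>x \<in> carrier M; y \<in> carrier M\<rbrakk> \<Longrightarrow> g (x \<oplus>\<^bsub>M\<^esub> y) = g x \<oplus> g y"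
    and g_smult: "\<And>a x. \<lbrakk>a \<in> carrier A; x \<in> carrier M\<rbrakk> \<Longrightarrow> g (a \<odot>\<^bsub>M\<^esub> x) = \<phi> a \<otimes> g x"
  shows "\<exists>h \<in> carrier V \<rightarrow> carrier C. (\<forall>T\<in>carrier V. \<forall>Y\<in>carrier V. h (T \<oplus>\<^bsub>V\<^esub> Y) = h T \<oplus> h Y) \<and>
    (\<forall>c\<in>carrier C. \<forall>x\<in>carrier M. h (tensor c x) = c \<otimes> g x)"
proof -
  interpret G: comm_group G
    by (rule comm_group_G)
  let ?f = "\<lambda>(c, x). c \<otimes> g x"
  have "?f ` (carrier C \<times> carrier M) \<subseteq> carrier (add_monoid C)"
    using g by auto
  then obtain h0 where h0: "h0 \<in> hom (free_Abelian_group (carrier C \<times> carrier M)) (add_monoid C)"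
    and h0_gen: "\<And>k. k \<in> carrier C \<times> carrier M \<Longrightarrow> h0 (frag_of k) = ?f k"
    by (rule comm_group.free_Abelian_group_universal[OF C.a_comm_group]) auto
  have h0_cl: "h0 t \<in> carrier C" if "t \<in> carrier G" for t
    using hom_in_carrier[OF h0] that by (simp add: tensor_group_def)
  have h0_add: "h0 (t + u) = h0 t \<oplus> h0 u" if "t \<in> carrier G" "u \<in> carrier G" for t u
    using hom_mult[OF h0, of t u] that by (simp add: tensor_group_def)
  have h0_diff: "h0 (t - u) = h0 t \<ominus> h0 u" if "t \<in> carrier G" "u \<in> carrier G" for t u
  proof -
    have "h0 t = h0 (t - u) \<oplus> h0 u"
      using h0_add[OF G_diff[OF that] that(2)] by simp
    then show ?thesis
      using h0_cl G_diff that by (simp add: C.minus_eq C.a_assoc C.r_neg)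
  qed
  have cancel: "x \<oplus> y \<ominus> x \<ominus> y = \<zero>" if "x \<in> carrier C" "y \<in> carrier C" for x y
  proof -
    have "x \<oplus> y \<ominus> x = y \<oplus> (x \<oplus> \<ominus> x)"
      using that by (simp only: C.minus_eq C.a_comm[of x y] C.a_assoc C.a_inv_closed)
    then show ?thesis
      using that by (simp add: C.r_neg C.minus_eq)
  qed
  have h0_N: "h0 t = \<zero>" if "t \<in> N" for t
  proof -
    let ?H = "{t \<in> carrier G. h0 t = \<zero>}"
    have z: "(0 :: _ \<Rightarrow>\<^sub>0 int) \<in> carrier G"
      by (simp add: carrier_G_iff)
    have h00: "h0 0 = \<zero>"
    proof -
      have "h0 0 = h0 0 \<ominus> h0 0"
        using h0_diff[OF z z] by simp
      also have "\<dots> = \<zero>"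
        using h0_cl[OF z] by (simp add: C.minus_eq C.r_neg)
      finally show ?thesis .
    qed
    have "subgroup ?H G"
    proof (rule G.subgroupI)
      show "?H \<noteq> {}"
        using z h00 by blast
    next
      fix t assume t: "t \<in> ?H"
      then have "inv\<^bsub>G\<^esub> t = 0 - t"
        by (simp add: tensor_group_def)
      then show "inv\<^bsub>G\<^esub> t \<in> ?H"
        using t z h0_diff[OF z, of t] G_diff[OF z, of t] h00 by simp
    next
      fix t u assume "t \<in> ?H" "u \<in> ?H"
      then show "t \<otimes>\<^bsub>G\<^esub> u \<in> ?H"
        using G_add h0_add by (simp add: mult_G)
    qed auto
    moreover have "tensor_relators A \<phi> C M \<subseteq> ?H"
    proof
      fix r assume r: "r \<in> tensor_relators A \<phi> C M"
      then have "h0 r = \<zero>"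
        unfolding tensor_relators_def
      proof (elim UnE)
        assume "r \<in> {frag_of (c \<oplus> e, x) - frag_of (c, x) - frag_of (e, x) |c e x.
          c \<in> carrier C \<and> e \<in> carrier C \<and> x \<in> carrier M}"
        then obtain c e x where *: "c \<in> carrier C" "e \<in> carrier C" "x \<in> carrier M"
          "r = frag_of (c \<oplus> e, x) - frag_of (c, x) - frag_of (e, x)"
          by blast
        moreover have "g x \<in> carrier C"
          using * g by auto
        ultimately show ?thesis
          by (simp add: h0_diff h0_gen G_diff G_frag_of C.l_distr cancel)
      next
        assume "r \<in> {frag_of (c, x \<oplus>\<^bsub>M\<^esub> y) - frag_of (c, x) - frag_of (c, y) |c x y.
          c \<in> carrier C \<and> x \<in> carrier M \<and> y \<in> carrier M}"
        then obtain c x y where *: "c \<in> carrier C" "x \<in> carrier M" "y \<in> carrier M"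
          "r = frag_of (c, x \<oplus>\<^bsub>M\<^esub> y) - frag_of (c, x) - frag_of (c, y)"
          by blast
        moreover have "g x \<in> carrier C" "g y \<in> carrier C"
          using * g by auto
        ultimately show ?thesis
          by (simp add: h0_diff h0_gen G_diff G_frag_of g_add C.r_distr cancel)
      next
        assume "r \<in> {frag_of (c \<otimes> \<phi> a, x) - frag_of (c, a \<odot>\<^bsub>M\<^esub> x) |c a x.
          c \<in> carrier C \<and> a \<in> carrier A \<and> x \<in> carrier M}"
        then obtain c a x where *: "c \<in> carrier C" "a \<in> carrier A" "x \<in> carrier M"
          "r = frag_of (c \<otimes> \<phi> a, x) - frag_of (c, a \<odot>\<^bsub>M\<^esub> x)"
          by blast
        moreover have "g x \<in> carrier C" "\<phi> a \<in> carrier C" "a \<odot>\<^bsub>M\<^esub> x \<in> carrier M"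
          using * g \<phi>_closed scale_closed by auto
        ultimately show ?thesis
          by (simp add: h0_diff h0_gen G_frag_of g_smult C.m_assoc C.r_right_minus_eq)
      qed
      then show "r \<in> ?H"
        using r relators_subset by blast
    qed
    ultimately have "N \<subseteq> ?H"
      unfolding tensor_null_def by (intro G.generate_subgroup_incl)
    then show ?thesis
      using that by blast
  qed
  \<comment> \<open>The extension \<open>h0\<close> is constant on each class, so the image of a
    class is a singleton.\<close>
  define h where "h = (\<lambda>T. the_elem (h0 ` T))"
  have h_coset: "h (coset t) = h0 t" if t: "t \<in> carrier G" for t
  proof -
    have "h0 u = h0 t" if "u \<in> coset t" for u
    proof -
      have "u - t \<in> N"
        using that by (simp add: coset_def)
      then have "h0 ((u - t) + t) = \<zero> \<oplus> h0 t"
        using h0_add[of "u - t" t] h0_N t N_subset by auto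
      then show ?thesis
        using h0_cl[OF t] by simp
    qed
    moreover have "t \<in> coset t"
      by (simp add: coset_def N_zero)
    ultimately have "h0 ` coset t = {h0 t}"
      by blast
    then show ?thesis
      by (simp add: h_def)
  qed
  show ?thesis
  proof (intro bexI[of _ h] conjI ballI)
    show "h \<in> carrier V \<rightarrow> carrier C"
      by (auto simp: carrier_V h_coset h0_cl)
    fix T Y assume "T \<in> carrier V" "Y \<in> carrier V"
    then show "h (T \<oplus>\<^bsub>V\<^esub> Y) = h T \<oplus> h Y"
      by (auto simp: carrier_V add_V h_coset h0_add G_add)
  next
    fix c x assume "c \<in> carrier C" "x \<in> carrier M"
    then show "h (tensor c x) = c \<otimes> g x"
      by (simp add: tensor_def h_coset G_frag_of h0_gen)
  qed
qed

end

section \<open>Freeness after inverting one element\<close>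

lemma (in domain) nat_pow_nonzero:
  assumes "a \<in> carrier R" "a \<noteq> \<zero>"
  shows "a [^] (n::nat) \<noteq> \<zero>"
proof (induction n)
  case (Suc n)
  then show ?case
    using assms integral[of "a [^] n" a] by auto
qed simp

lemma (in domain) localized_domain_powers:
  assumes "a \<in> carrier R" "a \<noteq> \<zero>"
  shows "localized_domain R (powers R a)"
proof unfold_locales
  show "powers R a \<subseteq> carrier R"
    using assms by (auto simp: powers_def)
  show "\<one> \<in> powers R a"
    unfolding powers_def by (intro CollectI exI[of _ "0::nat"]) simp
  show "\<zero> \<notin> powers R a"
  proof
    assume "\<zero> \<in> powers R a"
    then obtain j :: nat where j: "\<zero> = a [^] j"
      by (auto simp: powers_def)
    then show False
      using nat_pow_nonzero[OF assms, of j] by (elim notE) (rule j[symmetric])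
  qed
  fix s t assume "s \<in> powers R a" "t \<in> powers R a"
  then obtain i j :: nat where "s = a [^] i" "t = a [^] j"
    by (auto simp: powers_def)
  then have "s \<otimes> t = a [^] (i + j)"
    using assms by (simp add: nat_pow_mult)
  then show "s \<otimes> t \<in> powers R a"
    by (auto simp: powers_def)
qed

text \<open>If \<open>f M\<close> is contained in the span of the independent set \<open>S\<close>, the coordinates of \<open>f x\<close> divided
  by \<open>f\<close> are the coordinates of the image of \<open>x\<close> in the localized module.\<close>

lemma generically_freeI:
  fixes A (structure)
  assumes A: "domain A" and M: "module A M" and f: "f \<in> carrier A" "f \<noteq> \<zero>" and S: "S \<subseteq> carrier M"
    and ind: "\<And>Y c. \<lbrakk>finite Y; Y \<subseteq> S; c \<in> Y \<rightarrow> carrier A; (\<Oplus>\<^bsub>M\<^esub>s\<in>Y. c s \<odot>\<^bsub>M\<^esub> s) = \<zero>\<^bsub>M\<^esub>\<rbrakk>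
      \<Longrightarrow> \<forall>s\<in>Y. c s = \<zero>"
    and span: "\<And>x. x \<in> carrier M \<Longrightarrow> f \<odot>\<^bsub>M\<^esub> x \<in> submodule_gen A M S"
  shows "generically_free A M"
proof -
  interpret A: domain A
    by (rule A)
  interpret M: left_module A M
    by (rule module_imp_left_module[OF M])
  define P where "P = powers A f"
  interpret L: localized_domain A P
    unfolding P_def by (rule A.localized_domain_powers[OF f])
  let ?C = "localization A P"
  define \<phi> where "\<phi> a = fraction A P a \<one>" for a
  interpret C: cring ?C
    by (rule L.cring_localization)
  interpret E: scalar_extension A \<phi> ?C M
  proof
    fix a assume "a \<in> carrier A"
    then show "\<phi> a \<in> carrier ?C"
      using L.S_one by (simp add: \<phi>_def)
  qed simp
  interpret V: left_module ?C "base_change A \<phi> ?C M"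
    by (rule module_imp_left_module[OF E.module_V])
  have fP: "f \<in> P"
    unfolding P_def powers_def using f(1) by (intro CollectI exI[of _ "1::nat"]) simp
  define lc where "lc Y c = (\<Oplus>\<^bsub>M\<^esub>s\<in>Y. c s \<odot>\<^bsub>M\<^esub> s)" for Y and c :: "'c \<Rightarrow> 'a"
  have lc_cl: "(\<lambda>s. c s \<odot>\<^bsub>M\<^esub> s) \<in> Y \<rightarrow> carrier M" if "Y \<subseteq> S" "\<And>s. c s \<in> carrier A" for Y c
    using that S by auto
  have lc_mono: "lc Z c = lc Y c"
    if "Y \<subseteq> Z" "finite Z" "Z \<subseteq> S" "\<And>s. c s \<in> carrier A" "\<And>s. s \<notin> Y \<Longrightarrow> c s = \<zero>" for Y Z c
    unfolding lc_def using that S by (intro M.M.add.finprod_mono_neutral_cong_right) auto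
  \<comment> \<open>The family \<open>c\<close> holds the coordinates of \<open>f x\<close>,
    extended by zero to all indices, so that uniqueness of coordinates becomes equality of
    functions.\<close>
  define rep where "rep x c \<longleftrightarrow> (\<forall>s. c s \<in> carrier A) \<and>
    (\<exists>Y. finite Y \<and> Y \<subseteq> S \<and> (\<forall>s. s \<notin> Y \<longrightarrow> c s = \<zero>) \<and> f \<odot>\<^bsub>M\<^esub> x = lc Y c)" for x c
  have rep_cl: "c s \<in> carrier A" if "rep x c" for x c s
    using that unfolding rep_def by blast
  have rep_ex: "\<exists>c. rep x c" if x: "x \<in> carrier M" for x
  proof -
    obtain Y where Y: "finite Y" "Y \<subseteq> S" "f \<odot>\<^bsub>M\<^esub> x \<in> submodule_gen A M Y"
      using M.submodule_gen_finite_subset[OF S span[OF x]] by blast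
    have YM: "Y \<subseteq> carrier M"
      using Y(2) S by blast
    obtain c where c: "c \<in> Y \<rightarrow> carrier A" "f \<odot>\<^bsub>M\<^esub> x = (\<Oplus>\<^bsub>M\<^esub>s\<in>Y. c s \<odot>\<^bsub>M\<^esub> s)"
      using M.submodule_gen_lincomb[OF Y(1) YM Y(3)] by blast
    let ?c = "\<lambda>s. if s \<in> Y then c s else \<zero>"
    have cl: "?c s \<in> carrier A" for s
      using c(1) by auto
    have "(\<Oplus>\<^bsub>M\<^esub>s\<in>Y. c s \<odot>\<^bsub>M\<^esub> s) = lc Y ?c"
      unfolding lc_def using c(1) YM by (intro M.M.finsum_cong') (auto simp: Pi_iff subset_iff)
    then have "rep x ?c"
      unfolding rep_def c(2) using cl Y(1,2) by (intro conjI allI exI[of _ Y]) auto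
    then show ?thesis
      by blast
  qed
  have rep_add: "rep (x \<oplus>\<^bsub>M\<^esub> y) (\<lambda>s. c s \<oplus> d s)"
    if xy: "x \<in> carrier M" "y \<in> carrier M" and c: "rep x c" and d: "rep y d" for x y c d
  proof -
    obtain Y Z where Y: "finite Y" "Y \<subseteq> S" "\<And>s. s \<notin> Y \<Longrightarrow> c s = \<zero>" "f \<odot>\<^bsub>M\<^esub> x = lc Y c"
      and Z: "finite Z" "Z \<subseteq> S" "\<And>s. s \<notin> Z \<Longrightarrow> d s = \<zero>" "f \<odot>\<^bsub>M\<^esub> y = lc Z d"
      using c d unfolding rep_def by blast
    note cd = rep_cl[OF c] rep_cl[OF d]
    have YZ: "finite (Y \<union> Z)" "Y \<union> Z \<subseteq> S"
      using Y Z by auto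
    have "lc (Y \<union> Z) (\<lambda>s. c s \<oplus> d s) = (\<Oplus>\<^bsub>M\<^esub>s\<in>Y \<union> Z. c s \<odot>\<^bsub>M\<^esub> s \<oplus>\<^bsub>M\<^esub> d s \<odot>\<^bsub>M\<^esub> s)"
      unfolding lc_def using cd YZ(2) S by (intro M.M.finsum_cong') (auto simp: M.smult_l_distr subset_iff)
    also have "\<dots> = lc (Y \<union> Z) c \<oplus>\<^bsub>M\<^esub> lc (Y \<union> Z) d"
      unfolding lc_def by (intro M.M.finsum_addf lc_cl YZ(2) cd)
    also have "lc (Y \<union> Z) c = lc Y c"
      by (intro lc_mono YZ cd Y(3)) auto
    also have "lc (Y \<union> Z) d = lc Z d"
      by (intro lc_mono YZ cd Z(3)) auto
    finally have "f \<odot>\<^bsub>M\<^esub> (x \<oplus>\<^bsub>M\<^esub> y) = lc (Y \<union> Z) (\<lambda>s. c s \<oplus> d s)"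
      using f(1) xy Y(4) Z(4) by (simp add: M.smult_r_distr)
    then show ?thesis
      unfolding rep_def using cd YZ Y(3) Z(3) by (intro conjI allI exI[of _ "Y \<union> Z"]) auto
  qed
  have rep_smult: "rep (a \<odot>\<^bsub>M\<^esub> x) (\<lambda>s. a \<otimes> c s)"
    if a: "a \<in> carrier A" and x: "x \<in> carrier M" and c: "rep x c" for a x c
  proof -
    obtain Y where Y: "finite Y" "Y \<subseteq> S" "\<And>s. s \<notin> Y \<Longrightarrow> c s = \<zero>" "f \<odot>\<^bsub>M\<^esub> x = lc Y c"
      using c unfolding rep_def by blast
    note cA = rep_cl[OF c]
    have "lc Y (\<lambda>s. a \<otimes> c s) = (\<Oplus>\<^bsub>M\<^esub>s\<in>Y. a \<odot>\<^bsub>M\<^esub> (c s \<odot>\<^bsub>M\<^esub> s))"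
      unfolding lc_def using a cA Y(2) S
      by (intro M.M.finsum_cong') (auto simp: M.smult_assoc1 subset_iff)
    also have "\<dots> = a \<odot>\<^bsub>M\<^esub> lc Y c"
      unfolding lc_def by (intro M.smult_finsum[symmetric] lc_cl Y a cA)
    also have "\<dots> = a \<odot>\<^bsub>M\<^esub> (f \<odot>\<^bsub>M\<^esub> x)"
      by (simp add: Y(4))
    also have "\<dots> = f \<odot>\<^bsub>M\<^esub> (a \<odot>\<^bsub>M\<^esub> x)"
      using a f(1) x by (simp flip: M.smult_assoc1 add: A.m_comm)
    finally show ?thesis
      unfolding rep_def using a cA Y(1-3) by (intro conjI allI exI[of _ Y]) auto
  qed
  have rep_zero: "c s = \<zero>" if "rep \<zero>\<^bsub>M\<^esub> c" for c s
  proof -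
    have "\<exists>Y. finite Y \<and> Y \<subseteq> S \<and> (\<forall>s. s \<notin> Y \<longrightarrow> c s = \<zero>) \<and> f \<odot>\<^bsub>M\<^esub> \<zero>\<^bsub>M\<^esub> = lc Y c"
      using that unfolding rep_def by (rule conjunct2)
    then obtain Y where Y: "finite Y" "Y \<subseteq> S" "\<forall>s. s \<notin> Y \<longrightarrow> c s = \<zero>" "f \<odot>\<^bsub>M\<^esub> \<zero>\<^bsub>M\<^esub> = lc Y c"
      by (elim exE conjE)
    have "c \<in> Y \<rightarrow> carrier A"
      by (rule Pi_I) (rule rep_cl[OF that])
    moreover have "lc Y c = \<zero>\<^bsub>M\<^esub>"
      using M.smult_r_null[OF f(1)] by (rule trans[OF Y(4)[symmetric]])
    ultimately have "\<forall>s\<in>Y. c s = \<zero>"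
      unfolding lc_def by (rule ind[OF Y(1,2)])
    then show ?thesis
      using Y(3) by (cases "s \<in> Y") simp_all
  qed
  have rep_unique: "c = d" if x: "x \<in> carrier M" and cd: "rep x c" "rep x d" for x c d
  proof
    fix s
    have cl: "c s \<in> carrier A" "d s \<in> carrier A"
      by (rule rep_cl[OF cd(1)], rule rep_cl[OF cd(2)])
    \<comment> \<open>The difference of the two coordinate families represents
      \<open>\<zero>\<close>, where independence applies.\<close>
    have "rep (x \<oplus>\<^bsub>M\<^esub> (\<ominus> \<one>) \<odot>\<^bsub>M\<^esub> x) (\<lambda>s. c s \<oplus> \<ominus> \<one> \<otimes> d s)"
      using x cd by (intro rep_add rep_smult) auto
    then have "c s \<oplus> \<ominus> \<one> \<otimes> d s = \<zero>"
      using rep_zero[of "\<lambda>s. c s \<oplus> \<ominus> \<one> \<otimes> d s" s] x by (simp add: M.smult_l_minus M.M.r_neg)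
    then have "c s \<ominus> d s = \<zero>"
      using cl by (simp add: A.l_minus A.minus_eq)
    then show "c s = d s"
      using cl by simp
  qed
  define crd where "crd x = (THE c. rep x c)" for x
  have crd: "crd x = c" if "x \<in> carrier M" "rep x c" for x c
    unfolding crd_def using that rep_unique by blast
  have rep_crd: "rep x (crd x)" if "x \<in> carrier M" for x
    using rep_ex[OF that] crd[OF that] by blast
  have crd_cl: "crd x s \<in> carrier A" if "x \<in> carrier M" for x s
    using rep_crd[OF that] by (simp add: rep_def)
  have crd_add: "crd (x \<oplus>\<^bsub>M\<^esub> y) = (\<lambda>s. crd x s \<oplus> crd y s)" if "x \<in> carrier M" "y \<in> carrier M" for x y
    using that by (intro crd rep_add rep_crd) auto
  have crd_smult: "crd (a \<odot>\<^bsub>M\<^esub> x) = (\<lambda>s. a \<otimes> crd x s)" if "a \<in> carrier A" "x \<in> carrier M" for a x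
    using that by (intro crd rep_smult rep_crd) auto
  have crd_S: "crd t = (\<lambda>s. if s = t then f else \<zero>)" if t: "t \<in> S" for t
  proof (rule crd)
    show "rep t (\<lambda>s. if s = t then f else \<zero>)"
      unfolding rep_def lc_def using t f(1) S by (intro conjI allI exI[of _ "{t}"]) auto
  qed (use t S in auto)
  define g where "g s x = fraction A P (crd x s) f" for s x
  have "\<exists>h \<in> carrier (base_change A \<phi> ?C M) \<rightarrow> carrier ?C.
      (\<forall>T\<in>carrier (base_change A \<phi> ?C M). \<forall>Y\<in>carrier (base_change A \<phi> ?C M).
        h (T \<oplus>\<^bsub>base_change A \<phi> ?C M\<^esub> Y) = h T \<oplus>\<^bsub>?C\<^esub> h Y) \<and>
      (\<forall>c\<in>carrier ?C. \<forall>x\<in>carrier M. h (E.tensor c x) = c \<otimes>\<^bsub>?C\<^esub> g s x)" for s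
  proof (rule E.tensor_universal)
    show "g s \<in> carrier M \<rightarrow> carrier ?C"
      using crd_cl fP by (auto simp: g_def)
    fix x y assume xy: "x \<in> carrier M" "y \<in> carrier M"
    then have "g s x \<oplus>\<^bsub>?C\<^esub> g s y = fraction A P (crd x s \<otimes> f \<oplus> crd y s \<otimes> f) (f \<otimes> f)"
      unfolding g_def by (intro L.fraction_add crd_cl fP)
    also have "\<dots> = g s (x \<oplus>\<^bsub>M\<^esub> y)"
      unfolding g_def crd_add[OF xy] using crd_cl xy fP L.S_mult
      by (subst L.fraction_eq_iff) (auto simp: A.m_ac A.l_distr A.r_distr)
    finally show "g s (x \<oplus>\<^bsub>M\<^esub> y) = g s x \<oplus>\<^bsub>?C\<^esub> g s y"
      by simp
  next
    fix a x assume ax: "a \<in> carrier A" "x \<in> carrier M"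
    then have "\<phi> a \<otimes>\<^bsub>?C\<^esub> g s x = fraction A P (a \<otimes> crd x s) (\<one> \<otimes> f)"
      unfolding g_def \<phi>_def by (intro L.fraction_mult crd_cl fP L.S_one)
    then show "g s (a \<odot>\<^bsub>M\<^esub> x) = \<phi> a \<otimes>\<^bsub>?C\<^esub> g s x"
      using f(1) by (simp add: g_def crd_smult[OF ax])
  qed
  then obtain h where h: "\<And>s. h s \<in> carrier (base_change A \<phi> ?C M) \<rightarrow> carrier ?C"
    and h_add: "\<And>s T Y. \<lbrakk>T \<in> carrier (base_change A \<phi> ?C M); Y \<in> carrier (base_change A \<phi> ?C M)\<rbrakk>
      \<Longrightarrow> h s (T \<oplus>\<^bsub>base_change A \<phi> ?C M\<^esub> Y) = h s T \<oplus>\<^bsub>?C\<^esub> h s Y"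
    and h_tensor: "\<And>s c x. \<lbrakk>c \<in> carrier ?C; x \<in> carrier M\<rbrakk> \<Longrightarrow> h s (E.tensor c x) = c \<otimes>\<^bsub>?C\<^esub> g s x"
    by metis
  have h_basis: "h s (E.tensor c t) = (if s = t then c else \<zero>\<^bsub>?C\<^esub>)" if "c \<in> carrier ?C" "t \<in> S" for s t c
  proof -
    have "g s t = (if s = t then \<one>\<^bsub>?C\<^esub> else \<zero>\<^bsub>?C\<^esub>)"
      using fP by (simp add: g_def crd_S[OF that(2)] L.fraction_self L.fraction_zero)
    moreover have "t \<in> carrier M"
      using that(2) S by blast
    ultimately show ?thesis
      using that(1) by (simp add: h_tensor)
  qed
  have one_zero: "\<one>\<^bsub>?C\<^esub> \<noteq> \<zero>\<^bsub>?C\<^esub>"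
    using L.S_one by (simp add: L.localization_one L.localization_zero L.fraction_eq_iff)
  let ?b = "E.tensor \<one>\<^bsub>?C\<^esub>"
  have inj: "inj_on ?b S"
  proof (rule inj_onI, rule ccontr)
    fix s t assume "s \<in> S" "t \<in> S" "?b s = ?b t" "s \<noteq> t"
    then show False
      using h_basis[of "\<one>\<^bsub>?C\<^esub>" s s] h_basis[of "\<one>\<^bsub>?C\<^esub>" t s] one_zero by simp
  qed
  have smult_b: "c \<odot>\<^bsub>base_change A \<phi> ?C M\<^esub> ?b t = E.tensor c t" if "c \<in> carrier ?C" for c t
    using that by (simp add: E.smult_tensor)
  have bS: "?b ` S \<subseteq> carrier (base_change A \<phi> ?C M)"
    using S by auto
  have sub: "submodule (submodule_gen ?C (base_change A \<phi> ?C M) (?b ` S)) ?C (base_change A \<phi> ?C M)"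
    by (rule V.submodule_submodule_gen[OF bS])
  have "is_basis ?C (base_change A \<phi> ?C M) (?b ` S)"
  proof (rule V.is_basisI[OF bS, where h = "\<lambda>b. h (inv_into S ?b b)"])
    show "carrier (base_change A \<phi> ?C M) \<subseteq> submodule_gen ?C (base_change A \<phi> ?C M) (?b ` S)"
    proof (rule E.V_generated[OF sub])
      fix c x assume c: "c \<in> carrier ?C" and x: "x \<in> carrier M"
      \<comment> \<open>In the localization, the tensor of \<open>c\<close> with \<open>x\<close> is
        the tensor of \<open>c / f\<close> with \<open>f x\<close>, and \<open>f x\<close> is in the
        span of \<open>S\<close>.\<close>
      define c' where "c' = c \<otimes>\<^bsub>?C\<^esub> fraction A P \<one> f"
      have c': "c' \<in> carrier ?C"
        using c fP by (simp add: c'_def)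
      have "fraction A P \<one> f \<otimes>\<^bsub>?C\<^esub> \<phi> f = fraction A P (\<one> \<otimes> f) (f \<otimes> \<one>)"
        unfolding \<phi>_def using f fP L.S_one by (intro L.fraction_mult) auto
      also have "\<dots> = \<one>\<^bsub>?C\<^esub>"
        using f fP by (simp add: L.fraction_self)
      finally have "c' \<otimes>\<^bsub>?C\<^esub> \<phi> f = c"
        unfolding c'_def using c fP f E.\<phi>_closed by (simp add: C.m_assoc)
      then have eq: "E.tensor c x = E.tensor c' (f \<odot>\<^bsub>M\<^esub> x)"
        using E.tensor_balanced[OF c' f(1) x] by simp
      obtain Y where Y: "finite Y" "Y \<subseteq> S" "f \<odot>\<^bsub>M\<^esub> x = lc Y (crd x)"
        using rep_crd[OF x] unfolding rep_def by blast
      have "E.tensor c x = (\<Oplus>\<^bsub>base_change A \<phi> ?C M\<^esub>s\<in>Y. E.tensor c' (crd x s \<odot>\<^bsub>M\<^esub> s))"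
        unfolding eq Y(3) lc_def by (intro E.tensor_finsum c' Y(1) lc_cl Y(2) crd_cl x)
      moreover have "E.tensor c' (crd x s \<odot>\<^bsub>M\<^esub> s) \<in> submodule_gen ?C (base_change A \<phi> ?C M) (?b ` S)"
        if "s \<in> Y" for s
      proof -
        have s: "s \<in> S" "s \<in> carrier M"
          using that Y(2) S by auto
        have d: "c' \<otimes>\<^bsub>?C\<^esub> \<phi> (crd x s) \<in> carrier ?C"
          using c' E.\<phi>_closed[OF crd_cl[OF x]] by simp
        have "E.tensor c' (crd x s \<odot>\<^bsub>M\<^esub> s) = E.tensor (c' \<otimes>\<^bsub>?C\<^esub> \<phi> (crd x s)) s"
          using E.tensor_balanced[OF c' crd_cl[OF x] s(2)] by simp
        also have "\<dots> = (c' \<otimes>\<^bsub>?C\<^esub> \<phi> (crd x s)) \<odot>\<^bsub>base_change A \<phi> ?C M\<^esub> ?b s"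
          using smult_b[OF d] by simp
        also have "\<dots> \<in> submodule_gen ?C (base_change A \<phi> ?C M) (?b ` S)"
          using V.subset_submodule_gen[of "?b ` S"] s(1) by (intro V.submodule_smult[OF sub d]) auto
        finally show ?thesis .
      qed
      ultimately show "E.tensor c x \<in> submodule_gen ?C (base_change A \<phi> ?C M) (?b ` S)"
        by (simp only: V.submodule_finsum[OF sub])
    qed
  next
    fix b t' a assume b: "b \<in> ?b ` S" "t' \<in> ?b ` S" and a: "a \<in> carrier ?C"
    then obtain s t where st: "s \<in> S" "t \<in> S" "b = ?b s" "t' = ?b t"
      by blast
    then have "h (inv_into S ?b b) (a \<odot>\<^bsub>base_change A \<phi> ?C M\<^esub> t') = (if s = t then a else \<zero>\<^bsub>?C\<^esub>)"
      using inj a by (simp add: smult_b h_basis)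
    also have "\<dots> = (if b = t' then a else \<zero>\<^bsub>?C\<^esub>)"
      using st inj by (auto dest: inj_onD)
    finally show "h (inv_into S ?b b) (a \<odot>\<^bsub>base_change A \<phi> ?C M\<^esub> t') = (if b = t' then a else \<zero>\<^bsub>?C\<^esub>)" .
  qed (use h h_add in auto)
  then have free: "free_module ?C (base_change A \<phi> ?C M)"
    using E.module_V unfolding free_module_def by blast
  have \<phi>_eq: "\<phi> = (\<lambda>a. fraction A P a \<one>)"
    by (rule ext) (rule \<phi>_def)
  show ?thesis
    unfolding generically_free_def Let_def
  proof (intro bexI[of _ f] conjI allI)
    show "free_module (localization A (powers A f))
        (base_change A (\<lambda>a. fraction A (powers A f) a \<one>) (localization A (powers A f)) M)"
      using free unfolding \<phi>_eq P_def .
  qed (use f A.nat_pow_nonzero[OF f] in simp_all)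
qed

section \<open>Central scalars\<close>

text \<open>One locale covers \<open>K\<close> in \<open>B\<close>, \<open>K\<close> in
  \<open>G\<close> and \<open>K[X]\<close> in \<open>G[X]\<close>: scalars act as central elements,
  and their action is ring multiplication.\<close>

locale central_scalars = K: cring K + E: ring E
  for K :: "('k, 'r) ring_scheme" and E :: "('e, 'x) ring_scheme" and \<kappa> :: "'k \<Rightarrow> 'e" +
  assumes \<kappa>_hom: "\<kappa> \<in> ring_hom K E"
    and \<kappa>_central: "\<lbrakk>a \<in> carrier K; x \<in> carrier E\<rbrakk> \<Longrightarrow> \<kappa> a \<otimes>\<^bsub>E\<^esub> x = x \<otimes>\<^bsub>E\<^esub> \<kappa> a"
begin

lemma \<kappa>_closed [simp]: "a \<in> carrier K \<Longrightarrow> \<kappa> a \<in> carrier E"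
  by (rule ring_hom_closed[OF \<kappa>_hom])

lemma \<kappa>_zero: "\<kappa> \<zero>\<^bsub>K\<^esub> = \<zero>\<^bsub>E\<^esub>"
  by (rule ring_hom_zero[OF \<kappa>_hom K.ring_axioms E.ring_axioms])

lemma \<kappa>_finsum:
  assumes "finite Y" "f \<in> Y \<rightarrow> carrier K"
  shows "\<kappa> (\<Oplus>\<^bsub>K\<^esub>y\<in>Y. f y) = (\<Oplus>\<^bsub>E\<^esub>y\<in>Y. \<kappa> (f y))"
  using assms
proof (induction Y)
  case (insert y Y)
  then have "f y \<in> carrier K" "f \<in> Y \<rightarrow> carrier K" "(\<lambda>y. \<kappa> (f y)) \<in> Y \<rightarrow> carrier E"
    by (auto simp: Pi_iff)
  then show ?case
    using insert by (simp add: ring_hom_add[OF \<kappa>_hom])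
qed (simp add: \<kappa>_zero)

definition \<iota> :: "(nat \<Rightarrow> 'k) \<Rightarrow> nat \<Rightarrow> 'e"
  where "\<iota> p = (\<lambda>i. \<kappa> (p i))"

lemma \<iota>_closed [simp]:
  assumes "p \<in> carrier (UP K)"
  shows "\<iota> p \<in> carrier (UP E)"
proof -
  obtain n where "\<forall>i\<ge>n. p i = \<zero>\<^bsub>K\<^esub>"
    using assms by (auto simp: UP_mem_iff)
  then have "\<forall>i\<ge>n. \<iota> p i = \<zero>\<^bsub>E\<^esub>"
    by (simp add: \<iota>_def \<kappa>_zero)
  moreover have "\<forall>i. \<iota> p i \<in> carrier E"
    using assms by (simp add: \<iota>_def)
  ultimately show ?thesis
    unfolding UP_mem_iff by blast
qed

lemma \<iota>_hom: "\<iota> \<in> ring_hom (UP K) (UP E)"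
proof (rule ring_hom_memI)
  interpret KP: ring "UP K"
    by (rule K.ring_UP)
  interpret EP: ring "UP E"
    by (rule E.ring_UP)
  fix p q assume p: "p \<in> carrier (UP K)" and q: "q \<in> carrier (UP K)"
  show "\<iota> p \<in> carrier (UP E)"
    using p by simp
  show "\<iota> (p \<otimes>\<^bsub>UP K\<^esub> q) = \<iota> p \<otimes>\<^bsub>UP E\<^esub> \<iota> q"
  proof
    fix n
    have "\<iota> (p \<otimes>\<^bsub>UP K\<^esub> q) n = \<kappa> (\<Oplus>\<^bsub>K\<^esub>i\<in>{..n}. p i \<otimes>\<^bsub>K\<^esub> q (n - i))"
      unfolding \<iota>_def UP_mult_apply[OF p q] ..
    also have "\<dots> = (\<Oplus>\<^bsub>E\<^esub>i\<in>{..n}. \<kappa> (p i \<otimes>\<^bsub>K\<^esub> q (n - i)))"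
      using p q by (intro \<kappa>_finsum) auto
    also have "\<dots> = (\<Oplus>\<^bsub>E\<^esub>i\<in>{..n}. \<iota> p i \<otimes>\<^bsub>E\<^esub> \<iota> q (n - i))"
      using p q by (intro E.finsum_cong') (auto simp: \<iota>_def ring_hom_mult[OF \<kappa>_hom])
    also have "\<dots> = (\<iota> p \<otimes>\<^bsub>UP E\<^esub> \<iota> q) n"
      using p q by (intro UP_mult_apply[symmetric]) auto
    finally show "\<iota> (p \<otimes>\<^bsub>UP K\<^esub> q) n = (\<iota> p \<otimes>\<^bsub>UP E\<^esub> \<iota> q) n" .
  qed
  show "\<iota> (p \<oplus>\<^bsub>UP K\<^esub> q) = \<iota> p \<oplus>\<^bsub>UP E\<^esub> \<iota> q"
  proof
    fix n
    have "\<iota> (p \<oplus>\<^bsub>UP K\<^esub> q) n = \<kappa> (p n \<oplus>\<^bsub>K\<^esub> q n)"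
      unfolding \<iota>_def UP_add_apply[OF p q] ..
    also have "\<dots> = \<iota> p n \<oplus>\<^bsub>E\<^esub> \<iota> q n"
      using p q by (simp add: \<iota>_def ring_hom_add[OF \<kappa>_hom])
    also have "\<dots> = (\<iota> p \<oplus>\<^bsub>UP E\<^esub> \<iota> q) n"
      using p q by (intro UP_add_apply[symmetric]) auto
    finally show "\<iota> (p \<oplus>\<^bsub>UP K\<^esub> q) n = (\<iota> p \<oplus>\<^bsub>UP E\<^esub> \<iota> q) n" .
  qed
next
  show "\<iota> \<one>\<^bsub>UP K\<^esub> = \<one>\<^bsub>UP E\<^esub>"
    by (rule ext) (simp add: \<iota>_def UP_one_apply \<kappa>_zero ring_hom_one[OF \<kappa>_hom])
qed

lemma \<iota>_central:
  assumes p: "p \<in> carrier (UP K)" and u: "u \<in> carrier (UP E)"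
  shows "\<iota> p \<otimes>\<^bsub>UP E\<^esub> u = u \<otimes>\<^bsub>UP E\<^esub> \<iota> p"
proof
  fix n
  have "(\<iota> p \<otimes>\<^bsub>UP E\<^esub> u) n = (\<Oplus>\<^bsub>E\<^esub>i\<in>{..n}. u (n - i) \<otimes>\<^bsub>E\<^esub> \<iota> p i)"
    unfolding UP_mult_apply[OF \<iota>_closed[OF p] u] using p u
    by (intro E.finsum_cong') (auto simp: \<iota>_def \<kappa>_central)
  also have "\<dots> = (\<Oplus>\<^bsub>E\<^esub>i\<in>{..n}. u i \<otimes>\<^bsub>E\<^esub> \<iota> p (n - i))"
  proof -
    have "(\<Oplus>\<^bsub>E\<^esub>i\<in>(\<lambda>i. n - i) ` {..n}. u i \<otimes>\<^bsub>E\<^esub> \<iota> p (n - i))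
        = (\<Oplus>\<^bsub>E\<^esub>i\<in>{..n}. u (n - i) \<otimes>\<^bsub>E\<^esub> \<iota> p (n - (n - i)))"
      using p u by (intro E.finsum_reindex) (auto simp: inj_on_def)
    moreover have "(\<lambda>i. n - i) ` {..n} = {..n}"
      by (auto simp: image_iff) (metis atMost_iff diff_diff_cancel diff_le_self)
    moreover have "(\<Oplus>\<^bsub>E\<^esub>i\<in>{..n}. u (n - i) \<otimes>\<^bsub>E\<^esub> \<iota> p (n - (n - i)))
        = (\<Oplus>\<^bsub>E\<^esub>i\<in>{..n}. u (n - i) \<otimes>\<^bsub>E\<^esub> \<iota> p i)"
      using p u by (intro E.finsum_cong') auto
    ultimately show ?thesis
      by simp
  qed
  also have "\<dots> = (u \<otimes>\<^bsub>UP E\<^esub> \<iota> p) n"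
    using p u by (intro UP_mult_apply[symmetric]) auto
  finally show "(\<iota> p \<otimes>\<^bsub>UP E\<^esub> u) n = (u \<otimes>\<^bsub>UP E\<^esub> \<iota> p) n" .
qed

text \<open>Makes the locale applicable to polynomial rings; this is how
  \<open>torsion_bound\<close> reaches scalars from \<open>K[X]\<close>.\<close>

lemma central_scalars_UP: "central_scalars (UP K) (UP E) \<iota>"
proof -
  have "UP_cring K"
    by unfold_locales
  then have "cring (UP K)"
    by (rule UP_cring.UP_cring)
  then show ?thesis
    using \<iota>_hom \<iota>_central by (simp add: central_scalars_def central_scalars_axioms_def E.ring_UP)
qed

text \<open>A left ideal that is maximal among the ideals \<open>{x. \<kappa> a x \<in> J}\<close> with \<open>a \<noteq> 0\<close> contains
  all of them.\<close>

lemma torsion_bound: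
  assumes "domain K" and acc: "left_acc E" and J: "left_ideal J E"
  shows "\<exists>f\<in>carrier K. f \<noteq> \<zero>\<^bsub>K\<^esub> \<and>
    (\<forall>a\<in>carrier K. \<forall>x\<in>carrier E. a \<noteq> \<zero>\<^bsub>K\<^esub> \<and> \<kappa> a \<otimes>\<^bsub>E\<^esub> x \<in> J \<longrightarrow> \<kappa> f \<otimes>\<^bsub>E\<^esub> x \<in> J)"
proof -
  interpret K: domain K
    by (rule assms(1))
  define I where "I a = {x \<in> carrier E. \<kappa> a \<otimes>\<^bsub>E\<^esub> x \<in> J}" for a
  have I: "left_ideal (I a) E" if a: "a \<in> carrier K" for a
  proof (rule E.left_idealI)
    show "I a \<subseteq> carrier E"
      by (auto simp: I_def)
    show "\<zero>\<^bsub>E\<^esub> \<in> I a"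
      using a E.left_ideal_zero[OF J] by (simp add: I_def)
    show "x \<oplus>\<^bsub>E\<^esub> y \<in> I a" if "x \<in> I a" "y \<in> I a" for x y
      using that a E.left_ideal_add[OF J] by (simp add: I_def E.r_distr)
    show "b \<otimes>\<^bsub>E\<^esub> x \<in> I a" if "b \<in> carrier E" "x \<in> I a" for b x
    proof -
      have "\<kappa> a \<otimes>\<^bsub>E\<^esub> (b \<otimes>\<^bsub>E\<^esub> x) = b \<otimes>\<^bsub>E\<^esub> (\<kappa> a \<otimes>\<^bsub>E\<^esub> x)"
        using that a \<kappa>_central[OF a that(1)] by (simp add: I_def flip: E.m_assoc)
      then show ?thesis
        using that E.left_ideal_mult[OF J] by (simp add: I_def)
    qed
  qed
  let ?F = "I ` (carrier K - {\<zero>\<^bsub>K\<^esub>})"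
  have "\<exists>M\<in>?F. \<forall>L\<in>?F. M \<subseteq> L \<longrightarrow> L = M"
    by (rule left_acc_maximal[OF acc, of "I \<one>\<^bsub>K\<^esub>"]) (use I in auto)
  then obtain f where f: "f \<in> carrier K" "f \<noteq> \<zero>\<^bsub>K\<^esub>" and max: "\<forall>L\<in>?F. I f \<subseteq> L \<longrightarrow> L = I f"
    by blast
  have "\<kappa> f \<otimes>\<^bsub>E\<^esub> x \<in> J"
    if a: "a \<in> carrier K" "a \<noteq> \<zero>\<^bsub>K\<^esub>" and x: "x \<in> carrier E" "\<kappa> a \<otimes>\<^bsub>E\<^esub> x \<in> J" for a x
  proof -
    \<comment> \<open>The left ideal attached to \<open>f a\<close> contains those attached to
      \<open>f\<close> and to \<open>a\<close>; by maximality it equals the one of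
      \<open>f\<close>.\<close>
    have "f \<otimes>\<^bsub>K\<^esub> a \<noteq> \<zero>\<^bsub>K\<^esub>"
      using K.integral[OF _ f(1) a(1)] f(2) a(2) by blast
    then have "I (f \<otimes>\<^bsub>K\<^esub> a) \<in> ?F"
      using f(1) a(1) by auto
    moreover have "I f \<subseteq> I (f \<otimes>\<^bsub>K\<^esub> a)"
    proof
      fix y assume y: "y \<in> I f"
      then have "\<kappa> (f \<otimes>\<^bsub>K\<^esub> a) \<otimes>\<^bsub>E\<^esub> y = \<kappa> a \<otimes>\<^bsub>E\<^esub> (\<kappa> f \<otimes>\<^bsub>E\<^esub> y)"
        using f(1) a(1) \<kappa>_central[of f "\<kappa> a"]
        by (simp add: I_def ring_hom_mult[OF \<kappa>_hom] flip: E.m_assoc)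
      then show "y \<in> I (f \<otimes>\<^bsub>K\<^esub> a)"
        using y a(1) E.left_ideal_mult[OF J] by (simp add: I_def)
    qed
    ultimately have eq: "I (f \<otimes>\<^bsub>K\<^esub> a) = I f"
      using max by blast
    have "\<kappa> (f \<otimes>\<^bsub>K\<^esub> a) \<otimes>\<^bsub>E\<^esub> x = \<kappa> f \<otimes>\<^bsub>E\<^esub> (\<kappa> a \<otimes>\<^bsub>E\<^esub> x)"
      using f(1) a(1) x(1) by (simp add: ring_hom_mult[OF \<kappa>_hom] E.m_assoc)
    then have "x \<in> I (f \<otimes>\<^bsub>K\<^esub> a)"
      using x f(1) E.left_ideal_mult[OF J] by (simp add: I_def)
    then show ?thesis
      unfolding eq by (simp add: I_def)
  qed
  then show ?thesis
    using f by blast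
qed

text \<open>If \<open>S\<close> spans the coefficients over \<open>K\<close>, its constants span the
  polynomials over \<open>K[X]\<close>: for each \<open>s\<close>, collect the coordinates at
  \<open>s\<close> along the powers of \<open>X\<close>.\<close>

lemma polynomial_span:
  assumes S: "finite S" "S \<subseteq> carrier E" and V: "\<And>v. v \<in> V \<Longrightarrow> \<exists>c\<in>S \<rightarrow> carrier K. v = (\<Oplus>\<^bsub>E\<^esub>s\<in>S. \<kappa> (c s) \<otimes>\<^bsub>E\<^esub> s)"
    and u: "u \<in> carrier (UP E)" "\<And>i. u i \<in> V"
  shows "\<exists>p\<in>S \<rightarrow> carrier (UP K). u = (\<Oplus>\<^bsub>UP E\<^esub>s\<in>S. \<iota> (p s) \<otimes>\<^bsub>UP E\<^esub> up_ring.monom (UP E) s 0)"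
proof -
  obtain n where n: "\<forall>i\<ge>n. u i = \<zero>\<^bsub>E\<^esub>"
    using u(1) by (auto simp: UP_mem_iff)
  obtain c where c: "\<And>i. c i \<in> S \<rightarrow> carrier K" "\<And>i. u i = (\<Oplus>\<^bsub>E\<^esub>s\<in>S. \<kappa> (c i s) \<otimes>\<^bsub>E\<^esub> s)"
    using V[OF u(2)] by metis
  \<comment> \<open>Where \<open>u i\<close> vanishes, the chosen coordinates may still be non-zero,
    since \<open>S\<close> can be dependent. They are cut off at \<open>n\<close> to make
    \<open>p s\<close> a polynomial.\<close>
  define p where "p s i = (if i < n then c i s else \<zero>\<^bsub>K\<^esub>)" for s i
  have p: "p s \<in> carrier (UP K)" if "s \<in> S" for s
  proof -
    have "\<forall>i. p s i \<in> carrier K"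
      using c(1) that by (auto simp: p_def)
    moreover have "\<forall>i\<ge>n. p s i = \<zero>\<^bsub>K\<^esub>"
      by (simp add: p_def)
    ultimately show ?thesis
      unfolding UP_mem_iff by blast
  qed
  have cl: "(\<lambda>s. \<iota> (p s) \<otimes>\<^bsub>UP E\<^esub> up_ring.monom (UP E) s 0) \<in> S \<rightarrow> carrier (UP E)"
  proof
    interpret EP: ring "UP E"
      by (rule E.ring_UP)
    fix s assume "s \<in> S"
    then show "\<iota> (p s) \<otimes>\<^bsub>UP E\<^esub> up_ring.monom (UP E) s 0 \<in> carrier (UP E)"
      using p S by (intro EP.m_closed \<iota>_closed E.UP_monom_closed) auto
  qed
  have "u = (\<Oplus>\<^bsub>UP E\<^esub>s\<in>S. \<iota> (p s) \<otimes>\<^bsub>UP E\<^esub> up_ring.monom (UP E) s 0)"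
  proof
    fix i
    have "(\<Oplus>\<^bsub>UP E\<^esub>s\<in>S. \<iota> (p s) \<otimes>\<^bsub>UP E\<^esub> up_ring.monom (UP E) s 0) i
        = (\<Oplus>\<^bsub>E\<^esub>s\<in>S. (\<iota> (p s) \<otimes>\<^bsub>UP E\<^esub> up_ring.monom (UP E) s 0) i)"
      by (rule E.UP_finsum_apply[OF S(1) cl])
    also have "\<dots> = (\<Oplus>\<^bsub>E\<^esub>s\<in>S. \<kappa> (p s i) \<otimes>\<^bsub>E\<^esub> s)"
    proof (intro E.finsum_cong' refl)
      show "(\<lambda>s. \<kappa> (p s i) \<otimes>\<^bsub>E\<^esub> s) \<in> S \<rightarrow> carrier E"
        using p S by auto
      fix s assume "s \<in> S"
      then show "(\<iota> (p s) \<otimes>\<^bsub>UP E\<^esub> up_ring.monom (UP E) s 0) i = \<kappa> (p s i) \<otimes>\<^bsub>E\<^esub> s"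
        using E.mult_monom_apply[OF _ \<iota>_closed[OF p], of s s 0 i] S by (auto simp: \<iota>_def)
    qed
    also have "\<dots> = u i"
    proof (cases "i < n")
      case True
      then show ?thesis
        by (simp add: p_def c(2))
    next
      case False
      then have "(\<Oplus>\<^bsub>E\<^esub>s\<in>S. \<kappa> (p s i) \<otimes>\<^bsub>E\<^esub> s) = \<zero>\<^bsub>E\<^esub>"
        using S by (intro E.add.finprod_one_eqI) (auto simp: p_def \<kappa>_zero)
      with False n show ?thesis
        by simp
    qed
    finally show "u i = (\<Oplus>\<^bsub>UP E\<^esub>s\<in>S. \<iota> (p s) \<otimes>\<^bsub>UP E\<^esub> up_ring.monom (UP E) s 0) i"
      by simp
  qed
  then show ?thesis
    using p by (intro bexI[of _ p]) auto
qed

end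

section \<open>Filtered algebras\<close>

locale filtered_algebra = K: field K + B: ring B
  for K :: "('k, 'r) ring_scheme" and B :: "('k, 'b, 'x) module_scheme" +
  fixes F :: "int \<Rightarrow> 'b set"
  assumes algebra: "unital_algebra K B"
    and filt: "filtration K B F"
begin

sublocale KB: left_module K B
  using algebra by (intro module_imp_left_module) (simp add: unital_algebra_def)

lemma F_submodule: "-1 \<le> n \<Longrightarrow> submodule (F n) K B"
  using filt by (simp add: filtration_def)

lemma F_subset: "-1 \<le> n \<Longrightarrow> F n \<subseteq> carrier B"
  by (rule KB.submodule_subset[OF F_submodule])

lemma F_carrier: "\<lbrakk>-1 \<le> n; x \<in> F n\<rbrakk> \<Longrightarrow> x \<in> carrier B"
  using F_subset by blast

lemma F_zero: "-1 \<le> n \<Longrightarrow> \<zero>\<^bsub>B\<^esub> \<in> F n"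
  by (rule KB.submodule_zero[OF F_submodule])

lemma F_add: "\<lbrakk>-1 \<le> n; x \<in> F n; y \<in> F n\<rbrakk> \<Longrightarrow> x \<oplus>\<^bsub>B\<^esub> y \<in> F n"
  by (rule KB.submodule_add[OF F_submodule])

lemma F_minus: "\<lbrakk>-1 \<le> n; x \<in> F n; y \<in> F n\<rbrakk> \<Longrightarrow> x \<ominus>\<^bsub>B\<^esub> y \<in> F n"
  by (rule KB.submodule_minus[OF F_submodule])

lemma F_smult: "\<lbrakk>-1 \<le> n; a \<in> carrier K; x \<in> F n\<rbrakk> \<Longrightarrow> a \<odot>\<^bsub>B\<^esub> x \<in> F n"
  by (rule KB.submodule_smult[OF F_submodule])

lemma F_mono:
  assumes "-1 \<le> m" "m \<le> n"
  shows "F m \<subseteq> F n"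
  using assms(2)
proof (induction n rule: int_ge_induct)
  case (step n)
  have "\<forall>n\<ge>-1. F n \<subseteq> F (n + 1)"
    using filt by (simp add: filtration_def)
  then have "F n \<subseteq> F (n + 1)"
    using assms(1) step.hyps by simp
  then show ?case
    using step.IH by (rule order_trans[rotated])
qed simp

lemma F_bottom: "F (-1) = {\<zero>\<^bsub>B\<^esub>}"
  using filt by (simp add: filtration_def)

lemma F_mult: "\<lbrakk>0 \<le> m; 0 \<le> n; x \<in> F m; y \<in> F n\<rbrakk> \<Longrightarrow> x \<otimes>\<^bsub>B\<^esub> y \<in> F (m + n)"
  using filt by (simp add: filtration_def)

text \<open>Needed for products of cosets. For \<open>m = 0\<close> the index \<open>-1\<close> lies
  outside the multiplicativity condition of the filtration, but then \<open>x\<close> is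
  zero.\<close>

lemma F_mult_lower_left:
  assumes "x \<in> F (int m - 1)" "y \<in> F (int n)"
  shows "x \<otimes>\<^bsub>B\<^esub> y \<in> F (int (m + n) - 1)"
proof (cases "m = 0")
  case True
  then have "x = \<zero>\<^bsub>B\<^esub>"
    using assms(1) F_bottom by simp
  then show ?thesis
    using assms(2) F_carrier[of "int n" y] F_zero[of "int (m + n) - 1"] by simp
next
  case False
  then show ?thesis
    using assms F_mult[of "int m - 1" "int n" x y] by (simp add: algebra_simps)
qed

lemma F_mult_lower_right:
  assumes "x \<in> F (int m)" "y \<in> F (int n - 1)"
  shows "x \<otimes>\<^bsub>B\<^esub> y \<in> F (int (m + n) - 1)"
proof (cases "n = 0")
  case True
  then have "y = \<zero>\<^bsub>B\<^esub>"
    using assms(2) F_bottom by simp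
  then show ?thesis
    using assms(1) F_carrier[of "int m" x] F_zero[of "int (m + n) - 1"] by simp
next
  case False
  then show ?thesis
    using assms F_mult[of "int m" "int n - 1" x y] by (simp add: algebra_simps)
qed

text \<open>The filtration ascends, so the union of its members is a submodule and equals their
  sum.\<close>

lemma F_exhaust:
  assumes "b \<in> carrier B"
  shows "\<exists>n::nat. b \<in> F (int n)"
proof -
  let ?U = "\<Union>n::nat. F (int n)"
  have "submodule ?U K B"
    unfolding KB.submodule_iff
  proof (intro conjI ballI)
    show "?U \<subseteq> carrier B"
      by (rule UN_least) (simp add: F_subset)
    show "\<zero>\<^bsub>B\<^esub> \<in> ?U"
      by (rule UN_I[of 0]) (simp_all add: F_zero)
  next
    fix x y assume "x \<in> ?U" "y \<in> ?U"
    then obtain m n :: nat where mn: "x \<in> F (int m)" "y \<in> F (int n)"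
      by blast
    then have "x \<in> F (int (m + n))" "y \<in> F (int (m + n))"
      using F_mono[of "int m" "int (m + n)"] F_mono[of "int n" "int (m + n)"] by auto
    then have "x \<oplus>\<^bsub>B\<^esub> y \<in> F (int (m + n))"
      by (intro F_add) auto
    then show "x \<oplus>\<^bsub>B\<^esub> y \<in> ?U"
      by blast
  next
    fix a x assume a: "a \<in> carrier K" and "x \<in> ?U"
    then obtain m :: nat where "x \<in> F (int m)"
      by blast
    then have "a \<odot>\<^bsub>B\<^esub> x \<in> F (int m)"
      using a by (intro F_smult) auto
    then show "a \<odot>\<^bsub>B\<^esub> x \<in> ?U"
      by blast
  qed
  moreover have "(\<Union>n\<in>{0..}. F n) \<subseteq> ?U"
  proof
    fix x assume "x \<in> (\<Union>n\<in>{0..}. F n)"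
    then obtain n where "0 \<le> n" "x \<in> F n"
      by auto
    then have "x \<in> F (int (nat n))"
      by simp
    then show "x \<in> ?U"
      by blast
  qed
  ultimately have "carrier B \<subseteq> ?U"
    using KB.submodule_gen_minimal[of ?U "\<Union>n\<in>{0..}. F n"] filt by (simp add: filtration_def)
  then show ?thesis
    using assms by blast
qed

lemma F_one: "\<one>\<^bsub>B\<^esub> \<in> F 0"
proof -
  have "\<one>\<^bsub>K\<^esub> \<odot>\<^bsub>B\<^esub> \<one>\<^bsub>B\<^esub> \<in> F 0"
    using filt K.one_closed unfolding filtration_def by blast
  then show ?thesis
    by simp
qed

lemma smult_mult_left:
  "\<lbrakk>a \<in> carrier K; x \<in> carrier B; y \<in> carrier B\<rbrakk> \<Longrightarrow> (a \<odot>\<^bsub>B\<^esub> x) \<otimes>\<^bsub>B\<^esub> y = a \<odot>\<^bsub>B\<^esub> (x \<otimes>\<^bsub>B\<^esub> y)"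
  and smult_mult_right:
  "\<lbrakk>a \<in> carrier K; x \<in> carrier B; y \<in> carrier B\<rbrakk> \<Longrightarrow> x \<otimes>\<^bsub>B\<^esub> (a \<odot>\<^bsub>B\<^esub> y) = a \<odot>\<^bsub>B\<^esub> (x \<otimes>\<^bsub>B\<^esub> y)"
  using unital_algebra.smult_mult_left[OF algebra] unital_algebra.smult_mult_right[OF algebra]
  by blast+


section \<open>The associated graded algebra\<close>

definition cls :: "nat \<Rightarrow> 'b \<Rightarrow> 'b set"
  where "cls n b = F (int n - 1) +>\<^bsub>B\<^esub> b"

abbreviation G :: "('k, nat \<Rightarrow> 'b set) module"
  where "G \<equiv> gr B F"

lemma F_abelian_subgroup: "-1 \<le> n \<Longrightarrow> abelian_subgroup (F n) B"
  using submodule.axioms(1)[OF F_submodule]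
  by (intro abelian_subgroupI3 additive_subgroup.intro B.abelian_group_axioms)

lemma mem_cls_iff:
  assumes "b \<in> carrier B"
  shows "x \<in> cls n b \<longleftrightarrow> x \<in> carrier B \<and> x \<ominus>\<^bsub>B\<^esub> b \<in> F (int n - 1)"
proof
  assume "x \<in> cls n b"
  then obtain h where "h \<in> F (int n - 1)" "x = h \<oplus>\<^bsub>B\<^esub> b"
    by (auto simp: cls_def a_r_coset_def r_coset_def)
  then show "x \<in> carrier B \<and> x \<ominus>\<^bsub>B\<^esub> b \<in> F (int n - 1)"
    using assms F_carrier[of "int n - 1" h] by (simp add: B.minus_eq B.a_assoc B.r_neg)
next
  assume x: "x \<in> carrier B \<and> x \<ominus>\<^bsub>B\<^esub> b \<in> F (int n - 1)"
  then have "x = (x \<ominus>\<^bsub>B\<^esub> b) \<oplus>\<^bsub>B\<^esub> b"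
    using assms by (simp add: B.minus_eq B.a_assoc B.l_neg)
  with x show "x \<in> cls n b"
    unfolding cls_def a_r_coset_def r_coset_def by auto
qed

lemma cls_self: "b \<in> carrier B \<Longrightarrow> b \<in> cls n b"
  using F_zero[of "int n - 1"] by (simp add: mem_cls_iff B.minus_eq B.r_neg)

lemma cls_eq_iff:
  assumes "b \<in> carrier B" "c \<in> carrier B"
  shows "cls n b = cls n c \<longleftrightarrow> b \<ominus>\<^bsub>B\<^esub> c \<in> F (int n - 1)"
proof
  assume "cls n b = cls n c"
  then show "b \<ominus>\<^bsub>B\<^esub> c \<in> F (int n - 1)"
    using cls_self[OF assms(1), of n] assms by (simp add: mem_cls_iff)
next
  assume "b \<ominus>\<^bsub>B\<^esub> c \<in> F (int n - 1)"
  then have "b \<in> F (int n - 1) +>\<^bsub>B\<^esub> c"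
    using assms mem_cls_iff[OF assms(2), of b n] by (simp add: cls_def)
  then show "cls n b = cls n c"
    using B.a_repr_independence[of b "F (int n - 1)" c] assms
      submodule.axioms(1)[OF F_submodule[of "int n - 1"]] by (simp add: cls_def)
qed

lemma cls_zero: "cls n \<zero>\<^bsub>B\<^esub> = F (int n - 1)"
  using B.a_coset_join2[of "\<zero>\<^bsub>B\<^esub>" "F (int n - 1)"] F_zero[of "int n - 1"]
    submodule.axioms(1)[OF F_submodule[of "int n - 1"]]
  by (simp add: cls_def)

lemma cls_add: "\<lbrakk>b \<in> carrier B; c \<in> carrier B\<rbrakk> \<Longrightarrow> cls n b <+>\<^bsub>B\<^esub> cls n c = cls n (b \<oplus>\<^bsub>B\<^esub> c)"
  unfolding cls_def by (rule abelian_subgroup.a_rcos_sum[OF F_abelian_subgroup]) auto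

lemma carrier_gr_component: "carrier (gr_component B F n) = cls n ` F (int n)"
  by (auto simp: gr_component_def A_FactGroup_def FactGroup_def RCOSETS_def r_coset_def cls_def
      a_r_coset_def)

lemma mult_gr_component: "U \<otimes>\<^bsub>gr_component B F n\<^esub> V = U <+>\<^bsub>B\<^esub> V"
  by (simp add: gr_component_def A_FactGroup_def FactGroup_def set_add_def set_mult_def)

lemma one_gr_component: "\<one>\<^bsub>gr_component B F n\<^esub> = F (int n - 1)"
  by (simp add: gr_component_def A_FactGroup_def FactGroup_def)

lemma comm_group_gr_component: "comm_group (gr_component B F n)"
proof (rule comm_groupI)
  note Fc = F_carrier[of "int n"]
  show "\<one>\<^bsub>gr_component B F n\<^esub> \<in> carrier (gr_component B F n)"
    using F_zero[of "int n"] by (auto simp: one_gr_component carrier_gr_component cls_zero[symmetric])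
  show "\<exists>y\<in>carrier (gr_component B F n). y \<otimes>\<^bsub>gr_component B F n\<^esub> x = \<one>\<^bsub>gr_component B F n\<^esub>"
    if x: "x \<in> carrier (gr_component B F n)" for x
  proof -
    obtain b where b: "x = cls n b" "b \<in> F (int n)"
      using x unfolding carrier_gr_component by (rule imageE)
    have "\<zero>\<^bsub>B\<^esub> \<ominus>\<^bsub>B\<^esub> b \<in> F (int n)"
      using b(2) F_zero[of "int n"] by (intro F_minus) auto
    moreover have "cls n (\<zero>\<^bsub>B\<^esub> \<ominus>\<^bsub>B\<^esub> b) \<otimes>\<^bsub>gr_component B F n\<^esub> x = \<one>\<^bsub>gr_component B F n\<^esub>"
      using b Fc by (simp add: mult_gr_component one_gr_component cls_add B.minus_eq B.l_neg cls_zero)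
    ultimately show ?thesis
      by (auto simp: carrier_gr_component)
  qed
qed (auto simp: carrier_gr_component mult_gr_component one_gr_component cls_add cls_zero[symmetric]
    F_carrier[of "int n"] B.a_ac intro!: imageI F_add)

lemma gr_carrier_iff:
  "u \<in> carrier G \<longleftrightarrow> (\<forall>n. \<exists>b\<in>F (int n). u n = cls n b) \<and> finite {n. u n \<noteq> F (int n - 1)}"
proof -
  have "carrier G = {u \<in> \<Pi>\<^sub>E n\<in>UNIV. carrier (gr_component B F n).
      finite {n \<in> UNIV. u n \<noteq> \<one>\<^bsub>gr_component B F n\<^esub>}}"
    using comm_group.axioms(2)[OF comm_group_gr_component] by (simp add: gr_def carrier_sum_group)
  then show ?thesis
    by (auto simp: PiE_iff carrier_gr_component one_gr_component image_iff)
qed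

lemma gr_repr: "u \<in> carrier G \<Longrightarrow> \<exists>b\<in>F (int n). u n = cls n b"
  by (simp add: gr_carrier_iff)

lemma gr_zero_apply: "\<zero>\<^bsub>G\<^esub> n = F (int n - 1)"
  by (simp add: gr_def one_gr_component)

lemma gr_add_apply: "(u \<oplus>\<^bsub>G\<^esub> v) n = u n <+>\<^bsub>B\<^esub> v n"
  by (simp add: gr_def mult_gr_component)

lemma gr_one_apply: "\<one>\<^bsub>G\<^esub> n = (if n = 0 then cls 0 \<one>\<^bsub>B\<^esub> else F (int n - 1))"
  by (simp add: gr_def cls_def)

lemma gr_mult_apply:
  "(u \<otimes>\<^bsub>G\<^esub> v) n = finprod (gr_component B F n) (\<lambda>i. rcoset_mult B (F (int n - 1)) (u i) (v (n - i))) {..n}"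
  by (simp add: gr_def)

lemma rcoset_mult_cls:
  assumes b: "b \<in> F (int i)" and c: "c \<in> F (int j)"
  shows "rcoset_mult B (F (int (i + j) - 1)) (cls i b) (cls j c) = cls (i + j) (b \<otimes>\<^bsub>B\<^esub> c)"
proof -
  have bc: "b \<in> carrier B" "c \<in> carrier B"
    using F_carrier[OF _ b] F_carrier[OF _ c] by auto
  have *: "F (int (i + j) - 1) +>\<^bsub>B\<^esub> (x \<otimes>\<^bsub>B\<^esub> y) = cls (i + j) (b \<otimes>\<^bsub>B\<^esub> c)"
    if x: "x \<in> cls i b" and y: "y \<in> cls j c" for x y
  proof -
    have xB: "x \<in> carrier B" "x \<ominus>\<^bsub>B\<^esub> b \<in> F (int i - 1)" and yB: "y \<in> carrier B" "y \<ominus>\<^bsub>B\<^esub> c \<in> F (int j - 1)"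
      using x y bc by (auto simp: mem_cls_iff)
    have "y = (y \<ominus>\<^bsub>B\<^esub> c) \<oplus>\<^bsub>B\<^esub> c"
      using yB bc by (simp add: B.minus_eq B.a_assoc B.l_neg)
    moreover have "y \<ominus>\<^bsub>B\<^esub> c \<in> F (int j)"
      using yB(2) F_mono[of "int j - 1" "int j"] by auto
    ultimately have yF: "y \<in> F (int j)"
      using c F_add[of "int j" "y \<ominus>\<^bsub>B\<^esub> c" c] by simp
    have "x \<otimes>\<^bsub>B\<^esub> y \<ominus>\<^bsub>B\<^esub> b \<otimes>\<^bsub>B\<^esub> c = (x \<ominus>\<^bsub>B\<^esub> b) \<otimes>\<^bsub>B\<^esub> y \<oplus>\<^bsub>B\<^esub> b \<otimes>\<^bsub>B\<^esub> (y \<ominus>\<^bsub>B\<^esub> c)"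
    proof -
      have "(x \<ominus>\<^bsub>B\<^esub> b) \<otimes>\<^bsub>B\<^esub> y \<oplus>\<^bsub>B\<^esub> b \<otimes>\<^bsub>B\<^esub> (y \<ominus>\<^bsub>B\<^esub> c)
          = x \<otimes>\<^bsub>B\<^esub> y \<oplus>\<^bsub>B\<^esub> (\<ominus>\<^bsub>B\<^esub> (b \<otimes>\<^bsub>B\<^esub> y) \<oplus>\<^bsub>B\<^esub> b \<otimes>\<^bsub>B\<^esub> y) \<oplus>\<^bsub>B\<^esub> \<ominus>\<^bsub>B\<^esub> (b \<otimes>\<^bsub>B\<^esub> c)"
        using xB(1) yB(1) bc
        by (simp add: B.minus_eq B.l_distr B.r_distr B.l_minus B.r_minus B.a_assoc)
      then show ?thesis
        using xB(1) yB(1) bc by (simp add: B.l_neg B.minus_eq)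
    qed
    also have "\<dots> \<in> F (int (i + j) - 1)"
      by (intro F_add F_mult_lower_left F_mult_lower_right xB yB yF b) auto
    finally have "cls (i + j) (x \<otimes>\<^bsub>B\<^esub> y) = cls (i + j) (b \<otimes>\<^bsub>B\<^esub> c)"
      using xB(1) yB(1) bc by (simp add: cls_eq_iff)
    then show ?thesis
      by (simp add: cls_def)
  qed
  have "(\<Union>y\<in>cls j c. F (int (i + j) - 1) +>\<^bsub>B\<^esub> (x \<otimes>\<^bsub>B\<^esub> y)) = cls (i + j) (b \<otimes>\<^bsub>B\<^esub> c)" if "x \<in> cls i b" for x
  proof -
    have "(\<Union>y\<in>cls j c. F (int (i + j) - 1) +>\<^bsub>B\<^esub> (x \<otimes>\<^bsub>B\<^esub> y)) = (\<Union>y\<in>cls j c. cls (i + j) (b \<otimes>\<^bsub>B\<^esub> c))"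
      using *[OF that] by (rule SUP_cong[OF refl])
    then show ?thesis
      using cls_self[OF bc(2), of j] by auto
  qed
  then have "rcoset_mult B (F (int (i + j) - 1)) (cls i b) (cls j c) = (\<Union>x\<in>cls i b. cls (i + j) (b \<otimes>\<^bsub>B\<^esub> c))"
    unfolding rcoset_mult_def by (rule SUP_cong[OF refl])
  then show ?thesis
    using cls_self[OF bc(1), of i] by auto
qed

text \<open>For \<open>b \<in> F n\<close> this is the principal symbol of \<open>b\<close> in
  degree \<open>n\<close>: a homogeneous element, zero exactly if \<open>b\<close> lies in the
  previous step of the filtration.\<close>

definition sym :: "nat \<Rightarrow> 'b \<Rightarrow> nat \<Rightarrow> 'b set"
  where "sym n b = (\<lambda>m. if m = n then cls n b else F (int m - 1))"

lemma sym_closed: "b \<in> F (int n) \<Longrightarrow> sym n b \<in> carrier G"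
  unfolding gr_carrier_iff
proof
  assume b: "b \<in> F (int n)"
  show "\<forall>m. \<exists>c\<in>F (int m). sym n b m = cls m c"
  proof
    fix m show "\<exists>c\<in>F (int m). sym n b m = cls m c"
      using b F_zero[of "int m"]
      by (intro bexI[of _ "if m = n then b else \<zero>\<^bsub>B\<^esub>"]) (auto simp: sym_def cls_zero)
  qed
  have "{m. sym n b m \<noteq> F (int m - 1)} \<subseteq> {n}"
    by (auto simp: sym_def)
  then show "finite {m. sym n b m \<noteq> F (int m - 1)}"
    by (rule finite_subset) simp
qed

lemma F_set_add: "F (int n - 1) <+>\<^bsub>B\<^esub> F (int n - 1) = F (int n - 1)"
  using cls_add[of "\<zero>\<^bsub>B\<^esub>" "\<zero>\<^bsub>B\<^esub>" n] by (simp add: cls_zero)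

lemma sym_add:
  assumes "b \<in> F (int n)" "c \<in> F (int n)"
  shows "sym n (b \<oplus>\<^bsub>B\<^esub> c) = sym n b \<oplus>\<^bsub>G\<^esub> sym n c"
proof
  fix m show "sym n (b \<oplus>\<^bsub>B\<^esub> c) m = (sym n b \<oplus>\<^bsub>G\<^esub> sym n c) m"
    using assms F_carrier[of "int n"] by (simp add: gr_add_apply sym_def cls_add F_set_add)
qed

lemma sym_zero: "sym n \<zero>\<^bsub>B\<^esub> = \<zero>\<^bsub>G\<^esub>"
  by (rule ext) (simp add: sym_def cls_zero gr_zero_apply)

lemma sym_one: "sym 0 \<one>\<^bsub>B\<^esub> = \<one>\<^bsub>G\<^esub>"
  by (rule ext) (simp add: sym_def gr_one_apply)

text \<open>Only the term with index \<open>m\<close> of the convolution survives, because all other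
  components of \<open>sym m b\<close> are zero cosets.\<close>

lemma sym_mult_apply:
  assumes b: "b \<in> F (int m)" and w: "w \<in> carrier G"
  shows "(sym m b \<otimes>\<^bsub>G\<^esub> w) n = (if m \<le> n then rcoset_mult B (F (int n - 1)) (cls m b) (w (n - m)) else F (int n - 1))"
proof -
  interpret C: comm_group "gr_component B F n"
    by (rule comm_group_gr_component)
  have prod: "\<exists>c\<in>F (int n). rcoset_mult B (F (int n - 1)) (cls i a) (w (n - i)) = cls n c"
    if "i \<le> n" "a \<in> F (int i)" for i a
  proof -
    obtain c where c: "c \<in> F (int (n - i))" "w (n - i) = cls (n - i) c"
      using gr_repr[OF w] by blast
    have "a \<otimes>\<^bsub>B\<^esub> c \<in> F (int i + int (n - i))"
      using that c(1) by (intro F_mult) auto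
    then show ?thesis
      using rcoset_mult_cls[OF that(2) c(1)] c that(1) by (intro bexI[of _ "a \<otimes>\<^bsub>B\<^esub> c"]) auto
  qed
  have zero: "rcoset_mult B (F (int n - 1)) (F (int i - 1)) (w (n - i)) = F (int n - 1)" if "i \<le> n" for i
  proof -
    obtain c where c: "c \<in> F (int (n - i))" "w (n - i) = cls (n - i) c"
      using gr_repr[OF w] by blast
    then show ?thesis
      using rcoset_mult_cls[OF F_zero c(1), of i] that F_carrier[OF _ c(1)] by (simp add: cls_zero)
  qed
  have "(sym m b \<otimes>\<^bsub>G\<^esub> w) n = finprod (gr_component B F n)
      (\<lambda>i. if m = i then rcoset_mult B (F (int n - 1)) (cls i b) (w (n - i)) else \<one>\<^bsub>gr_component B F n\<^esub>) {..n}"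
    unfolding gr_mult_apply
  proof (rule C.finprod_cong')
    show "(\<lambda>i. if m = i then rcoset_mult B (F (int n - 1)) (cls i b) (w (n - i)) else \<one>\<^bsub>gr_component B F n\<^esub>)
        \<in> {..n} \<rightarrow> carrier (gr_component B F n)"
      using prod[of m b] b C.one_closed by (auto simp: carrier_gr_component)
  qed (auto simp: sym_def zero one_gr_component)
  also have "\<dots> = (if m \<le> n then rcoset_mult B (F (int n - 1)) (cls m b) (w (n - m)) else F (int n - 1))"
  proof (cases "m \<le> n")
    case True
    have "finprod (gr_component B F n)
      (\<lambda>i. if m = i then rcoset_mult B (F (int n - 1)) (cls m b) (w (n - m)) else \<one>\<^bsub>gr_component B F n\<^esub>) {..n}
      = rcoset_mult B (F (int n - 1)) (cls m b) (w (n - m))"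
      using prod[OF True b] True
      by (intro C.finprod_singleton[of m "{..n}" "\<lambda>_. rcoset_mult B (F (int n - 1)) (cls m b) (w (n - m))"])
        (auto simp: carrier_gr_component)
    with True show ?thesis
      by (simp cong: if_cong)
  next
    case False
    then have "finprod (gr_component B F n) (\<lambda>i. if m = i then rcoset_mult B (F (int n - 1)) (cls i b) (w (n - i))
        else \<one>\<^bsub>gr_component B F n\<^esub>) {..n} = \<one>\<^bsub>gr_component B F n\<^esub>"
      by (intro C.finprod_one_eqI) auto
    with False show ?thesis
      by (simp only: one_gr_component if_False)
  qed
  finally show ?thesis .
qed

lemma sym_mult:
  assumes b: "b \<in> F (int m)" and c: "c \<in> F (int n)"
  shows "sym m b \<otimes>\<^bsub>G\<^esub> sym n c = sym (m + n) (b \<otimes>\<^bsub>B\<^esub> c)"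
proof
  fix k
  have eq: "(sym m b \<otimes>\<^bsub>G\<^esub> sym n c) k
      = (if m \<le> k then rcoset_mult B (F (int k - 1)) (cls m b) (sym n c (k - m)) else F (int k - 1))"
    by (rule sym_mult_apply[OF b sym_closed[OF c]])
  show "(sym m b \<otimes>\<^bsub>G\<^esub> sym n c) k = sym (m + n) (b \<otimes>\<^bsub>B\<^esub> c) k"
  proof (cases "k = m + n")
    case True
    have "sym n c (m + n - m) = cls n c"
      by (simp add: sym_def)
    moreover have "sym (m + n) (b \<otimes>\<^bsub>B\<^esub> c) (m + n) = cls (m + n) (b \<otimes>\<^bsub>B\<^esub> c)"
      by (simp add: sym_def)
    ultimately show ?thesis
      unfolding eq unfolding True by (simp only: rcoset_mult_cls[OF b c] le_add1 if_True)
  next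
    case False
    have "rcoset_mult B (F (int k - 1)) (cls m b) (sym n c (k - m)) = F (int k - 1)" if "m \<le> k"
    proof -
      have "k - m \<noteq> n" and k: "m + (k - m) = k"
        using False that by auto
      then have "sym n c (k - m) = cls (k - m) \<zero>\<^bsub>B\<^esub>"
        by (simp add: sym_def cls_zero)
      moreover have "\<zero>\<^bsub>B\<^esub> \<in> F (int (k - m))"
        by (rule F_zero) simp
      ultimately have "rcoset_mult B (F (int k - 1)) (cls m b) (sym n c (k - m)) = cls k (b \<otimes>\<^bsub>B\<^esub> \<zero>\<^bsub>B\<^esub>)"
        using rcoset_mult_cls[OF b, of "\<zero>\<^bsub>B\<^esub>" "k - m"] by (simp only: k)
      moreover have "b \<in> carrier B"
        using F_carrier[OF _ b] by simp
      ultimately show ?thesis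
        by (simp add: cls_zero)
    qed
    moreover have "sym (m + n) (b \<otimes>\<^bsub>B\<^esub> c) k = F (int k - 1)"
      using False by (simp add: sym_def)
    ultimately show ?thesis
      unfolding eq by simp
  qed
qed

text \<open>Each element is the sum of its finitely many non-zero homogeneous parts, and each part
  is a symbol; the induction splits off one part at a time.\<close>

lemma gr_induct [consumes 1, case_names zero add sym]:
  assumes u: "u \<in> carrier G"
    and zero: "Q \<zero>\<^bsub>G\<^esub>"
    and add: "\<And>u v. \<lbrakk>u \<in> carrier G; v \<in> carrier G; Q u; Q v\<rbrakk> \<Longrightarrow> Q (u \<oplus>\<^bsub>G\<^esub> v)"
    and sym: "\<And>n b. b \<in> F (int n) \<Longrightarrow> Q (sym n b)"
  shows "Q u"
proof -
  have *: "Q u" if "finite S" "u \<in> carrier G" "\<And>n. n \<notin> S \<Longrightarrow> u n = F (int n - 1)" for S u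
    using that
  proof (induction S arbitrary: u)
    case empty
    then have "u = \<zero>\<^bsub>G\<^esub>"
      by (intro ext) (simp add: gr_zero_apply)
    then show ?case
      by (simp only: zero)
  next
    case (insert m S)
    obtain b where b: "b \<in> F (int m)" "u m = cls m b"
      using gr_repr[OF insert.prems(1)] by blast
    define v where "v n = (if n = m then F (int n - 1) else u n)" for n
    have "\<exists>c\<in>F (int n). v n = cls n c" for n
    proof (cases "n = m")
      case True
      then show ?thesis
        using F_zero[of "int n"] by (intro bexI[of _ "\<zero>\<^bsub>B\<^esub>"]) (auto simp: v_def cls_zero)
    next
      case False
      then show ?thesis
        using gr_repr[OF insert.prems(1), of n] by (simp add: v_def)
    qed
    moreover have "{n. v n \<noteq> F (int n - 1)} \<subseteq> S"
      using insert.prems(2) by (auto simp: v_def)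
    ultimately have v: "v \<in> carrier G"
      unfolding gr_carrier_iff using insert.hyps(1) finite_subset by blast
    have "Q v"
      using insert.prems(2) by (intro insert.IH v) (auto simp: v_def)
    moreover have "u = sym m b \<oplus>\<^bsub>G\<^esub> v"
    proof
      fix n
      obtain c where c: "c \<in> F (int n)" "u n = cls n c"
        using gr_repr[OF insert.prems(1)] by blast
      have "cls m b <+>\<^bsub>B\<^esub> F (int m - 1) = cls m b" "F (int n - 1) <+>\<^bsub>B\<^esub> cls n c = cls n c"
        using cls_add[of b "\<zero>\<^bsub>B\<^esub>" m] cls_add[of "\<zero>\<^bsub>B\<^esub>" c n] F_carrier[OF _ b(1)] F_carrier[OF _ c(1)]
        by (simp_all add: cls_zero)
      then show "u n = (sym m b \<oplus>\<^bsub>G\<^esub> v) n"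
        using b(2) c(2) by (cases "n = m") (auto simp: gr_add_apply sym_def v_def)
    qed
    ultimately show ?case
      using add[OF sym_closed[OF b(1)] v sym[OF b(1)]] by simp
  qed
  have "finite {n. u n \<noteq> F (int n - 1)}"
    using u unfolding gr_carrier_iff by (rule conjunct2)
  then show ?thesis
    using u by (rule *) simp
qed

section \<open>Scalars in \<open>B\<close> and in \<open>G\<close>\<close>

lemma central_scalars_B: "central_scalars K B (\<lambda>a. a \<odot>\<^bsub>B\<^esub> \<one>\<^bsub>B\<^esub>)"
proof unfold_locales
  show "(\<lambda>a. a \<odot>\<^bsub>B\<^esub> \<one>\<^bsub>B\<^esub>) \<in> ring_hom K B"
  proof (rule ring_hom_memI)
    fix a b assume ab: "a \<in> carrier K" "b \<in> carrier K"
    show "(a \<otimes>\<^bsub>K\<^esub> b) \<odot>\<^bsub>B\<^esub> \<one>\<^bsub>B\<^esub> = (a \<odot>\<^bsub>B\<^esub> \<one>\<^bsub>B\<^esub>) \<otimes>\<^bsub>B\<^esub> (b \<odot>\<^bsub>B\<^esub> \<one>\<^bsub>B\<^esub>)"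
      using ab by (simp add: smult_mult_left KB.smult_assoc1)
  qed (auto simp: KB.smult_l_distr)
next
  fix a x assume "a \<in> carrier K" "x \<in> carrier B"
  then show "a \<odot>\<^bsub>B\<^esub> \<one>\<^bsub>B\<^esub> \<otimes>\<^bsub>B\<^esub> x = x \<otimes>\<^bsub>B\<^esub> (a \<odot>\<^bsub>B\<^esub> \<one>\<^bsub>B\<^esub>)"
    by (simp add: smult_mult_left smult_mult_right)
qed

lemma smult_eq_mult: "\<lbrakk>a \<in> carrier K; x \<in> carrier B\<rbrakk> \<Longrightarrow> a \<odot>\<^bsub>B\<^esub> x = (a \<odot>\<^bsub>B\<^esub> \<one>\<^bsub>B\<^esub>) \<otimes>\<^bsub>B\<^esub> x"
  by (simp add: smult_mult_left)

text \<open>Places the scalars in degree 0 of \<open>G\<close>, whence \<open>K[X]\<close> preserves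
  the degree in graded modules.\<close>

lemma gr_smult_one:
  assumes a: "a \<in> carrier K"
  shows "a \<odot>\<^bsub>G\<^esub> \<one>\<^bsub>G\<^esub> = sym 0 (a \<odot>\<^bsub>B\<^esub> \<one>\<^bsub>B\<^esub>)"
proof
  fix n
  have *: "(\<Union>y\<in>cls n c. F (int n - 1) +>\<^bsub>B\<^esub> (a \<odot>\<^bsub>B\<^esub> y)) = cls n (a \<odot>\<^bsub>B\<^esub> c)" if c: "c \<in> carrier B" for c
  proof -
    have "F (int n - 1) +>\<^bsub>B\<^esub> (a \<odot>\<^bsub>B\<^esub> y) = cls n (a \<odot>\<^bsub>B\<^esub> c)" if "y \<in> cls n c" for y
    proof -
      have y: "y \<in> carrier B" "y \<ominus>\<^bsub>B\<^esub> c \<in> F (int n - 1)"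
        using that c by (auto simp: mem_cls_iff)
      have "a \<odot>\<^bsub>B\<^esub> y \<ominus>\<^bsub>B\<^esub> a \<odot>\<^bsub>B\<^esub> c = a \<odot>\<^bsub>B\<^esub> (y \<ominus>\<^bsub>B\<^esub> c)"
        using a c y(1) by (simp add: B.minus_eq KB.smult_r_distr KB.smult_r_minus)
      also have "\<dots> \<in> F (int n - 1)"
        using a y(2) by (intro F_smult) auto
      finally have "cls n (a \<odot>\<^bsub>B\<^esub> y) = cls n (a \<odot>\<^bsub>B\<^esub> c)"
        using a c y(1) by (simp add: cls_eq_iff)
      then show ?thesis
        by (simp add: cls_def)
    qed
    then have "(\<Union>y\<in>cls n c. F (int n - 1) +>\<^bsub>B\<^esub> (a \<odot>\<^bsub>B\<^esub> y)) = (\<Union>y\<in>cls n c. cls n (a \<odot>\<^bsub>B\<^esub> c))"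
      by (rule SUP_cong[OF refl])
    then show ?thesis
      using cls_self[OF c, of n] by auto
  qed
  have "(a \<odot>\<^bsub>G\<^esub> \<one>\<^bsub>G\<^esub>) n = (\<Union>y\<in>\<one>\<^bsub>G\<^esub> n. F (int n - 1) +>\<^bsub>B\<^esub> (a \<odot>\<^bsub>B\<^esub> y))"
    by (simp add: gr_def)
  also have "\<one>\<^bsub>G\<^esub> n = cls n (if n = 0 then \<one>\<^bsub>B\<^esub> else \<zero>\<^bsub>B\<^esub>)"
    by (auto simp: gr_one_apply cls_zero)
  also have "(\<Union>y\<in>\<dots>. F (int n - 1) +>\<^bsub>B\<^esub> (a \<odot>\<^bsub>B\<^esub> y)) = cls n (a \<odot>\<^bsub>B\<^esub> (if n = 0 then \<one>\<^bsub>B\<^esub> else \<zero>\<^bsub>B\<^esub>))"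
    by (rule *) auto
  also have "\<dots> = sym 0 (a \<odot>\<^bsub>B\<^esub> \<one>\<^bsub>B\<^esub>) n"
    using a by (auto simp: sym_def cls_zero)
  finally show "(a \<odot>\<^bsub>G\<^esub> \<one>\<^bsub>G\<^esub>) n = sym 0 (a \<odot>\<^bsub>B\<^esub> \<one>\<^bsub>B\<^esub>) n" .
qed

lemma scalar_in_F: "a \<in> carrier K \<Longrightarrow> a \<odot>\<^bsub>B\<^esub> \<one>\<^bsub>B\<^esub> \<in> F 0"
  by (intro F_smult F_one) auto

text \<open>The ring axioms of \<open>G\<close> come from \<open>left_noetherian\<close>, which
  contains them. Centrality can then be tested on symbols, where it is centrality of scalars in
  \<open>B\<close>.\<close>

lemma central_scalars_G:
  assumes "ring G"
  shows "central_scalars K G (\<lambda>a. a \<odot>\<^bsub>G\<^esub> \<one>\<^bsub>G\<^esub>)"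
proof -
  interpret G: ring G
    by (rule assms)
  have sF: "a \<odot>\<^bsub>B\<^esub> \<one>\<^bsub>B\<^esub> \<in> F (int 0)" if "a \<in> carrier K" for a
    using scalar_in_F[OF that] by simp
  show ?thesis
  proof unfold_locales
    show "(\<lambda>a. a \<odot>\<^bsub>G\<^esub> \<one>\<^bsub>G\<^esub>) \<in> ring_hom K G"
    proof (rule ring_hom_memI)
      fix a b assume ab: "a \<in> carrier K" "b \<in> carrier K"
      show "a \<odot>\<^bsub>G\<^esub> \<one>\<^bsub>G\<^esub> \<in> carrier G"
        using sym_closed[OF sF[OF ab(1)]] by (simp add: gr_smult_one ab)
      show "(a \<otimes>\<^bsub>K\<^esub> b) \<odot>\<^bsub>G\<^esub> \<one>\<^bsub>G\<^esub> = (a \<odot>\<^bsub>G\<^esub> \<one>\<^bsub>G\<^esub>) \<otimes>\<^bsub>G\<^esub> (b \<odot>\<^bsub>G\<^esub> \<one>\<^bsub>G\<^esub>)"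
        using ab sym_mult[OF sF[OF ab(1)] sF[OF ab(2)]]
        by (simp add: gr_smult_one smult_mult_left KB.smult_assoc1)
      show "(a \<oplus>\<^bsub>K\<^esub> b) \<odot>\<^bsub>G\<^esub> \<one>\<^bsub>G\<^esub> = a \<odot>\<^bsub>G\<^esub> \<one>\<^bsub>G\<^esub> \<oplus>\<^bsub>G\<^esub> b \<odot>\<^bsub>G\<^esub> \<one>\<^bsub>G\<^esub>"
        using ab sym_add[OF sF[OF ab(1)] sF[OF ab(2)]] by (simp add: gr_smult_one KB.smult_l_distr)
    next
      show "\<one>\<^bsub>K\<^esub> \<odot>\<^bsub>G\<^esub> \<one>\<^bsub>G\<^esub> = \<one>\<^bsub>G\<^esub>"
        by (simp add: gr_smult_one sym_one)
    qed
  next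
    fix a x assume a: "a \<in> carrier K" and x: "x \<in> carrier G"
    have aG: "sym 0 (a \<odot>\<^bsub>B\<^esub> \<one>\<^bsub>B\<^esub>) \<in> carrier G"
      by (rule sym_closed[OF sF[OF a]])
    from x show "a \<odot>\<^bsub>G\<^esub> \<one>\<^bsub>G\<^esub> \<otimes>\<^bsub>G\<^esub> x = x \<otimes>\<^bsub>G\<^esub> (a \<odot>\<^bsub>G\<^esub> \<one>\<^bsub>G\<^esub>)"
    proof (induction x rule: gr_induct)
      case zero
      then show ?case
        unfolding gr_smult_one[OF a] using aG by (simp only: G.l_null G.r_null)
    next
      case (add u v)
      then show ?case
        unfolding gr_smult_one[OF a] using aG by (simp only: G.l_distr G.r_distr)
    next
      case (sym n b)
      then show ?case
        unfolding gr_smult_one[OF a] sym_mult[OF sF[OF a] sym] sym_mult[OF sym sF[OF a]]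
        using a F_carrier[OF _ sym] by (simp add: smult_mult_left smult_mult_right)
    qed
  qed
qed

end

section \<open>Leading forms of left ideals\<close>

locale noetherian_filtered_algebra = filtered_algebra K B F
  for K :: "('k, 'r) ring_scheme" and B :: "('k, 'b, 'x) module_scheme" and F :: "int \<Rightarrow> 'b set" +
  assumes gr_noetherian: "left_noetherian (gr B F)"
    and F_finite: "locally_finite K B F"
begin

lemma ring_G: "ring G"
  using gr_noetherian by (simp add: left_noetherian_def)

sublocale G: ring G
  by (rule ring_G)

sublocale CB: central_scalars K B "\<lambda>a. a \<odot>\<^bsub>B\<^esub> \<one>\<^bsub>B\<^esub>"
  by (rule central_scalars_B)

sublocale CG: central_scalars K G "\<lambda>a. a \<odot>\<^bsub>G\<^esub> \<one>\<^bsub>G\<^esub>"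
  by (rule central_scalars_G[OF ring_G])

sublocale BP: ring "UP B"
  by (rule B.ring_UP)

sublocale GP: ring "UP G"
  by (rule G.ring_UP)

sublocale KP: domain "UP K"
  by (rule K.UP_domain_UP)

sublocale CGP: central_scalars "UP K" "UP G" CG.\<iota>
  by (rule CG.central_scalars_UP)

lemma acc_GP: "left_acc (UP G)"
  by (rule G.left_acc_UP[OF G.left_noetherian_imp_acc[OF gr_noetherian]])

text \<open>The subspace \<open>F n [X]\<close> of \<open>B[X]\<close>: the filtration induced on
  \<open>B[X]\<close> when \<open>X\<close> has degree 0.\<close>

definition PF :: "nat \<Rightarrow> (nat \<Rightarrow> 'b) set"
  where "PF n = {y \<in> carrier (UP B). \<forall>i. y i \<in> F (int n)}"

lemma PF_carrier: "y \<in> PF n \<Longrightarrow> y \<in> carrier (UP B)"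
  and PF_coeff: "y \<in> PF n \<Longrightarrow> y i \<in> F (int n)"
  by (simp_all add: PF_def)

lemma PF_exhaust:
  assumes y: "y \<in> carrier (UP B)"
  shows "\<exists>n. y \<in> PF n"
proof -
  obtain d where d: "\<forall>i\<ge>d. y i = \<zero>\<^bsub>B\<^esub>"
    using y by (auto simp: UP_mem_iff)
  have "\<forall>i. \<exists>n::nat. y i \<in> F (int n)"
    using F_exhaust y by blast
  then obtain \<nu> :: "nat \<Rightarrow> nat" where \<nu>: "\<And>i. y i \<in> F (int (\<nu> i))"
    by metis
  define N where "N = (\<Sum>j<d. \<nu> j)"
  have "y i \<in> F (int N)" for i
  proof (cases "i < d")
    case True
    then have "\<nu> i \<le> N"
      unfolding N_def by (intro member_le_sum) auto
    then show ?thesis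
      using \<nu>[of i] F_mono[of "int (\<nu> i)" "int N"] by auto
  next
    case False
    then have "y i = \<zero>\<^bsub>B\<^esub>"
      using d by simp
    then show ?thesis
      using F_zero[of "int N"] by simp
  qed
  then show ?thesis
    using y unfolding PF_def by blast
qed

lemma PF_zero: "\<zero>\<^bsub>UP B\<^esub> \<in> PF n"
  using F_zero[of "int n"] by (simp add: PF_def UP_zero_apply)

lemma PF_add:
  assumes "y \<in> PF n" "z \<in> PF n"
  shows "y \<oplus>\<^bsub>UP B\<^esub> z \<in> PF n"
proof -
  have "(y \<oplus>\<^bsub>UP B\<^esub> z) i \<in> F (int n)" for i
    unfolding UP_add_apply[OF assms[THEN PF_carrier]]
    by (intro F_add PF_coeff assms) auto
  then show ?thesis
    using assms[THEN PF_carrier] unfolding PF_def by blast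
qed

lemma PF_minus:
  assumes "y \<in> PF n" "z \<in> PF n"
  shows "y \<ominus>\<^bsub>UP B\<^esub> z \<in> PF n"
proof -
  have "(y \<ominus>\<^bsub>UP B\<^esub> z) i \<in> F (int n)" for i
    unfolding B.UP_minus_apply[OF assms[THEN PF_carrier]]
    by (intro F_minus PF_coeff assms) auto
  moreover have "y \<ominus>\<^bsub>UP B\<^esub> z \<in> carrier (UP B)"
    using assms[THEN PF_carrier] by (rule BP.minus_closed)
  ultimately show ?thesis
    unfolding PF_def by blast
qed

lemma F_finsum: "\<lbrakk>-1 \<le> n; \<And>j. j \<in> Y \<Longrightarrow> f j \<in> F n\<rbrakk> \<Longrightarrow> (\<Oplus>\<^bsub>B\<^esub>j\<in>Y. f j) \<in> F n"
  by (rule KB.submodule_finsum[OF F_submodule])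

lemma scalar_mult_apply:
  assumes p: "p \<in> carrier (UP K)" and y: "y \<in> carrier (UP B)"
  shows "(CB.\<iota> p \<otimes>\<^bsub>UP B\<^esub> y) i = (\<Oplus>\<^bsub>B\<^esub>j\<in>{..i}. p j \<odot>\<^bsub>B\<^esub> y (i - j))"
proof -
  have "(CB.\<iota> p \<otimes>\<^bsub>UP B\<^esub> y) i = (\<Oplus>\<^bsub>B\<^esub>j\<in>{..i}. CB.\<iota> p j \<otimes>\<^bsub>B\<^esub> y (i - j))"
    by (rule UP_mult_apply[OF CB.\<iota>_closed[OF p] y])
  also have "\<dots> = (\<Oplus>\<^bsub>B\<^esub>j\<in>{..i}. p j \<odot>\<^bsub>B\<^esub> y (i - j))"
  proof (intro B.finsum_cong' refl)
    show "(\<lambda>j. p j \<odot>\<^bsub>B\<^esub> y (i - j)) \<in> {..i} \<rightarrow> carrier B"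
      using p y by auto
    fix j
    show "CB.\<iota> p j \<otimes>\<^bsub>B\<^esub> y (i - j) = p j \<odot>\<^bsub>B\<^esub> y (i - j)"
      unfolding CB.\<iota>_def using p y by (intro smult_eq_mult[symmetric]) auto
  qed
  finally show ?thesis .
qed

lemma PF_scalar_mult:
  assumes p: "p \<in> carrier (UP K)" and y: "y \<in> PF n"
  shows "CB.\<iota> p \<otimes>\<^bsub>UP B\<^esub> y \<in> PF n"
proof -
  have "(CB.\<iota> p \<otimes>\<^bsub>UP B\<^esub> y) i \<in> F (int n)" for i
    unfolding scalar_mult_apply[OF p PF_carrier[OF y]]
    using p by (intro F_finsum F_smult PF_coeff y) auto
  moreover have "CB.\<iota> p \<otimes>\<^bsub>UP B\<^esub> y \<in> carrier (UP B)"
    using p PF_carrier[OF y] by simp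
  ultimately show ?thesis
    unfolding PF_def by blast
qed

text \<open>Symbols of degree \<open>n\<close> are taken coefficientwise, which identifies the
  associated graded ring of \<open>B[X]\<close> with \<open>G[X]\<close>.\<close>

definition psym :: "nat \<Rightarrow> (nat \<Rightarrow> 'b) \<Rightarrow> nat \<Rightarrow> nat \<Rightarrow> 'b set"
  where "psym n y = (\<lambda>i. sym n (y i))"

lemma psym_closed:
  assumes y: "y \<in> PF n"
  shows "psym n y \<in> carrier (UP G)"
proof -
  obtain d where d: "\<forall>i\<ge>d. y i = \<zero>\<^bsub>B\<^esub>"
    using PF_carrier[OF y] by (auto simp: UP_mem_iff)
  then have "\<forall>i\<ge>d. psym n y i = \<zero>\<^bsub>G\<^esub>"
    by (simp add: psym_def sym_zero)
  moreover have "\<forall>i. psym n y i \<in> carrier G"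
    unfolding psym_def by (intro allI sym_closed PF_coeff y)
  ultimately show ?thesis
    unfolding UP_mem_iff by blast
qed

lemma sym_finsum:
  assumes "finite Y" "\<And>j. j \<in> Y \<Longrightarrow> f j \<in> F (int n)"
  shows "sym n (\<Oplus>\<^bsub>B\<^esub>j\<in>Y. f j) = (\<Oplus>\<^bsub>G\<^esub>j\<in>Y. sym n (f j))"
  using assms
proof (induction Y)
  case (insert j Y)
  have f: "f \<in> Y \<rightarrow> carrier B" "f j \<in> carrier B"
    using insert.prems F_carrier[of "int n"] by auto
  have s: "(\<lambda>j. sym n (f j)) \<in> Y \<rightarrow> carrier G" "sym n (f j) \<in> carrier G"
    using insert.prems sym_closed by auto
  have "(\<Oplus>\<^bsub>B\<^esub>j\<in>Y. f j) \<in> F (int n)"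
    using insert.prems by (intro F_finsum) auto
  then have "sym n (f j \<oplus>\<^bsub>B\<^esub> (\<Oplus>\<^bsub>B\<^esub>j\<in>Y. f j)) = sym n (f j) \<oplus>\<^bsub>G\<^esub> (\<Oplus>\<^bsub>G\<^esub>j\<in>Y. sym n (f j))"
    using insert sym_add[of "f j" n "\<Oplus>\<^bsub>B\<^esub>j\<in>Y. f j"] by simp
  then show ?case
    using insert.hyps f s by (simp add: B.finsum_insert G.finsum_insert)
qed (simp add: sym_zero)

lemma sym_scalar:
  assumes "a \<in> carrier K" "b \<in> F (int n)"
  shows "(a \<odot>\<^bsub>G\<^esub> \<one>\<^bsub>G\<^esub>) \<otimes>\<^bsub>G\<^esub> sym n b = sym n (a \<odot>\<^bsub>B\<^esub> b)"
proof -
  have "a \<odot>\<^bsub>B\<^esub> \<one>\<^bsub>B\<^esub> \<in> F (int 0)"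
    using scalar_in_F[OF assms(1)] by simp
  from sym_mult[OF this assms(2)] show ?thesis
    using assms F_carrier[OF _ assms(2)] by (simp add: gr_smult_one flip: smult_eq_mult)
qed

lemma psym_scalar_mult:
  assumes p: "p \<in> carrier (UP K)" and y: "y \<in> PF n"
  shows "psym n (CB.\<iota> p \<otimes>\<^bsub>UP B\<^esub> y) = CG.\<iota> p \<otimes>\<^bsub>UP G\<^esub> psym n y"
proof
  fix i
  have py: "p j \<odot>\<^bsub>B\<^esub> y (i - j) \<in> F (int n)" for j
    using p by (intro F_smult PF_coeff y) auto
  have "psym n (CB.\<iota> p \<otimes>\<^bsub>UP B\<^esub> y) i = sym n (\<Oplus>\<^bsub>B\<^esub>j\<in>{..i}. p j \<odot>\<^bsub>B\<^esub> y (i - j))"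
    unfolding psym_def scalar_mult_apply[OF p PF_carrier[OF y]] ..
  also have "\<dots> = (\<Oplus>\<^bsub>G\<^esub>j\<in>{..i}. sym n (p j \<odot>\<^bsub>B\<^esub> y (i - j)))"
    using py by (intro sym_finsum) auto
  also have "\<dots> = (\<Oplus>\<^bsub>G\<^esub>j\<in>{..i}. CG.\<iota> p j \<otimes>\<^bsub>G\<^esub> psym n y (i - j))"
  proof (intro G.finsum_cong' refl)
    show "(\<lambda>j. CG.\<iota> p j \<otimes>\<^bsub>G\<^esub> psym n y (i - j)) \<in> {..i} \<rightarrow> carrier G"
      using CG.\<iota>_closed[OF p] psym_closed[OF y] by auto
    fix j
    show "sym n (p j \<odot>\<^bsub>B\<^esub> y (i - j)) = CG.\<iota> p j \<otimes>\<^bsub>G\<^esub> psym n y (i - j)"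
      unfolding CG.\<iota>_def psym_def using p by (intro sym_scalar[symmetric] PF_coeff y) auto
  qed
  also have "\<dots> = (CG.\<iota> p \<otimes>\<^bsub>UP G\<^esub> psym n y) i"
    by (rule UP_mult_apply[OF CG.\<iota>_closed[OF p] psym_closed[OF y], symmetric])
  finally show "psym n (CB.\<iota> p \<otimes>\<^bsub>UP B\<^esub> y) i = (CG.\<iota> p \<otimes>\<^bsub>UP G\<^esub> psym n y) i" .
qed

text \<open>The associated graded left ideal of \<open>L\<close>. One \<open>y\<close> must account
  for the part of degree \<open>n\<close> in all coefficients of \<open>u\<close> simultaneously,
  since homogeneity refers to the grading of \<open>G\<close> and not to the powers of
  \<open>X\<close>.\<close>

definition gr_ideal :: "(nat \<Rightarrow> 'b) set \<Rightarrow> (nat \<Rightarrow> nat \<Rightarrow> 'b set) set"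
  where "gr_ideal L = {u \<in> carrier (UP G). \<forall>n. \<exists>y\<in>L \<inter> PF n. \<forall>i. u i n = cls n (y i)}"

text \<open>In degree \<open>n\<close> the product is represented by \<open>b X^k\<close> times the
  representative of \<open>w\<close> in degree \<open>n - m\<close>; below degree \<open>m\<close>
  it vanishes.\<close>

lemma gr_ideal_monom_mult:
  assumes L: "left_ideal L (UP B)" and w: "w \<in> gr_ideal L" and b: "b \<in> F (int m)"
  shows "up_ring.monom (UP G) (sym m b) k \<otimes>\<^bsub>UP G\<^esub> w \<in> gr_ideal L"
proof -
  have wG: "w \<in> carrier (UP G)"
    using w by (simp add: gr_ideal_def)
  have bB: "b \<in> carrier B"
    using F_carrier[OF _ b] by simp
  have "\<exists>y\<in>L \<inter> PF n. \<forall>i. (up_ring.monom (UP G) (sym m b) k \<otimes>\<^bsub>UP G\<^esub> w) i n = cls n (y i)" for n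
  proof (cases "m \<le> n")
    case True
    obtain y where y: "y \<in> L" "y \<in> PF (n - m)" "\<And>i. w i (n - m) = cls (n - m) (y i)"
      using w unfolding gr_ideal_def by blast
    have mn: "m + (n - m) = n"
      using True by simp
    let ?z = "up_ring.monom (UP B) b k \<otimes>\<^bsub>UP B\<^esub> y"
    have zL: "?z \<in> L"
      using y(1) bB by (intro BP.left_ideal_mult[OF L]) auto
    have z: "?z i = (if k \<le> i then b \<otimes>\<^bsub>B\<^esub> y (i - k) else \<zero>\<^bsub>B\<^esub>)" for i
      by (rule B.monom_mult_apply[OF bB PF_carrier[OF y(2)]])
    have "?z i \<in> F (int n)" for i
      unfolding z using F_mult[OF _ _ b PF_coeff[OF y(2)], of "i - k"] True F_zero[of "int n"] by auto
    then have "?z \<in> L \<inter> PF n"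
      using zL BP.left_ideal_carrier[OF L zL] unfolding PF_def by blast
    moreover have "(up_ring.monom (UP G) (sym m b) k \<otimes>\<^bsub>UP G\<^esub> w) i n = cls n (?z i)" for i
    proof -
      have "rcoset_mult B (F (int n - 1)) (cls m b) (w (i - k) (n - m)) = cls n (b \<otimes>\<^bsub>B\<^esub> y (i - k))"
        unfolding y(3) using rcoset_mult_cls[OF b PF_coeff[OF y(2)], of "i - k"] by (simp only: mn)
      then show ?thesis
        unfolding z G.monom_mult_apply[OF sym_closed[OF b] wG]
        using True wG by (simp add: sym_mult_apply[OF b] gr_zero_apply cls_zero)
    qed
    ultimately show ?thesis
      by blast
  next
    case False
    have "(up_ring.monom (UP G) (sym m b) k \<otimes>\<^bsub>UP G\<^esub> w) i n = cls n (\<zero>\<^bsub>UP B\<^esub> i)" for i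
      unfolding G.monom_mult_apply[OF sym_closed[OF b] wG]
      using False wG by (simp add: sym_mult_apply[OF b] gr_zero_apply cls_zero UP_zero_apply)
    then show ?thesis
      using BP.left_ideal_zero[OF L] PF_zero by blast
  qed
  moreover have "up_ring.monom (UP G) (sym m b) k \<otimes>\<^bsub>UP G\<^esub> w \<in> carrier (UP G)"
    using sym_closed[OF b] wG by simp
  ultimately show ?thesis
    unfolding gr_ideal_def by blast
qed

lemma monom_add:
  assumes "a \<in> carrier G" "b \<in> carrier G"
  shows "up_ring.monom (UP G) (a \<oplus>\<^bsub>G\<^esub> b) k = up_ring.monom (UP G) a k \<oplus>\<^bsub>UP G\<^esub> up_ring.monom (UP G) b k"
proof
  fix i
  have "(up_ring.monom (UP G) a k \<oplus>\<^bsub>UP G\<^esub> up_ring.monom (UP G) b k) i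
      = up_ring.monom (UP G) a k i \<oplus>\<^bsub>G\<^esub> up_ring.monom (UP G) b k i"
    using assms by (intro UP_add_apply) auto
  then show "up_ring.monom (UP G) (a \<oplus>\<^bsub>G\<^esub> b) k i
      = (up_ring.monom (UP G) a k \<oplus>\<^bsub>UP G\<^esub> up_ring.monom (UP G) b k) i"
    using assms by (simp add: UP_monom_apply)
qed

lemma monom_zero: "up_ring.monom (UP G) \<zero>\<^bsub>G\<^esub> k = \<zero>\<^bsub>UP G\<^esub>"
  by (rule ext) (simp add: UP_monom_apply UP_zero_apply)

lemma UP_gr_induct [consumes 1, case_names zero add monom]:
  assumes u: "u \<in> carrier (UP G)"
    and zero: "Q \<zero>\<^bsub>UP G\<^esub>"
    and add: "\<And>u v. \<lbrakk>u \<in> carrier (UP G); v \<in> carrier (UP G); Q u; Q v\<rbrakk> \<Longrightarrow> Q (u \<oplus>\<^bsub>UP G\<^esub> v)"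
    and monom: "\<And>m b k. b \<in> F (int m) \<Longrightarrow> Q (up_ring.monom (UP G) (sym m b) k)"
  shows "Q u"
proof (rule G.UP_monom_induct[of u Q])
  fix i
  have "u i \<in> carrier G"
    using u by simp
  then show "Q (up_ring.monom (UP G) (u i) i)"
  proof (rule gr_induct[where Q = "\<lambda>a. Q (up_ring.monom (UP G) a i)"])
    show "Q (up_ring.monom (UP G) \<zero>\<^bsub>G\<^esub> i)"
      unfolding monom_zero by (rule zero)
    show "Q (up_ring.monom (UP G) (a \<oplus>\<^bsub>G\<^esub> b) i)"
      if "a \<in> carrier G" "b \<in> carrier G" "Q (up_ring.monom (UP G) a i)" "Q (up_ring.monom (UP G) b i)" for a b
      unfolding monom_add[OF that(1,2)] by (intro add that G.UP_monom_closed)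
  qed (rule monom)
qed (fact u zero add)+

lemma gr_ideal_left_ideal:
  assumes L: "left_ideal L (UP B)"
  shows "left_ideal (gr_ideal L) (UP G)"
proof (rule GP.left_idealI)
  show "gr_ideal L \<subseteq> carrier (UP G)"
    by (auto simp: gr_ideal_def)
  have "\<zero>\<^bsub>UP G\<^esub> i n = cls n (\<zero>\<^bsub>UP B\<^esub> i)" for i n
    by (simp add: UP_zero_apply gr_zero_apply cls_zero)
  then show zero: "\<zero>\<^bsub>UP G\<^esub> \<in> gr_ideal L"
    using BP.left_ideal_zero[OF L] PF_zero GP.zero_closed unfolding gr_ideal_def by blast
  show add: "u \<oplus>\<^bsub>UP G\<^esub> v \<in> gr_ideal L" if u: "u \<in> gr_ideal L" and v: "v \<in> gr_ideal L" for u v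
  proof -
    have uv: "u \<in> carrier (UP G)" "v \<in> carrier (UP G)"
      using u v by (simp_all add: gr_ideal_def)
    have "\<exists>y\<in>L \<inter> PF n. \<forall>i. (u \<oplus>\<^bsub>UP G\<^esub> v) i n = cls n (y i)" for n
    proof -
      obtain y z where yz: "y \<in> L" "y \<in> PF n" "z \<in> L" "z \<in> PF n"
        "\<And>i. u i n = cls n (y i)" "\<And>i. v i n = cls n (z i)"
        using u v unfolding gr_ideal_def by blast
      have "(u \<oplus>\<^bsub>UP G\<^esub> v) i n = cls n ((y \<oplus>\<^bsub>UP B\<^esub> z) i)" for i
        unfolding UP_add_apply[OF uv] UP_add_apply[OF PF_carrier[OF yz(2)] PF_carrier[OF yz(4)]]
          gr_add_apply yz(5,6)
        using PF_carrier[OF yz(2)] PF_carrier[OF yz(4)] by (intro cls_add) auto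
      then show ?thesis
        using BP.left_ideal_add[OF L yz(1,3)] PF_add[OF yz(2,4)] by blast
    qed
    then show ?thesis
      using uv GP.a_closed unfolding gr_ideal_def by blast
  qed
  fix a w assume a: "a \<in> carrier (UP G)" and w: "w \<in> gr_ideal L"
  have wG: "w \<in> carrier (UP G)"
    using w by (simp add: gr_ideal_def)
  from a show "a \<otimes>\<^bsub>UP G\<^esub> w \<in> gr_ideal L"
  proof (rule UP_gr_induct[where Q = "\<lambda>a. a \<otimes>\<^bsub>UP G\<^esub> w \<in> gr_ideal L"])
    show "\<zero>\<^bsub>UP G\<^esub> \<otimes>\<^bsub>UP G\<^esub> w \<in> gr_ideal L"
      unfolding GP.l_null[OF wG] by (rule zero)
    show "(u \<oplus>\<^bsub>UP G\<^esub> v) \<otimes>\<^bsub>UP G\<^esub> w \<in> gr_ideal L"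
      if "u \<in> carrier (UP G)" "v \<in> carrier (UP G)" "u \<otimes>\<^bsub>UP G\<^esub> w \<in> gr_ideal L" "v \<otimes>\<^bsub>UP G\<^esub> w \<in> gr_ideal L" for u v
      unfolding GP.l_distr[OF that(1,2) wG] by (intro add that)
  qed (rule gr_ideal_monom_mult[OF L w])
qed

text \<open>A homogeneous element has a single non-trivial degree, so membership amounts to one
  approximation of \<open>y\<close> from \<open>L\<close> modulo lower terms; in the other degrees
  the zero polynomial represents it.\<close>

lemma psym_gr_ideal_iff:
  assumes L: "left_ideal L (UP B)" and y: "y \<in> PF n"
  shows "psym n y \<in> gr_ideal L \<longleftrightarrow> (\<exists>z\<in>L \<inter> PF n. \<forall>i. y i \<ominus>\<^bsub>B\<^esub> z i \<in> F (int n - 1))"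
proof
  assume "psym n y \<in> gr_ideal L"
  then obtain z where z: "z \<in> L \<inter> PF n" "\<And>i. psym n y i n = cls n (z i)"
    unfolding gr_ideal_def by blast
  have "y i \<ominus>\<^bsub>B\<^esub> z i \<in> F (int n - 1)" for i
  proof -
    have "cls n (y i) = cls n (z i)"
      using z(2)[of i] by (simp add: psym_def sym_def)
    then show ?thesis
      using cls_eq_iff[of "y i" "z i" n] PF_carrier[OF y] PF_carrier[of z n] z(1) by auto
  qed
  then show "\<exists>z\<in>L \<inter> PF n. \<forall>i. y i \<ominus>\<^bsub>B\<^esub> z i \<in> F (int n - 1)"
    using z(1) by blast
next
  assume "\<exists>z\<in>L \<inter> PF n. \<forall>i. y i \<ominus>\<^bsub>B\<^esub> z i \<in> F (int n - 1)"
  then obtain z where z: "z \<in> L" "z \<in> PF n" "\<And>i. y i \<ominus>\<^bsub>B\<^esub> z i \<in> F (int n - 1)"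
    by blast
  have "\<exists>x\<in>L \<inter> PF m. \<forall>i. psym n y i m = cls m (x i)" for m
  proof (cases "m = n")
    case True
    have "psym n y i n = cls n (z i)" for i
      using z(3) cls_eq_iff[of "y i" "z i" n] PF_carrier[OF y] PF_carrier[OF z(2)]
      by (simp add: psym_def sym_def)
    then show ?thesis
      using z(1,2) True by blast
  next
    case False
    then have "psym n y i m = cls m (\<zero>\<^bsub>UP B\<^esub> i)" for i
      by (simp add: psym_def sym_def UP_zero_apply cls_zero)
    then show ?thesis
      using BP.left_ideal_zero[OF L] PF_zero by blast
  qed
  then show "psym n y \<in> gr_ideal L"
    using psym_closed[OF y] unfolding gr_ideal_def by blast
qed

lemma PF_lower:
  assumes "y \<in> carrier (UP B)" "\<And>i. y i \<in> F (int (Suc n) - 1)"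
  shows "y \<in> PF n"
  using assms by (simp add: PF_def)

text \<open>Passing to leading forms is injective along inclusions. An element of \<open>L'\<close>
  agrees with one of \<open>L\<close> up to a lower filtration step, the difference is again in
  \<open>L'\<close>, and the corrections end at \<open>F (-1) = {0}\<close>. This transfers the
  chain condition from \<open>G[X]\<close> to \<open>B[X]\<close>.\<close>

lemma gr_ideal_strict:
  assumes L: "left_ideal L (UP B)" and L': "left_ideal L' (UP B)" and sub: "L \<subseteq> L'"
    and gr: "gr_ideal L' = gr_ideal L"
  shows "L' = L"
proof -
  have "psym n y \<in> gr_ideal L" if "y \<in> L'" "y \<in> PF n" for n y
  proof -
    have "y i \<ominus>\<^bsub>B\<^esub> y i \<in> F (int n - 1)" for i
      using PF_carrier[OF that(2)] F_zero[of "int n - 1"] by (simp add: B.minus_eq B.r_neg)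
    then have "psym n y \<in> gr_ideal L'"
      using that unfolding psym_gr_ideal_iff[OF L' that(2)] by blast
    then show ?thesis
      by (simp add: gr)
  qed
  then have lift: "\<exists>z\<in>L \<inter> PF n. \<forall>i. y i \<ominus>\<^bsub>B\<^esub> z i \<in> F (int n - 1)" if "y \<in> L'" "y \<in> PF n" for n y
    using that psym_gr_ideal_iff[OF L that(2)] by blast
  have step: "\<exists>z\<in>L. y \<ominus>\<^bsub>UP B\<^esub> z \<in> L' \<and> (\<forall>i. (y \<ominus>\<^bsub>UP B\<^esub> z) i \<in> F (int n - 1))"
    if y: "y \<in> L'" "y \<in> PF n" for n y
  proof -
    obtain z where z: "z \<in> L" "z \<in> PF n" "\<forall>i. y i \<ominus>\<^bsub>B\<^esub> z i \<in> F (int n - 1)"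
      using lift[OF y] by blast
    have "(y \<ominus>\<^bsub>UP B\<^esub> z) i \<in> F (int n - 1)" for i
      unfolding B.UP_minus_apply[OF PF_carrier[OF y(2)] PF_carrier[OF z(2)]] using z(3) by blast
    moreover have "y \<ominus>\<^bsub>UP B\<^esub> z \<in> L'"
      using y(1) z(1) sub by (intro BP.left_ideal_minus[OF L']) auto
    ultimately show ?thesis
      using z(1) by blast
  qed
  have recombine: "y \<in> L" if "z \<in> L" "y \<ominus>\<^bsub>UP B\<^esub> z \<in> L" "y \<in> L'" for y z
  proof -
    have "(y \<ominus>\<^bsub>UP B\<^esub> z) \<oplus>\<^bsub>UP B\<^esub> z \<in> L"
      by (rule BP.left_ideal_add[OF L that(2,1)])
    moreover have "y \<in> carrier (UP B)" "z \<in> carrier (UP B)"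
      using that BP.left_ideal_carrier[OF L'] BP.left_ideal_carrier[OF L] by auto
    then have "(y \<ominus>\<^bsub>UP B\<^esub> z) \<oplus>\<^bsub>UP B\<^esub> z = y"
      by (simp add: BP.minus_eq BP.a_assoc BP.l_neg)
    ultimately show ?thesis
      by simp
  qed
  have "y \<in> L" if "y \<in> L'" "y \<in> PF n" for n y
    using that
  proof (induction n arbitrary: y)
    \<comment> \<open>In degree 0 the correction leaves coefficients in \<open>F (-1)\<close>, so
      the difference is zero.\<close>
    case 0
    then obtain z where z: "z \<in> L" "y \<ominus>\<^bsub>UP B\<^esub> z \<in> L'" "\<forall>i. (y \<ominus>\<^bsub>UP B\<^esub> z) i \<in> F (int 0 - 1)"
      using step by blast
    have "y \<ominus>\<^bsub>UP B\<^esub> z = \<zero>\<^bsub>UP B\<^esub>"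
    proof
      fix i show "(y \<ominus>\<^bsub>UP B\<^esub> z) i = \<zero>\<^bsub>UP B\<^esub> i"
        using z(3)[rule_format, of i] F_bottom by (simp add: UP_zero_apply)
    qed
    then have "y \<ominus>\<^bsub>UP B\<^esub> z \<in> L"
      using BP.left_ideal_zero[OF L] by (simp only:)
    then show ?case
      using recombine z(1) 0 by blast
  next
    case (Suc n)
    then obtain z where z: "z \<in> L" "y \<ominus>\<^bsub>UP B\<^esub> z \<in> L'" "\<forall>i. (y \<ominus>\<^bsub>UP B\<^esub> z) i \<in> F (int (Suc n) - 1)"
      using step by blast
    have "y \<ominus>\<^bsub>UP B\<^esub> z \<in> PF n"
      using BP.left_ideal_carrier[OF L' z(2)] z(3) by (intro PF_lower) auto
    then have "y \<ominus>\<^bsub>UP B\<^esub> z \<in> L"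
      by (rule Suc.IH[OF z(2)])
    then show ?case
      using recombine z(1) Suc.prems(1) by blast
  qed
  then have "L' \<subseteq> L"
    using PF_exhaust BP.left_ideal_carrier[OF L'] by blast
  then show ?thesis
    using sub by (rule subset_antisym)
qed

section \<open>The chain condition for \<open>B[X]\<close> and for \<open>B\<close>\<close>

lemma acc_BP: "left_acc (UP B)"
  unfolding left_acc_def
proof (intro allI impI)
  fix I :: "nat \<Rightarrow> (nat \<Rightarrow> 'b) set"
  assume *: "(\<forall>n. left_ideal (I n) (UP B)) \<and> (\<forall>n. I n \<subseteq> I (Suc n))"
  have I: "left_ideal (I n) (UP B)" and mono: "I n \<subseteq> I (Suc n)" for n
    using * by simp_all
  have gr_mono: "gr_ideal (I n) \<subseteq> gr_ideal (I (Suc n))" for n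
    unfolding gr_ideal_def using mono[of n] by blast
  have "\<exists>k. \<forall>n\<ge>k. gr_ideal (I n) = gr_ideal (I k)"
    using acc_GP gr_mono gr_ideal_left_ideal[OF I] unfolding left_acc_def by simp
  then obtain k where k: "\<forall>n\<ge>k. gr_ideal (I n) = gr_ideal (I k)" ..
  have "I n = I k" if "n \<ge> k" for n
    using I I B.chain_mono[of I, OF mono that] k[rule_format, OF that] by (rule gr_ideal_strict)
  then show "\<exists>k. \<forall>n\<ge>k. I n = I k"
    by blast
qed

text \<open>A left ideal of \<open>B\<close> is recovered from the polynomials with coefficients in
  it by looking at constants; so a chain in \<open>B\<close> is controlled by one in
  \<open>B[X]\<close>.\<close>

lemma acc_B: "left_acc B"
  unfolding left_acc_def
proof (intro allI impI)
  fix I :: "nat \<Rightarrow> 'b set"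
  assume *: "(\<forall>n. left_ideal (I n) B) \<and> (\<forall>n. I n \<subseteq> I (Suc n))"
  have I: "left_ideal (I n) B" and mono: "I n \<subseteq> I (Suc n)" for n
    using * by simp_all
  define J where "J n = {y \<in> carrier (UP B). \<forall>i. y i \<in> I n}" for n
  have "left_ideal (J n) (UP B)" for n
  proof (rule BP.left_idealI)
    show "J n \<subseteq> carrier (UP B)"
      by (auto simp: J_def)
    have "\<zero>\<^bsub>UP B\<^esub> i \<in> I n" for i
      unfolding UP_zero_apply by (rule B.left_ideal_zero[OF I])
    then show "\<zero>\<^bsub>UP B\<^esub> \<in> J n"
      unfolding J_def by blast
    fix x y assume xy: "x \<in> J n" "y \<in> J n"
    then have c: "x \<in> carrier (UP B)" "y \<in> carrier (UP B)"
      by (simp_all add: J_def)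
    have "(x \<oplus>\<^bsub>UP B\<^esub> y) i \<in> I n" for i
      unfolding UP_add_apply[OF c] using xy by (intro B.left_ideal_add[OF I]) (simp_all add: J_def)
    then show "x \<oplus>\<^bsub>UP B\<^esub> y \<in> J n"
      using c BP.a_closed unfolding J_def by blast
  next
    fix a x assume a: "a \<in> carrier (UP B)" and x: "x \<in> J n"
    then have c: "x \<in> carrier (UP B)"
      by (simp add: J_def)
    have "(a \<otimes>\<^bsub>UP B\<^esub> x) i \<in> I n" for i
      unfolding UP_mult_apply[OF a c] using a x
      by (intro B.left_ideal_finsum[OF I] B.left_ideal_mult[OF I]) (simp_all add: J_def)
    then show "a \<otimes>\<^bsub>UP B\<^esub> x \<in> J n"
      using a c BP.m_closed unfolding J_def by blast
  qed
  moreover have "J n \<subseteq> J (Suc n)" for n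
    unfolding J_def using mono[of n] by blast
  ultimately have "\<exists>k. \<forall>n\<ge>k. J n = J k"
    using acc_BP unfolding left_acc_def by simp
  then obtain k where k: "\<forall>n\<ge>k. J n = J k" ..
  have mem: "b \<in> I n \<longleftrightarrow> up_ring.monom (UP B) b 0 \<in> J n" if "b \<in> carrier B" for b n
  proof
    assume "b \<in> I n"
    then have "up_ring.monom (UP B) b 0 i \<in> I n" for i
      using B.left_ideal_zero[OF I] that by (simp add: UP_monom_apply)
    then show "up_ring.monom (UP B) b 0 \<in> J n"
      using that B.UP_monom_closed unfolding J_def by blast
  next
    assume "up_ring.monom (UP B) b 0 \<in> J n"
    then have "up_ring.monom (UP B) b 0 0 \<in> I n"
      unfolding J_def by blast
    then show "b \<in> I n"
      using that by (simp add: UP_monom_apply)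
  qed
  have "I n = I k" if "n \<ge> k" for n
  proof -
    have "b \<in> I n \<longleftrightarrow> b \<in> I k" if b: "b \<in> carrier B" for b
      unfolding mem[OF b] k[rule_format, OF \<open>n \<ge> k\<close>] ..
    then show ?thesis
      using B.left_ideal_carrier[OF I] by blast
  qed
  then show "\<exists>k. \<forall>n\<ge>k. I n = I k"
    by blast
qed

end

section \<open>Maximal left ideals of the polynomial ring\<close>

context noetherian_filtered_algebra
begin

text \<open>Supplies a non-unit that is coprime to \<open>f\<close>: the identity
  \<open>1 = p - X f\<close> gives coprimality, and the positive degree of \<open>p\<close> excludes
  an inverse, over finite fields too.\<close>

lemma one_plus_X_mult:
  assumes f: "f \<in> carrier (UP K)" "f \<noteq> \<zero>\<^bsub>UP K\<^esub>"
    and p: "p = \<one>\<^bsub>UP K\<^esub> \<oplus>\<^bsub>UP K\<^esub> up_ring.monom (UP K) \<one>\<^bsub>K\<^esub> 1 \<otimes>\<^bsub>UP K\<^esub> f"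
  shows "p \<in> carrier (UP K)" "p \<noteq> \<zero>\<^bsub>UP K\<^esub>" "\<And>c. c \<in> carrier (UP K) \<Longrightarrow> p \<otimes>\<^bsub>UP K\<^esub> c \<noteq> \<one>\<^bsub>UP K\<^esub>"
proof -
  interpret U: UP_domain K "UP K"
    by unfold_locales
  have m: "up_ring.monom (UP K) \<one>\<^bsub>K\<^esub> 1 \<in> carrier (UP K)"
    by (intro K.UP_monom_closed) simp
  then show p_cl: "p \<in> carrier (UP K)"
    unfolding p using f(1) by simp
  have "p (Suc (deg K f)) = \<one>\<^bsub>UP K\<^esub> (Suc (deg K f)) \<oplus>\<^bsub>K\<^esub> (up_ring.monom (UP K) \<one>\<^bsub>K\<^esub> 1 \<otimes>\<^bsub>UP K\<^esub> f) (Suc (deg K f))"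
    unfolding p using m f(1) by (intro UP_add_apply) auto
  also have "\<dots> = f (deg K f)"
    using f(1) K.monom_mult_apply[OF K.one_closed f(1), of 1 "Suc (deg K f)"] by (simp add: UP_one_apply)
  also have "\<dots> \<noteq> \<zero>\<^bsub>K\<^esub>"
    using U.lcoeff_nonzero[OF f(2,1)] f(1) by simp
  finally have nz: "p (Suc (deg K f)) \<noteq> \<zero>\<^bsub>K\<^esub>" .
  then show p_nz: "p \<noteq> \<zero>\<^bsub>UP K\<^esub>"
    by (metis UP_zero_apply)
  have "Suc (deg K f) \<le> deg K p"
    using nz U.deg_aboveD[OF _ p_cl, of "Suc (deg K f)"] p_cl by (metis coeff_UP not_le)
  then show "p \<otimes>\<^bsub>UP K\<^esub> c \<noteq> \<one>\<^bsub>UP K\<^esub>" if c: "c \<in> carrier (UP K)" for c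
  proof -
    have "deg K p + deg K c = 0" if eq: "p \<otimes>\<^bsub>UP K\<^esub> c = \<one>\<^bsub>UP K\<^esub>"
    proof -
      have "c \<noteq> \<zero>\<^bsub>UP K\<^esub>"
        using eq p_cl KP.r_null[OF p_cl] KP.one_not_zero by metis
      then show ?thesis
        using U.deg_mult[OF p_nz _ p_cl c] U.deg_one unfolding eq by simp
    qed
    then show ?thesis
      using \<open>Suc (deg K f) \<le> deg K p\<close> by linarith
  qed
qed

text \<open>If no non-zero scalar lies in \<open>L\<close>, the module \<open>N = B[X]/L\<close> is torsion-free and divisible over
  \<open>K[X]\<close>. Let \<open>f\<close> kill the torsion of the associated graded module and put \<open>p = 1 + X f\<close>. For \<open>z\<close> in
  \<open>N\<^sub>0\<close> (the image of \<open>F 0 [X]\<close>), the solution \<open>y\<close> of \<open>p y = z\<close> lies in \<open>N\<^sub>0\<close> again, because its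
  leading form is killed by \<open>p\<close>, hence by \<open>f\<close> and by \<open>1 = p - X f\<close>. But \<open>N\<^sub>0\<close> is a non-zero finitely
  generated free \<open>K[X]\<close>-module, so \<open>p\<close> would be a unit.\<close>

lemma scalar_division_in_F0:
  assumes L: "left_ideal L (UP B)"
    and div: "\<And>h z. \<lbrakk>h \<in> carrier (UP K); h \<noteq> \<zero>\<^bsub>UP K\<^esub>; z \<in> carrier (UP B)\<rbrakk>
      \<Longrightarrow> \<exists>y\<in>carrier (UP B). z \<ominus>\<^bsub>UP B\<^esub> CB.\<iota> h \<otimes>\<^bsub>UP B\<^esub> y \<in> L"
  shows "\<exists>p\<in>carrier (UP K). (\<forall>c\<in>carrier (UP K). p \<otimes>\<^bsub>UP K\<^esub> c \<noteq> \<one>\<^bsub>UP K\<^esub>) \<and>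
    (\<forall>z\<in>PF 0. \<exists>y\<in>PF 0. z \<ominus>\<^bsub>UP B\<^esub> CB.\<iota> p \<otimes>\<^bsub>UP B\<^esub> y \<in> L)"
proof -
  let ?J = "gr_ideal L"
  have J: "left_ideal ?J (UP G)"
    by (rule gr_ideal_left_ideal[OF L])
  obtain f where f: "f \<in> carrier (UP K)" "f \<noteq> \<zero>\<^bsub>UP K\<^esub>"
    and tors: "\<And>a u. \<lbrakk>a \<in> carrier (UP K); u \<in> carrier (UP G); a \<noteq> \<zero>\<^bsub>UP K\<^esub>; CG.\<iota> a \<otimes>\<^bsub>UP G\<^esub> u \<in> ?J\<rbrakk>
      \<Longrightarrow> CG.\<iota> f \<otimes>\<^bsub>UP G\<^esub> u \<in> ?J"
    using CGP.torsion_bound[OF KP.domain_axioms acc_GP J] by metis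
  define x where "x = up_ring.monom (UP K) \<one>\<^bsub>K\<^esub> 1"
  define p where "p = \<one>\<^bsub>UP K\<^esub> \<oplus>\<^bsub>UP K\<^esub> x \<otimes>\<^bsub>UP K\<^esub> f"
  have x: "x \<in> carrier (UP K)"
    unfolding x_def by (intro K.UP_monom_closed) simp
  have p: "p \<in> carrier (UP K)" "p \<noteq> \<zero>\<^bsub>UP K\<^esub>" "\<And>c. c \<in> carrier (UP K) \<Longrightarrow> p \<otimes>\<^bsub>UP K\<^esub> c \<noteq> \<one>\<^bsub>UP K\<^esub>"
    using one_plus_X_mult[OF f, of p] unfolding p_def x_def by blast+
  have absorb: "u \<in> ?J" if u: "u \<in> carrier (UP G)" and pu: "CG.\<iota> p \<otimes>\<^bsub>UP G\<^esub> u \<in> ?J" for u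
  proof -
    have fu: "CG.\<iota> f \<otimes>\<^bsub>UP G\<^esub> u \<in> ?J"
      by (rule tors[OF p(1) u p(2) pu])
    have "CG.\<iota> p \<otimes>\<^bsub>UP G\<^esub> u = u \<oplus>\<^bsub>UP G\<^esub> CG.\<iota> x \<otimes>\<^bsub>UP G\<^esub> (CG.\<iota> f \<otimes>\<^bsub>UP G\<^esub> u)"
      unfolding p_def using x f(1) u
      by (simp add: ring_hom_add[OF CG.\<iota>_hom] ring_hom_mult[OF CG.\<iota>_hom] ring_hom_one[OF CG.\<iota>_hom]
          GP.l_distr GP.m_assoc)
    moreover have xfu: "CG.\<iota> x \<otimes>\<^bsub>UP G\<^esub> (CG.\<iota> f \<otimes>\<^bsub>UP G\<^esub> u) \<in> ?J"
      by (rule GP.left_ideal_mult[OF J CG.\<iota>_closed[OF x] fu])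
    ultimately have "(u \<oplus>\<^bsub>UP G\<^esub> CG.\<iota> x \<otimes>\<^bsub>UP G\<^esub> (CG.\<iota> f \<otimes>\<^bsub>UP G\<^esub> u))
        \<ominus>\<^bsub>UP G\<^esub> CG.\<iota> x \<otimes>\<^bsub>UP G\<^esub> (CG.\<iota> f \<otimes>\<^bsub>UP G\<^esub> u) \<in> ?J"
      using pu by (intro GP.left_ideal_minus[OF J]) simp_all
    then show ?thesis
      using u x f(1) by (simp add: GP.minus_eq GP.a_assoc GP.r_neg)
  qed
  have descend: "\<exists>y\<in>PF 0. z \<ominus>\<^bsub>UP B\<^esub> CB.\<iota> p \<otimes>\<^bsub>UP B\<^esub> y \<in> L"
    if z: "z \<in> PF 0" and "y \<in> PF n" "z \<ominus>\<^bsub>UP B\<^esub> CB.\<iota> p \<otimes>\<^bsub>UP B\<^esub> y \<in> L" for z y n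
    using that(2,3)
  proof (induction n arbitrary: y)
    case 0
    then show ?case
      by blast
  next
    case (Suc n)
    note y = Suc.prems(1)
    have yB: "y \<in> carrier (UP B)" and zB: "z \<in> carrier (UP B)"
      using y z by (simp_all add: PF_carrier)
    let ?py = "CB.\<iota> p \<otimes>\<^bsub>UP B\<^esub> y"
    have py: "?py \<in> PF (Suc n)"
      by (rule PF_scalar_mult[OF p(1) y])
    have pyB: "?py \<in> carrier (UP B)"
      by (rule PF_carrier[OF py])
    have zn: "z i \<in> F (int (Suc n) - 1)" for i
      using PF_coeff[OF z, of i] F_mono[of 0 "int n"] by auto
    have "z \<in> PF (Suc n)"
      using zB PF_coeff[OF z] F_mono[of 0 "int (Suc n)"] unfolding PF_def by auto
    then have w: "?py \<ominus>\<^bsub>UP B\<^esub> z \<in> PF (Suc n)"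
      by (rule PF_minus[OF py])
    have "?py \<ominus>\<^bsub>UP B\<^esub> z = \<ominus>\<^bsub>UP B\<^esub> (z \<ominus>\<^bsub>UP B\<^esub> ?py)"
      using zB pyB by (simp add: BP.minus_eq BP.minus_add BP.a_comm)
    then have wL: "?py \<ominus>\<^bsub>UP B\<^esub> z \<in> L"
      using BP.left_ideal_uminus[OF L Suc.prems(2)] by simp
    \<comment> \<open>The element \<open>z\<close> has filtration degree 0, below
      \<open>Suc n\<close>, so in degree \<open>Suc n\<close> the leading form of \<open>p y\<close>
      is that of \<open>p y - z\<close>, which belongs to \<open>L\<close>.\<close>
    have "?py i \<ominus>\<^bsub>B\<^esub> (?py \<ominus>\<^bsub>UP B\<^esub> z) i \<in> F (int (Suc n) - 1)" for i
    proof -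
      have "?py i \<ominus>\<^bsub>B\<^esub> (?py \<ominus>\<^bsub>UP B\<^esub> z) i = z i"
        unfolding B.UP_minus_apply[OF pyB zB] using pyB zB
        by (simp add: B.minus_eq B.minus_add B.r_neg2 B.a_assoc[symmetric] B.r_neg)
      then show ?thesis
        using zn by (simp only:)
    qed
    then have "psym (Suc n) ?py \<in> ?J"
      unfolding psym_gr_ideal_iff[OF L py] using w wL by blast
    then have "psym (Suc n) y \<in> ?J"
      unfolding psym_scalar_mult[OF p(1) y] by (rule absorb[OF psym_closed[OF y]])
    then obtain y1 where y1: "y1 \<in> L" "y1 \<in> PF (Suc n)" "\<And>i. y i \<ominus>\<^bsub>B\<^esub> y1 i \<in> F (int (Suc n) - 1)"
      unfolding psym_gr_ideal_iff[OF L y] by blast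
    have y1B: "y1 \<in> carrier (UP B)"
      by (rule PF_carrier[OF y1(2)])
    \<comment> \<open>Correcting \<open>y\<close> by \<open>y1 \<in> L\<close> lowers its filtration
      degree and changes \<open>z - p y\<close> only by an element of \<open>L\<close>.\<close>
    have "y \<ominus>\<^bsub>UP B\<^esub> y1 \<in> PF n"
    proof (rule PF_lower)
      show "y \<ominus>\<^bsub>UP B\<^esub> y1 \<in> carrier (UP B)"
        using yB y1B by simp
      show "(y \<ominus>\<^bsub>UP B\<^esub> y1) i \<in> F (int (Suc n) - 1)" for i
        unfolding B.UP_minus_apply[OF yB y1B] by (rule y1(3))
    qed
    moreover have "z \<ominus>\<^bsub>UP B\<^esub> CB.\<iota> p \<otimes>\<^bsub>UP B\<^esub> (y \<ominus>\<^bsub>UP B\<^esub> y1) \<in> L"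
    proof -
      have "CB.\<iota> p \<otimes>\<^bsub>UP B\<^esub> y1 \<in> L"
        using p(1) y1(1) by (intro BP.left_ideal_mult[OF L]) auto
      then have "(z \<ominus>\<^bsub>UP B\<^esub> ?py) \<oplus>\<^bsub>UP B\<^esub> CB.\<iota> p \<otimes>\<^bsub>UP B\<^esub> y1 \<in> L"
        by (rule BP.left_ideal_add[OF L Suc.prems(2)])
      moreover have "(z \<ominus>\<^bsub>UP B\<^esub> ?py) \<oplus>\<^bsub>UP B\<^esub> CB.\<iota> p \<otimes>\<^bsub>UP B\<^esub> y1 = z \<ominus>\<^bsub>UP B\<^esub> CB.\<iota> p \<otimes>\<^bsub>UP B\<^esub> (y \<ominus>\<^bsub>UP B\<^esub> y1)"
        using p(1) yB y1B zB
        by (simp add: BP.minus_eq BP.r_distr BP.r_minus BP.minus_add BP.a_assoc)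
      ultimately show ?thesis
        by (simp only:)
    qed
    ultimately show ?case
      by (rule Suc.IH)
  qed
  have "\<exists>y\<in>PF 0. z \<ominus>\<^bsub>UP B\<^esub> CB.\<iota> p \<otimes>\<^bsub>UP B\<^esub> y \<in> L" if z: "z \<in> PF 0" for z
  proof -
    obtain y where y: "y \<in> carrier (UP B)" "z \<ominus>\<^bsub>UP B\<^esub> CB.\<iota> p \<otimes>\<^bsub>UP B\<^esub> y \<in> L"
      using div[OF p(1,2) PF_carrier[OF z]] by blast
    obtain n where "y \<in> PF n"
      using PF_exhaust[OF y(1)] by blast
    then show ?thesis
      using y(2) by (rule descend[OF z])
  qed
  then show ?thesis
    using p(1,3) by blast
qed

lemma F_span:
  obtains S where "finite S" "S \<subseteq> F (int n)"
    "\<And>b. b \<in> F (int n) \<Longrightarrow> \<exists>c\<in>S \<rightarrow> carrier K. b = (\<Oplus>\<^bsub>B\<^esub>s\<in>S. c s \<odot>\<^bsub>B\<^esub> s)"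
proof -
  have "\<exists>S. finite S \<and> S \<subseteq> F (int n) \<and> F (int n) = submodule_gen K B S"
    using F_finite unfolding locally_finite_def by simp
  then obtain S where S: "finite S" "S \<subseteq> F (int n)" "F (int n) = submodule_gen K B S"
    by (elim exE conjE)
  have "S \<subseteq> carrier B"
    using S(2) F_subset[of "int n"] by auto
  then show ?thesis
    using that[OF S(1,2)] KB.submodule_gen_lincomb[OF S(1)] S(3) by blast
qed

text \<open>The common source of both consequences. Torsion-freeness modulo \<open>L\<close> makes
  \<open>L\<close> saturated, so that \<open>F 0 [X]\<close> has a finite basis modulo
  \<open>L\<close>; divisibility lets \<open>scalar_division_in_F0\<close> divide a basis element by
  a non-unit.\<close>

theorem maximal_left_ideal_meets_scalars:
  assumes max: "maximal_left_ideal L (UP B)"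
  shows "\<exists>h\<in>carrier (UP K). h \<noteq> \<zero>\<^bsub>UP K\<^esub> \<and> CB.\<iota> h \<in> L"
proof (rule ccontr)
  assume no: "\<not> ?thesis"
  have L: "left_ideal L (UP B)" and one: "\<one>\<^bsub>UP B\<^esub> \<notin> L"
    using max by (simp_all add: maximal_left_ideal_def)
  have coprime: "\<exists>r\<in>carrier (UP B). \<exists>l\<in>L. \<one>\<^bsub>UP B\<^esub> = r \<otimes>\<^bsub>UP B\<^esub> x \<oplus>\<^bsub>UP B\<^esub> l"
    if "x \<in> carrier (UP B)" "x \<notin> L" for x
    using max that by (simp add: maximal_left_ideal_def)
  note Lc = BP.left_ideal_carrier[OF L]
  \<comment> \<open>An element \<open>y\<close> outside \<open>L\<close> generates
    \<open>B[X]\<close> modulo \<open>L\<close>; as \<open>h\<close> is central,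
    \<open>h y \<in> L\<close> would then put \<open>h\<close> itself into \<open>L\<close>.\<close>
  have torsion_free: "y \<in> L"
    if h: "h \<in> carrier (UP K)" "h \<noteq> \<zero>\<^bsub>UP K\<^esub>" and y: "y \<in> carrier (UP B)" "CB.\<iota> h \<otimes>\<^bsub>UP B\<^esub> y \<in> L" for h y
  proof (rule ccontr)
    assume "y \<notin> L"
    then obtain r l where rl: "r \<in> carrier (UP B)" "l \<in> L" "\<one>\<^bsub>UP B\<^esub> = r \<otimes>\<^bsub>UP B\<^esub> y \<oplus>\<^bsub>UP B\<^esub> l"
      using coprime[OF y(1)] by blast
    have "CB.\<iota> h = CB.\<iota> h \<otimes>\<^bsub>UP B\<^esub> (r \<otimes>\<^bsub>UP B\<^esub> y \<oplus>\<^bsub>UP B\<^esub> l)"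
      unfolding rl(3)[symmetric] using h(1) by simp
    also have "\<dots> = (CB.\<iota> h \<otimes>\<^bsub>UP B\<^esub> r) \<otimes>\<^bsub>UP B\<^esub> y \<oplus>\<^bsub>UP B\<^esub> CB.\<iota> h \<otimes>\<^bsub>UP B\<^esub> l"
      using h(1) rl(1,2) y(1) Lc by (simp add: BP.r_distr BP.m_assoc)
    also have "\<dots> = r \<otimes>\<^bsub>UP B\<^esub> (CB.\<iota> h \<otimes>\<^bsub>UP B\<^esub> y) \<oplus>\<^bsub>UP B\<^esub> CB.\<iota> h \<otimes>\<^bsub>UP B\<^esub> l"
      unfolding CB.\<iota>_central[OF h(1) rl(1)] using h(1) rl(1) y(1) by (simp add: BP.m_assoc)
    also have "\<dots> \<in> L"
      by (rule BP.left_ideal_add[OF L BP.left_ideal_mult[OF L rl(1) y(2)]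
            BP.left_ideal_mult[OF L CB.\<iota>_closed[OF h(1)] rl(2)]])
    finally show False
      using no h by blast
  qed
  \<comment> \<open>From \<open>1 = r h + l\<close> follows \<open>z = z r h + z l\<close>, and
    centrality moves \<open>h\<close> to the front of \<open>z r\<close>.\<close>
  have div: "\<exists>y\<in>carrier (UP B). z \<ominus>\<^bsub>UP B\<^esub> CB.\<iota> h \<otimes>\<^bsub>UP B\<^esub> y \<in> L"
    if h: "h \<in> carrier (UP K)" "h \<noteq> \<zero>\<^bsub>UP K\<^esub>" and z: "z \<in> carrier (UP B)" for h z
  proof -
    have "CB.\<iota> h \<notin> L"
      using no h by blast
    then obtain r l where rl: "r \<in> carrier (UP B)" "l \<in> L" "\<one>\<^bsub>UP B\<^esub> = r \<otimes>\<^bsub>UP B\<^esub> CB.\<iota> h \<oplus>\<^bsub>UP B\<^esub> l"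
      using coprime[of "CB.\<iota> h"] h(1) by auto
    have zr: "z \<otimes>\<^bsub>UP B\<^esub> r \<in> carrier (UP B)"
      using z rl(1) by simp
    have "z = z \<otimes>\<^bsub>UP B\<^esub> (r \<otimes>\<^bsub>UP B\<^esub> CB.\<iota> h \<oplus>\<^bsub>UP B\<^esub> l)"
      unfolding rl(3)[symmetric] using z by simp
    also have "\<dots> = (z \<otimes>\<^bsub>UP B\<^esub> r) \<otimes>\<^bsub>UP B\<^esub> CB.\<iota> h \<oplus>\<^bsub>UP B\<^esub> z \<otimes>\<^bsub>UP B\<^esub> l"
      using h(1) rl(1,2) z Lc by (simp add: BP.r_distr BP.m_assoc)
    also have "\<dots> = z \<otimes>\<^bsub>UP B\<^esub> l \<oplus>\<^bsub>UP B\<^esub> CB.\<iota> h \<otimes>\<^bsub>UP B\<^esub> (z \<otimes>\<^bsub>UP B\<^esub> r)"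
      unfolding CB.\<iota>_central[OF h(1) zr] using h(1) rl(2) z zr Lc by (intro BP.a_comm) auto
    finally have eq: "z = z \<otimes>\<^bsub>UP B\<^esub> l \<oplus>\<^bsub>UP B\<^esub> CB.\<iota> h \<otimes>\<^bsub>UP B\<^esub> (z \<otimes>\<^bsub>UP B\<^esub> r)" .
    have "z \<ominus>\<^bsub>UP B\<^esub> CB.\<iota> h \<otimes>\<^bsub>UP B\<^esub> (z \<otimes>\<^bsub>UP B\<^esub> r) = z \<otimes>\<^bsub>UP B\<^esub> l"
      using h(1) rl(2) z zr Lc
      by (subst eq) (simp add: BP.minus_eq BP.a_assoc BP.r_neg)
    then show ?thesis
      using z rl(2) zr BP.left_ideal_mult[OF L] by (intro bexI[of _ "z \<otimes>\<^bsub>UP B\<^esub> r"]) auto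
  qed
  obtain p where p: "p \<in> carrier (UP K)" "\<And>c. c \<in> carrier (UP K) \<Longrightarrow> p \<otimes>\<^bsub>UP K\<^esub> c \<noteq> \<one>\<^bsub>UP K\<^esub>"
    and pdiv: "\<And>z. z \<in> PF 0 \<Longrightarrow> \<exists>y\<in>PF 0. z \<ominus>\<^bsub>UP B\<^esub> CB.\<iota> p \<otimes>\<^bsub>UP B\<^esub> y \<in> L"
    using scalar_division_in_F0[OF L div] by blast
  obtain S0 where S0: "finite S0" "S0 \<subseteq> F (int 0)"
    "\<And>b. b \<in> F (int 0) \<Longrightarrow> \<exists>c\<in>S0 \<rightarrow> carrier K. b = (\<Oplus>\<^bsub>B\<^esub>s\<in>S0. c s \<odot>\<^bsub>B\<^esub> s)"
    using F_span[of 0] by blast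
  have S0B: "S0 \<subseteq> carrier B"
    using S0(2) F_subset[of "int 0"] by auto
  interpret R: left_module "UP B" "regular_module (UP B)"
    by (rule BP.left_module_regular_module)
  let ?V = "restrict_scalars CB.\<iota> (regular_module (UP B))"
  have V: "module (UP K) ?V"
    by (rule R.restrict_scalars_module[OF KP.is_cring CB.\<iota>_hom])
  interpret V: left_module "UP K" ?V
    by (rule module_imp_left_module[OF V])
  have LV: "submodule L (UP K) ?V"
    unfolding V.submodule_iff using L BP.left_ideal_iff by auto
  have PFV: "submodule (PF 0) (UP K) ?V"
    unfolding V.submodule_iff using PF_carrier PF_zero PF_add PF_scalar_mult by auto
  \<comment> \<open>Constants from a finite spanning set of \<open>F 0\<close> over
    \<open>K\<close>; they generate \<open>F 0 [X]\<close> over \<open>K[X]\<close>.\<close>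
  let ?Z = "(\<lambda>s. up_ring.monom (UP B) s 0) ` S0"
  have ZPF: "?Z \<subseteq> PF 0"
  proof
    fix y assume "y \<in> ?Z"
    then obtain s where s: "s \<in> S0" "y = up_ring.monom (UP B) s 0"
      by blast
    have "s \<in> carrier B"
      using s(1) S0B by blast
    then have "y i \<in> F (int 0)" for i
      unfolding s(2) using s(1) S0(2) F_zero[of 0] by (auto simp: UP_monom_apply)
    moreover have "y \<in> carrier (UP B)"
      using s S0B by auto
    ultimately show "y \<in> PF 0"
      unfolding PF_def by blast
  qed
  have Z: "finite ?Z" "?Z \<subseteq> carrier ?V"
    using S0(1) ZPF PF_carrier by auto
  let ?W = "submodule_gen (UP K) ?V ?Z"
  have W: "submodule ?W (UP K) ?V"
    by (rule V.submodule_submodule_gen[OF Z(2)])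
  have PFW: "y \<in> ?W" if y: "y \<in> PF 0" for y
  proof -
    have "\<exists>q\<in>S0 \<rightarrow> carrier (UP K). y = (\<Oplus>\<^bsub>UP B\<^esub>s\<in>S0. CB.\<iota> (q s) \<otimes>\<^bsub>UP B\<^esub> up_ring.monom (UP B) s 0)"
    proof (rule CB.polynomial_span[OF S0(1) S0B])
      show "y \<in> carrier (UP B)" "\<And>i. y i \<in> F (int 0)"
        using y by (simp_all add: PF_def)
      fix b assume "b \<in> F (int 0)"
      then obtain c where c: "c \<in> S0 \<rightarrow> carrier K" "b = (\<Oplus>\<^bsub>B\<^esub>s\<in>S0. c s \<odot>\<^bsub>B\<^esub> s)"
        using S0(3) by blast
      have "(\<Oplus>\<^bsub>B\<^esub>s\<in>S0. c s \<odot>\<^bsub>B\<^esub> s) = (\<Oplus>\<^bsub>B\<^esub>s\<in>S0. c s \<odot>\<^bsub>B\<^esub> \<one>\<^bsub>B\<^esub> \<otimes>\<^bsub>B\<^esub> s)"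
      proof (intro B.finsum_cong' refl)
        show "(\<lambda>s. c s \<odot>\<^bsub>B\<^esub> \<one>\<^bsub>B\<^esub> \<otimes>\<^bsub>B\<^esub> s) \<in> S0 \<rightarrow> carrier B"
          using c(1) S0B by (auto simp: Pi_iff subset_iff)
        fix s assume "s \<in> S0"
        then show "c s \<odot>\<^bsub>B\<^esub> s = c s \<odot>\<^bsub>B\<^esub> \<one>\<^bsub>B\<^esub> \<otimes>\<^bsub>B\<^esub> s"
          using c(1) S0B by (intro smult_eq_mult) auto
      qed
      then show "\<exists>c\<in>S0 \<rightarrow> carrier K. b = (\<Oplus>\<^bsub>B\<^esub>s\<in>S0. c s \<odot>\<^bsub>B\<^esub> \<one>\<^bsub>B\<^esub> \<otimes>\<^bsub>B\<^esub> s)"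
        using c by blast
    qed
    then obtain q where q: "q \<in> S0 \<rightarrow> carrier (UP K)"
      "y = (\<Oplus>\<^bsub>?V\<^esub>s\<in>S0. q s \<odot>\<^bsub>?V\<^esub> up_ring.monom (UP B) s 0)"
      by auto
    have "q s \<odot>\<^bsub>?V\<^esub> up_ring.monom (UP B) s 0 \<in> ?W" if "s \<in> S0" for s
      using that q(1) V.subset_submodule_gen[of ?Z] by (intro V.submodule_smult[OF W]) auto
    then show ?thesis
      unfolding q(2) by (intro V.submodule_finsum[OF W])
  qed
  have WPF: "y \<in> PF 0" if "y \<in> ?W" for y
    using that V.submodule_gen_minimal[OF PFV ZPF] by blast
  have "\<exists>S. finite S \<and> S \<subseteq> ?W \<and>
      (\<forall>w\<in>?W. \<exists>c\<in>S \<rightarrow> carrier (UP K). w \<ominus>\<^bsub>?V\<^esub> (\<Oplus>\<^bsub>?V\<^esub>s\<in>S. c s \<odot>\<^bsub>?V\<^esub> s) \<in> L) \<and>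
      (\<forall>c\<in>S \<rightarrow> carrier (UP K). (\<Oplus>\<^bsub>?V\<^esub>s\<in>S. c s \<odot>\<^bsub>?V\<^esub> s) \<in> L \<longrightarrow> (\<forall>s\<in>S. c s = \<zero>\<^bsub>UP K\<^esub>))"
  proof (rule euclidean_basis_modulo[OF K.UP_euclidean V LV _ Z])
    fix a x assume "a \<in> carrier (UP K)" "a \<noteq> \<zero>\<^bsub>UP K\<^esub>" "x \<in> carrier ?V" "a \<odot>\<^bsub>?V\<^esub> x \<in> L"
    then show "x \<in> L"
      using torsion_free by simp
  qed
  then obtain S where S: "finite S" "S \<subseteq> ?W"
    and span: "\<forall>w\<in>?W. \<exists>c\<in>S \<rightarrow> carrier (UP K). w \<ominus>\<^bsub>?V\<^esub> (\<Oplus>\<^bsub>?V\<^esub>s\<in>S. c s \<odot>\<^bsub>?V\<^esub> s) \<in> L"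
    and ind: "\<forall>c\<in>S \<rightarrow> carrier (UP K). (\<Oplus>\<^bsub>?V\<^esub>s\<in>S. c s \<odot>\<^bsub>?V\<^esub> s) \<in> L \<longrightarrow> (\<forall>s\<in>S. c s = \<zero>\<^bsub>UP K\<^esub>)"
    by (elim exE conjE)
  have SV: "S \<subseteq> carrier ?V"
    by (rule subset_trans[OF S(2) V.submodule_subset[OF W]])
  \<comment> \<open>An empty basis would make \<open>\<one>\<close>, which lies in
    \<open>F 0\<close>, congruent to 0 modulo \<open>L\<close>.\<close>
  have "S \<noteq> {}"
  proof
    assume "S = {}"
    have "\<one>\<^bsub>UP B\<^esub> i \<in> F (int 0)" for i
      using F_one F_zero[of 0] by (simp add: UP_one_apply)
    then have "\<one>\<^bsub>UP B\<^esub> \<in> PF 0"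
      unfolding PF_def using BP.one_closed by blast
    from span[rule_format, OF PFW[OF this]] obtain c
      where "\<one>\<^bsub>UP B\<^esub> \<ominus>\<^bsub>?V\<^esub> (\<Oplus>\<^bsub>?V\<^esub>s\<in>S. c s \<odot>\<^bsub>?V\<^esub> s) \<in> L"
      by (elim bexE)
    then have "\<one>\<^bsub>UP B\<^esub> \<ominus>\<^bsub>UP B\<^esub> \<zero>\<^bsub>UP B\<^esub> \<in> L"
      unfolding \<open>S = {}\<close> by simp
    then show False
      using one by (simp add: BP.minus_eq)
  qed
  then obtain s where s: "s \<in> S"
    by blast
  obtain y where y: "y \<in> PF 0" "s \<ominus>\<^bsub>UP B\<^esub> CB.\<iota> p \<otimes>\<^bsub>UP B\<^esub> y \<in> L"
    using pdiv[OF WPF[OF subsetD[OF S(2) s]]] by (elim bexE)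
  obtain c where c: "c \<in> S \<rightarrow> carrier (UP K)" "y \<ominus>\<^bsub>?V\<^esub> (\<Oplus>\<^bsub>?V\<^esub>t\<in>S. c t \<odot>\<^bsub>?V\<^esub> t) \<in> L"
    using span[rule_format, OF PFW[OF y(1)]] by (elim bexE)
  \<comment> \<open>Modulo \<open>L\<close> the basis element \<open>s\<close> equals
    \<open>p y\<close>, and \<open>y\<close> is the combination with coefficients \<open>c\<close>.
    So the combination with coefficients \<open>d\<close> is zero modulo \<open>L\<close>;
    independence at \<open>s\<close> gives \<open>p c_s = 1\<close>, although \<open>p\<close> is no
    unit.\<close>
  define d where "d t = (if s = t then \<one>\<^bsub>UP K\<^esub> else \<zero>\<^bsub>UP K\<^esub>) \<ominus>\<^bsub>UP K\<^esub> p \<otimes>\<^bsub>UP K\<^esub> c t" for t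
  have d: "d \<in> S \<rightarrow> carrier (UP K)"
    using c(1) p(1) by (auto simp: d_def Pi_iff)
  let ?lc = "\<Oplus>\<^bsub>?V\<^esub>t\<in>S. c t \<odot>\<^bsub>?V\<^esub> t"
  have cl: "(\<lambda>t. c t \<odot>\<^bsub>?V\<^esub> t) \<in> S \<rightarrow> carrier ?V"
  proof
    fix t assume "t \<in> S"
    then show "c t \<odot>\<^bsub>?V\<^esub> t \<in> carrier ?V"
      using c(1) SV by (intro V.smult_closed) auto
  qed
  have lc: "?lc \<in> carrier ?V"
    using cl by (rule V.M.finsum_closed)
  have sV: "s \<in> carrier ?V"
    using s SV by blast
  have "(\<Oplus>\<^bsub>?V\<^esub>t\<in>S. d t \<odot>\<^bsub>?V\<^esub> t) = (\<Oplus>\<^bsub>?V\<^esub>t\<in>S. (if s = t then t else \<zero>\<^bsub>?V\<^esub>) \<oplus>\<^bsub>?V\<^esub> (\<ominus>\<^bsub>UP K\<^esub> p) \<odot>\<^bsub>?V\<^esub> (c t \<odot>\<^bsub>?V\<^esub> t))"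
  proof (intro V.M.finsum_cong' refl)
    show "(\<lambda>t. (if s = t then t else \<zero>\<^bsub>?V\<^esub>) \<oplus>\<^bsub>?V\<^esub> (\<ominus>\<^bsub>UP K\<^esub> p) \<odot>\<^bsub>?V\<^esub> (c t \<odot>\<^bsub>?V\<^esub> t)) \<in> S \<rightarrow> carrier ?V"
    proof
      fix t assume "t \<in> S"
      then show "(if s = t then t else \<zero>\<^bsub>?V\<^esub>) \<oplus>\<^bsub>?V\<^esub> (\<ominus>\<^bsub>UP K\<^esub> p) \<odot>\<^bsub>?V\<^esub> (c t \<odot>\<^bsub>?V\<^esub> t) \<in> carrier ?V"
        using c(1) SV p(1) by (intro V.M.a_closed V.smult_closed) auto
    qed
    fix t assume t: "t \<in> S"
    then have tc: "t \<in> carrier ?V" "c t \<in> carrier (UP K)"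
      using SV c(1) by auto
    have "d t \<odot>\<^bsub>?V\<^esub> t = (if s = t then \<one>\<^bsub>UP K\<^esub> else \<zero>\<^bsub>UP K\<^esub>) \<odot>\<^bsub>?V\<^esub> t \<oplus>\<^bsub>?V\<^esub> (\<ominus>\<^bsub>UP K\<^esub> p \<otimes>\<^bsub>UP K\<^esub> c t) \<odot>\<^bsub>?V\<^esub> t"
    proof -
      have "d t = (if s = t then \<one>\<^bsub>UP K\<^esub> else \<zero>\<^bsub>UP K\<^esub>) \<oplus>\<^bsub>UP K\<^esub> \<ominus>\<^bsub>UP K\<^esub> p \<otimes>\<^bsub>UP K\<^esub> c t"
        unfolding d_def using p(1) tc(2) by (simp add: KP.minus_eq KP.l_minus)
      moreover have "(if s = t then \<one>\<^bsub>UP K\<^esub> else \<zero>\<^bsub>UP K\<^esub>) \<in> carrier (UP K)"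
        "\<ominus>\<^bsub>UP K\<^esub> p \<otimes>\<^bsub>UP K\<^esub> c t \<in> carrier (UP K)"
        using p(1) tc(2) by auto
      ultimately show ?thesis
        using V.smult_l_distr[OF _ _ tc(1)] by (simp only:)
    qed
    also have "(if s = t then \<one>\<^bsub>UP K\<^esub> else \<zero>\<^bsub>UP K\<^esub>) \<odot>\<^bsub>?V\<^esub> t = (if s = t then t else \<zero>\<^bsub>?V\<^esub>)"
      by (cases "s = t") (simp_all only: V.smult_one[OF tc(1)] V.smult_l_null[OF tc(1)] if_True if_False simp_thms)
    also have "(\<ominus>\<^bsub>UP K\<^esub> p \<otimes>\<^bsub>UP K\<^esub> c t) \<odot>\<^bsub>?V\<^esub> t = (\<ominus>\<^bsub>UP K\<^esub> p) \<odot>\<^bsub>?V\<^esub> (c t \<odot>\<^bsub>?V\<^esub> t)"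
      using p(1) tc by (intro V.smult_assoc1) auto
    finally show "d t \<odot>\<^bsub>?V\<^esub> t = (if s = t then t else \<zero>\<^bsub>?V\<^esub>) \<oplus>\<^bsub>?V\<^esub> (\<ominus>\<^bsub>UP K\<^esub> p) \<odot>\<^bsub>?V\<^esub> (c t \<odot>\<^bsub>?V\<^esub> t)" .
  qed
  also have "\<dots> = (\<Oplus>\<^bsub>?V\<^esub>t\<in>S. if s = t then t else \<zero>\<^bsub>?V\<^esub>) \<oplus>\<^bsub>?V\<^esub> (\<Oplus>\<^bsub>?V\<^esub>t\<in>S. (\<ominus>\<^bsub>UP K\<^esub> p) \<odot>\<^bsub>?V\<^esub> (c t \<odot>\<^bsub>?V\<^esub> t))"
  proof (rule V.M.finsum_addf)
    show "(\<lambda>t. if s = t then t else \<zero>\<^bsub>?V\<^esub>) \<in> S \<rightarrow> carrier ?V"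
      using SV V.M.zero_closed by auto
    show "(\<lambda>t. (\<ominus>\<^bsub>UP K\<^esub> p) \<odot>\<^bsub>?V\<^esub> (c t \<odot>\<^bsub>?V\<^esub> t)) \<in> S \<rightarrow> carrier ?V"
    proof
      fix t assume "t \<in> S"
      then show "(\<ominus>\<^bsub>UP K\<^esub> p) \<odot>\<^bsub>?V\<^esub> (c t \<odot>\<^bsub>?V\<^esub> t) \<in> carrier ?V"
        using p(1) by (intro V.smult_closed[OF _ funcset_mem[OF cl]]) simp_all
    qed
  qed
  also have "(\<Oplus>\<^bsub>?V\<^esub>t\<in>S. if s = t then t else \<zero>\<^bsub>?V\<^esub>) = s"
    using s S(1) SV by (intro V.M.finsum_singleton[of s S "\<lambda>t. t"]) auto
  also have "(\<Oplus>\<^bsub>?V\<^esub>t\<in>S. (\<ominus>\<^bsub>UP K\<^esub> p) \<odot>\<^bsub>?V\<^esub> (c t \<odot>\<^bsub>?V\<^esub> t)) = (\<ominus>\<^bsub>UP K\<^esub> p) \<odot>\<^bsub>?V\<^esub> ?lc"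
    by (rule V.smult_finsum[symmetric, OF S(1) _ cl]) (use p(1) in simp)
  also have "(\<ominus>\<^bsub>UP K\<^esub> p) \<odot>\<^bsub>?V\<^esub> ?lc = \<ominus>\<^bsub>?V\<^esub> (p \<odot>\<^bsub>?V\<^esub> ?lc)"
    by (rule V.smult_l_minus[OF p(1) lc])
  finally have sum_d: "(\<Oplus>\<^bsub>?V\<^esub>t\<in>S. d t \<odot>\<^bsub>?V\<^esub> t) = s \<ominus>\<^bsub>?V\<^esub> p \<odot>\<^bsub>?V\<^esub> ?lc"
    by (simp only: a_minus_def)
  have "CB.\<iota> p \<otimes>\<^bsub>UP B\<^esub> (y \<ominus>\<^bsub>UP B\<^esub> ?lc) \<in> L"
    using p(1) c(2) by (intro BP.left_ideal_mult[OF L]) auto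
  then have "(s \<ominus>\<^bsub>UP B\<^esub> CB.\<iota> p \<otimes>\<^bsub>UP B\<^esub> y) \<oplus>\<^bsub>UP B\<^esub> CB.\<iota> p \<otimes>\<^bsub>UP B\<^esub> (y \<ominus>\<^bsub>UP B\<^esub> ?lc) \<in> L"
    by (rule BP.left_ideal_add[OF L y(2)])
  also have "(s \<ominus>\<^bsub>UP B\<^esub> CB.\<iota> p \<otimes>\<^bsub>UP B\<^esub> y) \<oplus>\<^bsub>UP B\<^esub> CB.\<iota> p \<otimes>\<^bsub>UP B\<^esub> (y \<ominus>\<^bsub>UP B\<^esub> ?lc)
      = s \<ominus>\<^bsub>UP B\<^esub> CB.\<iota> p \<otimes>\<^bsub>UP B\<^esub> ?lc"
  proof -
    have *: "a \<in> carrier (UP B) \<Longrightarrow> b \<in> carrier (UP B) \<Longrightarrow> e \<in> carrier (UP B) \<Longrightarrow> q \<in> carrier (UP B) \<Longrightarrow>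
        (a \<ominus>\<^bsub>UP B\<^esub> q \<otimes>\<^bsub>UP B\<^esub> b) \<oplus>\<^bsub>UP B\<^esub> q \<otimes>\<^bsub>UP B\<^esub> (b \<ominus>\<^bsub>UP B\<^esub> e) = a \<ominus>\<^bsub>UP B\<^esub> q \<otimes>\<^bsub>UP B\<^esub> e" for a b e q
      by (simp add: BP.minus_eq BP.r_distr BP.r_minus BP.a_assoc BP.r_neg1)
    show ?thesis
      using sV lc PF_carrier[OF y(1)] p(1) by (intro *) simp_all
  qed
  finally have "(\<Oplus>\<^bsub>?V\<^esub>t\<in>S. d t \<odot>\<^bsub>?V\<^esub> t) \<in> L"
    unfolding sum_d by simp
  then have "d s = \<zero>\<^bsub>UP K\<^esub>"
    using ind[rule_format, OF d _ s] by blast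
  moreover have "c s \<in> carrier (UP K)"
    using c(1) s by auto
  ultimately have "p \<otimes>\<^bsub>UP K\<^esub> c s = \<one>\<^bsub>UP K\<^esub>"
    using p(1) by (simp add: d_def)
  then show False
    using p(2) \<open>c s \<in> carrier (UP K)\<close> by blast
qed

end

section \<open>Primitive and prime ideals\<close>

context ring
begin

lemma ideal_of_left_ideal:
  assumes L: "left_ideal L R" and r: "\<And>x a. \<lbrakk>x \<in> L; a \<in> carrier R\<rbrakk> \<Longrightarrow> x \<otimes> a \<in> L"
  shows "ideal L R"
proof (rule idealI[OF ring_axioms])
  show "subgroup L (add_monoid R)"
    using left_ideal_subset[OF L] left_ideal_zero[OF L]
    by (intro add.subgroupI) (auto intro: left_ideal_uminus[OF L] left_ideal_add[OF L])
qed (auto intro: left_ideal_mult[OF L] r)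

lemma ideal_left_ideal:
  assumes "ideal P R"
  shows "left_ideal P R"
proof -
  interpret ideal P R
    by (rule assms)
  show ?thesis
    by (rule left_idealI) (auto simp: a_subset I_l_closed a_closed)
qed

lemma a_r_coset_eq_iff:
  assumes L: "left_ideal L R" and "x \<in> carrier R" "y \<in> carrier R"
  shows "L +> x = L +> y \<longleftrightarrow> x \<ominus> y \<in> L"
proof -
  have mem: "u \<in> L +> y \<longleftrightarrow> u \<in> carrier R \<and> u \<ominus> y \<in> L" if y: "y \<in> carrier R" for u y
  proof
    assume "u \<in> L +> y"
    then obtain l where "l \<in> L" "u = l \<oplus> y"
      by (auto simp: a_r_coset_def r_coset_def)
    then show "u \<in> carrier R \<and> u \<ominus> y \<in> L"
      using y left_ideal_carrier[OF L] by (simp add: minus_eq a_assoc r_neg)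
  next
    assume u: "u \<in> carrier R \<and> u \<ominus> y \<in> L"
    then have "u = (u \<ominus> y) \<oplus> y"
      using y by (simp add: minus_eq a_assoc l_neg)
    with u show "u \<in> L +> y"
      unfolding a_r_coset_def r_coset_def by auto
  qed
  show ?thesis
  proof
    assume "L +> x = L +> y"
    moreover have "x \<in> L +> x"
      using assms left_ideal_zero[OF L] by (simp add: mem minus_eq r_neg)
    ultimately show "x \<ominus> y \<in> L"
      using assms by (simp add: mem)
  next
    assume xy: "x \<ominus> y \<in> L"
    have trans: "u \<ominus> z \<in> L" if "u \<in> carrier R" "v \<in> carrier R" "z \<in> carrier R" "u \<ominus> v \<in> L" "v \<ominus> z \<in> L" for u v z
    proof -
      have "u \<ominus> z = (u \<ominus> v) \<oplus> (v \<ominus> z)"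
        using that(1-3) by (simp add: minus_eq a_assoc r_neg1)
      then show ?thesis
        using left_ideal_add[OF L that(4,5)] by simp
    qed
    have "y \<ominus> x = \<ominus> (x \<ominus> y)"
      using assms(2,3) by (simp add: minus_eq minus_add a_comm)
    then have yx: "y \<ominus> x \<in> L"
      using left_ideal_uminus[OF L xy] by simp
    have "u \<ominus> x \<in> L \<longleftrightarrow> u \<ominus> y \<in> L" if u: "u \<in> carrier R" for u
      using trans[OF u assms(2,3) _ xy] trans[OF u assms(3,2) _ yx] by blast
    then show "L +> x = L +> y"
      using mem assms(2,3) by blast
  qed
qed

text \<open>The left module \<open>R / L\<close>. Its operations are computed on chosen
  representatives; for a left ideal the choice does not affect the result.\<close>

definition quotient_module :: "'a set \<Rightarrow> ('a, 'a set) module"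
  where "quotient_module L =
    \<lparr>carrier = (\<lambda>x. L +> x) ` carrier R, monoid.mult = undefined, one = undefined, ring.zero = L +> \<zero>,
     ring.add = (\<lambda>U V. L +> ((SOME u. u \<in> carrier R \<and> L +> u = U) \<oplus> (SOME v. v \<in> carrier R \<and> L +> v = V))),
     smult = (\<lambda>a U. L +> (a \<otimes> (SOME u. u \<in> carrier R \<and> L +> u = U)))\<rparr>"

context
  fixes L
  assumes L: "left_ideal L R"
begin

lemma coset_representative:
  assumes x: "x \<in> carrier R"
  obtains u where "u = (SOME u. u \<in> carrier R \<and> L +> u = L +> x)" "u \<in> carrier R" "u \<ominus> x \<in> L"
proof -
  have "(SOME u. u \<in> carrier R \<and> L +> u = L +> x) \<in> carrier R \<and>
      L +> (SOME u. u \<in> carrier R \<and> L +> u = L +> x) = L +> x"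
    by (rule someI[of _ x]) (use x in simp)
  then show ?thesis
    using that a_r_coset_eq_iff[OF L _ x] by blast
qed

lemma quotient_module_carrier: "carrier (quotient_module L) = (\<lambda>x. L +> x) ` carrier R"
  and quotient_module_zero: "\<zero>\<^bsub>quotient_module L\<^esub> = L +> \<zero>"
  by (simp_all add: quotient_module_def)

lemma quotient_module_add:
  assumes x: "x \<in> carrier R" and y: "y \<in> carrier R"
  shows "(L +> x) \<oplus>\<^bsub>quotient_module L\<^esub> (L +> y) = L +> (x \<oplus> y)"
proof -
  obtain u where u: "u = (SOME u. u \<in> carrier R \<and> L +> u = L +> x)" "u \<in> carrier R" "u \<ominus> x \<in> L"
    by (rule coset_representative[OF x])
  obtain v where v: "v = (SOME u. u \<in> carrier R \<and> L +> u = L +> y)" "v \<in> carrier R" "v \<ominus> y \<in> L"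
    by (rule coset_representative[OF y])
  have "(u \<oplus> v) \<ominus> (x \<oplus> y) = (u \<ominus> x) \<oplus> (v \<ominus> y)"
    using u(2) v(2) x y by (simp add: minus_eq minus_add a_ac)
  also have "\<dots> \<in> L"
    by (rule left_ideal_add[OF L u(3) v(3)])
  finally have "L +> (u \<oplus> v) = L +> (x \<oplus> y)"
    using a_r_coset_eq_iff[OF L] u(2) v(2) x y by simp
  then show ?thesis
    by (simp add: quotient_module_def flip: u(1) v(1))
qed

lemma quotient_module_smult:
  assumes a: "a \<in> carrier R" and x: "x \<in> carrier R"
  shows "a \<odot>\<^bsub>quotient_module L\<^esub> (L +> x) = L +> (a \<otimes> x)"
proof -
  obtain u where u: "u = (SOME u. u \<in> carrier R \<and> L +> u = L +> x)" "u \<in> carrier R" "u \<ominus> x \<in> L"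
    by (rule coset_representative[OF x])
  have "a \<otimes> u \<ominus> a \<otimes> x = a \<otimes> (u \<ominus> x)"
    using a u(2) x by (simp add: minus_eq r_distr r_minus)
  also have "\<dots> \<in> L"
    by (rule left_ideal_mult[OF L a u(3)])
  finally have "L +> (a \<otimes> u) = L +> (a \<otimes> x)"
    using a_r_coset_eq_iff[OF L] a u(2) x by simp
  then show ?thesis
    by (simp add: quotient_module_def flip: u(1))
qed

lemma quotient_module_left_module: "left_module R (quotient_module L)"
proof -
  note simps = quotient_module_carrier quotient_module_zero quotient_module_add quotient_module_smult
  have "abelian_group (quotient_module L)"
  proof (rule abelian_groupI)
    fix U assume "U \<in> carrier (quotient_module L)"
    then obtain x where x: "x \<in> carrier R" "U = L +> x"
      by (auto simp: simps)
    then have "(L +> (\<ominus> x)) \<oplus>\<^bsub>quotient_module L\<^esub> U = \<zero>\<^bsub>quotient_module L\<^esub>"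
      by (simp add: simps l_neg)
    moreover have "L +> (\<ominus> x) \<in> carrier (quotient_module L)"
      using x(1) by (simp add: simps)
    ultimately show "\<exists>V\<in>carrier (quotient_module L). V \<oplus>\<^bsub>quotient_module L\<^esub> U = \<zero>\<^bsub>quotient_module L\<^esub>"
      by blast
  qed (auto simp: simps a_ac)
  moreover have "left_module_axioms R (quotient_module L)"
    by unfold_locales (auto simp: simps l_distr r_distr m_assoc)
  ultimately show ?thesis
    by (simp add: left_module_def ring_axioms)
qed

end

text \<open>The set is the annihilator of \<open>R / Q\<close>. This module is simple because an
  element outside \<open>Q\<close> is left invertible modulo \<open>Q\<close>, so that its class
  generates the class of \<open>\<one>\<close>.\<close>

lemma primitive_ideal_of_maximal_left_ideal:
  assumes max: "maximal_left_ideal Q R"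
  shows "primitive_ideal {a \<in> carrier R. \<forall>x\<in>carrier R. a \<otimes> x \<in> Q} R"
proof -
  have Q: "left_ideal Q R" and one: "\<one> \<notin> Q"
    using max by (simp_all add: maximal_left_ideal_def)
  let ?M = "quotient_module Q"
  note simps = quotient_module_carrier[OF Q] quotient_module_zero[OF Q] quotient_module_add[OF Q]
    quotient_module_smult[OF Q]
  interpret M: left_module R ?M
    by (rule quotient_module_left_module[OF Q])
  have zero_iff: "Q +> x = Q +> \<zero> \<longleftrightarrow> x \<in> Q" if "x \<in> carrier R" for x
    using a_r_coset_eq_iff[OF Q that zero_closed] that by (simp add: minus_eq)
  have "simple_module R ?M"
    unfolding simple_module_def
  proof (intro conjI allI impI)
    have "Q +> \<one> \<in> carrier ?M" "Q +> \<one> \<noteq> \<zero>\<^bsub>?M\<^esub>"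
      using one zero_iff[OF one_closed] by (simp_all add: simps)
    then show "carrier ?M \<noteq> {\<zero>\<^bsub>?M\<^esub>}"
      by blast
  next
    fix N assume N: "submodule N R ?M"
    show "N = {\<zero>\<^bsub>?M\<^esub>} \<or> N = carrier ?M"
    proof (cases "N \<subseteq> {\<zero>\<^bsub>?M\<^esub>}")
      case True
      then show ?thesis
        using M.submodule_zero[OF N] by blast
    next
      case False
      then obtain U where U: "U \<in> N" "U \<noteq> \<zero>\<^bsub>?M\<^esub>"
        by blast
      then obtain x where x: "x \<in> carrier R" "U = Q +> x"
        using M.submodule_carrier[OF N] unfolding simps(1) by blast
      then have "x \<notin> Q"
        using U(2) zero_iff[OF x(1)] by (simp add: simps)
      then obtain r l where rl: "r \<in> carrier R" "l \<in> Q" "\<one> = r \<otimes> x \<oplus> l"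
        using max x(1) unfolding maximal_left_ideal_def by blast
      have "l \<in> carrier R"
        using left_ideal_carrier[OF Q rl(2)] .
      then have "\<one> \<ominus> r \<otimes> x = l"
        using rl(1) x(1) unfolding rl(3) by (simp add: minus_eq a_ac r_neg r_neg2)
      then have "Q +> \<one> = Q +> (r \<otimes> x)"
        using a_r_coset_eq_iff[OF Q one_closed, of "r \<otimes> x"] rl x(1) by simp
      then have one_N: "Q +> \<one> \<in> N"
        using M.submodule_smult[OF N rl(1) U(1)] rl(1) x by (simp add: simps)
      have "Q +> y \<in> N" if "y \<in> carrier R" for y
        using M.submodule_smult[OF N that one_N] that by (simp add: simps)
      then have "carrier ?M \<subseteq> N"
        by (auto simp: simps)
      then show ?thesis
        using M.submodule_subset[OF N] by blast
    qed
  qed (rule M.left_module_axioms)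
  moreover have "annihilator R ?M = {a \<in> carrier R. \<forall>x\<in>carrier R. a \<otimes> x \<in> Q}"
  proof -
    have "(\<forall>U\<in>carrier ?M. a \<odot>\<^bsub>?M\<^esub> U = \<zero>\<^bsub>?M\<^esub>) \<longleftrightarrow> (\<forall>x\<in>carrier R. a \<otimes> x \<in> Q)" if a: "a \<in> carrier R" for a
    proof -
      have "a \<odot>\<^bsub>?M\<^esub> (Q +> x) = \<zero>\<^bsub>?M\<^esub> \<longleftrightarrow> a \<otimes> x \<in> Q" if "x \<in> carrier R" for x
        by (simp only: simps(4)[OF a that] simps(2) zero_iff[OF m_closed[OF a that]])
      then show ?thesis
        unfolding simps(1) by blast
    qed
    then show ?thesis
      unfolding annihilator_def by blast
  qed
  ultimately show ?thesis
    using primitive_ideal_annihilator by metis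
qed

lemma primitive_ideal_ideal:
  assumes "primitive_ideal P R"
  shows "ideal P R"
proof -
  obtain M :: "('a, 'a set) module" where M: "simple_module R M" "P = annihilator R M"
    using assms unfolding primitive_ideal_def by blast
  interpret M: left_module R M
    using M(1) by (simp add: simple_module_def)
  have "left_ideal P R"
    unfolding M(2) annihilator_def
    by (rule left_idealI) (auto simp: M.smult_l_distr M.smult_assoc1)
  then show ?thesis
    unfolding M(2) annihilator_def
    by (rule ideal_of_left_ideal) (auto simp: M.smult_assoc1)
qed

text \<open>Passes from primeness for ideals to a criterion for elements without describing the
  ideal generated by \<open>a\<close>: the ideals \<open>J = {y. a R y \<subseteq> P}\<close> and
  \<open>I = {x. x R J \<subseteq> P}\<close> both contain \<open>a\<close>, and their product lies
  in \<open>P\<close>.\<close>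

lemma prime_ideal_mult_subset:
  assumes P: "prime_ideal P R" and a: "a \<in> carrier R" and aRa: "\<And>u. u \<in> carrier R \<Longrightarrow> a \<otimes> u \<otimes> a \<in> P"
  shows "a \<in> P"
proof -
  interpret P: ideal P R
    using P by (simp add: prime_ideal_def)
  define J where "J = {y \<in> carrier R. \<forall>u\<in>carrier R. a \<otimes> u \<otimes> y \<in> P}"
  define I where "I = {x \<in> carrier R. \<forall>u\<in>carrier R. \<forall>y\<in>J. x \<otimes> u \<otimes> y \<in> P}"
  have Jc: "y \<in> carrier R" if "y \<in> J" for y
    using that by (simp add: J_def)
  have "left_ideal J R"
  proof (rule left_idealI)
    show "b \<otimes> y \<in> J" if "b \<in> carrier R" "y \<in> J" for b y
    proof -
      have "a \<otimes> u \<otimes> (b \<otimes> y) = a \<otimes> (u \<otimes> b) \<otimes> y" if "u \<in> carrier R" for u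
        using that \<open>b \<in> carrier R\<close> Jc[OF \<open>y \<in> J\<close>] a by (simp add: m_assoc)
      then show ?thesis
        using that by (simp add: J_def)
    qed
  qed (use a in \<open>auto simp: J_def r_distr\<close>)
  then have J: "ideal J R"
  proof (rule ideal_of_left_ideal)
    fix y b assume y: "y \<in> J" and b: "b \<in> carrier R"
    have "a \<otimes> u \<otimes> (y \<otimes> b) = (a \<otimes> u \<otimes> y) \<otimes> b" if "u \<in> carrier R" for u
      using that b Jc[OF y] a by (simp add: m_assoc)
    then show "y \<otimes> b \<in> J"
      using y b P.I_r_closed by (simp add: J_def)
  qed
  have "left_ideal I R"
  proof (rule left_idealI)
    show "b \<otimes> x \<in> I" if b: "b \<in> carrier R" and x: "x \<in> I" for b x
    proof -
      have "b \<otimes> x \<otimes> u \<otimes> y = b \<otimes> (x \<otimes> u \<otimes> y)" if "u \<in> carrier R" "y \<in> J" for u y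
        using that b x Jc by (simp add: I_def m_assoc)
      then show ?thesis
        using b x P.I_l_closed by (simp add: I_def)
    qed
  qed (auto simp: I_def l_distr Jc)
  then have I: "ideal I R"
  proof (rule ideal_of_left_ideal)
    fix x b assume x: "x \<in> I" and b: "b \<in> carrier R"
    have "x \<otimes> b \<otimes> u \<otimes> y = x \<otimes> (b \<otimes> u) \<otimes> y" if "u \<in> carrier R" "y \<in> J" for u y
      using that b x Jc by (simp add: I_def m_assoc)
    then show "x \<otimes> b \<in> I"
      using x b by (simp add: I_def)
  qed
  have "ideal_prod R I J \<subseteq> P"
  proof
    fix z assume "z \<in> ideal_prod R I J"
    then show "z \<in> P"
    proof induction
      case (prod i j)
      then have "i \<otimes> \<one> \<otimes> j \<in> P" "i \<in> carrier R"
        using one_closed unfolding I_def by blast+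
      then show ?case
        by simp
    qed auto
  qed
  moreover have "a \<in> J" "a \<in> I"
    using a aRa by (simp_all add: I_def J_def)
  ultimately show ?thesis
    using P I J unfolding prime_ideal_def by blast
qed

text \<open>An element \<open>a \<in> J - P\<close> with maximal left annihilator modulo \<open>P\<close> satisfies \<open>a u a \<in> P\<close> for all \<open>u\<close>:
  a power of \<open>a u\<close> not in \<open>P\<close> has the same left annihilator modulo \<open>P\<close> as \<open>a\<close>.\<close>

lemma nil_ideal_subset_prime_ideal:
  assumes acc: "left_acc R" and P: "prime_ideal P R" and J: "ideal J R"
    and nil: "\<And>x. x \<in> J \<Longrightarrow> \<exists>n::nat. x [^] n \<in> P"
  shows "J \<subseteq> P"
proof (rule ccontr)
  assume "\<not> J \<subseteq> P"
  interpret P: ideal P R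
    using P by (simp add: prime_ideal_def)
  interpret J: ideal J R
    by (rule J)
  define l where "l a = {b \<in> carrier R. b \<otimes> a \<in> P}" for a
  have l: "left_ideal (l a) R" if "a \<in> carrier R" for a
    by (rule left_idealI) (use that in \<open>auto simp: l_def l_distr m_assoc P.I_l_closed\<close>)
  let ?F = "l ` (J - P)"
  obtain a0 where "a0 \<in> J - P"
    using \<open>\<not> J \<subseteq> P\<close> by blast
  have "\<exists>M\<in>?F. \<forall>L\<in>?F. M \<subseteq> L \<longrightarrow> L = M"
    by (rule left_acc_maximal[OF acc, of "l a0"]) (use l J.a_subset \<open>a0 \<in> J - P\<close> in auto)
  then obtain a where a: "a \<in> J" "a \<notin> P" and max: "\<forall>L\<in>?F. l a \<subseteq> L \<longrightarrow> L = l a"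
    by blast
  have aR: "a \<in> carrier R"
    using a(1) J.a_subset by blast
  have "a \<otimes> u \<otimes> a \<in> P" if u: "u \<in> carrier R" for u
  proof -
    let ?x = "a \<otimes> u"
    have x: "?x \<in> J" "?x \<in> carrier R"
      using J.I_r_closed[OF a(1) u] aR u by auto
    define n where "n = (LEAST n::nat. ?x [^] n \<in> P)"
    have n: "?x [^] n \<in> P"
      unfolding n_def using nil[OF x(1)] by (rule LeastI_ex)
    have least: "?x [^] k \<notin> P" if "k < n" for k
      using that not_less_Least unfolding n_def by blast
    \<comment> \<open>If the power with exponent 0 were in \<open>P\<close>, then \<open>P\<close>
      would contain \<open>\<one>\<close> and hence \<open>a\<close>.\<close>
    have "n \<noteq> 0"
    proof
      assume "n = 0"
      then have "\<one> \<in> P"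
        using n by simp
      then have "a \<in> P"
        using P.I_l_closed[OF _ aR] aR by fastforce
      then show False
        using a(2) by simp
    qed
    then obtain m where m: "n = Suc m"
      by (cases n) auto
    \<comment> \<open>The exponent \<open>m = 0\<close> stands apart because \<open>\<one>\<close>
      need not lie in \<open>J\<close>, so its annihilator is not in the family; there
      \<open>a u\<close> itself is in \<open>P\<close>.\<close>
    show ?thesis
    proof (cases "m = 0")
      case True
      then have "?x \<in> P"
        using n m x(2) by simp
      then show ?thesis
        using P.I_r_closed aR by simp
    next
      case False
      then obtain k where k: "m = Suc k"
        by (cases m) auto
      \<comment> \<open>The power begins with \<open>a\<close> on the left, so whatever multiplies
        \<open>a\<close> into \<open>P\<close> from the left does the same to the power.\<close>
      have pow: "?x [^] m = a \<otimes> (u \<otimes> ?x [^] k)"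
        unfolding k using x(2) aR u nat_pow_Suc2[OF x(2), of k] by (simp add: m_assoc)
      have xm: "?x [^] m \<in> J" "?x [^] m \<in> carrier R"
        unfolding pow using a(1) J.I_r_closed[OF a(1)] aR u x(2) by auto
      have "l a \<subseteq> l (?x [^] m)"
      proof
        fix b assume "b \<in> l a"
        then have b: "b \<in> carrier R" "b \<otimes> a \<in> P"
          by (simp_all add: l_def)
        have "b \<otimes> ?x [^] m = (b \<otimes> a) \<otimes> (u \<otimes> ?x [^] k)"
          unfolding pow using b(1) aR u x(2) by (simp add: m_assoc)
        then show "b \<in> l (?x [^] m)"
          using b u x(2) P.I_r_closed by (simp add: l_def)
      qed
      moreover have "l (?x [^] m) \<in> ?F"
        using xm(1) least[of m] m by blast
      ultimately have "l (?x [^] m) = l a"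
        using max by blast
      moreover have "?x \<in> l (?x [^] m)"
        using n x(2) nat_pow_Suc2[OF x(2), of m] by (simp add: l_def m)
      ultimately show ?thesis
        by (simp add: l_def)
    qed
  qed
  then have "a \<in> P"
    by (rule prime_ideal_mult_subset[OF P aR])
  then show False
    using a(2) by simp
qed

text \<open>Comparing coefficients in \<open>1 = w (1 - x X) + u\<close> gives \<open>w\<^sub>i \<equiv> x\<^sup>i\<close> modulo \<open>P\<close>.\<close>

lemma nilpotent_if_one_minus_mult_X:
  assumes P: "ideal P R" and x: "x \<in> carrier R" and w: "w \<in> carrier (UP R)"
    and u: "u \<in> carrier (UP R)" "\<And>i. u i \<in> P"
    and one: "\<one>\<^bsub>UP R\<^esub> = w \<otimes>\<^bsub>UP R\<^esub> (\<one>\<^bsub>UP R\<^esub> \<ominus>\<^bsub>UP R\<^esub> up_ring.monom (UP R) x 1) \<oplus>\<^bsub>UP R\<^esub> u"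
  shows "\<exists>n::nat. x [^] n \<in> P"
proof -
  interpret P: ideal P R
    by (rule P)
  interpret UP: ring "UP R"
    by (rule ring_UP)
  note PL = ideal_left_ideal[OF P]
  let ?m = "up_ring.monom (UP R) x 1"
  have m: "?m \<in> carrier (UP R)"
    using x by simp
  have "w \<otimes>\<^bsub>UP R\<^esub> (\<one>\<^bsub>UP R\<^esub> \<ominus>\<^bsub>UP R\<^esub> ?m) = w \<ominus>\<^bsub>UP R\<^esub> w \<otimes>\<^bsub>UP R\<^esub> ?m"
    using w m by (simp add: UP.minus_eq UP.r_distr UP.r_minus)
  then have one': "\<one>\<^bsub>UP R\<^esub> = (w \<ominus>\<^bsub>UP R\<^esub> w \<otimes>\<^bsub>UP R\<^esub> ?m) \<oplus>\<^bsub>UP R\<^esub> u"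
    using one by simp
  have wm: "w \<otimes>\<^bsub>UP R\<^esub> ?m \<in> carrier (UP R)" "w \<ominus>\<^bsub>UP R\<^esub> w \<otimes>\<^bsub>UP R\<^esub> ?m \<in> carrier (UP R)"
    using w m by simp_all
  have coeff: "\<one>\<^bsub>UP R\<^esub> i = (w i \<ominus> (if 1 \<le> i then w (i - 1) \<otimes> x else \<zero>)) \<oplus> u i" for i
  proof -
    have "\<one>\<^bsub>UP R\<^esub> i = ((w \<ominus>\<^bsub>UP R\<^esub> w \<otimes>\<^bsub>UP R\<^esub> ?m) \<oplus>\<^bsub>UP R\<^esub> u) i"
      using one' by (rule fun_cong)
    also have "\<dots> = (w i \<ominus> (w \<otimes>\<^bsub>UP R\<^esub> ?m) i) \<oplus> u i"
      unfolding UP_add_apply[OF wm(2) u(1)] UP_minus_apply[OF w wm(1)] ..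
    finally show ?thesis
      unfolding mult_monom_apply[OF x w] .
  qed
  have wi: "w i \<in> carrier R" and ui: "u i \<in> carrier R" for i
    using w u(1) by auto
  have "x [^] i \<ominus> w i \<in> P" for i
  proof (induction i)
    case 0
    have "\<one> = w 0 \<oplus> u 0"
      using coeff[of 0] wi[of 0] ui[of 0] by (simp add: UP_one_apply minus_eq)
    then have "x [^] (0::nat) \<ominus> w 0 = u 0"
      using wi[of 0] ui[of 0] by (simp add: minus_eq a_ac r_neg r_neg2)
    then show ?case
      using u(2) by simp
  next
    case (Suc i)
    have "\<zero> = w (Suc i) \<ominus> w i \<otimes> x \<oplus> u (Suc i)"
      using coeff[of "Suc i"] by (simp add: UP_one_apply)
    then have "w (Suc i) \<ominus> w i \<otimes> x = \<ominus> u (Suc i)"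
      using wi ui x by (metis m_closed minus_closed minus_equality)
    then have "w (Suc i) = w i \<otimes> x \<ominus> u (Suc i)"
      using wi ui x by (metis a_minus_def add.inv_solve_right' add.m_comm m_closed a_inv_closed)
    then have "x [^] Suc i \<ominus> w (Suc i) = (x [^] i \<ominus> w i) \<otimes> x \<oplus> u (Suc i)"
      using wi ui x by (simp add: minus_eq l_distr l_minus minus_add a_assoc)
    also have "\<dots> \<in> P"
      using Suc.IH u(2) x P.I_r_closed by simp
    finally show ?case .
  qed
  \<comment> \<open>Beyond the degree of \<open>w\<close> the congruence says that the power of
    \<open>x\<close> itself lies in \<open>P\<close>.\<close>
  moreover obtain n where "\<forall>i\<ge>n. w i = \<zero>"
    using w by (auto simp: UP_mem_iff)
  ultimately have "x [^] n \<ominus> \<zero> \<in> P"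
    by (metis order_refl)
  then show ?thesis
    using x by (auto simp: minus_eq)
qed

end


section \<open>The Jacobson property\<close>

context noetherian_filtered_algebra
begin

text \<open>Otherwise \<open>B[X] (1 - x X) + P[X]\<close> is proper and lies in a maximal left
  ideal \<open>L\<close>, which contains some scalar polynomial \<open>h \<noteq> 0\<close> of
  degree \<open>d\<close>. Modulo \<open>L\<close> the product \<open>x X\<close> behaves as 1, so
  \<open>x^d h\<close> becomes \<open>c = \<Sum> h_i x^(d - i)\<close>, an element of
  \<open>B\<close>. It belongs to \<open>L \<inter> B\<close>, hence to a maximal left ideal
  \<open>Q\<close> of \<open>B\<close> that contains \<open>P\<close>. The primitive ideal of
  \<open>Q\<close> contains \<open>x\<close>; so all terms of \<open>c\<close> with
  \<open>i < d\<close> are in \<open>Q\<close>, and what remains is the unit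
  \<open>h_d\<close>.\<close>

lemma primitive_radical_nil:
  assumes P: "ideal P B" and x: "x \<in> carrier B"
    and rad: "\<And>Q. \<lbrakk>primitive_ideal Q B; P \<subseteq> Q\<rbrakk> \<Longrightarrow> x \<in> Q"
  shows "\<exists>n::nat. x [^]\<^bsub>B\<^esub> n \<in> P"
proof (rule ccontr)
  assume nil: "\<not> ?thesis"
  interpret P: ideal P B
    by (rule P)
  let ?mon = "up_ring.monom (UP B)"
  define PX where "PX = {u \<in> carrier (UP B). \<forall>i. u i \<in> P}"
  have PX: "left_ideal PX (UP B)"
  proof (rule BP.left_idealI)
    show "PX \<subseteq> carrier (UP B)"
      by (auto simp: PX_def)
    have "\<zero>\<^bsub>UP B\<^esub> i \<in> P" for i
      unfolding UP_zero_apply by (rule P.zero_closed)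
    then show "\<zero>\<^bsub>UP B\<^esub> \<in> PX"
      unfolding PX_def by blast
    fix u v assume uv: "u \<in> PX" "v \<in> PX"
    then have c: "u \<in> carrier (UP B)" "v \<in> carrier (UP B)"
      by (simp_all add: PX_def)
    have "(u \<oplus>\<^bsub>UP B\<^esub> v) i \<in> P" for i
      unfolding UP_add_apply[OF c] using uv by (intro P.a_closed) (simp_all add: PX_def)
    then show "u \<oplus>\<^bsub>UP B\<^esub> v \<in> PX"
      using c BP.a_closed unfolding PX_def by blast
  next
    fix a u assume a: "a \<in> carrier (UP B)" and u: "u \<in> PX"
    then have c: "u \<in> carrier (UP B)"
      by (simp add: PX_def)
    have "(a \<otimes>\<^bsub>UP B\<^esub> u) i \<in> P" for i
      unfolding UP_mult_apply[OF a c] using a u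
      by (intro B.left_ideal_finsum[OF B.ideal_left_ideal[OF P]] P.I_l_closed) (simp_all add: PX_def)
    then show "a \<otimes>\<^bsub>UP B\<^esub> u \<in> PX"
      using a c BP.m_closed unfolding PX_def by blast
  qed
  define t where "t = \<one>\<^bsub>UP B\<^esub> \<ominus>\<^bsub>UP B\<^esub> ?mon x 1"
  have t: "t \<in> carrier (UP B)"
    unfolding t_def using x by simp
  let ?L0 = "{w \<otimes>\<^bsub>UP B\<^esub> t \<oplus>\<^bsub>UP B\<^esub> u |w u. w \<in> carrier (UP B) \<and> u \<in> PX}"
  have L0: "left_ideal ?L0 (UP B)"
    by (rule BP.left_ideal_sum_principal[OF PX t])
  have "\<one>\<^bsub>UP B\<^esub> \<notin> ?L0"
    using B.nilpotent_if_one_minus_mult_X[OF P x] nil unfolding t_def PX_def by blast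
  then obtain L where L: "maximal_left_ideal L (UP B)" and L0L: "?L0 \<subseteq> L"
    using BP.exists_maximal_left_ideal[OF acc_BP L0] by blast
  have Lid: "left_ideal L (UP B)" and one_L: "\<one>\<^bsub>UP B\<^esub> \<notin> L"
    using L by (simp_all add: maximal_left_ideal_def)
  have "t = \<one>\<^bsub>UP B\<^esub> \<otimes>\<^bsub>UP B\<^esub> t \<oplus>\<^bsub>UP B\<^esub> \<zero>\<^bsub>UP B\<^esub>"
    using t by simp
  then have tL: "t \<in> L"
    using L0L BP.left_ideal_zero[OF PX] BP.one_closed by blast
  have PXL: "u \<in> L" if "u \<in> PX" for u
  proof -
    have "u = \<zero>\<^bsub>UP B\<^esub> \<otimes>\<^bsub>UP B\<^esub> t \<oplus>\<^bsub>UP B\<^esub> u"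
      using t BP.left_ideal_carrier[OF PX that] by simp
    then show ?thesis
      using L0L that BP.zero_closed by blast
  qed
  obtain h where h: "h \<in> carrier (UP K)" "h \<noteq> \<zero>\<^bsub>UP K\<^esub>" "CB.\<iota> h \<in> L"
    using maximal_left_ideal_meets_scalars[OF L] by blast
  interpret UK: UP_ring K "UP K"
    by unfold_locales
  define d where "d = deg K h"
  have hd: "h d \<noteq> \<zero>\<^bsub>K\<^esub>" "\<And>i. i > d \<Longrightarrow> h i = \<zero>\<^bsub>K\<^esub>"
    using UK.lcoeff_nonzero[OF h(2,1)] UK.deg_aboveD[OF _ h(1)] h(1) by (simp_all add: d_def)
  have hK: "h i \<in> carrier K" for i
    using h(1) by simp
  have pow: "x [^]\<^bsub>B\<^esub> k \<in> carrier B" for k :: nat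
    using x by simp
  \<comment> \<open>Induction along
    \<open>1 - x^(k+1) X^(k+1) = (1 - x^k X^k) + x^k X^k (1 - x X)\<close>.\<close>
  have mpow: "\<one>\<^bsub>UP B\<^esub> \<ominus>\<^bsub>UP B\<^esub> ?mon (x [^]\<^bsub>B\<^esub> k) k \<in> L" for k
  proof (induction k)
    case 0
    have "?mon (x [^]\<^bsub>B\<^esub> (0::nat)) 0 = \<one>\<^bsub>UP B\<^esub>"
      by (rule ext) (simp add: UP_monom_apply UP_one_apply)
    then show ?case
      using BP.left_ideal_zero[OF Lid] by (simp add: BP.minus_eq BP.r_neg)
  next
    case (Suc k)
    have mc: "?mon (x [^]\<^bsub>B\<^esub> k) k \<in> carrier (UP B)" "?mon x 1 \<in> carrier (UP B)"
      using x by simp_all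
    have step: "?mon (x [^]\<^bsub>B\<^esub> Suc k) (Suc k) = ?mon (x [^]\<^bsub>B\<^esub> k) k \<otimes>\<^bsub>UP B\<^esub> ?mon x 1"
    proof
      fix i show "?mon (x [^]\<^bsub>B\<^esub> Suc k) (Suc k) i = (?mon (x [^]\<^bsub>B\<^esub> k) k \<otimes>\<^bsub>UP B\<^esub> ?mon x 1) i"
        unfolding B.mult_monom_apply[OF x mc(1)] using x by (auto simp: UP_monom_apply)
    qed
    have "(\<one>\<^bsub>UP B\<^esub> \<ominus>\<^bsub>UP B\<^esub> ?mon (x [^]\<^bsub>B\<^esub> k) k) \<oplus>\<^bsub>UP B\<^esub> ?mon (x [^]\<^bsub>B\<^esub> k) k \<otimes>\<^bsub>UP B\<^esub> t \<in> L"
      by (intro BP.left_ideal_add[OF Lid] BP.left_ideal_mult[OF Lid] Suc.IH tL mc)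
    also have "(\<one>\<^bsub>UP B\<^esub> \<ominus>\<^bsub>UP B\<^esub> ?mon (x [^]\<^bsub>B\<^esub> k) k) \<oplus>\<^bsub>UP B\<^esub> ?mon (x [^]\<^bsub>B\<^esub> k) k \<otimes>\<^bsub>UP B\<^esub> t
        = \<one>\<^bsub>UP B\<^esub> \<ominus>\<^bsub>UP B\<^esub> ?mon (x [^]\<^bsub>B\<^esub> k) k \<otimes>\<^bsub>UP B\<^esub> ?mon x 1"
      unfolding t_def using mc by (simp add: BP.minus_eq BP.r_distr BP.r_minus BP.a_assoc BP.r_neg1)
    finally show ?case
      unfolding step .
  qed
  \<comment> \<open>The reversed polynomial of \<open>h\<close> evaluated at \<open>x\<close>;
    formally \<open>x^d h(1/x)\<close>, with \<open>X\<close> in the role of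
    \<open>1/x\<close>.\<close>
  define c where "c = (\<Oplus>\<^bsub>B\<^esub>i\<in>{..d}. h i \<odot>\<^bsub>B\<^esub> x [^]\<^bsub>B\<^esub> (d - i))"
  have hx: "h i \<odot>\<^bsub>B\<^esub> x [^]\<^bsub>B\<^esub> (j::nat) \<in> carrier B" for i j
    using hK pow by simp
  have cB: "c \<in> carrier B"
    unfolding c_def using hx by (intro B.finsum_closed) auto
  have cL: "?mon c 0 \<in> L"
  proof -
    have xh: "?mon (x [^]\<^bsub>B\<^esub> d) 0 \<otimes>\<^bsub>UP B\<^esub> CB.\<iota> h \<in> L"
      using pow h(3) by (intro BP.left_ideal_mult[OF Lid]) auto
    let ?g = "\<lambda>i. ?mon (h i \<odot>\<^bsub>B\<^esub> x [^]\<^bsub>B\<^esub> (d - i)) 0 \<otimes>\<^bsub>UP B\<^esub> (\<one>\<^bsub>UP B\<^esub> \<ominus>\<^bsub>UP B\<^esub> ?mon (x [^]\<^bsub>B\<^esub> i) i)"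
    have g: "?g i \<in> L" for i
      using hx by (intro BP.left_ideal_mult[OF Lid] mpow) auto
    have gc: "?g \<in> {..d} \<rightarrow> carrier (UP B)"
      using BP.left_ideal_carrier[OF Lid g] by blast
    have sg: "(\<Oplus>\<^bsub>UP B\<^esub>i\<in>{..d}. ?g i) \<in> L"
      by (rule BP.left_ideal_finsum[OF Lid g])
    \<comment> \<open>Each term \<open>h_i X^i\<close> of \<open>x^d h\<close> is traded for
      \<open>h_i x^(d - i)\<close> by adding \<open>h_i x^(d - i) (1 - x^i X^i)\<close>, which is in
      \<open>L\<close>.\<close>
    have "?mon c 0 = ?mon (x [^]\<^bsub>B\<^esub> d) 0 \<otimes>\<^bsub>UP B\<^esub> CB.\<iota> h \<oplus>\<^bsub>UP B\<^esub> (\<Oplus>\<^bsub>UP B\<^esub>i\<in>{..d}. ?g i)"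
    proof
      fix k
      have g_apply: "?g i k = (if k = 0 then h i \<odot>\<^bsub>B\<^esub> x [^]\<^bsub>B\<^esub> (d - i) else \<zero>\<^bsub>B\<^esub>)
          \<ominus>\<^bsub>B\<^esub> (if i = k then h i \<odot>\<^bsub>B\<^esub> x [^]\<^bsub>B\<^esub> d else \<zero>\<^bsub>B\<^esub>)" if i: "i \<le> d" for i
      proof -
        have "(h i \<odot>\<^bsub>B\<^esub> x [^]\<^bsub>B\<^esub> (d - i)) \<otimes>\<^bsub>B\<^esub> x [^]\<^bsub>B\<^esub> i = h i \<odot>\<^bsub>B\<^esub> x [^]\<^bsub>B\<^esub> d"
          using hK x i by (simp add: smult_mult_left B.nat_pow_mult)
        moreover have "(\<one>\<^bsub>UP B\<^esub> \<ominus>\<^bsub>UP B\<^esub> ?mon (x [^]\<^bsub>B\<^esub> i) i) k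
            = (if k = 0 then \<one>\<^bsub>B\<^esub> else \<zero>\<^bsub>B\<^esub>) \<ominus>\<^bsub>B\<^esub> (if k = i then x [^]\<^bsub>B\<^esub> i else \<zero>\<^bsub>B\<^esub>)"
          using B.UP_minus_apply[of "\<one>\<^bsub>UP B\<^esub>" "?mon (x [^]\<^bsub>B\<^esub> i) i" k] pow
          by (simp add: UP_one_apply UP_monom_apply)
        moreover have "\<one>\<^bsub>UP B\<^esub> \<ominus>\<^bsub>UP B\<^esub> ?mon (x [^]\<^bsub>B\<^esub> i) i \<in> carrier (UP B)"
          using pow by simp
        ultimately show ?thesis
          using B.monom_mult_apply[OF hx, of "\<one>\<^bsub>UP B\<^esub> \<ominus>\<^bsub>UP B\<^esub> ?mon (x [^]\<^bsub>B\<^esub> i) i" i "d - i" 0 k] hx pow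
          by (auto simp: B.minus_eq B.r_distr B.r_minus)
      qed
      have "(\<Oplus>\<^bsub>UP B\<^esub>i\<in>{..d}. ?g i) k = (\<Oplus>\<^bsub>B\<^esub>i\<in>{..d}. ?g i k)"
        using gc by (intro B.UP_finsum_apply) auto
      also have "\<dots> = (\<Oplus>\<^bsub>B\<^esub>i\<in>{..d}. (if k = 0 then h i \<odot>\<^bsub>B\<^esub> x [^]\<^bsub>B\<^esub> (d - i) else \<zero>\<^bsub>B\<^esub>)
          \<oplus>\<^bsub>B\<^esub> (if k = i then \<ominus>\<^bsub>B\<^esub> (h i \<odot>\<^bsub>B\<^esub> x [^]\<^bsub>B\<^esub> d) else \<zero>\<^bsub>B\<^esub>))"
        using hx by (intro B.finsum_cong') (auto simp: g_apply B.minus_eq)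
      also have "\<dots> = (\<Oplus>\<^bsub>B\<^esub>i\<in>{..d}. if k = 0 then h i \<odot>\<^bsub>B\<^esub> x [^]\<^bsub>B\<^esub> (d - i) else \<zero>\<^bsub>B\<^esub>)
          \<oplus>\<^bsub>B\<^esub> (\<Oplus>\<^bsub>B\<^esub>i\<in>{..d}. if k = i then \<ominus>\<^bsub>B\<^esub> (h i \<odot>\<^bsub>B\<^esub> x [^]\<^bsub>B\<^esub> d) else \<zero>\<^bsub>B\<^esub>)"
        using hx by (intro B.finsum_addf) auto
      also have "(\<Oplus>\<^bsub>B\<^esub>i\<in>{..d}. if k = 0 then h i \<odot>\<^bsub>B\<^esub> x [^]\<^bsub>B\<^esub> (d - i) else \<zero>\<^bsub>B\<^esub>) = ?mon c 0 k"
      proof (cases "k = 0")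
        case True
        then show ?thesis
          by (simp only: if_True simp_thms c_def[symmetric] UP_monom_apply[OF cB])
      next
        case False
        then show ?thesis
          by (simp add: UP_monom_apply[OF cB])
      qed
      also have "(\<Oplus>\<^bsub>B\<^esub>i\<in>{..d}. if k = i then \<ominus>\<^bsub>B\<^esub> (h i \<odot>\<^bsub>B\<^esub> x [^]\<^bsub>B\<^esub> d) else \<zero>\<^bsub>B\<^esub>)
          = \<ominus>\<^bsub>B\<^esub> (h k \<odot>\<^bsub>B\<^esub> x [^]\<^bsub>B\<^esub> d)"
      proof (cases "k \<le> d")
        case True
        then show ?thesis
          using hx by (intro B.finsum_singleton[of k "{..d}" "\<lambda>i. \<ominus>\<^bsub>B\<^esub> (h i \<odot>\<^bsub>B\<^esub> x [^]\<^bsub>B\<^esub> d)"]) auto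
      next
        case False
        then have "(\<Oplus>\<^bsub>B\<^esub>i\<in>{..d}. if k = i then \<ominus>\<^bsub>B\<^esub> (h i \<odot>\<^bsub>B\<^esub> x [^]\<^bsub>B\<^esub> d) else \<zero>\<^bsub>B\<^esub>) = \<zero>\<^bsub>B\<^esub>"
          by (intro B.add.finprod_one_eqI) auto
        with False show ?thesis
          using hd(2)[of k] pow by simp
      qed
      finally have sum: "(\<Oplus>\<^bsub>UP B\<^esub>i\<in>{..d}. ?g i) k = ?mon c 0 k \<oplus>\<^bsub>B\<^esub> \<ominus>\<^bsub>B\<^esub> (h k \<odot>\<^bsub>B\<^esub> x [^]\<^bsub>B\<^esub> d)" .
      have "(?mon (x [^]\<^bsub>B\<^esub> d) 0 \<otimes>\<^bsub>UP B\<^esub> CB.\<iota> h) k = h k \<odot>\<^bsub>B\<^esub> x [^]\<^bsub>B\<^esub> d"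
        unfolding B.monom_mult_apply[OF pow CB.\<iota>_closed[OF h(1)]] unfolding CB.\<iota>_def
        using hK[of k] pow[of d] by (simp add: smult_mult_right)
      moreover have "(?mon (x [^]\<^bsub>B\<^esub> d) 0 \<otimes>\<^bsub>UP B\<^esub> CB.\<iota> h \<oplus>\<^bsub>UP B\<^esub> (\<Oplus>\<^bsub>UP B\<^esub>i\<in>{..d}. ?g i)) k
          = (?mon (x [^]\<^bsub>B\<^esub> d) 0 \<otimes>\<^bsub>UP B\<^esub> CB.\<iota> h) k \<oplus>\<^bsub>B\<^esub> (\<Oplus>\<^bsub>UP B\<^esub>i\<in>{..d}. ?g i) k"
        by (rule UP_add_apply[OF BP.left_ideal_carrier[OF Lid xh] BP.left_ideal_carrier[OF Lid sg]])
      moreover have "?mon c 0 k \<in> carrier B"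
        using cB by simp
      ultimately show "?mon c 0 k = (?mon (x [^]\<^bsub>B\<^esub> d) 0 \<otimes>\<^bsub>UP B\<^esub> CB.\<iota> h \<oplus>\<^bsub>UP B\<^esub> (\<Oplus>\<^bsub>UP B\<^esub>i\<in>{..d}. ?g i)) k"
        using hx sum by (simp add: B.a_lcomm B.r_neg)
    qed
    then show ?thesis
      using BP.left_ideal_add[OF Lid xh sg] by (simp only:)
  qed
  \<comment> \<open>The contraction of \<open>L\<close> to constants is a proper left ideal of
    \<open>B\<close> but need not be maximal; it is enlarged to a maximal \<open>Q\<close>.\<close>
  define L1 where "L1 = {b \<in> carrier B. ?mon b 0 \<in> L}"
  have "left_ideal L1 B"
  proof (rule B.left_idealI)
    show "L1 \<subseteq> carrier B"
      by (auto simp: L1_def)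
    have "?mon \<zero>\<^bsub>B\<^esub> 0 = \<zero>\<^bsub>UP B\<^esub>"
      by (rule ext) (simp add: UP_monom_apply UP_zero_apply)
    then show "\<zero>\<^bsub>B\<^esub> \<in> L1"
      unfolding L1_def using BP.left_ideal_zero[OF Lid] by simp
    fix a b assume ab: "a \<in> L1" "b \<in> L1"
    then have c: "a \<in> carrier B" "b \<in> carrier B"
      by (simp_all add: L1_def)
    have "?mon (a \<oplus>\<^bsub>B\<^esub> b) 0 = ?mon a 0 \<oplus>\<^bsub>UP B\<^esub> ?mon b 0"
    proof
      fix i
      have "(?mon a 0 \<oplus>\<^bsub>UP B\<^esub> ?mon b 0) i = ?mon a 0 i \<oplus>\<^bsub>B\<^esub> ?mon b 0 i"
        using c by (intro UP_add_apply) auto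
      then show "?mon (a \<oplus>\<^bsub>B\<^esub> b) 0 i = (?mon a 0 \<oplus>\<^bsub>UP B\<^esub> ?mon b 0) i"
        using c by (simp add: UP_monom_apply)
    qed
    then show "a \<oplus>\<^bsub>B\<^esub> b \<in> L1"
      using ab BP.left_ideal_add[OF Lid] by (simp add: L1_def)
  next
    fix a b assume a: "a \<in> carrier B" and b: "b \<in> L1"
    then have c: "b \<in> carrier B"
      by (simp add: L1_def)
    have "?mon (a \<otimes>\<^bsub>B\<^esub> b) 0 = ?mon a 0 \<otimes>\<^bsub>UP B\<^esub> ?mon b 0"
    proof
      fix i
      show "?mon (a \<otimes>\<^bsub>B\<^esub> b) 0 i = (?mon a 0 \<otimes>\<^bsub>UP B\<^esub> ?mon b 0) i"
        using a c B.monom_mult_apply[OF a B.UP_monom_closed[OF c, of 0], of 0 i] by (simp add: UP_monom_apply)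
    qed
    then show "a \<otimes>\<^bsub>B\<^esub> b \<in> L1"
      using a b BP.left_ideal_mult[OF Lid B.UP_monom_closed[OF a]] by (simp add: L1_def)
  qed
  moreover have "\<one>\<^bsub>B\<^esub> \<notin> L1"
  proof -
    have "?mon \<one>\<^bsub>B\<^esub> 0 = \<one>\<^bsub>UP B\<^esub>"
      by (rule ext) (simp add: UP_monom_apply UP_one_apply)
    then show ?thesis
      using one_L by (simp add: L1_def)
  qed
  ultimately obtain Q where Q: "maximal_left_ideal Q B" "L1 \<subseteq> Q"
    using B.exists_maximal_left_ideal[OF acc_B] by blast
  have Qid: "left_ideal Q B" and one_Q: "\<one>\<^bsub>B\<^esub> \<notin> Q"
    using Q(1) by (simp_all add: maximal_left_ideal_def)
  have "P \<subseteq> L1"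
  proof
    fix b assume b: "b \<in> P"
    then have bB: "b \<in> carrier B"
      using P.a_subset by blast
    have "?mon b 0 i \<in> P" for i
      using b bB P.zero_closed by (simp add: UP_monom_apply)
    then have "?mon b 0 \<in> PX"
      using B.UP_monom_closed[OF bB] unfolding PX_def by blast
    then show "b \<in> L1"
      using bB PXL by (simp add: L1_def)
  qed
  then have "P \<subseteq> Q"
    using Q(2) by (rule subset_trans)
  then have "a \<in> carrier B" "a \<otimes>\<^bsub>B\<^esub> y \<in> Q" if "a \<in> P" "y \<in> carrier B" for a y
    using P.I_r_closed[OF that] subsetD[OF P.a_subset that(1)] by auto
  then have PQ: "P \<subseteq> {a \<in> carrier B. \<forall>y\<in>carrier B. a \<otimes>\<^bsub>B\<^esub> y \<in> Q}"
    using P.a_subset by auto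
  have "x \<in> {a \<in> carrier B. \<forall>y\<in>carrier B. a \<otimes>\<^bsub>B\<^esub> y \<in> Q}"
    by (rule rad[OF B.primitive_ideal_of_maximal_left_ideal[OF Q(1)] PQ])
  then have xQ: "x \<otimes>\<^bsub>B\<^esub> y \<in> Q" if "y \<in> carrier B" for y
    using that by blast
  \<comment> \<open>For \<open>i < d\<close> the power begins with \<open>x\<close>, and
    \<open>x B \<subseteq> Q\<close> because \<open>x\<close> lies in the primitive ideal attached
    to \<open>Q\<close>.\<close>
  have term_Q: "h i \<odot>\<^bsub>B\<^esub> x [^]\<^bsub>B\<^esub> (d - i) \<in> Q" if "i < d" for i
  proof -
    have "d - i \<noteq> 0"
      using \<open>i < d\<close> by simp
    then obtain j where j: "d - i = Suc j"
      using not0_implies_Suc by blast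
    have "x [^]\<^bsub>B\<^esub> (d - i) = x \<otimes>\<^bsub>B\<^esub> x [^]\<^bsub>B\<^esub> j"
      unfolding j by (rule B.nat_pow_Suc2[OF x])
    then have "x [^]\<^bsub>B\<^esub> (d - i) \<in> Q"
      using xQ pow by simp
    then have "(h i \<odot>\<^bsub>B\<^esub> \<one>\<^bsub>B\<^esub>) \<otimes>\<^bsub>B\<^esub> x [^]\<^bsub>B\<^esub> (d - i) \<in> Q"
      using hK by (intro B.left_ideal_mult[OF Qid]) auto
    then show ?thesis
      unfolding smult_eq_mult[OF hK pow] .
  qed
  have atMost: "{..d} = insert d {..<d}"
    by auto
  have "(\<Oplus>\<^bsub>B\<^esub>i\<in>insert d {..<d}. h i \<odot>\<^bsub>B\<^esub> x [^]\<^bsub>B\<^esub> (d - i))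
      = h d \<odot>\<^bsub>B\<^esub> x [^]\<^bsub>B\<^esub> (d - d) \<oplus>\<^bsub>B\<^esub> (\<Oplus>\<^bsub>B\<^esub>i\<in>{..<d}. h i \<odot>\<^bsub>B\<^esub> x [^]\<^bsub>B\<^esub> (d - i))"
    using hx hK by (intro B.finsum_insert) auto
  then have "c = h d \<odot>\<^bsub>B\<^esub> \<one>\<^bsub>B\<^esub> \<oplus>\<^bsub>B\<^esub> (\<Oplus>\<^bsub>B\<^esub>i\<in>{..<d}. h i \<odot>\<^bsub>B\<^esub> x [^]\<^bsub>B\<^esub> (d - i))"
    unfolding c_def atMost by simp
  moreover have s: "(\<Oplus>\<^bsub>B\<^esub>i\<in>{..<d}. h i \<odot>\<^bsub>B\<^esub> x [^]\<^bsub>B\<^esub> (d - i)) \<in> Q"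
    using term_Q by (intro B.left_ideal_finsum[OF Qid]) auto
  moreover have "c \<in> Q"
    using cB cL Q(2) by (auto simp: L1_def)
  ultimately have "h d \<odot>\<^bsub>B\<^esub> \<one>\<^bsub>B\<^esub> \<in> Q"
    using B.left_ideal_minus[OF Qid, of c "\<Oplus>\<^bsub>B\<^esub>i\<in>{..<d}. h i \<odot>\<^bsub>B\<^esub> x [^]\<^bsub>B\<^esub> (d - i)"]
      B.left_ideal_carrier[OF Qid s] hK[of d] by (simp add: B.minus_eq B.a_assoc B.r_neg)
  moreover have inv: "inv\<^bsub>K\<^esub> h d \<in> carrier K" "inv\<^bsub>K\<^esub> h d \<otimes>\<^bsub>K\<^esub> h d = \<one>\<^bsub>K\<^esub>"
    using hd(1) hK K.field_Units by auto
  ultimately have "(inv\<^bsub>K\<^esub> h d \<odot>\<^bsub>B\<^esub> \<one>\<^bsub>B\<^esub>) \<otimes>\<^bsub>B\<^esub> (h d \<odot>\<^bsub>B\<^esub> \<one>\<^bsub>B\<^esub>) \<in> Q"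
    by (intro B.left_ideal_mult[OF Qid]) auto
  moreover have "(inv\<^bsub>K\<^esub> h d \<odot>\<^bsub>B\<^esub> \<one>\<^bsub>B\<^esub>) \<otimes>\<^bsub>B\<^esub> (h d \<odot>\<^bsub>B\<^esub> \<one>\<^bsub>B\<^esub>) = \<one>\<^bsub>B\<^esub>"
    using inv hK[of d] by (simp add: smult_mult_left KB.smult_assoc1[symmetric])
  ultimately show False
    using one_Q by simp
qed

text \<open>A semiprime ideal is an intersection of primes, so it suffices to treat a prime
  \<open>P\<close>: the intersection \<open>J\<close> of the primitive ideals above it is nil modulo
  \<open>P\<close>, and therefore contained in \<open>P\<close>.\<close>

theorem jacobson_B: "jacobson B"
  unfolding jacobson_def
proof (intro allI impI)
  fix I assume "semiprime_ideal I B"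
  then have I: "ideal I B" "I = \<Inter>{P. prime_ideal P B \<and> I \<subseteq> P}"
    by (simp_all add: semiprime_ideal_def)
  have prime: "x \<in> P"
    if P: "prime_ideal P B" and x: "x \<in> carrier B" "\<And>Q. \<lbrakk>primitive_ideal Q B; P \<subseteq> Q\<rbrakk> \<Longrightarrow> x \<in> Q" for P x
  proof -
    have Pid: "ideal P B"
      using P by (simp add: prime_ideal_def)
    \<comment> \<open>Formed inside \<open>carrier B\<close>, so that an empty family of primitive
      ideals gives all of \<open>B\<close>.\<close>
    define J where "J = {x \<in> carrier B. \<forall>Q. primitive_ideal Q B \<and> P \<subseteq> Q \<longrightarrow> x \<in> Q}"
    have "left_ideal J B"
    proof (rule B.left_idealI)
      show "\<zero>\<^bsub>B\<^esub> \<in> J"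
        unfolding J_def
        using additive_subgroup.zero_closed[OF ideal.axioms(1)[OF B.primitive_ideal_ideal]] by blast
      show "x \<oplus>\<^bsub>B\<^esub> y \<in> J" if "x \<in> J" "y \<in> J" for x y
        using that additive_subgroup.a_closed[OF ideal.axioms(1)[OF B.primitive_ideal_ideal]]
        unfolding J_def by blast
      show "a \<otimes>\<^bsub>B\<^esub> x \<in> J" if "a \<in> carrier B" "x \<in> J" for a x
        using that ideal.I_l_closed[OF B.primitive_ideal_ideal] unfolding J_def by blast
    qed (auto simp: J_def)
    then have "ideal J B"
    proof (rule B.ideal_of_left_ideal)
      show "x \<otimes>\<^bsub>B\<^esub> a \<in> J" if "x \<in> J" "a \<in> carrier B" for x a
        using that ideal.I_r_closed[OF B.primitive_ideal_ideal] unfolding J_def by blast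
    qed
    then have "J \<subseteq> P"
    proof (rule B.nil_ideal_subset_prime_ideal[OF acc_B P])
      show "\<exists>n::nat. y [^]\<^bsub>B\<^esub> n \<in> P" if "y \<in> J" for y
        using that by (intro primitive_radical_nil[OF Pid]) (auto simp: J_def)
    qed
    then show ?thesis
      using x unfolding J_def by blast
  qed
  let ?\<P> = "{Q. primitive_ideal Q B \<and> I \<subseteq> Q}"
  have "carrier B \<inter> \<Inter>?\<P> \<subseteq> I"
  proof
    fix x assume x: "x \<in> carrier B \<inter> \<Inter>?\<P>"
    have "x \<in> P" if "prime_ideal P B" "I \<subseteq> P" for P
      using prime[OF that(1)] x that(2) by blast
    then show "x \<in> I"
      by (subst I(2)) blast
  qed
  moreover have "I \<subseteq> carrier B \<inter> \<Inter>?\<P>"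
    using additive_subgroup.a_subset[OF ideal.axioms(1)[OF I(1)]] by blast
  ultimately have "I = carrier B \<inter> \<Inter>?\<P>"
    by (rule subset_antisym[rotated])
  then show "semiprimitive_ideal I B"
    unfolding semiprimitive_ideal_def by (intro exI[of _ ?\<P>]) simp
qed

end

section \<open>The commutant of a simple module\<close>

context filtered_algebra
begin

context
  fixes M :: "('b, 'm, 'y) module_scheme"
  assumes M: "left_module B M"
begin

interpretation M: left_module B M
  by (rule M)

lemma commutant_iff:
  "\<phi> \<in> carrier (commutant B M) \<longleftrightarrow> \<phi> \<in> extensional (carrier M) \<and> (\<forall>x\<in>carrier M. \<phi> x \<in> carrier M) \<and>
    (\<forall>x\<in>carrier M. \<forall>y\<in>carrier M. \<phi> (x \<oplus>\<^bsub>M\<^esub> y) = \<phi> x \<oplus>\<^bsub>M\<^esub> \<phi> y) \<and>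
    (\<forall>b\<in>carrier B. \<forall>x\<in>carrier M. \<phi> (b \<odot>\<^bsub>M\<^esub> x) = b \<odot>\<^bsub>M\<^esub> \<phi> x)"
  by (auto simp: commutant_def hom_def)

lemma commutant_closed: "\<lbrakk>\<phi> \<in> carrier (commutant B M); x \<in> carrier M\<rbrakk> \<Longrightarrow> \<phi> x \<in> carrier M"
  and commutant_add:
    "\<lbrakk>\<phi> \<in> carrier (commutant B M); x \<in> carrier M; y \<in> carrier M\<rbrakk> \<Longrightarrow> \<phi> (x \<oplus>\<^bsub>M\<^esub> y) = \<phi> x \<oplus>\<^bsub>M\<^esub> \<phi> y"
  and commutant_smult:
    "\<lbrakk>\<phi> \<in> carrier (commutant B M); b \<in> carrier B; x \<in> carrier M\<rbrakk> \<Longrightarrow> \<phi> (b \<odot>\<^bsub>M\<^esub> x) = b \<odot>\<^bsub>M\<^esub> \<phi> x"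
  by (simp_all add: commutant_iff)

lemma commutant_add_apply: "x \<in> carrier M \<Longrightarrow> (\<phi> \<oplus>\<^bsub>commutant B M\<^esub> \<psi>) x = \<phi> x \<oplus>\<^bsub>M\<^esub> \<psi> x"
  and commutant_zero_apply: "x \<in> carrier M \<Longrightarrow> \<zero>\<^bsub>commutant B M\<^esub> x = \<zero>\<^bsub>M\<^esub>"
  and commutant_smult_apply: "x \<in> carrier M \<Longrightarrow> (a \<odot>\<^bsub>commutant B M\<^esub> \<phi>) x = (a \<odot>\<^bsub>B\<^esub> \<one>\<^bsub>B\<^esub>) \<odot>\<^bsub>M\<^esub> \<phi> x"
  and commutant_mult_apply: "x \<in> carrier M \<Longrightarrow> (\<phi> \<otimes>\<^bsub>commutant B M\<^esub> \<psi>) x = \<phi> (\<psi> x)"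
  and commutant_one_apply: "x \<in> carrier M \<Longrightarrow> \<one>\<^bsub>commutant B M\<^esub> x = x"
  by (simp_all add: commutant_def compose_def)

lemma commutant_eqI:
  assumes "\<phi> \<in> carrier (commutant B M)" "\<psi> \<in> carrier (commutant B M)" "\<And>x. x \<in> carrier M \<Longrightarrow> \<phi> x = \<psi> x"
  shows "\<phi> = \<psi>"
proof (rule extensionalityI)
  show "\<phi> \<in> extensional (carrier M)" "\<psi> \<in> extensional (carrier M)"
    using assms(1,2) by (simp_all add: commutant_iff)
qed (rule assms(3))

lemma commutant_zero_closed: "\<zero>\<^bsub>commutant B M\<^esub> \<in> carrier (commutant B M)"
proof -
  have "\<zero>\<^bsub>commutant B M\<^esub> \<in> extensional (carrier M)"
    by (simp add: commutant_def)
  then show ?thesis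
    unfolding commutant_iff by (simp add: commutant_zero_apply)
qed

lemma commutant_one_closed: "\<one>\<^bsub>commutant B M\<^esub> \<in> carrier (commutant B M)"
proof -
  have "\<one>\<^bsub>commutant B M\<^esub> \<in> extensional (carrier M)"
    by (simp add: commutant_def)
  then show ?thesis
    unfolding commutant_iff by (simp add: commutant_one_apply)
qed

lemma commutant_add_closed:
  assumes "\<phi> \<in> carrier (commutant B M)" "\<psi> \<in> carrier (commutant B M)"
  shows "\<phi> \<oplus>\<^bsub>commutant B M\<^esub> \<psi> \<in> carrier (commutant B M)"
proof -
  have "\<phi> \<oplus>\<^bsub>commutant B M\<^esub> \<psi> \<in> extensional (carrier M)"
    by (simp add: commutant_def)
  then show ?thesis
    using assms unfolding commutant_iff
    by (simp add: commutant_add_apply M.M.a_ac M.smult_r_distr)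
qed

lemma commutant_mult_closed:
  assumes "\<phi> \<in> carrier (commutant B M)" "\<psi> \<in> carrier (commutant B M)"
  shows "\<phi> \<otimes>\<^bsub>commutant B M\<^esub> \<psi> \<in> carrier (commutant B M)"
proof -
  have "\<phi> \<otimes>\<^bsub>commutant B M\<^esub> \<psi> \<in> extensional (carrier M)"
    by (simp add: commutant_def)
  then show ?thesis
    using assms unfolding commutant_iff by (simp add: commutant_mult_apply)
qed

lemma commutant_smult_closed:
  assumes a: "a \<in> carrier K" and \<phi>: "\<phi> \<in> carrier (commutant B M)"
  shows "a \<odot>\<^bsub>commutant B M\<^esub> \<phi> \<in> carrier (commutant B M)"
proof -
  have "(a \<odot>\<^bsub>B\<^esub> \<one>\<^bsub>B\<^esub>) \<odot>\<^bsub>M\<^esub> (b \<odot>\<^bsub>M\<^esub> x) = b \<odot>\<^bsub>M\<^esub> ((a \<odot>\<^bsub>B\<^esub> \<one>\<^bsub>B\<^esub>) \<odot>\<^bsub>M\<^esub> x)"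
    if "b \<in> carrier B" "x \<in> carrier M" for b x
    using a that central_scalars.\<kappa>_central[OF central_scalars_B a that(1)]
    by (simp flip: M.smult_assoc1)
  moreover have "a \<odot>\<^bsub>commutant B M\<^esub> \<phi> \<in> extensional (carrier M)"
    by (simp add: commutant_def)
  ultimately show ?thesis
    using \<phi> a unfolding commutant_iff by (simp add: commutant_smult_apply M.smult_r_distr)
qed

text \<open>Lets the sum in \<open>algebraic_element\<close> be evaluated pointwise; powers are
  treated separately, as iterates.\<close>

lemma abelian_group_commutant: "abelian_group (commutant B M)"
proof (rule abelian_groupI)
  fix \<phi> assume \<phi>: "\<phi> \<in> carrier (commutant B M)"
  define \<psi> where "\<psi> = (\<lambda>x\<in>carrier M. \<ominus>\<^bsub>M\<^esub> \<phi> x)"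
  have \<psi>: "\<psi> \<in> carrier (commutant B M)"
    using \<phi> unfolding commutant_iff \<psi>_def by (simp add: M.M.minus_add M.smult_r_minus)
  have "\<psi> \<oplus>\<^bsub>commutant B M\<^esub> \<phi> = \<zero>\<^bsub>commutant B M\<^esub>"
    using \<phi> \<psi> by (intro commutant_eqI commutant_add_closed commutant_zero_closed)
      (simp_all add: commutant_add_apply commutant_zero_apply \<psi>_def M.M.l_neg commutant_closed)
  then show "\<exists>\<psi>\<in>carrier (commutant B M). \<psi> \<oplus>\<^bsub>commutant B M\<^esub> \<phi> = \<zero>\<^bsub>commutant B M\<^esub>"
    using \<psi> by blast
next
  fix \<phi> \<psi> \<chi> assume "\<phi> \<in> carrier (commutant B M)" "\<psi> \<in> carrier (commutant B M)" "\<chi> \<in> carrier (commutant B M)"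
  then show "\<phi> \<oplus>\<^bsub>commutant B M\<^esub> \<psi> \<oplus>\<^bsub>commutant B M\<^esub> \<chi> = \<phi> \<oplus>\<^bsub>commutant B M\<^esub> (\<psi> \<oplus>\<^bsub>commutant B M\<^esub> \<chi>)"
    by (intro commutant_eqI commutant_add_closed)
      (simp_all add: commutant_add_apply M.M.a_assoc commutant_closed)
next
  fix \<phi> \<psi> assume "\<phi> \<in> carrier (commutant B M)" "\<psi> \<in> carrier (commutant B M)"
  then show "\<phi> \<oplus>\<^bsub>commutant B M\<^esub> \<psi> = \<psi> \<oplus>\<^bsub>commutant B M\<^esub> \<phi>"
    by (intro commutant_eqI commutant_add_closed)
      (simp_all add: commutant_add_apply M.M.a_comm commutant_closed)
next
  fix \<phi> assume "\<phi> \<in> carrier (commutant B M)"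
  then show "\<zero>\<^bsub>commutant B M\<^esub> \<oplus>\<^bsub>commutant B M\<^esub> \<phi> = \<phi>"
    by (intro commutant_eqI commutant_add_closed commutant_zero_closed)
      (simp_all add: commutant_add_apply commutant_zero_apply commutant_closed)
qed (auto intro: commutant_add_closed commutant_zero_closed)

lemma commutant_finsum_apply:
  assumes "finite Y" "f \<in> Y \<rightarrow> carrier (commutant B M)" and x: "x \<in> carrier M"
  shows "(\<Oplus>\<^bsub>commutant B M\<^esub>y\<in>Y. f y) x = (\<Oplus>\<^bsub>M\<^esub>y\<in>Y. f y x)"
proof -
  interpret E: abelian_group "commutant B M"
    by (rule abelian_group_commutant)
  show ?thesis
    using assms(1,2)
  proof (induction Y)
    case empty
    then show ?case
      using x by (simp add: commutant_zero_apply)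
  next
    case (insert y Y)
    then have "f y \<in> carrier (commutant B M)" "f \<in> Y \<rightarrow> carrier (commutant B M)" "(\<lambda>y. f y x) \<in> Y \<rightarrow> carrier M"
      using x by (auto intro: commutant_closed)
    with insert show ?case
      using x by (simp add: commutant_add_apply commutant_closed)
  qed
qed

lemma commutant_pow_closed:
  assumes \<phi>: "\<phi> \<in> carrier (commutant B M)"
  shows "\<phi> [^]\<^bsub>commutant B M\<^esub> (n::nat) \<in> carrier (commutant B M)"
  by (induction n) (auto simp: nat_pow_def commutant_one_closed intro: commutant_mult_closed[unfolded] \<phi>)

lemma commutant_pow_apply:
  assumes \<phi>: "\<phi> \<in> carrier (commutant B M)" and x: "x \<in> carrier M"
  shows "(\<phi> [^]\<^bsub>commutant B M\<^esub> (n::nat)) x = (\<phi> ^^ n) x"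
  using x
proof (induction n arbitrary: x)
  case 0
  then show ?case
    by (simp add: nat_pow_def commutant_one_apply)
next
  case (Suc n)
  have "(\<phi> [^]\<^bsub>commutant B M\<^esub> Suc n) x = (\<phi> [^]\<^bsub>commutant B M\<^esub> n) (\<phi> x)"
    using Suc.prems by (simp add: nat_pow_def commutant_mult_apply)
  then show ?case
    using Suc.IH[OF commutant_closed[OF \<phi> Suc.prems]] by (simp only: funpow_Suc_right o_apply)
qed

lemma commutant_funpow_smult:
  assumes \<phi>: "\<phi> \<in> carrier (commutant B M)" and x: "x \<in> carrier M"
  shows "(\<phi> ^^ n) x \<in> carrier M" "b \<in> carrier B \<Longrightarrow> (\<phi> ^^ n) (b \<odot>\<^bsub>M\<^esub> x) = b \<odot>\<^bsub>M\<^esub> (\<phi> ^^ n) x"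
proof -
  show cl: "(\<phi> ^^ n) x \<in> carrier M" for n
    by (induction n) (auto simp: x commutant_closed[OF \<phi>])
  show "(\<phi> ^^ n) (b \<odot>\<^bsub>M\<^esub> x) = b \<odot>\<^bsub>M\<^esub> (\<phi> ^^ n) x" if "b \<in> carrier B"
    using that by (induction n) (auto simp: commutant_smult[OF \<phi>] cl)
qed

lemma commutant_finsum:
  assumes \<phi>: "\<phi> \<in> carrier (commutant B M)" and "finite Y" "f \<in> Y \<rightarrow> carrier M"
  shows "\<phi> (\<Oplus>\<^bsub>M\<^esub>y\<in>Y. f y) = (\<Oplus>\<^bsub>M\<^esub>y\<in>Y. \<phi> (f y))"
  using assms(2,3)
proof (induction Y)
  case empty
  have "\<phi> \<zero>\<^bsub>M\<^esub> = \<phi> (\<zero>\<^bsub>B\<^esub> \<odot>\<^bsub>M\<^esub> \<zero>\<^bsub>M\<^esub>)"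
    by simp
  also have "\<dots> = \<zero>\<^bsub>B\<^esub> \<odot>\<^bsub>M\<^esub> \<phi> \<zero>\<^bsub>M\<^esub>"
    by (intro commutant_smult[OF \<phi>]) auto
  also have "\<dots> = \<zero>\<^bsub>M\<^esub>"
    using commutant_closed[OF \<phi>] by simp
  finally show ?case
    by simp
next
  case (insert y Y)
  then have "f y \<in> carrier M" "f \<in> Y \<rightarrow> carrier M" "(\<lambda>y. \<phi> (f y)) \<in> Y \<rightarrow> carrier M"
    by (auto intro: commutant_closed[OF \<phi>])
  with insert show ?case
    by (simp add: commutant_add[OF \<phi>] commutant_closed[OF \<phi>])
qed

end

end

context noetherian_filtered_algebra
begin

text \<open>For \<open>v \<noteq> 0\<close> in \<open>M\<close>, the polynomials \<open>u\<close> with \<open>u(\<phi>) v = 0\<close> form a maximal left ideal of \<open>B[X]\<close>.\<close>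

theorem algebraic_commutant:
  fixes M :: "('b, 'm, 'y) module_scheme"
  assumes simple: "simple_module B M"
  shows "algebraic_algebra K (commutant B M)"
  unfolding algebraic_algebra_def
proof
  fix \<phi> assume \<phi>: "\<phi> \<in> carrier (commutant B M)"
  have LM: "left_module B M"
    using simple by (simp add: simple_module_def)
  interpret M: left_module B M
    by (rule LM)
  interpret E: abelian_group "commutant B M"
    by (rule abelian_group_commutant[OF LM])
  note \<phi>_rules = commutant_closed[OF LM \<phi>] commutant_add[OF LM \<phi>] commutant_smult[OF LM \<phi>]
  obtain v where v: "v \<in> carrier M" "v \<noteq> \<zero>\<^bsub>M\<^esub>"
    using simple M.M.zero_closed unfolding simple_module_def by blast
  define w where "w i = (\<phi> ^^ i) v" for i
  have w: "w i \<in> carrier M" for i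
    unfolding w_def by (rule commutant_funpow_smult(1)[OF LM \<phi> v(1)])
  \<comment> \<open>This is \<open>u(\<phi>) v\<close> as soon as \<open>n\<close> bounds the degree
    of \<open>u\<close>. The bound is explicit so that two polynomials can be evaluated with a
    common one.\<close>
  define ev where "ev n u = (\<Oplus>\<^bsub>M\<^esub>i\<in>{..<n}. u i \<odot>\<^bsub>M\<^esub> w i)" for n :: nat and u :: "nat \<Rightarrow> 'b"
  have uw: "(\<lambda>i. u i \<odot>\<^bsub>M\<^esub> w i) \<in> Y \<rightarrow> carrier M" if "u \<in> carrier (UP B)" for u Y
    using that w by auto
  have ev_closed: "ev n u \<in> carrier M" if "u \<in> carrier (UP B)" for n u
    unfolding ev_def by (rule M.M.finsum_closed[OF uw[OF that]])
  have ev_mono: "ev n u = ev m u" if "u \<in> carrier (UP B)" "m \<le> n" "\<And>i. i \<ge> m \<Longrightarrow> u i = \<zero>\<^bsub>B\<^esub>" for m n u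
    unfolding ev_def using that w by (intro M.M.add.finprod_mono_neutral_cong_right) auto
  define L where "L = {u \<in> carrier (UP B). \<exists>n. (\<forall>i\<ge>n. u i = \<zero>\<^bsub>B\<^esub>) \<and> ev n u = \<zero>\<^bsub>M\<^esub>}"
  have L_iff: "u \<in> L \<longleftrightarrow> ev n u = \<zero>\<^bsub>M\<^esub>" if u: "u \<in> carrier (UP B)" and n: "\<And>i. i \<ge> n \<Longrightarrow> u i = \<zero>\<^bsub>B\<^esub>" for u n
  proof
    assume "u \<in> L"
    then obtain m where m: "\<forall>i\<ge>m. u i = \<zero>\<^bsub>B\<^esub>" "ev m u = \<zero>\<^bsub>M\<^esub>"
      unfolding L_def by blast
    have "ev (max m n) u = ev m u" "ev (max m n) u = ev n u"
      using m(1) n by (auto intro!: ev_mono[OF u])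
    then show "ev n u = \<zero>\<^bsub>M\<^esub>"
      using m(2) by simp
  next
    assume "ev n u = \<zero>\<^bsub>M\<^esub>"
    then show "u \<in> L"
      using u n unfolding L_def by blast
  qed
  have ev_add: "ev n (u \<oplus>\<^bsub>UP B\<^esub> u') = ev n u \<oplus>\<^bsub>M\<^esub> ev n u'"
    if u: "u \<in> carrier (UP B)" and u': "u' \<in> carrier (UP B)" for n u u'
  proof -
    have "ev n (u \<oplus>\<^bsub>UP B\<^esub> u') = (\<Oplus>\<^bsub>M\<^esub>i\<in>{..<n}. u i \<odot>\<^bsub>M\<^esub> w i \<oplus>\<^bsub>M\<^esub> u' i \<odot>\<^bsub>M\<^esub> w i)"
      unfolding ev_def
    proof (intro M.M.finsum_cong' refl)
      fix i show "(u \<oplus>\<^bsub>UP B\<^esub> u') i \<odot>\<^bsub>M\<^esub> w i = u i \<odot>\<^bsub>M\<^esub> w i \<oplus>\<^bsub>M\<^esub> u' i \<odot>\<^bsub>M\<^esub> w i"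
        unfolding UP_add_apply[OF u u'] using u u' w by (intro M.smult_l_distr) auto
    qed (use u u' w in auto)
    then show ?thesis
      unfolding ev_def using M.M.finsum_addf[OF uw[OF u] uw[OF u']] by simp
  qed
  \<comment> \<open>Multiplication by \<open>b X^k\<close> acts on \<open>u(\<phi>) v\<close> as
    \<open>b \<phi>^k\<close>, because \<open>\<phi>\<close> commutes with the coefficients; the
    degree bound moves by \<open>k\<close>.\<close>
  have ev_monom: "ev (n + k) (up_ring.monom (UP B) b k \<otimes>\<^bsub>UP B\<^esub> u) = b \<odot>\<^bsub>M\<^esub> (\<phi> ^^ k) (ev n u)"
    if b: "b \<in> carrier B" and u: "u \<in> carrier (UP B)" for b k n u
  proof -
    let ?m = "up_ring.monom (UP B) b k \<otimes>\<^bsub>UP B\<^esub> u"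
    have mB: "?m \<in> carrier (UP B)"
      using b u by simp
    have m_apply: "?m i = (if k \<le> i then b \<otimes>\<^bsub>B\<^esub> u (i - k) else \<zero>\<^bsub>B\<^esub>)" for i
      by (rule B.monom_mult_apply[OF b u])
    have wk: "w (i + k) = (\<phi> ^^ k) (w i)" for i
      unfolding w_def by (simp add: funpow_add add.commute[of i k])
    have "ev (n + k) ?m = (\<Oplus>\<^bsub>M\<^esub>j\<in>(\<lambda>i. i + k) ` {..<n}. ?m j \<odot>\<^bsub>M\<^esub> w j)"
      unfolding ev_def
    proof (intro M.M.add.finprod_mono_neutral_cong_right)
      show "(\<lambda>i. i + k) ` {..<n} \<subseteq> {..<n + k}"
        by auto
      show "?m j \<odot>\<^bsub>M\<^esub> w j = \<zero>\<^bsub>M\<^esub>" if "j \<in> {..<n + k} - (\<lambda>i. i + k) ` {..<n}" for j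
      proof -
        have "j < k"
        proof (rule ccontr)
          assume "\<not> j < k"
          then have "j = (j - k) + k" "j - k < n"
            using that by auto
          then show False
            using that by blast
        qed
        then show ?thesis
          unfolding m_apply using w by simp
      qed
    qed (use uw[OF mB] in auto)
    also have "\<dots> = (\<Oplus>\<^bsub>M\<^esub>i\<in>{..<n}. ?m (i + k) \<odot>\<^bsub>M\<^esub> w (i + k))"
      using uw[OF mB] by (intro M.M.finsum_reindex) (auto simp: inj_on_def)
    also have "\<dots> = (\<Oplus>\<^bsub>M\<^esub>i\<in>{..<n}. b \<odot>\<^bsub>M\<^esub> (\<phi> ^^ k) (u i \<odot>\<^bsub>M\<^esub> w i))"
    proof (intro M.M.finsum_cong' refl)
      show "(\<lambda>i. b \<odot>\<^bsub>M\<^esub> (\<phi> ^^ k) (u i \<odot>\<^bsub>M\<^esub> w i)) \<in> {..<n} \<rightarrow> carrier M"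
        using b u w commutant_funpow_smult(1)[OF LM \<phi>] by auto
      fix i
      have "(\<phi> ^^ k) (u i \<odot>\<^bsub>M\<^esub> w i) = u i \<odot>\<^bsub>M\<^esub> (\<phi> ^^ k) (w i)"
        using u by (intro commutant_funpow_smult(2)[OF LM \<phi> w]) auto
      moreover have "(\<phi> ^^ k) (w i) \<in> carrier M"
        by (rule commutant_funpow_smult(1)[OF LM \<phi> w])
      ultimately show "?m (i + k) \<odot>\<^bsub>M\<^esub> w (i + k) = b \<odot>\<^bsub>M\<^esub> (\<phi> ^^ k) (u i \<odot>\<^bsub>M\<^esub> w i)"
        unfolding m_apply wk using b u by (simp add: M.smult_assoc1)
    qed
    also have "\<dots> = b \<odot>\<^bsub>M\<^esub> (\<Oplus>\<^bsub>M\<^esub>i\<in>{..<n}. (\<phi> ^^ k) (u i \<odot>\<^bsub>M\<^esub> w i))"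
      using b u w commutant_funpow_smult(1)[OF LM \<phi>] by (intro M.smult_finsum[symmetric]) auto
    also have "(\<Oplus>\<^bsub>M\<^esub>i\<in>{..<n}. (\<phi> ^^ k) (u i \<odot>\<^bsub>M\<^esub> w i)) = (\<phi> ^^ k) (ev n u)"
    proof (induction k)
      case 0
      then show ?case
        by (simp add: ev_def)
    next
      case (Suc k)
      have "(\<lambda>i. (\<phi> ^^ k) (u i \<odot>\<^bsub>M\<^esub> w i)) \<in> {..<n} \<rightarrow> carrier M"
        using u w commutant_funpow_smult(1)[OF LM \<phi>] by auto
      from commutant_finsum[OF LM \<phi> finite_lessThan this] Suc show ?case
        by simp
    qed
    finally show ?thesis .
  qed
  have zeroL: "\<zero>\<^bsub>UP B\<^esub> \<in> L"
    using L_iff[of "\<zero>\<^bsub>UP B\<^esub>" 0] by (simp add: UP_zero_apply ev_def)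
  have addL: "u \<oplus>\<^bsub>UP B\<^esub> u' \<in> L" if u: "u \<in> L" and u': "u' \<in> L" for u u'
  proof -
    have uB: "u \<in> carrier (UP B)" "u' \<in> carrier (UP B)"
      using u u' by (simp_all add: L_def)
    obtain n m where n: "\<forall>i\<ge>n. u i = \<zero>\<^bsub>B\<^esub>" and m: "\<forall>i\<ge>m. u' i = \<zero>\<^bsub>B\<^esub>"
      using uB by (auto simp: UP_mem_iff)
    have "ev (max n m) u = \<zero>\<^bsub>M\<^esub>" "ev (max n m) u' = \<zero>\<^bsub>M\<^esub>"
      using L_iff[OF uB(1), of "max n m"] L_iff[OF uB(2), of "max n m"] n m u u' by auto
    then have "ev (max n m) (u \<oplus>\<^bsub>UP B\<^esub> u') = \<zero>\<^bsub>M\<^esub>"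
      by (simp add: ev_add[OF uB])
    moreover have "(u \<oplus>\<^bsub>UP B\<^esub> u') i = \<zero>\<^bsub>B\<^esub>" if "i \<ge> max n m" for i
      unfolding UP_add_apply[OF uB] using n m that by simp
    ultimately show ?thesis
      using L_iff[OF BP.a_closed[OF uB]] by blast
  qed
  have monomL: "up_ring.monom (UP B) b k \<otimes>\<^bsub>UP B\<^esub> u \<in> L" if b: "b \<in> carrier B" and u: "u \<in> L" for b k u
  proof -
    have uB: "u \<in> carrier (UP B)"
      using u by (simp add: L_def)
    obtain n where n: "\<forall>i\<ge>n. u i = \<zero>\<^bsub>B\<^esub>"
      using uB by (auto simp: UP_mem_iff)
    have "ev n u = \<zero>\<^bsub>M\<^esub>"
      using L_iff[OF uB, of n] n u by blast
    moreover have "(\<phi> ^^ k) \<zero>\<^bsub>M\<^esub> = \<zero>\<^bsub>M\<^esub>"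
    proof -
      have "(\<phi> ^^ k) (\<zero>\<^bsub>B\<^esub> \<odot>\<^bsub>M\<^esub> \<zero>\<^bsub>M\<^esub>) = \<zero>\<^bsub>B\<^esub> \<odot>\<^bsub>M\<^esub> (\<phi> ^^ k) \<zero>\<^bsub>M\<^esub>"
        by (rule commutant_funpow_smult(2)[OF LM \<phi> M.M.zero_closed B.zero_closed])
      then show ?thesis
        using commutant_funpow_smult(1)[OF LM \<phi> M.M.zero_closed] by simp
    qed
    ultimately have "ev (n + k) (up_ring.monom (UP B) b k \<otimes>\<^bsub>UP B\<^esub> u) = \<zero>\<^bsub>M\<^esub>"
      using b by (simp add: ev_monom[OF b uB])
    moreover have "(up_ring.monom (UP B) b k \<otimes>\<^bsub>UP B\<^esub> u) i = \<zero>\<^bsub>B\<^esub>" if "i \<ge> n + k" for i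
      unfolding B.monom_mult_apply[OF b uB] using n b that by simp
    moreover have "up_ring.monom (UP B) b k \<otimes>\<^bsub>UP B\<^esub> u \<in> carrier (UP B)"
      using b uB by simp
    ultimately show ?thesis
      using L_iff by blast
  qed
  have L: "left_ideal L (UP B)"
  proof (rule BP.left_idealI)
    show "L \<subseteq> carrier (UP B)"
      by (auto simp: L_def)
    fix a u assume a: "a \<in> carrier (UP B)" and u: "u \<in> L"
    then have uB: "u \<in> carrier (UP B)"
      by (simp add: L_def)
    from a show "a \<otimes>\<^bsub>UP B\<^esub> u \<in> L"
    proof (rule B.UP_monom_induct[where Q = "\<lambda>a. a \<otimes>\<^bsub>UP B\<^esub> u \<in> L"])
      show "\<zero>\<^bsub>UP B\<^esub> \<otimes>\<^bsub>UP B\<^esub> u \<in> L"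
        unfolding BP.l_null[OF uB] by (rule zeroL)
      show "(p \<oplus>\<^bsub>UP B\<^esub> q) \<otimes>\<^bsub>UP B\<^esub> u \<in> L"
        if "p \<in> carrier (UP B)" "q \<in> carrier (UP B)" "p \<otimes>\<^bsub>UP B\<^esub> u \<in> L" "q \<otimes>\<^bsub>UP B\<^esub> u \<in> L" for p q
        unfolding BP.l_distr[OF that(1,2) uB] by (rule addL[OF that(3,4)])
      show "up_ring.monom (UP B) (a i) i \<otimes>\<^bsub>UP B\<^esub> u \<in> L" for i
        using a u by (intro monomL) auto
    qed
  qed (rule zeroL, rule addL)
  have ev_one: "ev (Suc n) \<one>\<^bsub>UP B\<^esub> = v" for n
  proof -
    have "ev (Suc n) \<one>\<^bsub>UP B\<^esub> = ev 1 \<one>\<^bsub>UP B\<^esub>"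
      by (rule ev_mono) (auto simp: UP_one_apply)
    also have "\<dots> = v"
      using v(1) by (simp add: ev_def UP_one_apply w_def lessThan_Suc)
    finally show ?thesis .
  qed
  have one_L: "\<one>\<^bsub>UP B\<^esub> \<notin> L"
    using L_iff[of "\<one>\<^bsub>UP B\<^esub>" 1] ev_one[of 0] v(2) by (simp add: UP_one_apply)
  have "maximal_left_ideal L (UP B)"
    unfolding maximal_left_ideal_def
  proof (intro conjI L one_L ballI)
    fix u assume u: "u \<in> carrier (UP B) - L"
    then have uB: "u \<in> carrier (UP B)"
      by simp
    obtain n where n: "\<forall>i\<ge>n. u i = \<zero>\<^bsub>B\<^esub>"
      using uB by (auto simp: UP_mem_iff)
    \<comment> \<open>A positive bound covers the polynomial \<open>\<one>\<close> as well.\<close>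
    have n': "\<forall>i\<ge>Suc n. u i = \<zero>\<^bsub>B\<^esub>"
      using n by simp
    then have "ev (Suc n) u \<noteq> \<zero>\<^bsub>M\<^esub>"
      using L_iff[OF uB, of "Suc n"] u by blast
    \<comment> \<open>By simplicity \<open>u(\<phi>) v\<close> generates \<open>M\<close>. If
      \<open>b\<close> maps it to \<open>v\<close>, then \<open>1 - b u\<close> is in
      \<open>L\<close>, which is the maximality condition.\<close>
    then have "v \<in> (\<lambda>b. b \<odot>\<^bsub>M\<^esub> ev (Suc n) u) ` carrier B"
      using simple_module_generated[OF simple ev_closed[OF uB]] v(1) by blast
    then obtain b where b: "b \<in> carrier B" "v = b \<odot>\<^bsub>M\<^esub> ev (Suc n) u"
      by blast
    let ?r = "up_ring.monom (UP B) b 0"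
    let ?r' = "up_ring.monom (UP B) (\<ominus>\<^bsub>B\<^esub> b) 0"
    have r: "?r \<in> carrier (UP B)" "?r' \<in> carrier (UP B)"
      using b(1) by simp_all
    let ?l = "\<one>\<^bsub>UP B\<^esub> \<oplus>\<^bsub>UP B\<^esub> ?r' \<otimes>\<^bsub>UP B\<^esub> u"
    have ru: "?r' \<otimes>\<^bsub>UP B\<^esub> u \<in> carrier (UP B)"
      using r uB by simp
    have "ev (Suc n) (?r' \<otimes>\<^bsub>UP B\<^esub> u) = (\<ominus>\<^bsub>B\<^esub> b) \<odot>\<^bsub>M\<^esub> ev (Suc n) u"
      using ev_monom[of "\<ominus>\<^bsub>B\<^esub> b" u "Suc n" 0] b(1) uB by simp
    also have "\<dots> = \<ominus>\<^bsub>M\<^esub> v"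
      unfolding b(2) by (rule M.smult_l_minus[OF b(1) ev_closed[OF uB]])
    finally have "ev (Suc n) ?l = \<zero>\<^bsub>M\<^esub>"
      unfolding ev_add[OF BP.one_closed ru] ev_one using v(1) by (simp add: M.M.r_neg)
    moreover have "?l i = \<zero>\<^bsub>B\<^esub>" if "i \<ge> Suc n" for i
      unfolding UP_add_apply[OF BP.one_closed ru] B.monom_mult_apply[OF B.a_inv_closed[OF b(1)] uB]
      using that n' b(1) by (simp add: UP_one_apply)
    ultimately have lL: "?l \<in> L"
      using L_iff[OF BP.a_closed[OF BP.one_closed ru]] by blast
    have "?r \<oplus>\<^bsub>UP B\<^esub> ?r' = \<zero>\<^bsub>UP B\<^esub>"
    proof
      fix i show "(?r \<oplus>\<^bsub>UP B\<^esub> ?r') i = \<zero>\<^bsub>UP B\<^esub> i"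
        unfolding UP_add_apply[OF r] using b(1) by (simp add: UP_monom_apply UP_zero_apply B.r_neg)
    qed
    then have "(?r \<oplus>\<^bsub>UP B\<^esub> ?r') \<otimes>\<^bsub>UP B\<^esub> u = \<zero>\<^bsub>UP B\<^esub>"
      using BP.l_null[OF uB] by (simp only:)
    then have "?r \<otimes>\<^bsub>UP B\<^esub> u \<oplus>\<^bsub>UP B\<^esub> ?r' \<otimes>\<^bsub>UP B\<^esub> u = \<zero>\<^bsub>UP B\<^esub>"
      using BP.l_distr[OF r uB] by simp
    moreover have "?r \<otimes>\<^bsub>UP B\<^esub> u \<oplus>\<^bsub>UP B\<^esub> ?l = \<one>\<^bsub>UP B\<^esub> \<oplus>\<^bsub>UP B\<^esub> (?r \<otimes>\<^bsub>UP B\<^esub> u \<oplus>\<^bsub>UP B\<^esub> ?r' \<otimes>\<^bsub>UP B\<^esub> u)"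
      using BP.a_lcomm[OF BP.m_closed[OF r(1) uB] BP.one_closed ru] .
    ultimately have "?r \<otimes>\<^bsub>UP B\<^esub> u \<oplus>\<^bsub>UP B\<^esub> ?l = \<one>\<^bsub>UP B\<^esub>"
      using BP.r_zero[OF BP.one_closed] by (simp only:)
    then show "\<exists>r\<in>carrier (UP B). \<exists>l\<in>L. \<one>\<^bsub>UP B\<^esub> = r \<otimes>\<^bsub>UP B\<^esub> u \<oplus>\<^bsub>UP B\<^esub> l"
      using r(1) lL by (intro bexI[of _ ?r] bexI[of _ ?l]) (simp_all only:)
  qed
  then obtain h where h: "h \<in> carrier (UP K)" "h \<noteq> \<zero>\<^bsub>UP K\<^esub>" "CB.\<iota> h \<in> L"
    using maximal_left_ideal_meets_scalars by blast
  interpret UK: UP_ring K "UP K"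
    by unfold_locales
  have hK: "h i \<in> carrier K" for i
    using h(1) by simp
  have h0: "CB.\<iota> h i = \<zero>\<^bsub>B\<^esub>" if "i \<ge> Suc (deg K h)" for i
    unfolding CB.\<iota>_def using UK.deg_aboveD[OF _ h(1), of i] h(1) that by simp
  have ev_h: "(\<Oplus>\<^bsub>M\<^esub>i\<in>{..deg K h}. (h i \<odot>\<^bsub>B\<^esub> \<one>\<^bsub>B\<^esub>) \<odot>\<^bsub>M\<^esub> w i) = \<zero>\<^bsub>M\<^esub>"
  proof -
    have "ev (Suc (deg K h)) (CB.\<iota> h) = \<zero>\<^bsub>M\<^esub>"
      using h(3) by (simp only: L_iff[OF CB.\<iota>_closed[OF h(1)] h0])
    then show ?thesis
      by (simp only: ev_def CB.\<iota>_def lessThan_Suc_atMost)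
  qed
  let ?f = "\<lambda>i. h i \<odot>\<^bsub>commutant B M\<^esub> \<phi> [^]\<^bsub>commutant B M\<^esub> i"
  have f: "?f i \<in> carrier (commutant B M)" for i
    by (rule commutant_smult_closed[OF LM hK commutant_pow_closed[OF LM \<phi>]])
  have "(\<Oplus>\<^bsub>commutant B M\<^esub>i\<in>{..deg K h}. ?f i) = \<zero>\<^bsub>commutant B M\<^esub>"
  proof (rule commutant_eqI[OF LM])
    show "(\<Oplus>\<^bsub>commutant B M\<^esub>i\<in>{..deg K h}. ?f i) \<in> carrier (commutant B M)"
      using f by (intro E.finsum_closed) auto
    \<comment> \<open>The relation holds at \<open>v\<close>, and \<open>M = B v\<close>; since
      \<open>h(\<phi>)\<close> commutes with \<open>B\<close>, it vanishes on all of
      \<open>M\<close>.\<close>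
    fix x assume x: "x \<in> carrier M"
    have "x \<in> (\<lambda>b. b \<odot>\<^bsub>M\<^esub> v) ` carrier B"
      using simple_module_generated[OF simple v] x by simp
    then obtain b where b: "b \<in> carrier B" "x = b \<odot>\<^bsub>M\<^esub> v"
      by blast
    have "(\<Oplus>\<^bsub>commutant B M\<^esub>i\<in>{..deg K h}. ?f i) x = (\<Oplus>\<^bsub>M\<^esub>i\<in>{..deg K h}. ?f i x)"
      using f by (intro commutant_finsum_apply[OF LM _ _ x]) auto
    also have "\<dots> = (\<Oplus>\<^bsub>M\<^esub>i\<in>{..deg K h}. b \<odot>\<^bsub>M\<^esub> ((h i \<odot>\<^bsub>B\<^esub> \<one>\<^bsub>B\<^esub>) \<odot>\<^bsub>M\<^esub> w i))"
    proof (intro M.M.finsum_cong' refl)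
      show "(\<lambda>i. b \<odot>\<^bsub>M\<^esub> ((h i \<odot>\<^bsub>B\<^esub> \<one>\<^bsub>B\<^esub>) \<odot>\<^bsub>M\<^esub> w i)) \<in> {..deg K h} \<rightarrow> carrier M"
        using b(1) hK w by auto
      fix i
      have "?f i x = (h i \<odot>\<^bsub>B\<^esub> \<one>\<^bsub>B\<^esub>) \<odot>\<^bsub>M\<^esub> (b \<odot>\<^bsub>M\<^esub> w i)"
        unfolding commutant_smult_apply[OF LM x] commutant_pow_apply[OF LM \<phi> x]
        unfolding b(2) commutant_funpow_smult(2)[OF LM \<phi> v(1) b(1)] w_def ..
      then show "?f i x = b \<odot>\<^bsub>M\<^esub> ((h i \<odot>\<^bsub>B\<^esub> \<one>\<^bsub>B\<^esub>) \<odot>\<^bsub>M\<^esub> w i)"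
        using hK w b(1) CB.\<kappa>_central[OF hK b(1), of i] by (simp flip: M.smult_assoc1)
    qed
    also have "\<dots> = b \<odot>\<^bsub>M\<^esub> (\<Oplus>\<^bsub>M\<^esub>i\<in>{..deg K h}. (h i \<odot>\<^bsub>B\<^esub> \<one>\<^bsub>B\<^esub>) \<odot>\<^bsub>M\<^esub> w i)"
      using hK w b(1) by (intro M.smult_finsum[symmetric]) auto
    also have "\<dots> = \<zero>\<^bsub>M\<^esub>"
      unfolding ev_h using b(1) by simp
    finally show "(\<Oplus>\<^bsub>commutant B M\<^esub>i\<in>{..deg K h}. ?f i) x = \<zero>\<^bsub>commutant B M\<^esub> x"
      using x by (simp add: commutant_zero_apply[OF LM])
  qed (rule commutant_zero_closed[OF LM])
  then show "algebraic_element K (commutant B M) \<phi>"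
    unfolding algebraic_element_def using h(1,2)
    by (intro bexI[of _ h] conjI) (simp_all only: coeff_UP[OF h(1)] simp_thms)
qed

end

section \<open>Generic freeness\<close>

context noetherian_filtered_algebra
begin

lemma poly_scalars_eq: "p \<in> carrier (UP K) \<Longrightarrow> poly_scalars K G p = CG.\<iota> p"
  by (simp add: poly_scalars_def CG.\<iota>_def)

lemma poly_scalars_hom: "poly_scalars K G \<in> ring_hom (UP K) (UP G)"
proof (rule ring_hom_memI)
  fix p q assume p: "p \<in> carrier (UP K)" and q: "q \<in> carrier (UP K)"
  show "poly_scalars K G p \<in> carrier (UP G)"
    unfolding poly_scalars_eq[OF p] by (rule CG.\<iota>_closed[OF p])
  show "poly_scalars K G (p \<otimes>\<^bsub>UP K\<^esub> q) = poly_scalars K G p \<otimes>\<^bsub>UP G\<^esub> poly_scalars K G q"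
    unfolding poly_scalars_eq[OF p] poly_scalars_eq[OF q] poly_scalars_eq[OF KP.m_closed[OF p q]]
    by (rule ring_hom_mult[OF CG.\<iota>_hom p q])
  show "poly_scalars K G (p \<oplus>\<^bsub>UP K\<^esub> q) = poly_scalars K G p \<oplus>\<^bsub>UP G\<^esub> poly_scalars K G q"
    unfolding poly_scalars_eq[OF p] poly_scalars_eq[OF q] poly_scalars_eq[OF KP.a_closed[OF p q]]
    by (rule ring_hom_add[OF CG.\<iota>_hom p q])
next
  show "poly_scalars K G \<one>\<^bsub>UP K\<^esub> = \<one>\<^bsub>UP G\<^esub>"
    unfolding poly_scalars_eq[OF KP.one_closed] by (rule ring_hom_one[OF CG.\<iota>_hom])
qed

lemma gr_poly_component_iff:
  "u \<in> gr_poly_component B F n \<longleftrightarrow> u \<in> carrier (UP G) \<and> (\<forall>i m. m \<noteq> n \<longrightarrow> u i m = F (int m - 1))"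
  by (auto simp: gr_poly_component_def gr_zero_apply)

lemma \<iota>_gr_poly_component:
  assumes p: "p \<in> carrier (UP K)"
  shows "CG.\<iota> p \<in> gr_poly_component B F 0"
proof -
  have "CG.\<iota> p i m = F (int m - 1)" if "m \<noteq> 0" for i m
    unfolding CG.\<iota>_def gr_smult_one[OF UP_coeff_closed[OF p]] using that by (simp add: sym_def)
  then show ?thesis
    unfolding gr_poly_component_iff using CG.\<iota>_closed[OF p] by blast
qed

lemma monom_gr_poly_component:
  assumes b: "b \<in> F (int m)"
  shows "up_ring.monom (UP G) (sym m b) k \<in> gr_poly_component B F m"
proof -
  have "up_ring.monom (UP G) (sym m b) k i n = F (int n - 1)" if "n \<noteq> m" for i n
    unfolding UP_monom_apply[OF sym_closed[OF b]] using that by (simp add: sym_def gr_zero_apply)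
  then show ?thesis
    unfolding gr_poly_component_iff using G.UP_monom_closed[OF sym_closed[OF b]] by blast
qed

text \<open>Moves a scalar and a power of \<open>X\<close> out of \<open>G[X]\<close> into
  \<open>K[X]\<close>, so that symbols that are constant in \<open>X\<close> suffice as generators
  over \<open>K[X]\<close>.\<close>

lemma monom_sym_smult:
  assumes a: "a \<in> carrier K" and b: "b \<in> F (int m)"
  shows "up_ring.monom (UP G) (sym m (a \<odot>\<^bsub>B\<^esub> b)) (k + l)
    = CG.\<iota> (up_ring.monom (UP K) a k) \<otimes>\<^bsub>UP G\<^esub> up_ring.monom (UP G) (sym m b) l"
proof
  fix i
  have aK: "up_ring.monom (UP K) a k \<in> carrier (UP K)"
    using a by (rule K.UP_monom_closed)
  have bB: "b \<in> carrier B"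
    using F_carrier[OF _ b] by simp
  have ab: "a \<odot>\<^bsub>B\<^esub> b \<in> F (int m)"
    using a b by (intro F_smult) auto
  have "(CG.\<iota> (up_ring.monom (UP K) a k) \<otimes>\<^bsub>UP G\<^esub> up_ring.monom (UP G) (sym m b) l) i
      = (if l \<le> i then CG.\<iota> (up_ring.monom (UP K) a k) (i - l) \<otimes>\<^bsub>G\<^esub> sym m b else \<zero>\<^bsub>G\<^esub>)"
    by (rule G.mult_monom_apply[OF sym_closed[OF b] CG.\<iota>_closed[OF aK]])
  also have "\<dots> = (if i = k + l then sym m (a \<odot>\<^bsub>B\<^esub> b) else \<zero>\<^bsub>G\<^esub>)"
  proof (cases "l \<le> i")
    case True
    have "CG.\<iota> (up_ring.monom (UP K) a k) (i - l) \<otimes>\<^bsub>G\<^esub> sym m b = sym m (up_ring.monom (UP K) a k (i - l) \<odot>\<^bsub>B\<^esub> b)"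
      unfolding CG.\<iota>_def by (rule sym_scalar[OF UP_coeff_closed[OF aK] b])
    also have "up_ring.monom (UP K) a k (i - l) \<odot>\<^bsub>B\<^esub> b = (if i = k + l then a \<odot>\<^bsub>B\<^esub> b else \<zero>\<^bsub>B\<^esub>)"
      unfolding UP_monom_apply[OF a] using True bB by auto
    finally show ?thesis
      using True by (simp add: sym_zero)
  qed auto
  also have "\<dots> = up_ring.monom (UP G) (sym m (a \<odot>\<^bsub>B\<^esub> b)) (k + l) i"
    by (rule UP_monom_apply[OF sym_closed[OF ab], symmetric])
  finally show "up_ring.monom (UP G) (sym m (a \<odot>\<^bsub>B\<^esub> b)) (k + l) i
      = (CG.\<iota> (up_ring.monom (UP K) a k) \<otimes>\<^bsub>UP G\<^esub> up_ring.monom (UP G) (sym m b) l) i"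
    by simp
qed

text \<open>The grading keeps the bases of different degrees independent of each other, and the
  common \<open>f\<close> makes them span: an element of \<open>W n\<close> differs from a
  combination of its basis by torsion, which \<open>f\<close> kills. So after multiplication by
  \<open>f\<close> everything lies in the span of the union, as \<open>generically_freeI\<close>
  demands.\<close>

theorem cyclic_graded_module_generically_free:
  fixes M :: "(nat \<Rightarrow> nat \<Rightarrow> 'b set, 'm, 'y) module_scheme"
  assumes cyclic: "cyclic_module (UP G) M" and grading: "module_grading (gr_poly_component B F) M N"
  shows "generically_free (UP K) (restrict_scalars (poly_scalars K G) M)"
proof -
  interpret M: left_module "UP G" M
    using cyclic by (simp add: cyclic_module_def)
  obtain g where g: "g \<in> carrier M" "carrier M = submodule_gen (UP G) M {g}"
    using cyclic unfolding cyclic_module_def by blast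
  have gen: "\<exists>u\<in>carrier (UP G). x = u \<odot>\<^bsub>M\<^esub> g" if x: "x \<in> carrier M" for x
  proof -
    have "x \<in> submodule_gen (UP G) M {g}"
      using x by (simp only: g(2)[symmetric])
    then obtain c where "c \<in> {g} \<rightarrow> carrier (UP G)" "x = (\<Oplus>\<^bsub>M\<^esub>s\<in>{g}. c s \<odot>\<^bsub>M\<^esub> s)"
      using M.submodule_gen_lincomb[of "{g}" x] g(1) by auto
    then show ?thesis
      using g(1) by (intro bexI[of _ "c g"]) auto
  qed
  let ?V = "restrict_scalars (poly_scalars K G) M"
  have V: "module (UP K) ?V"
    by (rule M.restrict_scalars_module[OF KP.is_cring poly_scalars_hom])
  interpret V: left_module "UP K" ?V
    by (rule module_imp_left_module[OF V])
  have V_smult: "a \<odot>\<^bsub>?V\<^esub> x = CG.\<iota> a \<odot>\<^bsub>M\<^esub> x" if "a \<in> carrier (UP K)" for a x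
    by (simp add: poly_scalars_eq[OF that])

  \<comment> \<open>The annihilator of the generator: \<open>M\<close> is \<open>G[X] / J\<close>,
    which turns torsion of \<open>M\<close> into the situation of
    \<open>torsion_bound\<close>.\<close>
  define J where "J = {u \<in> carrier (UP G). u \<odot>\<^bsub>M\<^esub> g = \<zero>\<^bsub>M\<^esub>}"
  have J: "left_ideal J (UP G)"
    by (rule GP.left_idealI) (auto simp: J_def M.smult_l_distr M.smult_assoc1 g(1))
  obtain f where f: "f \<in> carrier (UP K)" "f \<noteq> \<zero>\<^bsub>UP K\<^esub>"
    and tors_J: "\<And>a u. \<lbrakk>a \<in> carrier (UP K); u \<in> carrier (UP G); a \<noteq> \<zero>\<^bsub>UP K\<^esub>; CG.\<iota> a \<otimes>\<^bsub>UP G\<^esub> u \<in> J\<rbrakk>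
      \<Longrightarrow> CG.\<iota> f \<otimes>\<^bsub>UP G\<^esub> u \<in> J"
    using CGP.torsion_bound[OF KP.domain_axioms acc_GP J] by metis
  have tors: "f \<odot>\<^bsub>?V\<^esub> x = \<zero>\<^bsub>?V\<^esub>"
    if a: "a \<in> carrier (UP K)" "a \<noteq> \<zero>\<^bsub>UP K\<^esub>" and x: "x \<in> carrier ?V" "a \<odot>\<^bsub>?V\<^esub> x = \<zero>\<^bsub>?V\<^esub>" for a x
  proof -
    obtain u where u: "u \<in> carrier (UP G)" "x = u \<odot>\<^bsub>M\<^esub> g"
      using gen x(1) by auto
    have eq: "b \<odot>\<^bsub>?V\<^esub> x = (CG.\<iota> b \<otimes>\<^bsub>UP G\<^esub> u) \<odot>\<^bsub>M\<^esub> g" if "b \<in> carrier (UP K)" for b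
      unfolding V_smult[OF that] u(2) using that u(1) g(1) by (intro M.smult_assoc1[symmetric]) auto
    have "CG.\<iota> a \<otimes>\<^bsub>UP G\<^esub> u \<in> J"
      using x(2) a(1) u(1) unfolding eq[OF a(1)] J_def by simp
    then have "CG.\<iota> f \<otimes>\<^bsub>UP G\<^esub> u \<in> J"
      by (rule tors_J[OF a(1) u(1) a(2)])
    then show ?thesis
      unfolding eq[OF f(1)] J_def by simp
  qed
  \<comment> \<open>This is the whole torsion submodule, by the choice of \<open>f\<close>. It is
    saturated, as \<open>a x \<in> T\<close> means that the non-zero scalar \<open>f a\<close> kills
    \<open>x\<close>.\<close>
  define T where "T = {x \<in> carrier ?V. f \<odot>\<^bsub>?V\<^esub> x = \<zero>\<^bsub>?V\<^esub>}"
  have f_comm: "f \<odot>\<^bsub>?V\<^esub> (a \<odot>\<^bsub>?V\<^esub> x) = a \<odot>\<^bsub>?V\<^esub> (f \<odot>\<^bsub>?V\<^esub> x)" if "a \<in> carrier (UP K)" "x \<in> carrier ?V" for a x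
    unfolding V.smult_assoc1[OF f(1) that, symmetric] V.smult_assoc1[OF that(1) f(1) that(2), symmetric]
      KP.m_comm[OF f(1) that(1)] ..
  have T: "submodule T (UP K) ?V"
    unfolding V.submodule_iff
  proof (intro conjI ballI)
    show "T \<subseteq> carrier ?V"
      unfolding T_def by blast
    show "\<zero>\<^bsub>?V\<^esub> \<in> T"
      unfolding T_def using V.smult_r_null[OF f(1)] V.M.zero_closed by blast
    show "x \<oplus>\<^bsub>?V\<^esub> y \<in> T" if "x \<in> T" "y \<in> T" for x y
    proof -
      have xy: "x \<in> carrier ?V" "y \<in> carrier ?V" "f \<odot>\<^bsub>?V\<^esub> x = \<zero>\<^bsub>?V\<^esub>" "f \<odot>\<^bsub>?V\<^esub> y = \<zero>\<^bsub>?V\<^esub>"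
        using that by (simp_all only: T_def mem_Collect_eq)
      have "f \<odot>\<^bsub>?V\<^esub> (x \<oplus>\<^bsub>?V\<^esub> y) = \<zero>\<^bsub>?V\<^esub>"
        unfolding V.smult_r_distr[OF f(1) xy(1,2)] xy(3,4) by (rule V.M.l_zero[OF V.M.zero_closed])
      then show ?thesis
        unfolding T_def using V.M.a_closed[OF xy(1,2)] by blast
    qed
    show "a \<odot>\<^bsub>?V\<^esub> x \<in> T" if "a \<in> carrier (UP K)" "x \<in> T" for a x
    proof -
      have x: "x \<in> carrier ?V" "f \<odot>\<^bsub>?V\<^esub> x = \<zero>\<^bsub>?V\<^esub>"
        using that(2) by (simp_all only: T_def mem_Collect_eq)
      have "f \<odot>\<^bsub>?V\<^esub> (a \<odot>\<^bsub>?V\<^esub> x) = \<zero>\<^bsub>?V\<^esub>"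
        unfolding f_comm[OF that(1) x(1)] x(2) by (rule V.smult_r_null[OF that(1)])
      then show ?thesis
        unfolding T_def using V.smult_closed[OF that(1) x(1)] by blast
    qed
  qed
  have T_sat: "x \<in> T" if a: "a \<in> carrier (UP K)" "a \<noteq> \<zero>\<^bsub>UP K\<^esub>" and x: "x \<in> carrier ?V" "a \<odot>\<^bsub>?V\<^esub> x \<in> T" for a x
  proof -
    have "f \<odot>\<^bsub>?V\<^esub> (a \<odot>\<^bsub>?V\<^esub> x) = \<zero>\<^bsub>?V\<^esub>"
      using x(2) by (simp only: T_def mem_Collect_eq)
    then have "(f \<otimes>\<^bsub>UP K\<^esub> a) \<odot>\<^bsub>?V\<^esub> x = \<zero>\<^bsub>?V\<^esub>"
      unfolding V.smult_assoc1[OF f(1) a(1) x(1)] .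
    moreover have "f \<otimes>\<^bsub>UP K\<^esub> a \<noteq> \<zero>\<^bsub>UP K\<^esub>"
      using KP.integral[OF _ f(1) a(1)] f(2) a(2) by blast
    ultimately have "f \<odot>\<^bsub>?V\<^esub> x = \<zero>\<^bsub>?V\<^esub>"
      using tors[OF KP.m_closed[OF f(1) a(1)] _ x(1)] by blast
    then show ?thesis
      unfolding T_def using x(1) by blast
  qed

  have N_subgroup: "subgroup (N n) (add_monoid M)" for n
    using grading by (simp add: module_grading_def)
  have N_carrier: "x \<in> carrier M" if "x \<in> N n" for x n
    using subgroup.mem_carrier[OF N_subgroup that] by simp
  have N_zero: "\<zero>\<^bsub>M\<^esub> \<in> N n" for n
    using subgroup.one_closed[OF N_subgroup] by simp
  have N_add: "x \<oplus>\<^bsub>M\<^esub> y \<in> N n" if "x \<in> N n" "y \<in> N n" for x y n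
    using subgroup.m_closed[OF N_subgroup that] by simp
  have N_smult: "u \<odot>\<^bsub>M\<^esub> x \<in> N (m + n)" if "u \<in> gr_poly_component B F m" "x \<in> N n" for u x m n
    using grading that by (simp add: module_grading_def)
  have N_submodule: "submodule (N n) (UP K) ?V" for n
    unfolding V.submodule_iff
  proof (intro conjI ballI)
    show "a \<odot>\<^bsub>?V\<^esub> x \<in> N n" if "a \<in> carrier (UP K)" "x \<in> N n" for a x
      using N_smult[OF \<iota>_gr_poly_component[OF that(1)] that(2)] by (simp only: V_smult[OF that(1)] add_0)
  qed (use N_carrier N_zero N_add in auto)
  have decomp: "\<exists>!c. (\<forall>n. c n \<in> N n) \<and> finite {n. c n \<noteq> \<zero>\<^bsub>M\<^esub>} \<and> x = (\<Oplus>\<^bsub>M\<^esub>n\<in>{n. c n \<noteq> \<zero>\<^bsub>M\<^esub>}. c n)"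
    if "x \<in> carrier M" for x
    using grading that by (simp add: module_grading_def)
  \<comment> \<open>The grading speaks of sums over supports; two decompositions are compared after
    padding with zeros to a common index set.\<close>
  have unique: "c = d"
    if I: "finite I" and c: "\<And>n. c n \<in> N n" "\<And>n. n \<notin> I \<Longrightarrow> c n = \<zero>\<^bsub>M\<^esub>"
      and d: "\<And>n. d n \<in> N n" "\<And>n. n \<notin> I \<Longrightarrow> d n = \<zero>\<^bsub>M\<^esub>"
      and eq: "(\<Oplus>\<^bsub>M\<^esub>n\<in>I. c n) = (\<Oplus>\<^bsub>M\<^esub>n\<in>I. d n)" for c d I
  proof -
    have supp: "finite {n. e n \<noteq> \<zero>\<^bsub>M\<^esub>}" "(\<Oplus>\<^bsub>M\<^esub>n\<in>I. e n) = (\<Oplus>\<^bsub>M\<^esub>n\<in>{n. e n \<noteq> \<zero>\<^bsub>M\<^esub>}. e n)"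
      if "\<And>n. e n \<in> N n" "\<And>n. n \<notin> I \<Longrightarrow> e n = \<zero>\<^bsub>M\<^esub>" for e
    proof -
      have sub: "{n. e n \<noteq> \<zero>\<^bsub>M\<^esub>} \<subseteq> I"
        using that(2) by blast
      then show "finite {n. e n \<noteq> \<zero>\<^bsub>M\<^esub>}"
        using I by (rule finite_subset)
      show "(\<Oplus>\<^bsub>M\<^esub>n\<in>I. e n) = (\<Oplus>\<^bsub>M\<^esub>n\<in>{n. e n \<noteq> \<zero>\<^bsub>M\<^esub>}. e n)"
        using sub I N_carrier[OF that(1)] by (intro M.M.add.finprod_mono_neutral_cong_right) auto
    qed
    have "(\<Oplus>\<^bsub>M\<^esub>n\<in>I. c n) \<in> carrier M"
      using N_carrier[OF c(1)] by (intro M.M.finsum_closed) auto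
    from decomp[OF this] show ?thesis
      using supp[OF c] supp[OF d] c(1) d(1) eq by (elim ex1E) metis
  qed
  have N_disjoint: "x = \<zero>\<^bsub>M\<^esub>" if x: "x \<in> N m" "x \<in> N n" and "m \<noteq> n" for x m n
  proof -
    have xM: "x \<in> carrier M"
      by (rule N_carrier[OF x(1)])
    have "(\<lambda>i. if i = m then x else \<zero>\<^bsub>M\<^esub>) = (\<lambda>i. if i = n then x else \<zero>\<^bsub>M\<^esub>)"
      by (rule unique[of "{m, n}"]) (use x xM N_zero \<open>m \<noteq> n\<close> in auto)
    then have "(if m = m then x else \<zero>\<^bsub>M\<^esub>) = (if m = n then x else \<zero>\<^bsub>M\<^esub>)"
      by (rule fun_cong)
    then show ?thesis
      using \<open>m \<noteq> n\<close> by simp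
  qed

  \<comment> \<open>The generator need not be homogeneous; its finitely many components
    \<open>\<gamma> j\<close> together generate \<open>M\<close>.\<close>
  obtain \<gamma> where \<gamma>: "\<And>n. \<gamma> n \<in> N n" "finite {n. \<gamma> n \<noteq> \<zero>\<^bsub>M\<^esub>}" "g = (\<Oplus>\<^bsub>M\<^esub>n\<in>{n. \<gamma> n \<noteq> \<zero>\<^bsub>M\<^esub>}. \<gamma> n)"
    using decomp[OF g(1)] by metis
  define D where "D = {n. \<gamma> n \<noteq> \<zero>\<^bsub>M\<^esub>}"
  have \<gamma>M: "\<gamma> n \<in> carrier M" for n
    by (rule N_carrier[OF \<gamma>(1)])
  have "\<exists>S. finite S \<and> S \<subseteq> F (int m) \<and> F (int m) = submodule_gen K B S" for m
    using F_finite unfolding locally_finite_def by simp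
  then obtain S0 where S0: "\<And>m. finite (S0 m)" "\<And>m. S0 m \<subseteq> F (int m)" "\<And>m. F (int m) = submodule_gen K B (S0 m)"
    by metis
  \<comment> \<open>Generators of degree \<open>n\<close> over \<open>K[X]\<close>: symbols of
    degree \<open>n - j\<close>, taken from a finite spanning set, applied to the component
    \<open>\<gamma> j\<close>. Local finiteness and finiteness of \<open>D\<close> make the set
    finite.\<close>
  define Z where "Z n = (\<Union>j\<in>{j\<in>D. j \<le> n}. (\<lambda>s. up_ring.monom (UP G) (sym (n - j) s) 0 \<odot>\<^bsub>M\<^esub> \<gamma> j) ` S0 (n - j))" for n
  have Z_finite: "finite (Z n)" for n
    unfolding Z_def D_def using \<gamma>(2) S0(1) by auto
  have Z_N: "Z n \<subseteq> N n" for n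
  proof
    fix z assume "z \<in> Z n"
    then obtain j s where js: "j \<le> n" "s \<in> S0 (n - j)" "z = up_ring.monom (UP G) (sym (n - j) s) 0 \<odot>\<^bsub>M\<^esub> \<gamma> j"
      unfolding Z_def by blast
    have "s \<in> F (int (n - j))"
      using js(2) S0(2) by blast
    then have "z \<in> N (n - j + j)"
      unfolding js(3) by (intro N_smult monom_gr_poly_component \<gamma>(1))
    then show "z \<in> N n"
      using js(1) by simp
  qed
  have Z_V: "Z n \<subseteq> carrier ?V" for n
    using Z_N N_carrier by auto
  define W where "W n = submodule_gen (UP K) ?V (Z n)" for n
  have W: "submodule (W n) (UP K) ?V" for n
    unfolding W_def by (rule V.submodule_submodule_gen[OF Z_V])
  have W_N: "W n \<subseteq> N n" for n
    unfolding W_def by (rule V.submodule_gen_minimal[OF N_submodule Z_N])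
  have monom_W: "up_ring.monom (UP G) (sym m b) k \<odot>\<^bsub>M\<^esub> \<gamma> j \<in> W (m + j)" if j: "j \<in> D" and b: "b \<in> F (int m)" for j m b k
  proof -
    let ?Q = "{b \<in> F (int m). up_ring.monom (UP G) (sym m b) k \<odot>\<^bsub>M\<^esub> \<gamma> j \<in> W (m + j)}"
    have step: "up_ring.monom (UP G) (sym m (a \<odot>\<^bsub>B\<^esub> b)) (k + l) \<odot>\<^bsub>M\<^esub> \<gamma> j \<in> W (m + j)"
      if a: "a \<in> carrier K" and b: "b \<in> F (int m)" and bW: "up_ring.monom (UP G) (sym m b) l \<odot>\<^bsub>M\<^esub> \<gamma> j \<in> W (m + j)" for a b k l
    proof -
      have p: "up_ring.monom (UP K) a k \<in> carrier (UP K)"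
        using a by (rule K.UP_monom_closed)
      have "up_ring.monom (UP G) (sym m (a \<odot>\<^bsub>B\<^esub> b)) (k + l) \<odot>\<^bsub>M\<^esub> \<gamma> j
          = up_ring.monom (UP K) a k \<odot>\<^bsub>?V\<^esub> (up_ring.monom (UP G) (sym m b) l \<odot>\<^bsub>M\<^esub> \<gamma> j)"
        unfolding monom_sym_smult[OF a b] V_smult[OF p]
        by (rule M.smult_assoc1[OF CG.\<iota>_closed[OF p] G.UP_monom_closed[OF sym_closed[OF b]] \<gamma>M])
      then show ?thesis
        using V.submodule_smult[OF W p bW] by simp
    qed
    have "submodule ?Q K B"
      unfolding KB.submodule_iff
    proof (intro conjI ballI)
      show "?Q \<subseteq> carrier B"
        using F_subset[of "int m"] by auto
      have "up_ring.monom (UP G) (sym m \<zero>\<^bsub>B\<^esub>) k \<odot>\<^bsub>M\<^esub> \<gamma> j = \<zero>\<^bsub>M\<^esub>"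
        unfolding sym_zero monom_zero by (rule M.smult_l_null[OF \<gamma>M])
      then show "\<zero>\<^bsub>B\<^esub> \<in> ?Q"
        using V.submodule_zero[OF W] F_zero[of "int m"] by simp
      fix b c assume "b \<in> ?Q" "c \<in> ?Q"
      then have bc: "b \<in> F (int m)" "c \<in> F (int m)" "up_ring.monom (UP G) (sym m b) k \<odot>\<^bsub>M\<^esub> \<gamma> j \<in> W (m + j)"
        "up_ring.monom (UP G) (sym m c) k \<odot>\<^bsub>M\<^esub> \<gamma> j \<in> W (m + j)"
        by simp_all
      have "up_ring.monom (UP G) (sym m (b \<oplus>\<^bsub>B\<^esub> c)) k \<odot>\<^bsub>M\<^esub> \<gamma> j
          = up_ring.monom (UP G) (sym m b) k \<odot>\<^bsub>M\<^esub> \<gamma> j \<oplus>\<^bsub>M\<^esub> up_ring.monom (UP G) (sym m c) k \<odot>\<^bsub>M\<^esub> \<gamma> j"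
        unfolding sym_add[OF bc(1,2)] monom_add[OF sym_closed[OF bc(1)] sym_closed[OF bc(2)]]
        by (intro M.smult_l_distr G.UP_monom_closed sym_closed bc \<gamma>M)
      then show "b \<oplus>\<^bsub>B\<^esub> c \<in> ?Q"
        using V.submodule_add[OF W bc(3,4)] F_add[OF _ bc(1,2)] by simp
    next
      fix a b assume "a \<in> carrier K" "b \<in> ?Q"
      then show "a \<odot>\<^bsub>B\<^esub> b \<in> ?Q"
        using step[of a b k 0] F_smult[of "int m" a b] by simp
    qed
    moreover have "S0 m \<subseteq> ?Q"
    proof
      fix s assume s: "s \<in> S0 m"
      then have sF: "s \<in> F (int m)"
        using S0(2) by blast
      have "up_ring.monom (UP G) (sym m s) 0 \<odot>\<^bsub>M\<^esub> \<gamma> j \<in> Z (m + j)"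
        unfolding Z_def using j s by (intro UN_I[of j]) auto
      then have "up_ring.monom (UP G) (sym m s) 0 \<odot>\<^bsub>M\<^esub> \<gamma> j \<in> W (m + j)"
        unfolding W_def using V.subset_submodule_gen by blast
      from step[OF K.one_closed sF this, of k] show "s \<in> ?Q"
        using sF F_carrier[OF _ sF] by simp
    qed
    ultimately have "F (int m) \<subseteq> ?Q"
      unfolding S0(3)[of m] by (rule KB.submodule_gen_minimal)
    then show ?thesis
      using b by blast
  qed

  have "\<forall>n. \<exists>S. finite S \<and> S \<subseteq> W n \<and>
      (\<forall>w\<in>W n. \<exists>c\<in>S \<rightarrow> carrier (UP K). w \<ominus>\<^bsub>?V\<^esub> (\<Oplus>\<^bsub>?V\<^esub>s\<in>S. c s \<odot>\<^bsub>?V\<^esub> s) \<in> T) \<and>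
      (\<forall>c\<in>S \<rightarrow> carrier (UP K). (\<Oplus>\<^bsub>?V\<^esub>s\<in>S. c s \<odot>\<^bsub>?V\<^esub> s) \<in> T \<longrightarrow> (\<forall>s\<in>S. c s = \<zero>\<^bsub>UP K\<^esub>))"
    unfolding W_def by (rule allI, rule euclidean_basis_modulo[OF K.UP_euclidean V T T_sat Z_finite Z_V])
  from choice[OF this] obtain S where S: "\<forall>n. finite (S n) \<and> S n \<subseteq> W n \<and>
      (\<forall>w\<in>W n. \<exists>c\<in>S n \<rightarrow> carrier (UP K). w \<ominus>\<^bsub>?V\<^esub> (\<Oplus>\<^bsub>?V\<^esub>s\<in>S n. c s \<odot>\<^bsub>?V\<^esub> s) \<in> T) \<and>
      (\<forall>c\<in>S n \<rightarrow> carrier (UP K). (\<Oplus>\<^bsub>?V\<^esub>s\<in>S n. c s \<odot>\<^bsub>?V\<^esub> s) \<in> T \<longrightarrow> (\<forall>s\<in>S n. c s = \<zero>\<^bsub>UP K\<^esub>))"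
    by (elim exE)
  have S_finite: "finite (S n)" for n
    by (rule conjunct1[OF spec[OF S]])
  have S_W: "S n \<subseteq> W n" for n
    by (rule conjunct1[OF conjunct2[OF spec[OF S]]])
  have span: "\<forall>w\<in>W n. \<exists>c\<in>S n \<rightarrow> carrier (UP K). w \<ominus>\<^bsub>?V\<^esub> (\<Oplus>\<^bsub>?V\<^esub>s\<in>S n. c s \<odot>\<^bsub>?V\<^esub> s) \<in> T" for n
    by (rule conjunct1[OF conjunct2[OF conjunct2[OF spec[OF S]]]])
  have ind: "\<forall>c\<in>S n \<rightarrow> carrier (UP K). (\<Oplus>\<^bsub>?V\<^esub>s\<in>S n. c s \<odot>\<^bsub>?V\<^esub> s) \<in> T \<longrightarrow> (\<forall>s\<in>S n. c s = \<zero>\<^bsub>UP K\<^esub>)" for n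
    by (rule conjunct2[OF conjunct2[OF conjunct2[OF spec[OF S]]]])
  have S_N: "s \<in> N n" if "s \<in> S n" for s n
    using subsetD[OF W_N subsetD[OF S_W that]] .
  have S_V: "S n \<subseteq> carrier ?V" for n
    using S_N N_carrier by auto
  \<comment> \<open>A basis element 0 would violate independence. Its absence makes the sets
    \<open>S n\<close> disjoint, since distinct components of the grading meet only in 0.\<close>
  have zero_S: "\<zero>\<^bsub>M\<^esub> \<notin> S n" for n
  proof
    assume z: "\<zero>\<^bsub>M\<^esub> \<in> S n"
    define c where "c s = (if s = \<zero>\<^bsub>M\<^esub> then \<one>\<^bsub>UP K\<^esub> else \<zero>\<^bsub>UP K\<^esub>)" for s
    have c: "c \<in> S n \<rightarrow> carrier (UP K)"
      by (simp add: c_def)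
    have "c s \<odot>\<^bsub>?V\<^esub> s = \<zero>\<^bsub>?V\<^esub>" if "s \<in> S n" for s
    proof (cases "s = \<zero>\<^bsub>?V\<^esub>")
      case True
      have "c s \<in> carrier (UP K)"
        using c that by blast
      with True show ?thesis
        by (simp only: V.smult_r_null)
    next
      case False
      then have "c s = \<zero>\<^bsub>UP K\<^esub>"
        by (simp add: c_def)
      then show ?thesis
        using V.smult_l_null[OF subsetD[OF S_V that]] by (simp only:)
    qed
    then have "(\<Oplus>\<^bsub>?V\<^esub>s\<in>S n. c s \<odot>\<^bsub>?V\<^esub> s) = \<zero>\<^bsub>?V\<^esub>"
      by (intro V.M.add.finprod_one_eqI)
    then have "(\<Oplus>\<^bsub>?V\<^esub>s\<in>S n. c s \<odot>\<^bsub>?V\<^esub> s) \<in> T"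
      using V.submodule_zero[OF T] by (simp only:)
    then have "c \<zero>\<^bsub>M\<^esub> = \<zero>\<^bsub>UP K\<^esub>"
      using ind[rule_format, OF c _ z] by blast
    then show False
      by (simp add: c_def)
  qed
  define SS where "SS = (\<Union>n. S n)"
  have SS_V: "SS \<subseteq> carrier ?V"
    unfolding SS_def using S_V by (rule UN_least)
  have S_disjoint: "m = n" if "s \<in> S m" "s \<in> S n" for s m n
    using N_disjoint[OF S_N[OF that(1)] S_N[OF that(2)]] zero_S that(1) by blast

  show ?thesis
  proof (rule generically_freeI[OF KP.domain_axioms V f SS_V])
    fix Y c assume Y: "finite Y" "Y \<subseteq> SS" and c: "c \<in> Y \<rightarrow> carrier (UP K)"
      and sum0: "(\<Oplus>\<^bsub>?V\<^esub>s\<in>Y. c s \<odot>\<^bsub>?V\<^esub> s) = \<zero>\<^bsub>?V\<^esub>"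
    have "\<forall>s\<in>Y. \<exists>n. s \<in> S n"
      using Y(2) unfolding SS_def by blast
    then obtain \<nu> where \<nu>: "\<And>s. s \<in> Y \<Longrightarrow> s \<in> S (\<nu> s)"
      by metis
    define I where "I = \<nu> ` Y"
    have I: "finite I"
      unfolding I_def using Y(1) by simp
    have cY: "c s \<odot>\<^bsub>?V\<^esub> s \<in> carrier ?V" if "s \<in> Y" for s
      using c that Y(2) SS_V by (intro V.smult_closed) auto
    \<comment> \<open>The part of degree \<open>n\<close> of the relation. Uniqueness of the
      homogeneous decomposition makes each part vanish, and independence within \<open>S n\<close>
      finishes.\<close>
    define y where "y n = (\<Oplus>\<^bsub>?V\<^esub>s\<in>Y \<inter> S n. c s \<odot>\<^bsub>?V\<^esub> s)" for n
    have yN: "y n \<in> N n" for n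
      unfolding y_def
    proof (rule V.submodule_finsum[OF N_submodule])
      fix s assume "s \<in> Y \<inter> S n"
      then show "c s \<odot>\<^bsub>?V\<^esub> s \<in> N n"
        using c S_N by (intro V.submodule_smult[OF N_submodule]) auto
    qed
    have y0: "y n = \<zero>\<^bsub>M\<^esub>" if "n \<notin> I" for n
    proof -
      have "Y \<inter> S n = {}"
        using that \<nu> S_disjoint unfolding I_def by blast
      then show ?thesis
        unfolding y_def by simp
    qed
    have "(\<Union>n\<in>I. Y \<inter> S n) = Y"
      unfolding I_def using \<nu> by blast
    moreover have "(\<Oplus>\<^bsub>?V\<^esub>s\<in>(\<Union>n\<in>I. Y \<inter> S n). c s \<odot>\<^bsub>?V\<^esub> s) = (\<Oplus>\<^bsub>?V\<^esub>n\<in>I. y n)"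
      unfolding y_def
    proof (rule V.M.add.finprod_UN_disjoint[OF I])
      show "pairwise (\<lambda>i j. disjnt (Y \<inter> S i) (Y \<inter> S j)) I"
        using S_disjoint by (auto simp: pairwise_def disjnt_def)
      show "finite (Y \<inter> S n)" for n
        using Y(1) by simp
      show "c s \<odot>\<^bsub>?V\<^esub> s \<in> carrier ?V" if "s \<in> Y \<inter> S n" for n s
        using cY[of s] that by blast
    qed
    ultimately have "(\<Oplus>\<^bsub>M\<^esub>n\<in>I. y n) = \<zero>\<^bsub>M\<^esub>"
      using sum0 by simp
    also have "\<dots> = (\<Oplus>\<^bsub>M\<^esub>n\<in>I. \<zero>\<^bsub>M\<^esub>)"
      by (simp add: M.M.add.finprod_one_eqI)
    finally have "y = (\<lambda>n. \<zero>\<^bsub>M\<^esub>)"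
      by (intro unique[OF I] yN y0 N_zero) auto
    then have y_zero: "y n = \<zero>\<^bsub>?V\<^esub>" for n
      by simp
    show "\<forall>s\<in>Y. c s = \<zero>\<^bsub>UP K\<^esub>"
    proof
      fix s assume s: "s \<in> Y"
      let ?n = "\<nu> s"
      let ?c = "\<lambda>t. if t \<in> Y then c t else \<zero>\<^bsub>UP K\<^esub>"
      have c': "?c \<in> S ?n \<rightarrow> carrier (UP K)"
        using c by auto
      have "(\<Oplus>\<^bsub>?V\<^esub>t\<in>S ?n. ?c t \<odot>\<^bsub>?V\<^esub> t) = y ?n"
        unfolding y_def
      proof (rule V.M.add.finprod_mono_neutral_cong_right[OF S_finite])
        show "Y \<inter> S ?n \<subseteq> S ?n"
          by blast
        show "?c t \<odot>\<^bsub>?V\<^esub> t = \<zero>\<^bsub>?V\<^esub>" if "t \<in> S ?n - Y \<inter> S ?n" for t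
        proof -
          have "t \<notin> Y" "t \<in> carrier ?V"
            using that S_V[of ?n] by blast+
          then show ?thesis
            using V.smult_l_null[of t] by (simp only: if_False)
        qed
        show "?c t \<odot>\<^bsub>?V\<^esub> t = c t \<odot>\<^bsub>?V\<^esub> t" if "t \<in> Y \<inter> S ?n" for t
          using that by (simp only: Int_iff if_True)
        show "(\<lambda>t. ?c t \<odot>\<^bsub>?V\<^esub> t) \<in> S ?n \<rightarrow> carrier ?V"
        proof
          fix t assume t: "t \<in> S ?n"
          show "?c t \<odot>\<^bsub>?V\<^esub> t \<in> carrier ?V"
            by (rule V.smult_closed[OF funcset_mem[OF c' t] subsetD[OF S_V t]])
        qed
      qed
      then have "(\<Oplus>\<^bsub>?V\<^esub>t\<in>S ?n. ?c t \<odot>\<^bsub>?V\<^esub> t) \<in> T"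
        unfolding y_zero using V.submodule_zero[OF T] by (simp only:)
      then have "?c s = \<zero>\<^bsub>UP K\<^esub>"
        using ind[rule_format, OF c' _ \<nu>[OF s]] by blast
      then show "c s = \<zero>\<^bsub>UP K\<^esub>"
        using s by simp
    qed
  next
    let ?P = "submodule_gen (UP K) ?V SS"
    have P: "submodule ?P (UP K) ?V"
      by (rule V.submodule_submodule_gen[OF SS_V])
    \<comment> \<open>Being closed under sums, \<open>Q\<close> need only be shown to contain the
      homogeneous monomials applied to the components of \<open>g\<close>, which are elements of the
      \<open>W n\<close>.\<close>
    define Q where "Q = {x \<in> carrier ?V. f \<odot>\<^bsub>?V\<^esub> x \<in> ?P}"
    have Q: "submodule Q (UP K) ?V"
      unfolding V.submodule_iff
    proof (intro conjI ballI)
      show "Q \<subseteq> carrier ?V"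
        unfolding Q_def by blast
      have "f \<odot>\<^bsub>?V\<^esub> \<zero>\<^bsub>?V\<^esub> \<in> ?P"
        unfolding V.smult_r_null[OF f(1)] by (rule V.submodule_zero[OF P])
      then show "\<zero>\<^bsub>?V\<^esub> \<in> Q"
        unfolding Q_def using V.M.zero_closed by blast
      show "x \<oplus>\<^bsub>?V\<^esub> y \<in> Q" if "x \<in> Q" "y \<in> Q" for x y
      proof -
        have xy: "x \<in> carrier ?V" "y \<in> carrier ?V" "f \<odot>\<^bsub>?V\<^esub> x \<in> ?P" "f \<odot>\<^bsub>?V\<^esub> y \<in> ?P"
          using that by (simp_all only: Q_def mem_Collect_eq)
        have "f \<odot>\<^bsub>?V\<^esub> (x \<oplus>\<^bsub>?V\<^esub> y) \<in> ?P"
          unfolding V.smult_r_distr[OF f(1) xy(1,2)] by (rule V.submodule_add[OF P xy(3,4)])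
        then show ?thesis
          unfolding Q_def using V.M.a_closed[OF xy(1,2)] by blast
      qed
      show "a \<odot>\<^bsub>?V\<^esub> x \<in> Q" if "a \<in> carrier (UP K)" "x \<in> Q" for a x
      proof -
        have x: "x \<in> carrier ?V" "f \<odot>\<^bsub>?V\<^esub> x \<in> ?P"
          using that(2) by (simp_all only: Q_def mem_Collect_eq)
        have "f \<odot>\<^bsub>?V\<^esub> (a \<odot>\<^bsub>?V\<^esub> x) \<in> ?P"
          unfolding f_comm[OF that(1) x(1)] by (rule V.submodule_smult[OF P that(1) x(2)])
        then show ?thesis
          unfolding Q_def using V.smult_closed[OF that(1) x(1)] by blast
      qed
    qed
    have W_Q: "w \<in> Q" if w: "w \<in> W n" for w n
    proof -
      obtain c where c: "c \<in> S n \<rightarrow> carrier (UP K)" "w \<ominus>\<^bsub>?V\<^esub> (\<Oplus>\<^bsub>?V\<^esub>s\<in>S n. c s \<odot>\<^bsub>?V\<^esub> s) \<in> T"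
        using span[rule_format, OF w] by (elim bexE)
      let ?lc = "\<Oplus>\<^bsub>?V\<^esub>s\<in>S n. c s \<odot>\<^bsub>?V\<^esub> s"
      have wV: "w \<in> carrier ?V"
        by (rule V.submodule_carrier[OF W w])
      have lcP: "?lc \<in> ?P"
      proof (rule V.submodule_finsum[OF P])
        fix s assume s: "s \<in> S n"
        have "s \<in> ?P"
          using s V.subset_submodule_gen[of SS] unfolding SS_def by blast
        then show "c s \<odot>\<^bsub>?V\<^esub> s \<in> ?P"
          by (rule V.submodule_smult[OF P funcset_mem[OF c(1) s]])
      qed
      have lcV: "?lc \<in> carrier ?V"
        by (rule V.submodule_carrier[OF P lcP])
      have "f \<odot>\<^bsub>?V\<^esub> w = f \<odot>\<^bsub>?V\<^esub> ((w \<ominus>\<^bsub>?V\<^esub> ?lc) \<oplus>\<^bsub>?V\<^esub> ?lc)"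
        using wV lcV by (simp only: V.M.minus_eq V.M.a_assoc V.M.l_neg V.M.r_zero V.M.a_inv_closed)
      also have "\<dots> = f \<odot>\<^bsub>?V\<^esub> (w \<ominus>\<^bsub>?V\<^esub> ?lc) \<oplus>\<^bsub>?V\<^esub> f \<odot>\<^bsub>?V\<^esub> ?lc"
        by (rule V.smult_r_distr[OF f(1) V.M.minus_closed[OF wV lcV] lcV])
      also have "f \<odot>\<^bsub>?V\<^esub> (w \<ominus>\<^bsub>?V\<^esub> ?lc) = \<zero>\<^bsub>?V\<^esub>"
        using c(2) by (simp only: T_def mem_Collect_eq)
      also have "\<zero>\<^bsub>?V\<^esub> \<oplus>\<^bsub>?V\<^esub> f \<odot>\<^bsub>?V\<^esub> ?lc = f \<odot>\<^bsub>?V\<^esub> ?lc"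
        by (rule V.M.l_zero[OF V.smult_closed[OF f(1) lcV]])
      also have "\<dots> \<in> ?P"
        by (rule V.submodule_smult[OF P f(1) lcP])
      finally show ?thesis
        unfolding Q_def using wV by blast
    qed
    fix x assume "x \<in> carrier ?V"
    then obtain u where u: "u \<in> carrier (UP G)" "x = u \<odot>\<^bsub>M\<^esub> g"
      using gen by auto
    from u(1) have "u \<odot>\<^bsub>M\<^esub> g \<in> Q"
    proof (rule UP_gr_induct[where Q = "\<lambda>u. u \<odot>\<^bsub>M\<^esub> g \<in> Q"])
      show "\<zero>\<^bsub>UP G\<^esub> \<odot>\<^bsub>M\<^esub> g \<in> Q"
        unfolding M.smult_l_null[OF g(1)] using V.submodule_zero[OF Q] by simp
      show "(u \<oplus>\<^bsub>UP G\<^esub> v) \<odot>\<^bsub>M\<^esub> g \<in> Q"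
        if "u \<in> carrier (UP G)" "v \<in> carrier (UP G)" "u \<odot>\<^bsub>M\<^esub> g \<in> Q" "v \<odot>\<^bsub>M\<^esub> g \<in> Q" for u v
        unfolding M.smult_l_distr[OF that(1,2) g(1)] using V.submodule_add[OF Q that(3,4)] by simp
      show "up_ring.monom (UP G) (sym m b) k \<odot>\<^bsub>M\<^esub> g \<in> Q" if b: "b \<in> F (int m)" for m b k
      proof -
        have "up_ring.monom (UP G) (sym m b) k \<odot>\<^bsub>M\<^esub> g = (\<Oplus>\<^bsub>M\<^esub>j\<in>D. up_ring.monom (UP G) (sym m b) k \<odot>\<^bsub>M\<^esub> \<gamma> j)"
          unfolding \<gamma>(3) D_def[symmetric]
          using \<gamma>(2) \<gamma>M sym_closed[OF b] by (intro M.smult_finsum) (auto simp: D_def)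
        also have "\<dots> = (\<Oplus>\<^bsub>?V\<^esub>j\<in>D. up_ring.monom (UP G) (sym m b) k \<odot>\<^bsub>M\<^esub> \<gamma> j)"
          by simp
        also have "\<dots> \<in> Q"
          using W_Q[OF monom_W[OF _ b]] by (intro V.submodule_finsum[OF Q])
        finally show ?thesis .
      qed
    qed
    then show "f \<odot>\<^bsub>?V\<^esub> x \<in> ?P"
      unfolding u(2)[symmetric] by (simp only: Q_def mem_Collect_eq)
  qed
qed

end

theorem theorem22:
  fixes K :: "('k, 'r) ring_scheme"
    and B :: "('k, 'b, 'x) module_scheme"
    and F :: "int \<Rightarrow> 'b set"
  assumes "unital_algebra K B"
    and "filtration K B F"
    and "locally_finite K B F"
    and "left_noetherian (gr B F)"
  shows
    "(\<forall>(M :: (nat \<Rightarrow> nat \<Rightarrow> 'b set, 'm, 'y) module_scheme) N.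
        cyclic_module (UP (gr B F)) M \<and> module_grading (gr_poly_component B F) M N \<longrightarrow>
        generically_free (UP K) (restrict_scalars (poly_scalars K (gr B F)) M)) \<and>
     jacobson B \<and>
     (\<forall>M :: ('b, 'n, 'z) module_scheme.
        simple_module B M \<longrightarrow> algebraic_algebra K (commutant B M))"
proof -
  interpret noetherian_filtered_algebra K B F
    using assms by (intro noetherian_filtered_algebra.intro filtered_algebra.intro
        filtered_algebra_axioms.intro noetherian_filtered_algebra_axioms.intro)
      (simp_all add: unital_algebra_def)
  show ?thesis
  proof (intro conjI allI impI)
    show "generically_free (UP K) (restrict_scalars (poly_scalars K (gr B F)) M)"
      if "cyclic_module (UP (gr B F)) M \<and> module_grading (gr_poly_component B F) M N"
      for M :: "(nat \<Rightarrow> nat \<Rightarrow> 'b set, 'm, 'y) module_scheme" and N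
      using that by (elim conjE) (rule cyclic_graded_module_generically_free)
    show "jacobson B"
      by (rule jacobson_B)
    show "algebraic_algebra K (commutant B M)" if "simple_module B M"
      for M :: "('b, 'n, 'z) module_scheme"
      using that by (rule algebraic_commutant)
  qed
qed

end
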